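(* Let $\mathcal{X}$ be an absolutely irreducible, smooth, projective algebraic curve over a finite field $\mathbb{F}$, let $P$ and $Q$ be two distinct $\mathbb{F}$-rational points of $\mathcal{X}$, let $B$ be a divisor on $\mathcal{X}$, and let $a,b\in\mathbb{Z}$. Then the divisor $B+aP+bQ$ has a basepoint at $P$ if and only if $\sigma_B(a)>b$.
   Context: For a divisor $A$ on $\mathcal{X}$ (defined over $\mathbb{F}$), $L(A)=\{f\in\mathbb{F}(\mathcal{X})^\times : \operatorname{div}(f)\ge -A\}\cup\{0\}$. A divisor $D$ has a basepoint at a rational point $P$ if $L(D)=L(D-P)$. $\Delta(P,Q)$ is the set of all divisors $D$ on $\mathcal{X}$ such that $L(D)\ne L(D-P)$ and $L(D-Q)=L(D-P-Q)$; its elements are called discrepancies for $P$ and $Q$. For a given divisor $B$ it is known (Duursma--Park) that for each $i\in\mathbb{Z}$ there is a unique integer, denoted $\sigma_B(i)$, such that $B+iP+\sigma_B(i)Q\in\Delta(P,Q)$, and that the resulting function $\sigma_B\colon\mathbb{Z}\to\mathbb{Z}$ is a bijection; thus $\{B+iP+jQ : i,j\in\mathbb{Z}\}\cap\Delta(P,Q)=\{B+iP+\sigma_B(i)Q : i\in\mathbb{Z}\}$. *)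

theory Defs
  imports
    "HOL-Algebra.Algebraic_Closure_Type"
    "HOL-Algebra.Finite_Extensions"
    "HOL-Algebra.Generated_Fields"
    "HOL-Library.Poly_Mapping"
    "HOL-Library.Function_Algebras"
begin

text \<open>
  Curves are treated in the classical language: a projective variety is the set of its geometric
  points, i.e. its points over the algebraic closure \<open>'a alg_closure\<close> of the base field \<open>'a\<close>.
\<close>

section \<open>Forms\<close>

text \<open>A polynomial in the variables indexed by \<^typ>\<open>nat\<close>; a monomial is its exponent vector.\<close>

type_synonym 'a mpoly = "(nat \<Rightarrow>\<^sub>0 nat) \<Rightarrow>\<^sub>0 'a"

definition mpoly_eval :: "(nat \<Rightarrow> 'a) \<Rightarrow> 'a mpoly \<Rightarrow> 'a::comm_semiring_1" where
  "mpoly_eval v p =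
     (\<Sum>m\<in>Poly_Mapping.keys p. Poly_Mapping.lookup p m *
        (\<Prod>i\<in>Poly_Mapping.keys m. v i ^ Poly_Mapping.lookup m i))"

definition mpoly_partial :: "nat \<Rightarrow> 'a mpoly \<Rightarrow> 'a::comm_semiring_1 mpoly" where
  "mpoly_partial i p =
     (\<Sum>m\<in>Poly_Mapping.keys p. Poly_Mapping.single (m - Poly_Mapping.single i 1)
        (of_nat (Poly_Mapping.lookup m i) * Poly_Mapping.lookup p m))"

text \<open>
  Forms of degree \<open>d\<close> in the variables with indices \<open>0, \<dots>, n\<close>; the zero polynomial is a form of
  every degree.
\<close>

definition form :: "nat \<Rightarrow> nat \<Rightarrow> 'a::zero mpoly \<Rightarrow> bool" where
  "form n d p \<longleftrightarrow> (\<forall>m\<in>Poly_Mapping.keys p.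
     Poly_Mapping.keys m \<subseteq> {..n} \<and> (\<Sum>i\<in>Poly_Mapping.keys m. Poly_Mapping.lookup m i) = d)"

section \<open>Projective varieties\<close>

text \<open>
  A point of projective \<open>n\<close>-space is the set of all its vectors of homogeneous coordinates; such a
  vector is extended by \<open>0\<close> beyond index \<open>n\<close>.
\<close>

type_synonym 'a proj_point = "(nat \<Rightarrow> 'a) set"

definition proj_space :: "nat \<Rightarrow> 'a::field proj_point set" where
  "proj_space n = (\<lambda>v. {\<lambda>i. c * v i |c. c \<noteq> 0}) ` {v. (\<exists>i. v i \<noteq> 0) \<and> (\<forall>i>n. v i = 0)}"

definition proj_zeros :: "nat \<Rightarrow> 'a mpoly set \<Rightarrow> 'a::field proj_point set" where
  "proj_zeros n E = {P \<in> proj_space n. \<forall>p\<in>E. \<forall>v\<in>P. mpoly_eval v p = 0}"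

definition zariski_closed :: "nat \<Rightarrow> 'a::field proj_point set \<Rightarrow> bool" where
  "zariski_closed n Z \<longleftrightarrow> (\<exists>E. (\<forall>p\<in>E. \<exists>d. form n d p) \<and> Z = proj_zeros n E)"

definition zariski_irreducible :: "nat \<Rightarrow> 'a::field proj_point set \<Rightarrow> bool" where
  "zariski_irreducible n C \<longleftrightarrow> C \<noteq> {} \<and>
     (\<forall>Y Z. zariski_closed n Y \<longrightarrow> zariski_closed n Z \<longrightarrow> C \<subseteq> Y \<union> Z \<longrightarrow> C \<subseteq> Y \<or> C \<subseteq> Z)"

definition vanishing_ideal :: "'a::field proj_point set \<Rightarrow> 'a mpoly set" where
  "vanishing_ideal C = {p. \<forall>P\<in>C. \<forall>v\<in>P. mpoly_eval v p = 0}"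

abbreviation base_change :: "'a::field mpoly \<Rightarrow> 'a alg_closure mpoly" where
  "base_change \<equiv> Poly_Mapping.map to_ac"

definition defined_over_base :: "nat \<Rightarrow> 'a::field alg_closure proj_point set \<Rightarrow> bool" where
  "defined_over_base n C \<longleftrightarrow>
     (\<exists>E :: 'a mpoly set. (\<forall>p\<in>E. \<exists>d. form n d p) \<and> C = proj_zeros n (base_change ` E))"

section \<open>Rational functions\<close>

text \<open>
  The following notions are meant for an irreducible \<open>C\<close>. A rational function is the class of
  all fractions \<open>g / h\<close> representing it, where \<open>g\<close> and \<open>h\<close> are forms of the same degree and \<open>h\<close>
  does not vanish identically on \<open>C\<close>.
\<close>

type_synonym 'a rat_fun = "('a mpoly \<times> 'a mpoly) set"

definition fractions :: "nat \<Rightarrow> 'a::field proj_point set \<Rightarrow> ('a mpoly \<times> 'a mpoly) set" where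
  "fractions n C = {(g, h). \<exists>d. form n d g \<and> form n d h \<and> h \<notin> vanishing_ideal C}"

definition rat_fun :: "nat \<Rightarrow> 'a::field proj_point set \<Rightarrow> 'a mpoly \<Rightarrow> 'a mpoly \<Rightarrow> 'a rat_fun" where
  "rat_fun n C g h = {(g', h') \<in> fractions n C. g * h' - g' * h \<in> vanishing_ideal C}"

definition function_field :: "nat \<Rightarrow> 'a::field proj_point set \<Rightarrow> 'a rat_fun ring" where
  "function_field n C = \<lparr>
     carrier = (\<lambda>(g, h). rat_fun n C g h) ` fractions n C,
     monoid.mult = (\<lambda>f f'. \<Union>(g, h)\<in>f. \<Union>(g', h')\<in>f'. rat_fun n C (g * g') (h * h')),
     one = rat_fun n C 1 1,
     ring.zero = rat_fun n C 0 1,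
     add = (\<lambda>f f'. \<Union>(g, h)\<in>f. \<Union>(g', h')\<in>f'. rat_fun n C (g * h' + g' * h) (h * h'))\<rparr>"

definition constants :: "nat \<Rightarrow> 'a::field proj_point set \<Rightarrow> 'a rat_fun set" where
  "constants n C = range (\<lambda>c. rat_fun n C (Poly_Mapping.single 0 c) 1)"

text \<open>The dimension is the transcendence degree of the function field over the constants.\<close>

definition one_dimensional :: "nat \<Rightarrow> 'a::field proj_point set \<Rightarrow> bool" where
  "one_dimensional n C \<longleftrightarrow> (let K = function_field n C; k = constants n C in
     \<exists>t\<in>carrier K. (ring.transcendental K over k) t \<and>
       (\<forall>f\<in>carrier K. (ring.algebraic K over generate_field K (insert t k)) f))"

text \<open>The Jacobian criterion for a curve: the Jacobian matrix has rank \<open>n - 1\<close> at every point.\<close>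

definition smooth_curve :: "nat \<Rightarrow> 'a::field proj_point set \<Rightarrow> bool" where
  "smooth_curve n C \<longleftrightarrow> (\<forall>P\<in>C. \<forall>v\<in>P.
     Suc (vector_space.dim (\<lambda>c w i. c * w i)
       {(\<lambda>i. mpoly_eval v (mpoly_partial i g)) |g. g \<in> vanishing_ideal C \<and> (\<exists>d. form n d g)}) = n)"

definition smooth_projective_curve :: "nat \<Rightarrow> 'a::field alg_closure proj_point set \<Rightarrow> bool" where
  "smooth_projective_curve n C \<longleftrightarrow>
     defined_over_base n C \<and> zariski_irreducible n C \<and> one_dimensional n C \<and> smooth_curve n C"

definition rational_point :: "'a::field alg_closure proj_point set \<Rightarrow> 'a alg_closure proj_point \<Rightarrow> bool" where
  "rational_point C P \<longleftrightarrow> P \<in> C \<and> (\<exists>w :: nat \<Rightarrow> 'a. (\<lambda>i. to_ac (w i)) \<in> P)"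

definition base_functions :: "nat \<Rightarrow> 'a::field alg_closure proj_point set \<Rightarrow> 'a alg_closure rat_fun set" where
  "base_functions n C =
     {f \<in> carrier (function_field n C). \<exists>g h :: 'a mpoly. (base_change g, base_change h) \<in> f}"

section \<open>Orders\<close>

definition local_ring :: "nat \<Rightarrow> 'a::field proj_point set \<Rightarrow> 'a proj_point \<Rightarrow> 'a rat_fun set" where
  "local_ring n C P =
     {f \<in> carrier (function_field n C). \<exists>(g, h)\<in>f. \<forall>v\<in>P. mpoly_eval v h \<noteq> 0}"

definition local_max_ideal :: "nat \<Rightarrow> 'a::field proj_point set \<Rightarrow> 'a proj_point \<Rightarrow> 'a rat_fun set" where
  "local_max_ideal n C P =
     {f \<in> carrier (function_field n C). \<exists>(g, h)\<in>f. \<forall>v\<in>P. mpoly_eval v h \<noteq> 0 \<and> mpoly_eval v g = 0}"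

definition uniformizer :: "nat \<Rightarrow> 'a::field proj_point set \<Rightarrow> 'a proj_point \<Rightarrow> 'a rat_fun \<Rightarrow> bool" where
  "uniformizer n C P t \<longleftrightarrow> t \<in> local_max_ideal n C P \<and>
     local_max_ideal n C P = (\<lambda>r. r \<otimes>\<^bsub>function_field n C\<^esub> t) ` local_ring n C P"

text \<open>At a smooth point of a curve, every nonzero rational function is uniquely \<open>u t\<^sup>k\<close>.\<close>

definition point_order :: "nat \<Rightarrow> 'a::field proj_point set \<Rightarrow> 'a proj_point \<Rightarrow> 'a rat_fun \<Rightarrow> int" where
  "point_order n C P f = (THE k. \<exists>t u. uniformizer n C P t \<and>
     u \<in> local_ring n C P - local_max_ideal n C P \<and>
     f = u \<otimes>\<^bsub>function_field n C\<^esub> (t [^]\<^bsub>function_field n C\<^esub> k))"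

section \<open>Divisors\<close>

definition base_automorphisms :: "('a::field alg_closure \<Rightarrow> 'a alg_closure) set" where
  "base_automorphisms = {s. bij s \<and> (\<forall>x y. s (x + y) = s x + s y) \<and>
     (\<forall>x y. s (x * y) = s x * s y) \<and> (\<forall>x. s (to_ac x) = to_ac x)}"

text \<open>
  A divisor over a perfect base field is a formal sum of geometric points invariant under the
  automorphisms of the algebraic closure over the base field.
\<close>

definition divisor ::
    "'a::field alg_closure proj_point set \<Rightarrow> ('a alg_closure proj_point \<Rightarrow>\<^sub>0 int) \<Rightarrow> bool" where
  "divisor C D \<longleftrightarrow> Poly_Mapping.keys D \<subseteq> C \<and>
     (\<forall>s\<in>base_automorphisms. \<forall>P\<in>C.
        Poly_Mapping.lookup D ((\<lambda>v. s \<circ> v) ` P) = Poly_Mapping.lookup D P)"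

definition riemann_roch_space :: "nat \<Rightarrow> 'a::field alg_closure proj_point set \<Rightarrow>
    ('a alg_closure proj_point \<Rightarrow>\<^sub>0 int) \<Rightarrow> 'a alg_closure rat_fun set" where
  "riemann_roch_space n C D =
     {f \<in> base_functions n C - {\<zero>\<^bsub>function_field n C\<^esub>}.
        \<forall>P\<in>C. point_order n C P f \<ge> - Poly_Mapping.lookup D P}
     \<union> {\<zero>\<^bsub>function_field n C\<^esub>}"

abbreviation pt :: "'a proj_point \<Rightarrow> 'a proj_point \<Rightarrow>\<^sub>0 int" where
  "pt P \<equiv> Poly_Mapping.single P 1"

abbreviation mult_pt :: "int \<Rightarrow> 'a proj_point \<Rightarrow> 'a proj_point \<Rightarrow>\<^sub>0 int" where
  "mult_pt a P \<equiv> Poly_Mapping.single P a"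

definition has_basepoint :: "nat \<Rightarrow> 'a::field alg_closure proj_point set \<Rightarrow>
    ('a alg_closure proj_point \<Rightarrow>\<^sub>0 int) \<Rightarrow> 'a alg_closure proj_point \<Rightarrow> bool" where
  "has_basepoint n C D P \<longleftrightarrow> riemann_roch_space n C D = riemann_roch_space n C (D - pt P)"

definition discrepancies :: "nat \<Rightarrow> 'a::field alg_closure proj_point set \<Rightarrow>
    'a alg_closure proj_point \<Rightarrow> 'a alg_closure proj_point \<Rightarrow>
    ('a alg_closure proj_point \<Rightarrow>\<^sub>0 int) set" where
  "discrepancies n C P Q = {D. divisor C D \<and>
     riemann_roch_space n C D \<noteq> riemann_roch_space n C (D - pt P) \<and>
     riemann_roch_space n C (D - pt Q) = riemann_roch_space n C (D - pt P - pt Q)}"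

definition discrepancy_fun :: "nat \<Rightarrow> 'a::field alg_closure proj_point set \<Rightarrow>
    'a alg_closure proj_point \<Rightarrow> 'a alg_closure proj_point \<Rightarrow>
    ('a alg_closure proj_point \<Rightarrow>\<^sub>0 int) \<Rightarrow> int \<Rightarrow> int" where
  "discrepancy_fun n C P Q B i = (THE j. B + mult_pt i P + mult_pt j Q \<in> discrepancies n C P Q)"

end

theory Submission
  imports Defs
begin

text \<open>
  Fix \<open>a\<close> and consider the divisors \<open>D\<^sub>j = B + a P + j Q\<close>. A function showing that \<open>D\<^sub>j\<close> has no
  basepoint at \<open>P\<close> has the largest pole order at \<open>P\<close> that \<open>D\<^sub>j\<close> allows; it still does so for
  larger \<open>j\<close>, since the coefficient at \<open>P\<close> does not change. Hence the set of all \<open>j\<close> with a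
  basepoint at \<open>P\<close> is closed downwards. If it is neither empty nor everything, it is \<open>{..<\<sigma>}\<close> for
  some integer \<open>\<sigma>\<close>, and \<open>D\<^sub>j\<close> is a discrepancy iff \<open>j\<close> lies outside the set and \<open>j - 1\<close> inside,
  that is, iff \<open>j = \<sigma>\<close>. This is the argument of \<open>basepoint_iff\<close>. It leaves two statements about
  the curve, which take up most of the development.

  For very negative \<open>j\<close> the space \<open>L(D\<^sub>j)\<close> is zero (\<open>RR_trivial\<close>), so there is a basepoint. Behind
  this is the theorem that a regular function on a projective curve is constant
  (\<open>no_poles_imp_zero\<close>), proved with a projective Nullstellensatz for curves (\<open>nullstellensatz\<close>).

  For some \<open>j\<close> there is no basepoint (\<open>exact_pole_exists\<close>): a function over the base field is
  needed whose pole at \<open>P\<close> has a prescribed order and whose behaviour is controlled everywhere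
  except at \<open>Q\<close>. Over the algebraic closure such functions are made from one nonconstant function
  with poles only at \<open>Q\<close> (\<open>pole_function\<close>), which exists by counting forms of large degree
  (\<open>many_forms\<close>) against the linear conditions imposed on them. Taking the norm, the product of
  the conjugates under Frobenius, then gives a function over the base field
  (\<open>rational_approximation\<close>).

  The two hypotheses on the curve enter as follows. That its dimension is one is used through
  \<open>divides_homog\<close>: every form that is not zero on the curve divides there a nonzero homogeneous
  polynomial in two given linear forms. It yields finiteness of zeros and orders and the
  Nullstellensatz. Smoothness is used through \<open>loc_param_exists\<close>: at every point of the curve the
  maximal ideal is generated by a linear form, by the Jacobian criterion. Orders of vanishing are
  defined for homogeneous functions on the cone over the curve, and \<open>point_order_quot\<close> relates
  them to the orders of rational functions.
\<close>

section \<open>Forms, their values and their partial derivatives\<close>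

definition monom_eval :: "(nat \<Rightarrow> 'k) \<Rightarrow> (nat \<Rightarrow>\<^sub>0 nat) \<Rightarrow> 'k::comm_semiring_1" where
  "monom_eval v m = (\<Prod>i\<in>Poly_Mapping.keys m. v i ^ Poly_Mapping.lookup m i)"

abbreviation cst_poly :: "'k::zero \<Rightarrow> 'k mpoly" where
  "cst_poly c \<equiv> Poly_Mapping.single 0 c"

definition pvar :: "nat \<Rightarrow> 'k::comm_semiring_1 mpoly" where
  "pvar i = Poly_Mapping.single (Poly_Mapping.single i 1) 1"

definition monom_deg :: "nat \<Rightarrow> nat \<Rightarrow> (nat \<Rightarrow>\<^sub>0 nat) \<Rightarrow> bool" where
  "monom_deg n d m \<longleftrightarrow> Poly_Mapping.keys m \<subseteq> {..n} \<and>
     (\<Sum>i\<in>Poly_Mapping.keys m. Poly_Mapping.lookup m i) = d"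

lemma monom_eval_superset:
  assumes "finite A" "Poly_Mapping.keys m \<subseteq> A"
  shows "monom_eval v m = (\<Prod>i\<in>A. v i ^ Poly_Mapping.lookup m i)"
  unfolding monom_eval_def using assms
  by (intro prod.mono_neutral_left) (auto simp: in_keys_iff)

lemma monom_eval_0 [simp]: "monom_eval v 0 = 1"
  by (simp add: monom_eval_def)

lemma monom_eval_var [simp]: "monom_eval v (Poly_Mapping.single i 1) = v i"
  by (simp add: monom_eval_def)

lemma monom_eval_add: "monom_eval v (m + m') = monom_eval v m * monom_eval v m'"
proof -
  let ?A = "Poly_Mapping.keys m \<union> Poly_Mapping.keys m'"
  have A: "finite ?A" "Poly_Mapping.keys (m + m') \<subseteq> ?A"
    by (auto dest: subsetD[OF keys_add])
  show ?thesis
    using monom_eval_superset[OF A, of v] monom_eval_superset[OF A(1), of m v]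
      monom_eval_superset[OF A(1), of m' v]
    by (simp add: lookup_add power_add prod.distrib)
qed

lemma mpoly_eval_monom: "mpoly_eval v p = (\<Sum>m\<in>Poly_Mapping.keys p. Poly_Mapping.lookup p m * monom_eval v m)"
  by (simp add: mpoly_eval_def monom_eval_def)

lemma mpoly_eval_0 [simp]: "mpoly_eval v 0 = 0"
  by (simp add: mpoly_eval_def)

lemma mpoly_eval_single: "mpoly_eval v (Poly_Mapping.single m c) = c * monom_eval v m"
  by (simp add: mpoly_eval_monom)

lemma mpoly_eval_add: "mpoly_eval v (p + q) = mpoly_eval v p + mpoly_eval v q"
  unfolding mpoly_eval_monom by (rule setsum_keys_plus_distrib) (auto simp: algebra_simps)

lemma mpoly_eval_sum: "mpoly_eval v (\<Sum>i\<in>A. f i) = (\<Sum>i\<in>A. mpoly_eval v (f i))"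
  by (induction A rule: infinite_finite_induct) (auto simp: mpoly_eval_add)

lemma sum_monomials: "(\<Sum>m\<in>Poly_Mapping.keys p. Poly_Mapping.single m (Poly_Mapping.lookup p m)) = p"
proof (rule poly_mapping_eqI)
  fix k
  have "(\<Sum>m\<in>Poly_Mapping.keys p. Poly_Mapping.lookup (Poly_Mapping.single m (Poly_Mapping.lookup p m)) k)
     = (\<Sum>m\<in>Poly_Mapping.keys p. if m = k then Poly_Mapping.lookup p m else 0)"
    by (intro sum.cong) (auto simp: lookup_single)
  then show "Poly_Mapping.lookup (\<Sum>m\<in>Poly_Mapping.keys p. Poly_Mapping.single m (Poly_Mapping.lookup p m)) k
      = Poly_Mapping.lookup p k"
    by (simp add: lookup_sum in_keys_iff)
qed

lemma sum_in_closed: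
  assumes "P 0" "\<And>x y. P x \<Longrightarrow> P y \<Longrightarrow> P (x + y)" "\<And>i. i \<in> A \<Longrightarrow> P (f i)"
  shows "P (\<Sum>i\<in>A. f i)"
  using assms(3) by (induction A rule: infinite_finite_induct) (auto simp: assms(1,2))

lemma mpoly_induct [case_names zero single add]:
  assumes "P 0" "\<And>m c. P (Poly_Mapping.single m c)" "\<And>p q. P p \<Longrightarrow> P q \<Longrightarrow> P (p + q)"
  shows "P (p :: 'k::comm_monoid_add mpoly)"
proof -
  have "P (\<Sum>m\<in>Poly_Mapping.keys p. Poly_Mapping.single m (Poly_Mapping.lookup p m))"
    by (rule sum_in_closed[where P = P]) (use assms in auto)
  then show ?thesis by (simp only: sum_monomials)
qed

lemma mpoly_eval_mult: "mpoly_eval v (p * q) = mpoly_eval v p * mpoly_eval v q"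
proof (induction p rule: mpoly_induct)
  case (single m c)
  show ?case
    by (induction q rule: mpoly_induct)
      (auto simp: mult_single mpoly_eval_single monom_eval_add mpoly_eval_add algebra_simps)
qed (auto simp: mpoly_eval_add algebra_simps)

lemma mpoly_eval_cst [simp]: "mpoly_eval v (cst_poly c) = c"
  by (simp add: mpoly_eval_single)

lemma mpoly_eval_1 [simp]: "mpoly_eval v 1 = 1"
  using mpoly_eval_cst[of v 1] by (simp flip: single_one)

lemma mpoly_eval_pvar [simp]: "mpoly_eval v (pvar i) = v i"
  by (simp only: pvar_def mpoly_eval_single monom_eval_var mult_1)

lemma mpoly_eval_power: "mpoly_eval v (p ^ k) = mpoly_eval v p ^ k"
  by (induction k) (auto simp: mpoly_eval_mult)

lemma mpoly_eval_uminus: "mpoly_eval v (- p) = - mpoly_eval v (p :: 'k::comm_ring_1 mpoly)"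
  using mpoly_eval_add[of v p "- p"] by (simp add: eq_neg_iff_add_eq_0 add.commute)

lemma mpoly_eval_diff: "mpoly_eval v (p - q) = mpoly_eval v p - mpoly_eval v (q :: 'k::comm_ring_1 mpoly)"
  using mpoly_eval_add[of v p "- q"] by (simp add: mpoly_eval_uminus)

lemma form_iff_monom_deg: "form n d p \<longleftrightarrow> (\<forall>m\<in>Poly_Mapping.keys p. monom_deg n d m)"
  by (auto simp: form_def monom_deg_def)

lemma monom_deg_add:
  assumes "monom_deg n d m" "monom_deg n e m'"
  shows "monom_deg n (d + e) (m + m')"
proof -
  have sup: "(\<Sum>i\<in>Poly_Mapping.keys k. Poly_Mapping.lookup k i) = (\<Sum>i\<le>n. Poly_Mapping.lookup k i)"
    if "Poly_Mapping.keys k \<subseteq> {..n}" for k :: "nat \<Rightarrow>\<^sub>0 nat"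
    using that by (intro sum.mono_neutral_left) (auto simp: in_keys_iff)
  have "Poly_Mapping.keys (m + m') \<subseteq> {..n}"
    using assms keys_add[of m m'] by (auto simp: monom_deg_def)
  then show ?thesis
    using assms sup[of m] sup[of m'] sup[of "m + m'"] unfolding monom_deg_def by (simp add: lookup_add sum.distrib)
qed

lemma monom_deg_0: "monom_deg n 0 0" by (simp add: monom_deg_def)

lemma monom_deg_var: "i \<le> n \<Longrightarrow> monom_deg n 1 (Poly_Mapping.single i 1)"
  by (simp add: monom_deg_def)

lemma monom_deg_Suc: "monom_deg n d m \<Longrightarrow> i \<le> n \<Longrightarrow> monom_deg n (Suc d) (m + Poly_Mapping.single i 1)"
  using monom_deg_add[OF _ monom_deg_var, of n d m i] by simp

lemma form_0 [simp]: "form n d 0" by (simp add: form_def)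

lemma form_single: "monom_deg n d m \<Longrightarrow> form n d (Poly_Mapping.single m c)"
  by (simp add: form_iff_monom_deg)

lemma form_add: "form n d p \<Longrightarrow> form n d q \<Longrightarrow> form n d (p + q)"
  unfolding form_iff_monom_deg using keys_add[of p q] by blast

lemma form_uminus: "form n d p \<Longrightarrow> form n d (- p :: 'k::ab_group_add mpoly)"
  by (auto simp: form_iff_monom_deg in_keys_iff)

lemma form_diff: "form n d p \<Longrightarrow> form n d q \<Longrightarrow> form n d (p - q :: 'k::ab_group_add mpoly)"
  using form_add[of n d p "- q"] form_uminus[of n d q] by simp

lemma form_mult: "form n d p \<Longrightarrow> form n e q \<Longrightarrow> form n (d + e) (p * q :: 'k::semiring_0 mpoly)"
  unfolding form_iff_monom_deg using keys_mult[of p q] monom_deg_add by blast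

lemma form_cst: "form n 0 (cst_poly c)"
  by (rule form_single) (rule monom_deg_0)

lemma form_1: "form n 0 (1 :: 'k::comm_semiring_1 mpoly)"
  by (metis form_cst single_one)

lemma form_pvar: "i \<le> n \<Longrightarrow> form n 1 (pvar i)"
  unfolding pvar_def by (intro form_single monom_deg_var)

lemma form_power: "form n d p \<Longrightarrow> form n (k * d) (p ^ k :: 'k::comm_semiring_1 mpoly)"
  by (induction k) (auto simp: form_1 form_mult)

lemma form_cst_mult: "form n d p \<Longrightarrow> form n d (cst_poly c * p :: 'k::semiring_0 mpoly)"
  using form_mult[OF form_cst, of n d p c] by simp

lemma form_induct [consumes 1, case_names zero single add]:
  assumes "form n d p" "P 0" "\<And>m c. monom_deg n d m \<Longrightarrow> P (Poly_Mapping.single m c)"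
    "\<And>p q. P p \<Longrightarrow> P q \<Longrightarrow> P (p + q)"
  shows "P (p :: 'k::comm_monoid_add mpoly)"
proof -
  have "P (\<Sum>m\<in>Poly_Mapping.keys p. Poly_Mapping.single m (Poly_Mapping.lookup p m))"
    by (rule sum_in_closed[where P = P]) (use assms in \<open>auto simp: form_iff_monom_deg\<close>)
  then show ?thesis by (simp only: sum_monomials)
qed

text \<open>
  Building a monomial one variable at a time is the induction that suits the identities of Euler
  and Taylor: both are stable under multiplication by a variable, by the product rule
  \<open>monom_partial_Suc\<close> below.
\<close>

lemma monom_deg_induct [consumes 1, case_names zero Suc]:
  assumes "monom_deg n d m" "P 0 0"
    "\<And>d m j. monom_deg n d m \<Longrightarrow> j \<le> n \<Longrightarrow> P d m \<Longrightarrow> P (Suc d) (m + Poly_Mapping.single j 1)"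
  shows "P d m"
  using assms(1)
proof (induction d arbitrary: m)
  case 0
  have "m = 0"
  proof (rule poly_mapping_eqI)
    fix i show "Poly_Mapping.lookup m i = Poly_Mapping.lookup 0 i"
      using 0 by (cases "i \<in> Poly_Mapping.keys m") (auto simp: monom_deg_def in_keys_iff)
  qed
  then show ?case using assms(2) by simp
next
  case (Suc d)
  then obtain j where j: "j \<in> Poly_Mapping.keys m" "j \<le> n"
    by (auto simp: monom_deg_def) (metis Suc_neq_Zero atMost_iff subsetD sum.neutral)
  define m' where "m' = m - Poly_Mapping.single j 1"
  have m: "m = m' + Poly_Mapping.single j 1"
    using j(1) by (intro poly_mapping_eqI)
      (auto simp: m'_def lookup_add lookup_minus lookup_single when_def in_keys_iff)
  have m'k: "Poly_Mapping.keys m' \<subseteq> {..n}"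
    using Suc.prems by (auto simp: monom_deg_def m'_def in_keys_iff lookup_minus subset_iff)
  then have "monom_deg n (\<Sum>i\<in>Poly_Mapping.keys m'. Poly_Mapping.lookup m' i) m'"
    by (simp add: monom_deg_def)
  moreover from monom_deg_Suc[OF this j(2)]
  have "Suc (\<Sum>i\<in>Poly_Mapping.keys m'. Poly_Mapping.lookup m' i) = Suc d"
    using Suc.prems m unfolding monom_deg_def by simp
  ultimately have "monom_deg n d m'" by simp
  then show ?case unfolding m by (intro assms(3) Suc.IH j)
qed

lemma monom_eval_scale: "monom_deg n d m \<Longrightarrow> monom_eval (\<lambda>i. c * v i) m = c ^ d * monom_eval v m"
  by (induction rule: monom_deg_induct) (simp_all add: monom_eval_add mult_ac del: One_nat_def)

lemma form_eval_scale: "form n d p \<Longrightarrow> mpoly_eval (\<lambda>i. c * v i) p = c ^ d * mpoly_eval v p"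
  by (induction rule: form_induct)
    (auto simp: mpoly_eval_add mpoly_eval_single monom_eval_scale algebra_simps)

text \<open>
  The value at \<open>v\<close> of the partial derivative of the monomial \<open>m\<close> with respect to variable \<open>l\<close>.
  Where \<open>l\<close> does not occur in \<open>m\<close> the truncated difference of exponents is harmless, since the
  coefficient is \<open>0\<close>.
\<close>

definition monom_partial :: "(nat \<Rightarrow> 'k) \<Rightarrow> (nat \<Rightarrow>\<^sub>0 nat) \<Rightarrow> nat \<Rightarrow> 'k::comm_semiring_1" where
  "monom_partial v m l = of_nat (Poly_Mapping.lookup m l) * monom_eval v (m - Poly_Mapping.single l 1)"

lemma eval_partial:
  "mpoly_eval v (mpoly_partial l p) = (\<Sum>m\<in>Poly_Mapping.keys p. Poly_Mapping.lookup p m * monom_partial v m l)"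
  by (simp add: mpoly_partial_def mpoly_eval_sum mpoly_eval_single monom_partial_def mult_ac)

lemma eval_partial_0 [simp]: "mpoly_eval v (mpoly_partial l 0) = 0"
  by (simp add: eval_partial)

lemma eval_partial_single: "mpoly_eval v (mpoly_partial l (Poly_Mapping.single m c)) = c * monom_partial v m l"
  by (simp add: eval_partial)

lemma eval_partial_add:
  "mpoly_eval v (mpoly_partial l (p + q)) = mpoly_eval v (mpoly_partial l p) + mpoly_eval v (mpoly_partial l q)"
  unfolding eval_partial by (rule setsum_keys_plus_distrib) (auto simp: algebra_simps)

lemma monom_partial_0 [simp]: "monom_partial v 0 l = 0"
  by (simp add: monom_partial_def)

lemma monom_partial_Suc:
  "monom_partial v (m + Poly_Mapping.single j 1) l =
     (if l = j then monom_eval v m else 0) + v j * monom_partial v m l"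
proof -
  have *: "monom_eval v m = v i * monom_eval v (m - Poly_Mapping.single i 1)" if "Poly_Mapping.lookup m i \<noteq> 0" for i
  proof -
    have "m = (m - Poly_Mapping.single i 1) + Poly_Mapping.single i 1"
      using that by (intro poly_mapping_eqI) (auto simp: lookup_add lookup_minus lookup_single when_def)
    then have "monom_eval v m = monom_eval v ((m - Poly_Mapping.single i 1) + Poly_Mapping.single i 1)" by simp
    then show ?thesis unfolding monom_eval_add by (simp add: mult_ac del: One_nat_def)
  qed
  show ?thesis
  proof (cases "l = j")
    case True
    then show ?thesis
      using *[of j] by (cases "Poly_Mapping.lookup m j = 0")
        (auto simp: monom_partial_def lookup_add algebra_simps)
  next
    case False
    then have "m + Poly_Mapping.single j 1 - Poly_Mapping.single l 1 = (m - Poly_Mapping.single l 1) + Poly_Mapping.single j 1"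
      by (intro poly_mapping_eqI) (auto simp: lookup_add lookup_minus lookup_single when_def)
    then have "monom_eval v (m + Poly_Mapping.single j 1 - Poly_Mapping.single l 1) = monom_eval v (m - Poly_Mapping.single l 1) * v j"
      by (simp only: monom_eval_add monom_eval_var)
    then show ?thesis using False
      by (simp add: monom_partial_def lookup_add lookup_single when_def mult_ac)
  qed
qed

lemma euler_monom:
  "monom_deg n d m \<Longrightarrow> (\<Sum>l\<le>n. v l * monom_partial v m l) = of_nat d * monom_eval v m"
proof (induction rule: monom_deg_induct)
  case (Suc d m j)
  have "(\<Sum>l\<le>n. v l * monom_partial v (m + Poly_Mapping.single j 1) l) =
     (\<Sum>l\<le>n. (if l = j then v l * monom_eval v m else 0) + v j * (v l * monom_partial v m l))"
    unfolding monom_partial_Suc by (intro sum.cong) (auto simp: algebra_simps)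
  also have "\<dots> = v j * monom_eval v m + v j * (of_nat d * monom_eval v m)"
    using Suc by (simp add: sum.distrib flip: sum_distrib_left)
  finally show ?case by (simp only: monom_eval_add monom_eval_var) (simp add: algebra_simps)
qed auto

lemma euler: "form n d p \<Longrightarrow> (\<Sum>l\<le>n. v l * mpoly_eval v (mpoly_partial l p)) = of_nat d * mpoly_eval v p"
proof (induction rule: form_induct)
  case (single m c)
  have "(\<Sum>l\<le>n. v l * (c * monom_partial v m l)) = c * (\<Sum>l\<le>n. v l * monom_partial v m l)"
    by (simp add: sum_distrib_left mult_ac)
  then show ?case using euler_monom[OF single, of v]
    by (simp add: eval_partial_single mpoly_eval_single mult_ac)
qed (auto simp: mpoly_eval_add eval_partial_add algebra_simps sum.distrib)

text \<open>
  With \<open>y\<^sub>l = v\<^sub>i x\<^sub>l - v\<^sub>l x\<^sub>i\<close> this is the Taylor expansion at \<open>v\<close> in the affine chart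
  \<open>x\<^sub>i \<noteq> 0\<close>, cleared of denominators. The remainder \<open>\<Sum> y\<^sub>l r\<^sub>l\<close> is of second order: both the forms
  \<open>y\<^sub>l\<close> and the forms \<open>r\<^sub>l\<close> vanish at \<open>v\<close>. The factor \<open>x\<^sub>i\<close> on the left makes all terms
  homogeneous of the same degree. Multiplying a monomial by a new variable \<open>x\<^sub>j\<close> and writing
  \<open>v\<^sub>i x\<^sub>j = v\<^sub>j x\<^sub>i + y\<^sub>j\<close> carries the identity over, with a remainder that can be written down.
\<close>

lemma taylor_monom:
  fixes v :: "nat \<Rightarrow> 'k::comm_ring_1"
  assumes "monom_deg n d m" "i \<le> n"
  shows "\<exists>r. (\<forall>a. form n d (r a) \<and> mpoly_eval v (r a) = 0) \<and>
    (\<forall>x. x i * v i ^ d * monom_eval x m = monom_eval v m * x i ^ Suc d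
       + x i ^ d * (\<Sum>l\<le>n. monom_partial v m l * (v i * x l - v l * x i))
       + (\<Sum>l\<le>n. (v i * x l - v l * x i) * mpoly_eval x (r l)))"
  using assms(1)
proof (induction rule: monom_deg_induct)
  case zero
  show ?case by (rule exI[of _ "\<lambda>_. 0"]) auto
next
  case (Suc d m j)
  then obtain r where r: "\<And>a. form n d (r a)" "\<And>a. mpoly_eval v (r a) = 0" and
    eq: "\<And>x. x i * v i ^ d * monom_eval x m = monom_eval v m * x i ^ Suc d
       + x i ^ d * (\<Sum>l\<le>n. monom_partial v m l * (v i * x l - v l * x i))
       + (\<Sum>l\<le>n. (v i * x l - v l * x i) * mpoly_eval x (r l))" by blast
  define r' where "r' a = cst_poly (monom_partial v m a) * (pvar i ^ d * (cst_poly (v i) * pvar j - cst_poly (v j) * pvar i))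
      + cst_poly (v i) * (pvar j * r a)" for a
  have "form n (Suc d) (r' a)" for a
  proof -
    have "form n (d * 1 + 1) (pvar i ^ d * (cst_poly (v i) * pvar j - cst_poly (v j) * pvar i))"
      using Suc.hyps assms(2) by (intro form_mult form_diff form_cst_mult form_power form_pvar)
    moreover have "form n (1 + d) (pvar j * r a)"
      using Suc.hyps r by (intro form_mult form_pvar)
    ultimately show ?thesis unfolding r'_def by (auto intro!: form_add form_cst_mult)
  qed
  moreover have "mpoly_eval v (r' a) = 0" for a
    by (simp add: r'_def mpoly_eval_add mpoly_eval_mult mpoly_eval_diff r mult_ac)
  moreover have "x i * v i ^ Suc d * monom_eval x (m + Poly_Mapping.single j 1)
       = monom_eval v (m + Poly_Mapping.single j 1) * x i ^ Suc (Suc d)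
       + x i ^ Suc d * (\<Sum>l\<le>n. monom_partial v (m + Poly_Mapping.single j 1) l * (v i * x l - v l * x i))
       + (\<Sum>l\<le>n. (v i * x l - v l * x i) * mpoly_eval x (r' l))" for x
  proof -
    define y where "y l = v i * x l - v l * x i" for l
    define S where "S = (\<Sum>l\<le>n. monom_partial v m l * y l)"
    define T where "T = (\<Sum>l\<le>n. y l * mpoly_eval x (r l))"
    have eq': "x i * v i ^ d * monom_eval x m = monom_eval v m * x i ^ Suc d + x i ^ d * S + T"
      unfolding S_def T_def y_def by (rule eq)
    have 1: "(\<Sum>l\<le>n. monom_partial v (m + Poly_Mapping.single j 1) l * y l) = monom_eval v m * y j + v j * S"
    proof -
      have "(\<Sum>l\<le>n. monom_partial v (m + Poly_Mapping.single j 1) l * y l) =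
        (\<Sum>l\<le>n. (if l = j then monom_eval v m * y l else 0) + v j * (monom_partial v m l * y l))"
        unfolding monom_partial_Suc by (intro sum.cong) (auto simp: algebra_simps)
      then show ?thesis using Suc.hyps by (simp add: S_def sum.distrib sum_distrib_left)
    qed
    have 2: "(\<Sum>l\<le>n. y l * mpoly_eval x (r' l)) = x i ^ d * y j * S + v i * x j * T"
    proof -
      have "(\<Sum>l\<le>n. y l * mpoly_eval x (r' l)) =
         (\<Sum>l\<le>n. x i ^ d * y j * (monom_partial v m l * y l) + v i * x j * (y l * mpoly_eval x (r l)))"
        by (intro sum.cong) (auto simp: r'_def mpoly_eval_add mpoly_eval_mult mpoly_eval_diff mpoly_eval_power y_def algebra_simps)
      then show ?thesis by (simp add: S_def T_def sum.distrib sum_distrib_left)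
    qed
    have "x i * v i ^ Suc d * monom_eval x (m + Poly_Mapping.single j 1) = (v i * x j) * (x i * v i ^ d * monom_eval x m)"
      by (simp only: monom_eval_add monom_eval_var power_Suc mult_ac)
    also have "\<dots> = (v i * x j) * (monom_eval v m * x i ^ Suc d + x i ^ d * S) + v i * x j * T"
      unfolding eq' by (simp only: algebra_simps)
    also have "v i * x j = v j * x i + y j" by (simp add: y_def)
    also have "(v j * x i + y j) * (monom_eval v m * x i ^ Suc d + x i ^ d * S) =
       monom_eval v m * v j * x i ^ Suc (Suc d) + x i ^ Suc d * (monom_eval v m * y j + v j * S) + x i ^ d * y j * S"
      by (simp add: algebra_simps)
    also have "\<dots> + (v j * x i + y j) * T = monom_eval v m * v j * x i ^ Suc (Suc d) + x i ^ Suc d * (monom_eval v m * y j + v j * S)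
       + (x i ^ d * y j * S + v i * x j * T)"
      by (simp add: y_def)
    finally show ?thesis
      using 1 2 unfolding y_def by (simp only: monom_eval_add monom_eval_var)
  qed
  ultimately show ?case by blast
qed

text \<open>
  Both sides of the identity are linear in the form, so the case of monomials suffices. On a curve
  it expresses the linear relations between the \<open>y\<^sub>l\<close> modulo the square of the maximal ideal that
  the Jacobian criterion is about.
\<close>

lemma taylor:
  fixes v :: "nat \<Rightarrow> 'k::comm_ring_1"
  assumes "form n d p" "i \<le> n"
  shows "\<exists>r. (\<forall>a. form n d (r a) \<and> mpoly_eval v (r a) = 0) \<and>
    (\<forall>x. x i * v i ^ d * mpoly_eval x p = mpoly_eval v p * x i ^ Suc d
       + x i ^ d * (\<Sum>l\<le>n. mpoly_eval v (mpoly_partial l p) * (v i * x l - v l * x i))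
       + (\<Sum>l\<le>n. (v i * x l - v l * x i) * mpoly_eval x (r l)))"
  using assms(1)
proof (induction rule: form_induct)
  case zero
  show ?case by (rule exI[of _ "\<lambda>_. 0"]) auto
next
  case (single m c)
  from taylor_monom[OF this assms(2), of v]
  obtain r where r: "\<And>a. form n d (r a)" "\<And>a. mpoly_eval v (r a) = 0" and
    eq: "\<And>x. x i * v i ^ d * monom_eval x m = monom_eval v m * x i ^ Suc d
       + x i ^ d * (\<Sum>l\<le>n. monom_partial v m l * (v i * x l - v l * x i))
       + (\<Sum>l\<le>n. (v i * x l - v l * x i) * mpoly_eval x (r l))" by blast
  have eqc: "c * (x i * v i ^ d * monom_eval x m) = c * (monom_eval v m * x i ^ Suc d
       + x i ^ d * (\<Sum>l\<le>n. monom_partial v m l * (v i * x l - v l * x i))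
       + (\<Sum>l\<le>n. (v i * x l - v l * x i) * mpoly_eval x (r l)))" for x
    by (simp only: eq)
  show ?case
  proof (rule exI[of _ "\<lambda>a. cst_poly c * r a"], intro conjI allI)
    fix x
    show "x i * v i ^ d * mpoly_eval x (Poly_Mapping.single m c) = mpoly_eval v (Poly_Mapping.single m c) * x i ^ Suc d
       + x i ^ d * (\<Sum>l\<le>n. mpoly_eval v (mpoly_partial l (Poly_Mapping.single m c)) * (v i * x l - v l * x i))
       + (\<Sum>l\<le>n. (v i * x l - v l * x i) * mpoly_eval x (cst_poly c * r l))"
    proof -
      have 1: "(\<Sum>l\<le>n. c * monom_partial v m l * (v i * x l - v l * x i)) =
          c * (\<Sum>l\<le>n. monom_partial v m l * (v i * x l - v l * x i))"
        by (simp add: sum_distrib_left mult.assoc)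
      have 2: "(\<Sum>l\<le>n. (v i * x l - v l * x i) * (c * mpoly_eval x (r l))) =
          c * (\<Sum>l\<le>n. (v i * x l - v l * x i) * mpoly_eval x (r l))"
        by (simp only: sum_distrib_left mult.left_commute)
      have gen: "w * (c * mm) = c * aa * bb + dd * (c * ss) + c * tt" if "c * (w * mm) = c * (aa * bb + dd * ss + tt)"
        for w mm aa bb dd ss tt :: 'k
        using that by (simp only: distrib_left mult_ac)
      show ?thesis
        unfolding mpoly_eval_single eval_partial_single mpoly_eval_mult monom_eval_0 mult_1_right 1 2
        by (rule gen[OF eqc[of x]])
    qed
  qed (auto simp: r mpoly_eval_mult intro: form_cst_mult)
next
  case (add p q)
  from add(1) obtain r where r: "\<And>a. form n d (r a)" "\<And>a. mpoly_eval v (r a) = 0" and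
    eq1: "\<And>x. x i * v i ^ d * mpoly_eval x p = mpoly_eval v p * x i ^ Suc d
       + x i ^ d * (\<Sum>l\<le>n. mpoly_eval v (mpoly_partial l p) * (v i * x l - v l * x i))
       + (\<Sum>l\<le>n. (v i * x l - v l * x i) * mpoly_eval x (r l))" by blast
  from add(2) obtain r' where r': "\<And>a. form n d (r' a)" "\<And>a. mpoly_eval v (r' a) = 0" and
    eq2: "\<And>x. x i * v i ^ d * mpoly_eval x q = mpoly_eval v q * x i ^ Suc d
       + x i ^ d * (\<Sum>l\<le>n. mpoly_eval v (mpoly_partial l q) * (v i * x l - v l * x i))
       + (\<Sum>l\<le>n. (v i * x l - v l * x i) * mpoly_eval x (r' l))" by blast
  show ?case
  proof (rule exI[of _ "\<lambda>a. r a + r' a"], intro conjI allI)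
    fix x
    define y where "y l = v i * x l - v l * x i" for l
    have s1: "x i * v i ^ d * mpoly_eval x (p + q) = x i * v i ^ d * mpoly_eval x p + x i * v i ^ d * mpoly_eval x q"
      by (simp only: mpoly_eval_add distrib_left)
    have s2: "(\<Sum>l\<le>n. mpoly_eval v (mpoly_partial l (p + q)) * y l) =
      (\<Sum>l\<le>n. mpoly_eval v (mpoly_partial l p) * y l) + (\<Sum>l\<le>n. mpoly_eval v (mpoly_partial l q) * y l)"
      by (simp only: eval_partial_add distrib_right sum.distrib)
    have s3: "(\<Sum>l\<le>n. y l * mpoly_eval x (r l + r' l)) =
      (\<Sum>l\<le>n. y l * mpoly_eval x (r l)) + (\<Sum>l\<le>n. y l * mpoly_eval x (r' l))"
      by (simp only: mpoly_eval_add distrib_left sum.distrib)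
    show "x i * v i ^ d * mpoly_eval x (p + q) = mpoly_eval v (p + q) * x i ^ Suc d
       + x i ^ d * (\<Sum>l\<le>n. mpoly_eval v (mpoly_partial l (p + q)) * (v i * x l - v l * x i))
       + (\<Sum>l\<le>n. (v i * x l - v l * x i) * mpoly_eval x (r l + r' l))"
      unfolding y_def[symmetric] s1 s2 s3 eq1[of x, folded y_def] eq2[of x, folded y_def]
      by (simp only: mpoly_eval_add) (simp only: algebra_simps)
  qed (auto simp: r r' mpoly_eval_add intro: form_add)
qed

section \<open>Linearly independent families of functions\<close>

definition cst :: "'k \<Rightarrow> 'x \<Rightarrow> 'k" where "cst c = (\<lambda>_. c)"

lemma cst_apply [simp]: "cst c x = c" by (simp add: cst_def)
lemma cst_0 [simp]: "cst 0 = 0" by (simp add: cst_def fun_eq_iff)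
lemma cst_1 [simp]: "cst 1 = 1" by (simp add: cst_def fun_eq_iff)
lemma cst_add: "cst (a + b) = cst a + cst b" by (simp add: cst_def fun_eq_iff)
lemma cst_mult: "cst (a * b) = cst a * cst b" by (simp add: cst_def fun_eq_iff)
lemma cst_uminus: "cst (- a) = - cst (a :: 'k::ab_group_add)" by (simp add: cst_def fun_eq_iff)
lemma cst_sum: "cst (sum f A) = (\<Sum>i\<in>A. cst (f i))"
  by (induction A rule: infinite_finite_induct) (simp_all only: sum.infinite sum.empty sum.insert cst_add cst_0 simp_thms)

lemma sum_fun_apply: "(\<Sum>i\<in>A. f i) x = (\<Sum>i\<in>A. f i x)"
  by (induction A rule: infinite_finite_induct) auto

lemma prod_fun_apply: "(\<Prod>i\<in>A. f i) x = (\<Prod>i\<in>A. f i x)"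
  by (induction A rule: infinite_finite_induct) auto

lemma power_fun_apply: "(f ^ k) x = (f x) ^ k"
  by (induction k) auto

definition indep_family :: "'i set \<Rightarrow> ('i \<Rightarrow> 'x \<Rightarrow> 'k::field) \<Rightarrow> bool" where
  "indep_family I \<phi> \<longleftrightarrow> (\<forall>c. (\<Sum>i\<in>I. cst (c i) * \<phi> i) = 0 \<longrightarrow> (\<forall>i\<in>I. c i = 0))"

definition linear_space :: "('x \<Rightarrow> 'k::field) set \<Rightarrow> bool" where
  "linear_space W \<longleftrightarrow> 0 \<in> W \<and> (\<forall>x\<in>W. \<forall>y\<in>W. x + y \<in> W) \<and> (\<forall>c. \<forall>x\<in>W. cst c * x \<in> W)"

text \<open>
  Codimension at most one, in the form in which it is verified and used: two vectors of the larger
  space have a nontrivial combination in the smaller one.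
\<close>

definition codim_le_1 :: "('x \<Rightarrow> 'k::field) set \<Rightarrow> ('x \<Rightarrow> 'k) set \<Rightarrow> bool" where
  "codim_le_1 W' W \<longleftrightarrow> (\<forall>x\<in>W. \<forall>y\<in>W. \<exists>a b. (a \<noteq> 0 \<or> b \<noteq> 0) \<and> cst a * x + cst b * y \<in> W')"

lemma indep_familyD: "indep_family I \<phi> \<Longrightarrow> (\<Sum>i\<in>I. cst (c i) * \<phi> i) = 0 \<Longrightarrow> i \<in> I \<Longrightarrow> c i = 0"
  unfolding indep_family_def by blast

lemma indep_family_subset:
  assumes "indep_family I \<phi>" "J \<subseteq> I" "finite I"
  shows "indep_family J \<phi>"
  unfolding indep_family_def
proof (intro allI impI)
  fix c assume 0: "(\<Sum>i\<in>J. cst (c i) * \<phi> i) = 0"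
  define c' where "c' i = (if i \<in> J then c i else 0)" for i
  have "(\<Sum>i\<in>I. cst (c' i) * \<phi> i) = (\<Sum>i\<in>J. cst (c i) * \<phi> i)"
    using assms(2,3) by (intro sum.mono_neutral_cong_right) (auto simp: c'_def)
  then have "(\<Sum>i\<in>I. cst (c' i) * \<phi> i) = 0" using 0 by (rule trans)
  then have "\<forall>i\<in>I. c' i = 0" using indep_familyD[OF assms(1), of c'] by blast
  then show "\<forall>i\<in>J. c i = 0" using assms(2) unfolding c'_def by (meson subsetD)
qed

text \<open>
  If some member \<open>\<phi> i0\<close> lies outside \<open>W'\<close>, every other member can be corrected by a multiple of
  \<open>\<phi> i0\<close> so as to lie in \<open>W'\<close>; the corrected family, without \<open>i0\<close>, is still independent. Thus a
  linear condition costs at most one dimension. This is the only kind of dimension count used for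
  spaces of forms with prescribed zeros.
\<close>

lemma indep_family_step:
  assumes fin: "finite I" and ind: "indep_family I \<phi>" and W: "\<phi> ` I \<subseteq> W"
    and W': "linear_space W'" "codim_le_1 W' W"
  shows "\<exists>J \<psi>. J \<subseteq> I \<and> card I \<le> card J + 1 \<and> indep_family J \<psi> \<and> \<psi> ` J \<subseteq> W'"
proof (cases "\<phi> ` I \<subseteq> W'")
  case True
  then show ?thesis using ind by (intro exI[of _ I] exI[of _ \<phi>]) auto
next
  case False
  then obtain i0 where i0: "i0 \<in> I" "\<phi> i0 \<notin> W'" by auto
  have scale: "cst c * x \<in> W'" if "x \<in> W'" for c x
    using that W'(1) by (auto simp: linear_space_def)
  have "\<exists>b. \<phi> i + cst b * \<phi> i0 \<in> W'" if i: "i \<in> I" for i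
  proof -
    \<comment> \<open>In a nontrivial combination lying in \<open>W'\<close> the coefficient of \<open>\<phi> i\<close> cannot be \<open>0\<close>, as \<open>\<phi> i0\<close> is not
      in \<open>W'\<close>.\<close>
    have "\<phi> i \<in> W" "\<phi> i0 \<in> W" using W i i0(1) by auto
    then obtain a b where ab: "a \<noteq> 0 \<or> b \<noteq> 0" "cst a * \<phi> i + cst b * \<phi> i0 \<in> W'"
      using W'(2) unfolding codim_le_1_def by blast
    have "a \<noteq> 0"
    proof
      assume "a = 0"
      with ab have "b \<noteq> 0" "cst b * \<phi> i0 \<in> W'" by auto
      then have "cst (inverse b) * (cst b * \<phi> i0) \<in> W'" by (intro scale[of "cst b * \<phi> i0"])
      moreover have "cst (inverse b) * (cst b * \<phi> i0) = \<phi> i0"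
        using \<open>b \<noteq> 0\<close> by (simp add: fun_eq_iff)
      ultimately show False using i0(2) by simp
    qed
    have "cst (inverse a) * (cst a * \<phi> i + cst b * \<phi> i0) \<in> W'" by (intro scale ab)
    also have "cst (inverse a) * (cst a * \<phi> i + cst b * \<phi> i0) = \<phi> i + cst (inverse a * b) * \<phi> i0"
      using \<open>a \<noteq> 0\<close> by (simp add: fun_eq_iff field_simps)
    finally show ?thesis by blast
  qed
  then obtain b where b: "\<And>i. i \<in> I \<Longrightarrow> \<phi> i + cst (b i) * \<phi> i0 \<in> W'" by metis
  define \<psi> where "\<psi> i = \<phi> i + cst (b i) * \<phi> i0" for i
  have "indep_family (I - {i0}) \<psi>"
    unfolding indep_family_def
  proof (intro allI impI)
    fix c assume 0: "(\<Sum>i\<in>I - {i0}. cst (c i) * \<psi> i) = 0"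
    define c' where "c' i = (if i = i0 then (\<Sum>i\<in>I - {i0}. c i * b i) else c i)" for i
    have "(\<Sum>i\<in>I. cst (c' i) * \<phi> i) = cst (c' i0) * \<phi> i0 + (\<Sum>i\<in>I - {i0}. cst (c' i) * \<phi> i)"
      using fin i0 by (simp add: sum.remove)
    also have "(\<Sum>i\<in>I - {i0}. cst (c' i) * \<phi> i) = (\<Sum>i\<in>I - {i0}. cst (c i) * \<phi> i)"
      by (intro sum.cong) (auto simp: c'_def)
    also have "cst (c' i0) * \<phi> i0 = (\<Sum>i\<in>I - {i0}. cst (c i) * (cst (b i) * \<phi> i0))"
      by (simp add: c'_def cst_sum cst_mult sum_distrib_right mult.assoc)
    also have "\<dots> + (\<Sum>i\<in>I - {i0}. cst (c i) * \<phi> i) = (\<Sum>i\<in>I - {i0}. cst (c i) * \<psi> i)"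
      by (simp add: \<psi>_def distrib_left sum.distrib add.commute)
    finally have "(\<Sum>i\<in>I. cst (c' i) * \<phi> i) = 0" using 0 by (rule trans)
    then have "\<forall>i\<in>I. c' i = 0" using indep_familyD[OF ind, of c'] by blast
    then show "\<forall>i\<in>I - {i0}. c i = 0" by (auto simp: c'_def split: if_splits)
  qed
  moreover have "\<psi> ` (I - {i0}) \<subseteq> W'" using b by (auto simp: \<psi>_def)
  moreover have "card I \<le> card (I - {i0}) + 1" using fin i0 by simp
  ultimately show ?thesis by blast
qed

lemma indep_family_steps:
  assumes "finite I" "indep_family I \<phi>" "\<phi> ` I \<subseteq> W 0"
    and "\<And>t. t < T \<Longrightarrow> linear_space (W (Suc t)) \<and> codim_le_1 (W (Suc t)) (W t)"
  shows "\<exists>J \<psi>. J \<subseteq> I \<and> card I \<le> card J + T \<and> indep_family J \<psi> \<and> \<psi> ` J \<subseteq> W (T::nat)"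
  using assms(4)
proof (induction T)
  case 0
  show ?case using assms by (intro exI[of _ I] exI[of _ \<phi>]) auto
next
  case (Suc T)
  then obtain J \<psi> where J: "J \<subseteq> I" "card I \<le> card J + T" "indep_family J \<psi>" "\<psi> ` J \<subseteq> W T"
    using less_SucI by blast
  have "finite J" using J(1) assms(1) by (rule finite_subset)
  with J Suc.prems[of T] obtain J' \<psi>' where
    "J' \<subseteq> J" "card J \<le> card J' + 1" "indep_family J' \<psi>'" "\<psi>' ` J' \<subseteq> W (Suc T)"
    using indep_family_step[of J \<psi> "W T" "W (Suc T)"] by auto
  with J show ?case by (intro exI[of _ J'] exI[of _ \<psi>']) auto
qed

definition lin_span :: "('x \<Rightarrow> 'k::field) set \<Rightarrow> ('x \<Rightarrow> 'k) set" where
  "lin_span S = {\<Sum>s\<in>S. cst (c s) * s |c. True}"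

lemma lin_span_linear: "linear_space (lin_span S)"
  unfolding linear_space_def
proof (intro conjI ballI allI)
  show "0 \<in> lin_span S" unfolding lin_span_def by (auto intro!: exI[of _ "\<lambda>_. 0"])
next
  fix x y assume "x \<in> lin_span S" "y \<in> lin_span S"
  then obtain c d where "x = (\<Sum>s\<in>S. cst (c s) * s)" "y = (\<Sum>s\<in>S. cst (d s) * s)"
    by (auto simp: lin_span_def)
  then show "x + y \<in> lin_span S" unfolding lin_span_def
    by (auto intro!: exI[of _ "\<lambda>s. c s + d s"] simp: cst_add distrib_right sum.distrib)
next
  fix a x assume "x \<in> lin_span S"
  then obtain c where "x = (\<Sum>s\<in>S. cst (c s) * s)" by (auto simp: lin_span_def)
  then show "cst a * x \<in> lin_span S" unfolding lin_span_def
    by (auto intro!: exI[of _ "\<lambda>s. a * c s"] simp: cst_mult sum_distrib_left mult.assoc)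
qed

lemma lin_span_0: "0 \<in> lin_span S"
  and lin_span_add: "x \<in> lin_span S \<Longrightarrow> y \<in> lin_span S \<Longrightarrow> x + y \<in> lin_span S"
  and lin_span_scale: "x \<in> lin_span S \<Longrightarrow> cst c * x \<in> lin_span S"
  using lin_span_linear[of S] unfolding linear_space_def by blast+

lemma lin_span_base: "finite S \<Longrightarrow> x \<in> S \<Longrightarrow> x \<in> lin_span S"
proof -
  assume "finite S" "x \<in> S"
  then have "(\<Sum>s\<in>S. cst (if s = x then 1 else 0) * s) = (\<Sum>s\<in>S. if s = x then s else 0)"
    by (intro sum.cong) auto
  also have "\<dots> = x" using \<open>finite S\<close> \<open>x \<in> S\<close> by simp
  finally show ?thesis unfolding lin_span_def by (intro CollectI exI conjI TrueI) (rule sym)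
qed

text \<open>
  Removing one generator from a span is a step of codimension at most one, so the bound follows
  from the previous lemmas by induction on the generators.
\<close>

lemma indep_family_card_le:
  assumes "finite S" "finite I" "indep_family I \<phi>" "\<phi> ` I \<subseteq> lin_span S"
  shows "card I \<le> card S"
  using assms
proof (induction S arbitrary: I \<phi> rule: finite_induct)
  case empty
  have "i \<notin> I" for i
  proof
    assume i: "i \<in> I"
    have "(\<Sum>i\<in>I. cst 1 * \<phi> i) = 0" using empty(3) by (auto simp: lin_span_def intro!: sum.neutral)
    then have "\<forall>i\<in>I. (1::'b) = 0" using empty(2) unfolding indep_family_def by (elim allE[of _ "\<lambda>_. 1"]) simp
    then show False using i by simp
  qed
  then have "I = {}" by blast
  then show ?case by simp
next
  case (insert s S)
  have "codim_le_1 (lin_span S) (lin_span (insert s S))"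
    unfolding codim_le_1_def
  proof (intro ballI)
    fix x y assume "x \<in> lin_span (insert s S)" "y \<in> lin_span (insert s S)"
    then obtain c d where x: "x = (\<Sum>t\<in>insert s S. cst (c t) * t)" and y: "y = (\<Sum>t\<in>insert s S. cst (d t) * t)"
      by (auto simp: lin_span_def)
    have x': "x = cst (c s) * s + (\<Sum>t\<in>S. cst (c t) * t)" and y': "y = cst (d s) * s + (\<Sum>t\<in>S. cst (d t) * t)"
      using insert.hyps by (auto simp: x y)
    have S: "(\<Sum>t\<in>S. cst (c t) * t) \<in> lin_span S" for c by (auto simp: lin_span_def)
    show "\<exists>a b. (a \<noteq> 0 \<or> b \<noteq> 0) \<and> cst a * x + cst b * y \<in> lin_span S"
    proof (cases "c s = 0")
      case True
      then show ?thesis using S[of c] by (intro exI[of _ 1] exI[of _ 0]) (auto simp: x')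
    next
      case False
      have "cst (- d s) * x + cst (c s) * y = cst (- d s) * (\<Sum>t\<in>S. cst (c t) * t) + cst (c s) * (\<Sum>t\<in>S. cst (d t) * t)"
        by (simp add: x' y' fun_eq_iff algebra_simps)
      then have "cst (- d s) * x + cst (c s) * y \<in> lin_span S"
        by (simp only:) (intro lin_span_add lin_span_scale S)
      with False show ?thesis by blast
    qed
  qed
  then obtain J \<psi> where J: "J \<subseteq> I" "card I \<le> card J + 1" "indep_family J \<psi>" "\<psi> ` J \<subseteq> lin_span S"
    using indep_family_step[OF insert.prems lin_span_linear] by blast
  then have "card J \<le> card S"
    using insert.IH[of J \<psi>] insert.prems(1) by (auto intro: finite_subset)
  then show ?case using J insert.hyps by simp
qed

section \<open>Homogeneous functions on the cone of a projective variety\<close>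

definition point_of :: "(nat \<Rightarrow> 'k::field) \<Rightarrow> 'k proj_point" where
  "point_of v = {\<lambda>i. c * v i |c. c \<noteq> 0}"

lemma point_of_self: "v \<in> point_of v"
  unfolding point_of_def by (intro CollectI exI[of _ 1]) auto

lemma point_of_scale:
  assumes "c \<noteq> 0" shows "point_of (\<lambda>i. c * v i) = point_of v"
proof (intro equalityI subsetI)
  fix w assume "w \<in> point_of (\<lambda>i. c * v i)"
  then obtain a where "a \<noteq> 0" "w = (\<lambda>i. a * (c * v i))" by (auto simp: point_of_def)
  then show "w \<in> point_of v" unfolding point_of_def using assms
    by (intro CollectI exI[of _ "a * c"]) (auto simp: mult.assoc)
next
  fix w assume "w \<in> point_of v"
  then obtain a where "a \<noteq> 0" "w = (\<lambda>i. a * v i)" by (auto simp: point_of_def)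
  then show "w \<in> point_of (\<lambda>i. c * v i)" unfolding point_of_def using assms
    by (intro CollectI exI[of _ "a / c"]) auto
qed

lemma proj_space_iff: "P \<in> proj_space n \<longleftrightarrow> (\<exists>v. (\<exists>i. v i \<noteq> 0) \<and> (\<forall>i>n. v i = 0) \<and> P = point_of v)"
  unfolding proj_space_def point_of_def by auto

lemma in_proj_space:
  assumes "P \<in> proj_space n" "v \<in> P"
  shows "P = point_of v" "\<exists>i\<le>n. v i \<noteq> 0" "\<And>i. i > n \<Longrightarrow> v i = 0"
proof -
  obtain w where w: "\<exists>i. w i \<noteq> 0" "\<forall>i>n. w i = 0" "P = point_of w"
    using assms(1) by (auto simp: proj_space_iff)
  then obtain c where c: "c \<noteq> 0" "v = (\<lambda>i. c * w i)" using assms(2) by (auto simp: point_of_def)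
  show "P = point_of v" using w(3) c point_of_scale by metis
  show "v i = 0" if "i > n" for i using w(2) c that by simp
  obtain i where "w i \<noteq> 0" using w(1) by blast
  with w(2) have "i \<le> n" by (meson not_le)
  then show "\<exists>i\<le>n. v i \<noteq> 0" using \<open>w i \<noteq> 0\<close> c by auto
qed

text \<open>
  The homogeneous coordinate ring of \<open>C\<close> is modelled by functions on the affine cone, the set of
  all coordinate vectors of points of \<open>C\<close>. Equality modulo the vanishing ideal then becomes
  equality of functions.
\<close>

locale projective_variety =
  fixes n :: nat and C :: "'k::alg_closed_field proj_point set"
  assumes closed: "zariski_closed n C" and irreducible: "zariski_irreducible n C"
begin

definition cone :: "(nat \<Rightarrow> 'k) set" where "cone = \<Union>C"

text \<open>
  Functions are total, so their values outside the cone must be fixed. Composing with a retraction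
  onto the cone keeps \<open>Ev\<close> a ring homomorphism, which setting them to \<open>0\<close> would not: constants
  would be lost.
\<close>

definition retr :: "(nat \<Rightarrow> 'k) \<Rightarrow> nat \<Rightarrow> 'k" where
  "retr v = (if v \<in> cone then v else (SOME w. w \<in> cone))"

definition Ev :: "'k mpoly \<Rightarrow> (nat \<Rightarrow> 'k) \<Rightarrow> 'k" where
  "Ev p = (\<lambda>v. mpoly_eval (retr v) p)"

text \<open>The homogeneous part of degree \<open>d\<close> of the coordinate ring.\<close>

definition V :: "nat \<Rightarrow> ((nat \<Rightarrow> 'k) \<Rightarrow> 'k) set" where
  "V d = Ev ` {p. form n d p}"

lemma C_subset: "P \<in> C \<Longrightarrow> P \<in> proj_space n"
  using closed by (auto simp: zariski_closed_def proj_zeros_def)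

lemma point_of_in_C: "v \<in> cone \<Longrightarrow> point_of v \<in> C"
  unfolding cone_def using in_proj_space(1)[OF C_subset] by (metis UnionE)

lemma C_eq_point_of: "P \<in> C \<Longrightarrow> v \<in> P \<Longrightarrow> P = point_of v"
  using in_proj_space(1)[OF C_subset] by blast

lemma C_cone: "P \<in> C \<Longrightarrow> v \<in> P \<Longrightarrow> v \<in> cone" by (auto simp: cone_def)

lemma C_rep: "P \<in> C \<Longrightarrow> \<exists>v. v \<in> P"
  using C_subset[of P] by (auto simp: proj_space_iff intro: point_of_self)

lemma cone_nonzero: "v \<in> cone \<Longrightarrow> \<exists>i\<le>n. v i \<noteq> 0"
  using in_proj_space(2)[OF C_subset] by (auto simp: cone_def)

lemma cone_supp: "v \<in> cone \<Longrightarrow> i > n \<Longrightarrow> v i = 0"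
  using in_proj_space(3)[OF C_subset] by (auto simp: cone_def)

lemma cone_scale: "v \<in> cone \<Longrightarrow> c \<noteq> 0 \<Longrightarrow> (\<lambda>i. c * v i) \<in> cone"
  using point_of_in_C[of v] C_cone[of "point_of v" "\<lambda>i. c * v i"] by (auto simp: point_of_def)

lemma cone_nonempty: "\<exists>v. v \<in> cone"
  using irreducible C_rep by (auto simp: zariski_irreducible_def cone_def)

lemma retr_in [simp]: "retr v \<in> cone"
  unfolding retr_def using cone_nonempty someI_ex[of "\<lambda>w. w \<in> cone"] by auto

lemma retr_id [simp]: "v \<in> cone \<Longrightarrow> retr v = v" by (simp add: retr_def)

lemma Ev_apply: "v \<in> cone \<Longrightarrow> Ev p v = mpoly_eval v p" by (simp add: Ev_def)

lemma Ev_add: "Ev (p + q) = Ev p + Ev q" by (simp add: Ev_def fun_eq_iff mpoly_eval_add)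
lemma Ev_diff: "Ev (p - q) = Ev p - Ev q" by (simp add: Ev_def fun_eq_iff mpoly_eval_diff)
lemma Ev_uminus: "Ev (- p) = - Ev p" by (simp add: Ev_def fun_eq_iff mpoly_eval_uminus)
lemma Ev_mult: "Ev (p * q) = Ev p * Ev q" by (simp add: Ev_def fun_eq_iff mpoly_eval_mult)
lemma Ev_0 [simp]: "Ev 0 = 0" by (simp add: Ev_def fun_eq_iff)
lemma Ev_1 [simp]: "Ev 1 = 1" by (simp add: Ev_def fun_eq_iff)
lemma Ev_cst [simp]: "Ev (cst_poly c) = cst c" by (simp add: Ev_def fun_eq_iff)
lemma Ev_power: "Ev (p ^ k) = Ev p ^ k" by (induction k) (auto simp: Ev_mult)
lemma Ev_prod: "Ev (\<Prod>i\<in>A. f i) = (\<Prod>i\<in>A. Ev (f i))"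
proof (induction A rule: infinite_finite_induct)
  case (insert x F)
  show ?case unfolding prod.insert[OF insert.hyps] Ev_mult insert.IH ..
qed simp_all

lemma Ev_eq_0_iff: "Ev p = 0 \<longleftrightarrow> p \<in> vanishing_ideal C"
proof
  assume "Ev p = 0"
  then have "mpoly_eval v p = 0" if "v \<in> cone" for v using Ev_apply[OF that, of p] by simp
  then show "p \<in> vanishing_ideal C" by (auto simp: vanishing_ideal_def cone_def)
next
  assume "p \<in> vanishing_ideal C"
  then have "mpoly_eval v p = 0" if "v \<in> cone" for v using that by (auto simp: vanishing_ideal_def cone_def)
  then show "Ev p = 0" by (simp add: Ev_def fun_eq_iff)
qed

lemma VI: "form n d p \<Longrightarrow> Ev p \<in> V d" by (auto simp: V_def)
lemma VE: assumes "\<phi> \<in> V d" obtains p where "form n d p" "\<phi> = Ev p"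
  using assms by (auto simp: V_def)

lemma V_0 [simp]: "0 \<in> V d" using VI[of d 0] by simp
lemma V_add: "\<phi> \<in> V d \<Longrightarrow> \<psi> \<in> V d \<Longrightarrow> \<phi> + \<psi> \<in> V d"
  by (elim VE) (simp add: VI form_add flip: Ev_add)
lemma V_diff: "\<phi> \<in> V d \<Longrightarrow> \<psi> \<in> V d \<Longrightarrow> \<phi> - \<psi> \<in> V d"
  by (elim VE) (simp add: VI form_diff flip: Ev_diff)
lemma V_uminus: "\<phi> \<in> V d \<Longrightarrow> - \<phi> \<in> V d"
  by (elim VE) (simp add: VI form_uminus flip: Ev_uminus)
lemma V_mult: "\<phi> \<in> V d \<Longrightarrow> \<psi> \<in> V e \<Longrightarrow> \<phi> * \<psi> \<in> V (d + e)"
  by (elim VE) (simp add: VI form_mult flip: Ev_mult)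
lemma V_cst: "cst c \<in> V 0" using VI[OF form_cst] by simp
lemma V_1: "1 \<in> V 0" using V_cst[of 1] by simp
lemma V_cst_mult: "\<phi> \<in> V d \<Longrightarrow> cst c * \<phi> \<in> V d"
  using V_mult[OF V_cst] by fastforce
lemma V_power: "\<phi> \<in> V d \<Longrightarrow> \<phi> ^ k \<in> V (k * d)"
  by (induction k) (auto intro: V_1 V_mult)
lemma V_sum: "(\<And>i. i \<in> A \<Longrightarrow> f i \<in> V d) \<Longrightarrow> (\<Sum>i\<in>A. f i) \<in> V d"
  by (induction A rule: infinite_finite_induct) (auto intro: V_add)
lemma V_prod: "(\<And>i. i \<in> A \<Longrightarrow> f i \<in> V (d i)) \<Longrightarrow> (\<Prod>i\<in>A. f i) \<in> V (\<Sum>i\<in>A. d i)"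
  by (induction A rule: infinite_finite_induct) (auto intro: V_1 V_mult)
lemma V_eq: "\<phi> \<in> V d \<Longrightarrow> d = e \<Longrightarrow> \<phi> \<in> V e" by simp

definition Xc :: "nat \<Rightarrow> (nat \<Rightarrow> 'k) \<Rightarrow> 'k" where "Xc i = Ev (pvar i)"

lemma V_X: "i \<le> n \<Longrightarrow> Xc i \<in> V 1" unfolding Xc_def by (rule VI[OF form_pvar])
lemma X_apply: "v \<in> cone \<Longrightarrow> Xc i v = v i" by (simp add: Xc_def Ev_apply)

lemma V_retr: "\<phi> \<in> V d \<Longrightarrow> \<phi> v = \<phi> (retr v)"
  by (elim VE) (simp add: Ev_def)

lemma V_eqI: "\<phi> \<in> V d \<Longrightarrow> \<psi> \<in> V e \<Longrightarrow> (\<And>v. v \<in> cone \<Longrightarrow> \<phi> v = \<psi> v) \<Longrightarrow> \<phi> = \<psi>"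
  by (rule ext) (metis V_retr retr_in)

lemma V_nonzero: "\<phi> \<in> V d \<Longrightarrow> \<phi> \<noteq> 0 \<Longrightarrow> \<exists>v\<in>cone. \<phi> v \<noteq> 0"
  using V_eqI[OF _ V_0] by fastforce

lemma V_scale: "\<phi> \<in> V d \<Longrightarrow> v \<in> cone \<Longrightarrow> c \<noteq> 0 \<Longrightarrow> \<phi> (\<lambda>i. c * v i) = c ^ d * \<phi> v"
  by (elim VE) (simp add: Ev_apply cone_scale form_eval_scale)

text \<open>
  A product vanishing on \<open>C\<close> covers \<open>C\<close> by the zero sets of the two factors, and irreducibility
  says that one of them suffices.
\<close>

lemma V_domain:
  assumes "\<phi> \<in> V d" "\<psi> \<in> V e" "\<phi> * \<psi> = 0"
  shows "\<phi> = 0 \<or> \<psi> = 0"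
proof -
  obtain p q where p: "form n d p" "\<phi> = Ev p" and q: "form n e q" "\<psi> = Ev q"
    using assms by (metis VE)
  have cl: "zariski_closed n (proj_zeros n {r})" if "form n f r" for f and r :: "'k mpoly"
    unfolding zariski_closed_def using that by blast
  have "P \<in> proj_zeros n {p} \<union> proj_zeros n {q}" if P: "P \<in> C" for P
  proof -
    obtain v where v: "v \<in> P" using C_rep P by blast
    have Pv: "P = point_of v" using C_eq_point_of P v by blast
    have vc: "v \<in> cone" using C_cone P v by blast
    have "(\<phi> * \<psi>) v = 0" using assms(3) by simp
    then have "mpoly_eval v p = 0 \<or> mpoly_eval v q = 0"
      by (simp add: p q Ev_apply vc)
    moreover have "\<forall>w\<in>P. mpoly_eval w r = 0" if "mpoly_eval v r = 0" "form n f r" for f r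
      using that by (auto simp: Pv point_of_def form_eval_scale)
    ultimately show ?thesis using p q C_subset[OF P] unfolding proj_zeros_def by blast
  qed
  then have "C \<subseteq> proj_zeros n {p} \<or> C \<subseteq> proj_zeros n {q}"
    using irreducible cl[OF p(1)] cl[OF q(1)] unfolding zariski_irreducible_def by blast
  then have "p \<in> vanishing_ideal C \<or> q \<in> vanishing_ideal C"
    by (auto simp: vanishing_ideal_def proj_zeros_def)
  then show ?thesis by (simp add: p q Ev_eq_0_iff)
qed

lemma V_mult_nonzero: "\<phi> \<in> V d \<Longrightarrow> \<psi> \<in> V e \<Longrightarrow> \<phi> \<noteq> 0 \<Longrightarrow> \<psi> \<noteq> 0 \<Longrightarrow> \<phi> * \<psi> \<noteq> 0"
  using V_domain by blast

lemma V_power_nonzero: "\<phi> \<in> V d \<Longrightarrow> \<phi> \<noteq> 0 \<Longrightarrow> \<phi> ^ k \<noteq> 0"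
proof (induction k)
  case (Suc k)
  then show ?case unfolding power_Suc by (intro V_mult_nonzero[OF _ V_power])
qed simp

lemma V_prod_nonzero: "(\<And>i. i \<in> A \<Longrightarrow> f i \<in> V (d i) \<and> f i \<noteq> 0) \<Longrightarrow> (\<Prod>i\<in>A. f i) \<noteq> 0"
proof (induction A rule: infinite_finite_induct)
  case (insert x F)
  have "f x * (\<Prod>i\<in>F. f i) \<noteq> 0"
  proof (rule V_mult_nonzero[of _ "d x" _ "\<Sum>i\<in>F. d i"])
    show "(\<Prod>i\<in>F. f i) \<in> V (\<Sum>i\<in>F. d i)" by (rule V_prod) (use insert.prems in blast)
    show "(\<Prod>i\<in>F. f i) \<noteq> 0" by (rule insert.IH) (use insert.prems in blast)
  qed (use insert.prems in blast)+
  then show ?case unfolding prod.insert[OF insert.hyps] .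
qed simp_all

lemma V_cancel:
  assumes "\<chi> \<in> V d" "\<chi> \<noteq> 0" "\<phi> \<in> V e" "\<psi> \<in> V e" "\<chi> * \<phi> = \<chi> * \<psi>"
  shows "\<phi> = \<psi>"
proof -
  have "\<chi> * (\<phi> - \<psi>) = 0" using assms(5) by (simp add: right_diff_distrib)
  then have "\<phi> - \<psi> = 0" using V_domain[OF assms(1) V_diff[OF assms(3,4)]] assms(2) by blast
  then show ?thesis by simp
qed

text \<open>Homogeneous functions are sums of monomials; this is the induction along such a sum.\<close>

lemma V_induct [consumes 1, case_names zero monom add]:
  assumes "\<phi> \<in> V d" "P 0" "\<And>m c. monom_deg n d m \<Longrightarrow> P (cst c * Ev (Poly_Mapping.single m 1))"
    "\<And>\<phi> \<psi>. P \<phi> \<Longrightarrow> P \<psi> \<Longrightarrow> P (\<phi> + \<psi>)"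
  shows "P \<phi>"
proof -
  obtain p where p: "form n d p" "\<phi> = Ev p" using assms(1) by (rule VE)
  have "P (Ev p)" using p(1)
  proof (induction rule: form_induct)
    case (single m c)
    have "Ev (Poly_Mapping.single m c) = cst c * Ev (Poly_Mapping.single m 1)"
      by (simp add: mult_single flip: Ev_cst Ev_mult)
    show ?case unfolding \<open>Ev (Poly_Mapping.single m c) = _\<close> by (rule assms(3)[OF single])
  next
    case zero
    show ?case unfolding Ev_0 by (rule assms(2))
  next
    case (add p q)
    then show ?case unfolding Ev_add by (rule assms(4))
  qed
  then show ?thesis using p by simp
qed

text \<open>
  \<open>C\<close> is closed, so it is cut out by the forms of its vanishing ideal: membership in the cone can
  be tested on forms.
\<close>

lemma cone_memI:
  assumes "\<forall>i>n. v i = 0" "\<exists>i. v i \<noteq> 0"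
    and "\<And>p d. form n d p \<Longrightarrow> Ev p = 0 \<Longrightarrow> mpoly_eval v p = 0"
  shows "v \<in> cone"
proof -
  obtain E where E: "\<forall>p\<in>E. \<exists>d. form n d p" "C = proj_zeros n E"
    using closed by (auto simp: zariski_closed_def)
  have "point_of v \<in> proj_zeros n E"
    unfolding proj_zeros_def
  proof (intro CollectI conjI ballI)
    show "point_of v \<in> proj_space n" using assms(1,2) by (auto simp: proj_space_iff)
    fix p w assume p: "p \<in> E" and w: "w \<in> point_of v"
    obtain d where d: "form n d p" using E(1) p by blast
    have "p \<in> vanishing_ideal C" using p by (auto simp: E(2) vanishing_ideal_def proj_zeros_def)
    then have "mpoly_eval v p = 0" using assms(3)[OF d] by (simp add: Ev_eq_0_iff)
    then show "mpoly_eval w p = 0" using w d by (auto simp: point_of_def form_eval_scale)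
  qed
  then show ?thesis unfolding cone_def using E(2) point_of_self by blast
qed

lemma X_neq_0: "Xc i v \<noteq> 0 \<Longrightarrow> Xc i \<noteq> 0" by auto

text \<open>
  Two non-proportional vectors have a nonzero two by two minor, and expanding that minor with the
  entries of the first vector replaced by variables gives the linear form.
\<close>

lemma separate_points:
  assumes "v \<in> cone" "w \<in> cone" "point_of v \<noteq> point_of w"
  shows "\<exists>l\<in>V 1. l v \<noteq> 0 \<and> l w = 0"
proof -
  obtain i where i: "i \<le> n" "w i \<noteq> 0" using cone_nonzero assms(2) by blast
  have "\<exists>j\<le>n. w i * v j \<noteq> w j * v i"
  proof (rule ccontr)
    assume "\<not> ?thesis"
    then have "w i * v j = w j * v i" if "j \<le> n" for j using that by blast
    then have eq: "w i * v j = w j * v i" for j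
      using cone_supp[OF assms(1), of j] cone_supp[OF assms(2), of j] by (cases "j \<le> n") (auto simp: not_le)
    then have v: "v = (\<lambda>j. (v i / w i) * w j)" using i(2) by (auto simp: fun_eq_iff field_simps)
    have "v i \<noteq> 0" using v cone_nonzero[OF assms(1)] by (metis div_0 mult_zero_left)
    then have "point_of v = point_of w"
      using v point_of_scale[of "v i / w i" w] i(2) by simp
    with assms(3) show False by simp
  qed
  then obtain j where j: "j \<le> n" "w i * v j \<noteq> w j * v i" by blast
  have "cst (w i) * Xc j - cst (w j) * Xc i \<in> V 1" by (intro V_diff V_cst_mult V_X i j)
  moreover have "(cst (w i) * Xc j - cst (w j) * Xc i) v \<noteq> 0" "(cst (w i) * Xc j - cst (w j) * Xc i) w = 0"
    using j by (auto simp: X_apply assms)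
  ultimately show ?thesis by blast
qed

end

section \<open>The function field\<close>

context projective_variety
begin

abbreviation K where "K \<equiv> function_field n C"

text \<open>
  The rational function \<open>\<phi> / \<psi>\<close> as the class of all its representatives; the numerator and the
  denominator are functions on the cone, so that equality of fractions becomes
  cross-multiplication (\<open>quot_eq_iff\<close>).
\<close>

definition quot :: "((nat \<Rightarrow> 'k) \<Rightarrow> 'k) \<Rightarrow> ((nat \<Rightarrow> 'k) \<Rightarrow> 'k) \<Rightarrow> 'k rat_fun" where
  "quot \<phi> \<psi> = {(g, h) \<in> fractions n C. \<phi> * Ev h = Ev g * \<psi>}"

definition fraction :: "nat \<Rightarrow> ((nat \<Rightarrow> 'k) \<Rightarrow> 'k) \<Rightarrow> ((nat \<Rightarrow> 'k) \<Rightarrow> 'k) \<Rightarrow> bool" where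
  "fraction d \<phi> \<psi> \<longleftrightarrow> \<phi> \<in> V d \<and> \<psi> \<in> V d \<and> \<psi> \<noteq> 0"

lemma fractions_iff: "(g, h) \<in> fractions n C \<longleftrightarrow> (\<exists>d. form n d g \<and> form n d h \<and> Ev h \<noteq> 0)"
  by (simp add: fractions_def Ev_eq_0_iff)

lemma fractions_frac: "(g, h) \<in> fractions n C \<Longrightarrow> \<exists>d. fraction d (Ev g) (Ev h)"
  unfolding fractions_iff fraction_def using VI by blast

lemma frac_rep: "fraction d \<phi> \<psi> \<Longrightarrow> \<exists>g h. form n d g \<and> form n d h \<and> \<phi> = Ev g \<and> \<psi> = Ev h \<and> (g, h) \<in> fractions n C"
  unfolding fraction_def fractions_iff by (metis VE)

lemma rat_fun_quot: "rat_fun n C g h = quot (Ev g) (Ev h)"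
proof -
  have "g * h' - g' * h \<in> vanishing_ideal C \<longleftrightarrow> Ev g * Ev h' = Ev g' * Ev h" for g' h'
    by (simp add: Ev_diff Ev_mult flip: Ev_eq_0_iff)
  then show ?thesis by (simp add: rat_fun_def quot_def)
qed

lemma frac_mult: "fraction d \<phi> \<psi> \<Longrightarrow> fraction e \<phi>' \<psi>' \<Longrightarrow> fraction (d + e) (\<phi> * \<phi>') (\<psi> * \<psi>')"
  unfolding fraction_def by (metis V_mult V_mult_nonzero)

lemma frac_add: "fraction d \<phi> \<psi> \<Longrightarrow> fraction e \<phi>' \<psi>' \<Longrightarrow> fraction (d + e) (\<phi> * \<psi>' + \<phi>' * \<psi>) (\<psi> * \<psi>')"
  unfolding fraction_def by (metis V_mult V_mult_nonzero V_add add.commute)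

lemma frac_power: "fraction d \<phi> \<psi> \<Longrightarrow> fraction (k * d) (\<phi> ^ k) (\<psi> ^ k)"
  unfolding fraction_def by (metis V_power V_power_nonzero)

lemma frac_uminus: "fraction d \<phi> \<psi> \<Longrightarrow> fraction d (- \<phi>) \<psi>"
  unfolding fraction_def by (metis V_uminus)

lemma frac_cst: "fraction 0 (cst c) 1"
  unfolding fraction_def using V_cst V_1 by auto

lemma frac_inv: "fraction d \<phi> \<psi> \<Longrightarrow> \<phi> \<noteq> 0 \<Longrightarrow> fraction d \<psi> \<phi>"
  unfolding fraction_def by blast

lemma quot_eq_iff:
  assumes "fraction d \<phi> \<psi>" "fraction e \<phi>' \<psi>'"
  shows "quot \<phi> \<psi> = quot \<phi>' \<psi>' \<longleftrightarrow> \<phi> * \<psi>' = \<phi>' * \<psi>"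
proof
  assume eq: "quot \<phi> \<psi> = quot \<phi>' \<psi>'"
  obtain g h where "form n d g" "form n d h" and gh: "\<phi> = Ev g" "\<psi> = Ev h" "(g, h) \<in> fractions n C"
    using frac_rep[OF assms(1)] by blast
  then have "(g, h) \<in> quot \<phi> \<psi>" by (simp add: quot_def)
  then have "(g, h) \<in> quot \<phi>' \<psi>'" using eq by simp
  then show "\<phi> * \<psi>' = \<phi>' * \<psi>" by (simp add: quot_def gh)
next
  assume eq: "\<phi> * \<psi>' = \<phi>' * \<psi>"
  have sub: "quot \<phi> \<psi> \<subseteq> quot \<phi>' \<psi>'"
    if "fraction d \<phi> \<psi>" "fraction e \<phi>' \<psi>'" "\<phi> * \<psi>' = \<phi>' * \<psi>" for d \<phi> \<psi> e \<phi>' \<psi>'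
  proof
    fix x assume x: "x \<in> quot \<phi> \<psi>"
    obtain g h where gh: "x = (g, h)" by (cases x)
    then have gh': "(g, h) \<in> fractions n C" "\<phi> * Ev h = Ev g * \<psi>" using x by (auto simp: quot_def)
    obtain f where f: "fraction f (Ev g) (Ev h)" using fractions_frac gh'(1) by blast
    have "\<psi> * (\<phi>' * Ev h) = (\<phi>' * \<psi>) * Ev h" by (simp only: mult_ac)
    also have "\<dots> = (\<phi> * Ev h) * \<psi>'" unfolding that(3)[symmetric] by (simp only: mult_ac)
    also have "\<dots> = \<psi> * (Ev g * \<psi>')" unfolding gh'(2) by (simp only: mult_ac)
    finally have "\<phi>' * Ev h = Ev g * \<psi>'"
      using that f V_cancel[of \<psi> d "\<phi>' * Ev h" "e + f" "Ev g * \<psi>'"] V_mult[of \<phi>' e "Ev h" f]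
        V_mult[of "\<psi>'" e "Ev g" f]
      by (auto simp: fraction_def mult.commute)
    then show "x \<in> quot \<phi>' \<psi>'" using gh gh'(1) by (simp add: quot_def)
  qed
  show "quot \<phi> \<psi> = quot \<phi>' \<psi>'"
    using sub[OF assms eq] sub[OF assms(2,1) eq[symmetric]] by blast
qed

lemma quot_memD:
  assumes "fraction d \<phi> \<psi>" "(g, h) \<in> quot \<phi> \<psi>"
  shows "\<exists>e. form n e g \<and> form n e h \<and> fraction e (Ev g) (Ev h)" "\<phi> * Ev h = Ev g * \<psi>"
  using assms(2) fractions_iff VI unfolding quot_def fraction_def by auto

lemma quot_nonempty: "fraction d \<phi> \<psi> \<Longrightarrow> \<exists>g h. (g, h) \<in> quot \<phi> \<psi>"
  using frac_rep unfolding quot_def by fastforce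

lemma quot_carrier: "fraction d \<phi> \<psi> \<Longrightarrow> quot \<phi> \<psi> \<in> carrier K"
  using frac_rep[of d \<phi> \<psi>] by (force simp: function_field_def rat_fun_quot)

lemma carrierE:
  assumes "f \<in> carrier K" obtains d \<phi> \<psi> where "fraction d \<phi> \<psi>" "f = quot \<phi> \<psi>"
proof -
  obtain g h where gh: "(g, h) \<in> fractions n C" "f = quot (Ev g) (Ev h)"
    using assms by (auto simp: function_field_def rat_fun_quot)
  then show thesis using fractions_frac that by blast
qed

lemma UN_const_eq: "(\<And>x. x \<in> A \<Longrightarrow> f x = c) \<Longrightarrow> A \<noteq> {} \<Longrightarrow> (\<Union>x\<in>A. f x) = c"
  by auto

lemma quot_mult:
  assumes "fraction d \<phi> \<psi>" "fraction e \<phi>' \<psi>'"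
  shows "quot \<phi> \<psi> \<otimes>\<^bsub>K\<^esub> quot \<phi>' \<psi>' = quot (\<phi> * \<phi>') (\<psi> * \<psi>')"
proof -
  have *: "rat_fun n C (g * g') (h * h') = quot (\<phi> * \<phi>') (\<psi> * \<psi>')"
    if gh: "(g, h) \<in> quot \<phi> \<psi>" "(g', h') \<in> quot \<phi>' \<psi>'" for g h g' h'
  proof -
    obtain a b where ab: "fraction a (Ev g) (Ev h)" "fraction b (Ev g') (Ev h')"
      using quot_memD(1)[OF assms(1) gh(1)] quot_memD(1)[OF assms(2) gh(2)] by blast
    have "(Ev g * Ev g') * (\<psi> * \<psi>') = (Ev g * \<psi>) * (Ev g' * \<psi>')" by (simp only: mult_ac)
    also have "\<dots> = (\<phi> * Ev h) * (\<phi>' * Ev h')"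
      using quot_memD(2)[OF assms(1) gh(1)] quot_memD(2)[OF assms(2) gh(2)] by (simp only:)
    also have "\<dots> = (\<phi> * \<phi>') * (Ev h * Ev h')" by (simp only: mult_ac)
    finally show ?thesis unfolding rat_fun_quot Ev_mult
      using quot_eq_iff[OF frac_mult[OF ab] frac_mult[OF assms]] by blast
  qed
  have "quot \<phi> \<psi> \<otimes>\<^bsub>K\<^esub> quot \<phi>' \<psi>' = (\<Union>(g, h)\<in>quot \<phi> \<psi>. \<Union>(g', h')\<in>quot \<phi>' \<psi>'. rat_fun n C (g * g') (h * h'))"
    by (simp add: function_field_def)
  also have "\<dots> = quot (\<phi> * \<phi>') (\<psi> * \<psi>')"
    using quot_nonempty[OF assms(1)] quot_nonempty[OF assms(2)]
    by (intro UN_const_eq) (auto simp: *)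
  finally show ?thesis .
qed

lemma quot_add:
  assumes "fraction d \<phi> \<psi>" "fraction e \<phi>' \<psi>'"
  shows "quot \<phi> \<psi> \<oplus>\<^bsub>K\<^esub> quot \<phi>' \<psi>' = quot (\<phi> * \<psi>' + \<phi>' * \<psi>) (\<psi> * \<psi>')"
proof -
  have *: "rat_fun n C (g * h' + g' * h) (h * h') = quot (\<phi> * \<psi>' + \<phi>' * \<psi>) (\<psi> * \<psi>')"
    if gh: "(g, h) \<in> quot \<phi> \<psi>" "(g', h') \<in> quot \<phi>' \<psi>'" for g h g' h'
  proof -
    obtain a b where ab: "fraction a (Ev g) (Ev h)" "fraction b (Ev g') (Ev h')"
      using quot_memD(1)[OF assms(1) gh(1)] quot_memD(1)[OF assms(2) gh(2)] by blast
    have "(Ev g * Ev h' + Ev g' * Ev h) * (\<psi> * \<psi>') = (Ev g * \<psi>) * (Ev h' * \<psi>') + (Ev g' * \<psi>') * (Ev h * \<psi>)"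
      by (simp only: distrib_right distrib_left mult_ac)
    also have "\<dots> = (\<phi> * Ev h) * (Ev h' * \<psi>') + (\<phi>' * Ev h') * (Ev h * \<psi>)"
      using quot_memD(2)[OF assms(1) gh(1)] quot_memD(2)[OF assms(2) gh(2)] by (simp only:)
    also have "\<dots> = (\<phi> * \<psi>' + \<phi>' * \<psi>) * (Ev h * Ev h')" by (simp only: distrib_right distrib_left mult_ac)
    finally show ?thesis unfolding rat_fun_quot Ev_mult Ev_add
      using quot_eq_iff[OF frac_add[OF ab] frac_add[OF assms]] by blast
  qed
  have "quot \<phi> \<psi> \<oplus>\<^bsub>K\<^esub> quot \<phi>' \<psi>' = (\<Union>(g, h)\<in>quot \<phi> \<psi>. \<Union>(g', h')\<in>quot \<phi>' \<psi>'. rat_fun n C (g * h' + g' * h) (h * h'))"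
    by (simp add: function_field_def)
  also have "\<dots> = quot (\<phi> * \<psi>' + \<phi>' * \<psi>) (\<psi> * \<psi>')"
    using quot_nonempty[OF assms(1)] quot_nonempty[OF assms(2)]
    by (intro UN_const_eq) (auto simp: *)
  finally show ?thesis .
qed

lemma one_K: "\<one>\<^bsub>K\<^esub> = quot 1 1" by (simp add: function_field_def rat_fun_quot)
lemma zero_K: "\<zero>\<^bsub>K\<^esub> = quot 0 1" by (simp add: function_field_def rat_fun_quot)

lemma frac_1: "fraction 0 1 1" and frac_0: "fraction 0 0 1"
  using frac_cst[of 1] frac_cst[of 0] by simp_all

lemma quot_eq_0_iff: "fraction d \<phi> \<psi> \<Longrightarrow> quot \<phi> \<psi> = \<zero>\<^bsub>K\<^esub> \<longleftrightarrow> \<phi> = 0"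
  unfolding zero_K by (subst quot_eq_iff[OF _ frac_0]) auto

lemma quot_eq_1_iff: "fraction d \<phi> \<psi> \<Longrightarrow> quot \<phi> \<psi> = \<one>\<^bsub>K\<^esub> \<longleftrightarrow> \<phi> = \<psi>"
  unfolding one_K by (subst quot_eq_iff[OF _ frac_1]) auto

text \<open>
  The field axioms hold for fractions over the domain of homogeneous functions; degrees have to be
  carried along because only forms of equal degree make up a fraction.
\<close>

lemma field_K: "field K"
proof -
  have add_inv: "\<exists>y\<in>carrier K. y \<oplus>\<^bsub>K\<^esub> x = \<zero>\<^bsub>K\<^esub>" if x: "x \<in> carrier K" for x
  proof -
    obtain d \<phi> \<psi> where f: "fraction d \<phi> \<psi>" "x = quot \<phi> \<psi>" using carrierE[OF x] by blast
    have "quot (- \<phi>) \<psi> \<oplus>\<^bsub>K\<^esub> quot \<phi> \<psi> = \<zero>\<^bsub>K\<^esub>"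
      unfolding quot_add[OF frac_uminus[OF f(1)] f(1)]
        quot_eq_0_iff[OF frac_add[OF frac_uminus[OF f(1)] f(1)]] by simp
    then show ?thesis using f quot_carrier[OF frac_uminus[OF f(1)]] by blast
  qed
  have A: "abelian_group K"
  proof (rule abelian_groupI)
    fix x y z assume "x \<in> carrier K" "y \<in> carrier K" "z \<in> carrier K"
    then obtain d1 \<phi>1 \<psi>1 d2 \<phi>2 \<psi>2 d3 \<phi>3 \<psi>3 where
      f: "fraction d1 \<phi>1 \<psi>1" "fraction d2 \<phi>2 \<psi>2" "fraction d3 \<phi>3 \<psi>3"
      and xyz: "x = quot \<phi>1 \<psi>1" "y = quot \<phi>2 \<psi>2" "z = quot \<phi>3 \<psi>3"
      by (metis carrierE)
    show "x \<oplus>\<^bsub>K\<^esub> y \<oplus>\<^bsub>K\<^esub> z = x \<oplus>\<^bsub>K\<^esub> (y \<oplus>\<^bsub>K\<^esub> z)"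
      unfolding xyz quot_add[OF f(1,2)] quot_add[OF f(2,3)]
        quot_add[OF frac_add[OF f(1,2)] f(3)] quot_add[OF f(1) frac_add[OF f(2,3)]]
        quot_eq_iff[OF frac_add[OF frac_add[OF f(1,2)] f(3)] frac_add[OF f(1) frac_add[OF f(2,3)]]]
      by (simp only: algebra_simps)
  next
    fix x y assume "x \<in> carrier K" "y \<in> carrier K"
    then obtain d1 \<phi>1 \<psi>1 d2 \<phi>2 \<psi>2 where
      f: "fraction d1 \<phi>1 \<psi>1" "fraction d2 \<phi>2 \<psi>2" and xyz: "x = quot \<phi>1 \<psi>1" "y = quot \<phi>2 \<psi>2"
      by (metis carrierE)
    show "x \<oplus>\<^bsub>K\<^esub> y \<in> carrier K" unfolding xyz quot_add[OF f] by (rule quot_carrier[OF frac_add[OF f]])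
    show "x \<oplus>\<^bsub>K\<^esub> y = y \<oplus>\<^bsub>K\<^esub> x"
      unfolding xyz quot_add[OF f] quot_add[OF f(2,1)] by (simp only: algebra_simps)
  next
    show "\<zero>\<^bsub>K\<^esub> \<in> carrier K" unfolding zero_K by (rule quot_carrier[OF frac_0])
  next
    fix x assume "x \<in> carrier K"
    then obtain d \<phi> \<psi> where f: "fraction d \<phi> \<psi>" "x = quot \<phi> \<psi>" by (metis carrierE)
    show "\<zero>\<^bsub>K\<^esub> \<oplus>\<^bsub>K\<^esub> x = x" unfolding zero_K f(2) quot_add[OF frac_0 f(1)] by simp
  next
    fix x assume "x \<in> carrier K"
    then show "\<exists>y\<in>carrier K. y \<oplus>\<^bsub>K\<^esub> x = \<zero>\<^bsub>K\<^esub>" by (rule add_inv)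
  qed
  have M: "Group.comm_monoid K"
  proof (rule comm_monoidI)
    fix x y z assume "x \<in> carrier K" "y \<in> carrier K" "z \<in> carrier K"
    then obtain d1 \<phi>1 \<psi>1 d2 \<phi>2 \<psi>2 d3 \<phi>3 \<psi>3 where
      f: "fraction d1 \<phi>1 \<psi>1" "fraction d2 \<phi>2 \<psi>2" "fraction d3 \<phi>3 \<psi>3"
      and xyz: "x = quot \<phi>1 \<psi>1" "y = quot \<phi>2 \<psi>2" "z = quot \<phi>3 \<psi>3"
      by (metis carrierE)
    show "x \<otimes>\<^bsub>K\<^esub> y \<otimes>\<^bsub>K\<^esub> z = x \<otimes>\<^bsub>K\<^esub> (y \<otimes>\<^bsub>K\<^esub> z)"
      unfolding xyz quot_mult[OF f(1,2)] quot_mult[OF f(2,3)]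
        quot_mult[OF frac_mult[OF f(1,2)] f(3)] quot_mult[OF f(1) frac_mult[OF f(2,3)]]
      by (simp only: mult_ac)
  next
    fix x y assume "x \<in> carrier K" "y \<in> carrier K"
    then obtain d1 \<phi>1 \<psi>1 d2 \<phi>2 \<psi>2 where
      f: "fraction d1 \<phi>1 \<psi>1" "fraction d2 \<phi>2 \<psi>2" and xyz: "x = quot \<phi>1 \<psi>1" "y = quot \<phi>2 \<psi>2"
      by (metis carrierE)
    show "x \<otimes>\<^bsub>K\<^esub> y \<in> carrier K" unfolding xyz quot_mult[OF f] by (rule quot_carrier[OF frac_mult[OF f]])
    show "x \<otimes>\<^bsub>K\<^esub> y = y \<otimes>\<^bsub>K\<^esub> x"
      unfolding xyz quot_mult[OF f] quot_mult[OF f(2,1)] by (simp only: mult_ac)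
  next
    show "\<one>\<^bsub>K\<^esub> \<in> carrier K" unfolding one_K by (rule quot_carrier[OF frac_1])
  next
    fix x assume "x \<in> carrier K"
    then obtain d \<phi> \<psi> where f: "fraction d \<phi> \<psi>" "x = quot \<phi> \<psi>" by (metis carrierE)
    show "\<one>\<^bsub>K\<^esub> \<otimes>\<^bsub>K\<^esub> x = x" unfolding one_K f(2) quot_mult[OF frac_1 f(1)] by simp
  qed
  have R: "cring K"
  proof (rule cringI[OF A M])
    fix x y z assume "x \<in> carrier K" "y \<in> carrier K" "z \<in> carrier K"
    then obtain d1 \<phi>1 \<psi>1 d2 \<phi>2 \<psi>2 d3 \<phi>3 \<psi>3 where
      f: "fraction d1 \<phi>1 \<psi>1" "fraction d2 \<phi>2 \<psi>2" "fraction d3 \<phi>3 \<psi>3"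
      and xyz: "x = quot \<phi>1 \<psi>1" "y = quot \<phi>2 \<psi>2" "z = quot \<phi>3 \<psi>3"
      by (metis carrierE)
    show "(x \<oplus>\<^bsub>K\<^esub> y) \<otimes>\<^bsub>K\<^esub> z = x \<otimes>\<^bsub>K\<^esub> z \<oplus>\<^bsub>K\<^esub> y \<otimes>\<^bsub>K\<^esub> z"
      unfolding xyz quot_add[OF f(1,2)] quot_mult[OF f(1,3)] quot_mult[OF f(2,3)]
        quot_mult[OF frac_add[OF f(1,2)] f(3)] quot_add[OF frac_mult[OF f(1,3)] frac_mult[OF f(2,3)]]
        quot_eq_iff[OF frac_mult[OF frac_add[OF f(1,2)] f(3)] frac_add[OF frac_mult[OF f(1,3)] frac_mult[OF f(2,3)]]]
      by (simp only: algebra_simps)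
  qed
  show "field K"
  proof (rule cring.cring_fieldI2[OF R])
    show "\<zero>\<^bsub>K\<^esub> \<noteq> \<one>\<^bsub>K\<^esub>" using quot_eq_0_iff[OF frac_1] one_K by simp
  next
    fix x assume x: "x \<in> carrier K" "x \<noteq> \<zero>\<^bsub>K\<^esub>"
    then obtain d \<phi> \<psi> where f: "fraction d \<phi> \<psi>" "x = quot \<phi> \<psi>" by (metis carrierE)
    then have f': "fraction d \<psi> \<phi>" using x(2) frac_inv quot_eq_0_iff by blast
    have "x \<otimes>\<^bsub>K\<^esub> quot \<psi> \<phi> = \<one>\<^bsub>K\<^esub>"
      unfolding f(2) quot_mult[OF f(1) f'] quot_eq_1_iff[OF frac_mult[OF f(1) f']] by (rule mult.commute)
    then show "\<exists>y\<in>carrier K. x \<otimes>\<^bsub>K\<^esub> y = \<one>\<^bsub>K\<^esub>" using quot_carrier[OF f'] by blast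
  qed
qed

sublocale K: field K by (rule field_K)

lemma quot_inv:
  assumes "fraction d \<phi> \<psi>" "\<phi> \<noteq> 0"
  shows "inv\<^bsub>K\<^esub> (quot \<phi> \<psi>) = quot \<psi> \<phi>"
proof (rule K.comm_inv_char)
  have f': "fraction d \<psi> \<phi>" using assms frac_inv by blast
  show "quot \<phi> \<psi> \<otimes>\<^bsub>K\<^esub> quot \<psi> \<phi> = \<one>\<^bsub>K\<^esub>"
    unfolding quot_mult[OF assms(1) f'] quot_eq_1_iff[OF frac_mult[OF assms(1) f']] by (rule mult.commute)
qed (use assms frac_inv quot_carrier in blast)+

lemma quot_uminus:
  assumes "fraction d \<phi> \<psi>"
  shows "\<ominus>\<^bsub>K\<^esub> (quot \<phi> \<psi>) = quot (- \<phi>) \<psi>"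
proof (rule K.minus_equality)
  show "quot (- \<phi>) \<psi> \<oplus>\<^bsub>K\<^esub> quot \<phi> \<psi> = \<zero>\<^bsub>K\<^esub>"
      unfolding quot_add[OF frac_uminus[OF assms(1)] assms(1)]
        quot_eq_0_iff[OF frac_add[OF frac_uminus[OF assms(1)] assms(1)]] by simp
qed (use assms frac_uminus quot_carrier in blast)+

lemma quot_nat_pow:
  assumes "fraction d \<phi> \<psi>"
  shows "quot \<phi> \<psi> [^]\<^bsub>K\<^esub> (k::nat) = quot (\<phi> ^ k) (\<psi> ^ k)"
proof (induction k)
  case 0
  show ?case unfolding power_0 one_K[symmetric] by simp
next
  case (Suc k)
  show ?case unfolding K.nat_pow_Suc Suc quot_mult[OF frac_power[OF assms] assms] power_Suc2 ..
qed

lemma quot_int_pow: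
  assumes "fraction d \<phi> \<psi>" "\<phi> \<noteq> 0"
  shows "quot \<phi> \<psi> [^]\<^bsub>K\<^esub> (k::int) =
     (if k \<ge> 0 then quot (\<phi> ^ nat k) (\<psi> ^ nat k) else quot (\<psi> ^ nat (- k)) (\<phi> ^ nat (- k)))"
proof (cases "k \<ge> 0")
  case True
  then have "quot \<phi> \<psi> [^]\<^bsub>K\<^esub> k = quot \<phi> \<psi> [^]\<^bsub>K\<^esub> nat k" by (simp add: int_pow_def2 nat_pow_def)
  then show ?thesis using True quot_nat_pow[OF assms(1)] by simp
next
  case False
  have "\<phi> ^ nat (- k) \<noteq> 0" using assms V_power_nonzero unfolding fraction_def by blast
  then have "inv\<^bsub>K\<^esub> (quot \<phi> \<psi> [^]\<^bsub>K\<^esub> nat (- k)) = quot (\<psi> ^ nat (- k)) (\<phi> ^ nat (- k))"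
    unfolding quot_nat_pow[OF assms(1)] by (rule quot_inv[OF frac_power[OF assms(1)]])
  then show ?thesis using False by (simp add: int_pow_def2 nat_pow_def)
qed

end

section \<open>Algebraic dependence of two rational functions\<close>

text \<open>
  From here on functions are mostly treated as elements of a ring; pointwise evaluation is invoked
  explicitly.
\<close>

lemmas fun_apply = plus_fun_apply times_fun_apply zero_fun_apply one_fun_apply minus_apply uminus_apply cst_apply

declare fun_apply [simp del]

lemma lin_span_induct [consumes 1, case_names zero scale add]:
  assumes "x \<in> lin_span S" "P 0" "\<And>c s. s \<in> S \<Longrightarrow> P (cst c * s)" "\<And>x y. P x \<Longrightarrow> P y \<Longrightarrow> P (x + y)"
  shows "P x"
proof -
  obtain c where c: "x = (\<Sum>s\<in>S. cst (c s) * s)" using assms(1) by (auto simp: lin_span_def)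
  show ?thesis unfolding c by (rule sum_in_closed[where P = P]) (use assms in blast)+
qed

lemma lin_span_mult:
  assumes "\<And>s s'. s \<in> S \<Longrightarrow> s' \<in> S' \<Longrightarrow> s * s' \<in> lin_span T" "x \<in> lin_span S" "y \<in> lin_span S'"
  shows "x * y \<in> lin_span T"
  using assms(2)
proof (induction rule: lin_span_induct)
  case zero
  show ?case by (simp only: mult_zero_left lin_span_0)
next
  case (scale c s)
  have "s * y \<in> lin_span T" using assms(3)
  proof (induction rule: lin_span_induct)
    case zero
    show ?case by (simp only: mult_zero_right lin_span_0)
  next
    case (scale c s')
    have "s * (cst c * s') = cst c * (s * s')" by (simp only: mult.left_commute)
    then show ?case using lin_span_scale[OF assms(1)[OF \<open>s \<in> S\<close> scale]] by (simp only:)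
  next
    case (add y y')
    then show ?case by (simp only: distrib_left lin_span_add)
  qed
  then show ?case by (simp only: mult.assoc lin_span_scale)
next
  case (add x x')
  then show ?case by (simp only: distrib_right lin_span_add)
qed

text \<open>
  Their span represents the polynomials in \<open>t = t1 / t0\<close> of degree at most \<open>e\<close>, multiplied by
  \<open>t0 ^ e\<close>.
\<close>

definition binary_monomials :: "('x \<Rightarrow> 'k::comm_ring_1) \<Rightarrow> ('x \<Rightarrow> 'k) \<Rightarrow> nat \<Rightarrow> ('x \<Rightarrow> 'k) set" where
  "binary_monomials t1 t0 e = (\<lambda>i. t1 ^ i * t0 ^ (e - i)) ` {..e}"

lemma finite_binary_monomials [simp]: "finite (binary_monomials t1 t0 e)"
  by (simp add: binary_monomials_def)

lemma card_binary_monomials: "card (binary_monomials t1 t0 e) \<le> Suc e"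
  unfolding binary_monomials_def using card_image_le[of "{..e}"] by simp

lemma binary_monomials_mult:
  assumes "s \<in> binary_monomials t1 t0 e" "s' \<in> binary_monomials t1 t0 e'"
  shows "s * s' \<in> binary_monomials t1 t0 (e + e')"
proof -
  obtain i j where i: "i \<le> e" "s = t1 ^ i * t0 ^ (e - i)" and j: "j \<le> e'" "s' = t1 ^ j * t0 ^ (e' - j)"
    using assms by (auto simp: binary_monomials_def)
  have e: "e + e' - (i + j) = (e - i) + (e' - j)" using i j by simp
  have "s * s' = t1 ^ (i + j) * t0 ^ (e + e' - (i + j))"
    unfolding e power_add i(2) j(2) by (simp only: mult_ac)
  then show ?thesis using i j unfolding binary_monomials_def by (intro image_eqI[of _ _ "i + j"]) auto
qed

text \<open>
  With \<open>f = f1 / f0\<close> and \<open>t = t1 / t0\<close>, their span represents the polynomials in \<open>t\<close> and \<open>f\<close> of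
  degree at most \<open>e\<close> in \<open>t\<close> and less than \<open>m\<close> in \<open>f\<close>, after multiplication by \<open>t0 ^ e * f0 ^ L\<close>.
\<close>

definition low_monomials where
  "low_monomials t1 t0 f1 f0 e m L = (\<lambda>(s, v). s * (f1 ^ v * f0 ^ (L - v))) ` (binary_monomials t1 t0 e \<times> {..<m::nat})"

lemma low_mult:
  assumes "x \<in> lin_span (binary_monomials t1 t0 e')" "y \<in> lin_span (low_monomials t1 t0 f1 f0 e m L)"
  shows "x * y \<in> lin_span (low_monomials t1 t0 f1 (f0 :: 'x \<Rightarrow> 'k::field) (e' + e) m L)"
proof (rule lin_span_mult[OF _ assms])
  fix s s' assume s: "s \<in> binary_monomials t1 t0 e'" and "s' \<in> low_monomials t1 t0 f1 f0 e m L"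
  then obtain r v where s': "s' = r * (f1 ^ v * f0 ^ (L - v))" "r \<in> binary_monomials t1 t0 e" "v < m"
    by (auto simp: low_monomials_def)
  have "s * s' = (s * r) * (f1 ^ v * f0 ^ (L - v))" unfolding s'(1) by (simp only: mult.assoc)
  moreover have "finite (low_monomials t1 t0 f1 f0 (e' + e) m L)" by (simp add: low_monomials_def)
  ultimately show "s * s' \<in> lin_span (low_monomials t1 t0 f1 f0 (e' + e) m L)"
    using binary_monomials_mult[OF s s'(2)] s'(3)
    by (intro lin_span_base) (auto simp: low_monomials_def intro!: image_eqI[of _ _ "(s * r, v)"])
qed

lemma binary_span_mult:
  assumes "x \<in> lin_span (binary_monomials t1 t0 e')" "y \<in> lin_span (binary_monomials t1 (t0 :: 'x \<Rightarrow> 'k::field) e)"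
  shows "x * y \<in> lin_span (binary_monomials t1 t0 (e' + e))"
  by (rule lin_span_mult[OF _ assms]) (simp add: lin_span_base binary_monomials_mult)

lemma binary_span_one: "1 \<in> lin_span (binary_monomials t1 (t0 :: 'x \<Rightarrow> 'k::field) 0)"
  by (rule lin_span_base) (auto simp: binary_monomials_def)

lemma binary_span_power:
  "x \<in> lin_span (binary_monomials t1 t0 e) \<Longrightarrow> x ^ k \<in> lin_span (binary_monomials t1 (t0 :: 'x \<Rightarrow> 'k::field) (k * e))"
proof (induction k)
  case 0
  show ?case unfolding power_0 mult_0 by (rule binary_span_one)
next
  case (Suc k)
  then show ?case unfolding power_Suc mult_Suc by (intro binary_span_mult)
qed

text \<open>
  Suppose that \<open>f\<close> satisfies an equation of degree \<open>m\<close> whose coefficients are polynomials in \<open>t\<close>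
  of degree at most \<open>e\<close> and whose leading coefficient is \<open>A\<close>. Every use of the equation lowers the
  power of \<open>f\<close> at the cost of one factor \<open>A\<close>, hence \<open>A\<^sup>a f\<^sup>a\<close> is a polynomial in \<open>t\<close> and \<open>f\<close> with
  degree below \<open>m\<close> in \<open>f\<close>. What matters is that the degree \<open>a e\<close> in \<open>t\<close> is linear in \<open>a\<close>.
\<close>

lemma low_power:
  fixes f1 f0 :: "'x \<Rightarrow> 'k::field"
  assumes A: "A \<in> lin_span (binary_monomials t1 t0 e)"
    and rel: "A * f1 ^ m \<in> lin_span (low_monomials t1 t0 f1 f0 e m m)"
    and m: "0 < m" "m \<le> L" and a: "a \<le> L"
  shows "A ^ a * (f1 ^ a * f0 ^ (L - a)) \<in> lin_span (low_monomials t1 t0 f1 f0 (a * e) m L)"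
  using a
proof (induction a rule: less_induct)
  case (less a)
  have fin: "finite (low_monomials t1 t0 f1 f0 e' m L)" for e' by (simp add: low_monomials_def)
  show ?case
  proof (cases "a < m")
    case True
    have "1 * (f1 ^ a * f0 ^ (L - a)) \<in> low_monomials t1 t0 f1 f0 0 m L"
      unfolding low_monomials_def using True
      by (intro image_eqI[of _ _ "(1, a)"]) (auto simp: binary_monomials_def)
    then have "f1 ^ a * f0 ^ (L - a) \<in> lin_span (low_monomials t1 t0 f1 f0 0 m L)"
      unfolding mult_1 by (rule lin_span_base[OF fin])
    from low_mult[OF binary_span_power[OF A] this, of a] show ?thesis unfolding add_0_right .
  next
    case False
    have "A ^ (a - 1) * (f1 ^ (a - m) * f0 ^ (L - a)) * y \<in> lin_span (low_monomials t1 t0 f1 f0 (a * e) m L)"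
      if "y \<in> lin_span (low_monomials t1 t0 f1 f0 e m m)" for y
      using that
    proof (induction rule: lin_span_induct)
      case zero
      show ?case by (simp only: mult_zero_right lin_span_0)
    next
      case (scale c s)
      then obtain r v where s: "s = r * (f1 ^ v * f0 ^ (m - v))" "r \<in> binary_monomials t1 t0 e" "v < m"
        by (auto simp: low_monomials_def)
      \<comment> \<open>One use of the equation turns \<open>f\<^sup>a\<close> into powers \<open>f\<^sup>b\<close> with \<open>b < a\<close>. The induction
        hypothesis for \<open>f\<^sup>b\<close> uses \<open>b\<close> factors \<open>A\<close>, and the remaining \<open>a - 1 - b\<close> are put
        into the coefficient.\<close>
      define b where "b = a - m + v"
      have b: "b < a" "b \<le> L" using False s(3) less.prems by (auto simp: b_def)
      have exps: "a - 1 = (a - 1 - b) + b" "L - b = (L - a) + (m - v)"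
        using b False s(3) less.prems by (auto simp: b_def)
      have IH: "A ^ b * (f1 ^ b * f0 ^ (L - b)) \<in> lin_span (low_monomials t1 t0 f1 f0 (b * e) m L)"
        by (rule less.IH[OF b])
      have r: "A ^ (a - 1 - b) * r \<in> lin_span (binary_monomials t1 t0 ((a - 1 - b) * e + e))"
        by (intro binary_span_mult binary_span_power A lin_span_base s) simp
      have "A ^ (a - 1) * (f1 ^ (a - m) * f0 ^ (L - a)) * (cst c * s) =
          cst c * ((A ^ (a - 1 - b) * r) * (A ^ b * (f1 ^ b * f0 ^ (L - b))))"
        unfolding exps(2) s(1) by (subst exps(1)) (simp only: b_def power_add mult_ac)
      moreover have "(a - 1 - b) * e + e + b * e = a * e"
      proof -
        have "(a - 1 - b) * e + e + b * e = (a - 1 - b + 1 + b) * e" by (simp only: distrib_right mult_1)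
        then show ?thesis using b by simp
      qed
      ultimately show ?case using lin_span_scale[OF low_mult[OF r IH], of c] by (simp only:)
    next
      case (add x y)
      then show ?case by (simp only: distrib_left lin_span_add)
    qed
    from this[OF rel]
    have "A ^ (a - 1) * (f1 ^ (a - m) * f0 ^ (L - a)) * (A * f1 ^ m) \<in> lin_span (low_monomials t1 t0 f1 f0 (a * e) m L)" .
    moreover have "a = Suc (a - 1)" "a = (a - m) + m" using False m by auto
    then have "A ^ a = A * A ^ (a - 1)" "f1 ^ a = f1 ^ (a - m) * f1 ^ m"
      by (metis power_Suc, metis power_add)
    then have "A ^ a * (f1 ^ a * f0 ^ (L - a)) = A ^ (a - 1) * (f1 ^ (a - m) * f0 ^ (L - a)) * (A * f1 ^ m)"
      by (simp only: mult_ac)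
    ultimately show ?thesis by (simp only:)
  qed
qed

lemma one_neq_zero_fun: "(1 :: 'x \<Rightarrow> 'k::zero_neq_one) \<noteq> 0"
  by simp

locale projective_curve = projective_variety +
  assumes one_dim: "one_dimensional n C"
begin

lemma one_dim_generator:
  obtains dt t1 t0 where "fraction dt t1 t0"
    "\<And>f. f \<in> carrier K \<Longrightarrow> (K.algebraic over generate_field K (insert (quot t1 t0) (constants n C))) f"
  using one_dim carrierE unfolding one_dimensional_def Let_def by metis

lemma binary_V:
  assumes "fraction dt t1 t0" "x \<in> lin_span (binary_monomials t1 t0 e)"
  shows "x \<in> V (e * dt)"
  using assms(2)
proof (induction rule: lin_span_induct)
  case (scale c s)
  then obtain i where i: "i \<le> e" "s = t1 ^ i * t0 ^ (e - i)" by (auto simp: binary_monomials_def)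
  have "t1 ^ i * t0 ^ (e - i) \<in> V (i * dt + (e - i) * dt)"
    using assms(1) unfolding fraction_def by (intro V_mult V_power) auto
  then have "s \<in> V (e * dt)" using i by (simp flip: add_mult_distrib)
  then show ?case by (rule V_cst_mult)
next
  case zero
  show ?case by (rule V_0)
next
  case (add x y)
  then show ?case by (rule V_add)
qed

text \<open>
  Elements of the field generated by \<open>t\<close> over the constants are quotients of two polynomials in
  \<open>t\<close>, homogenised to a common degree.
\<close>

lemma generated_field_binary:
  assumes t: "fraction dt t1 t0" and z: "z \<in> generate_field K (insert (quot t1 t0) (constants n C))"
  shows "\<exists>e \<alpha> \<beta>. \<alpha> \<in> lin_span (binary_monomials t1 t0 e) \<and> \<beta> \<in> lin_span (binary_monomials t1 t0 e) \<and> \<beta> \<noteq> 0 \<and> z = quot \<alpha> \<beta>"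
  using z
proof (induction rule: generate_field.induct)
  case one
  show ?case unfolding one_K using binary_span_one[of t1 t0] one_neq_zero_fun by blast
next
  case (incl h)
  then consider "h = quot t1 t0" | "h \<in> constants n C" by blast
  then show ?case
  proof cases
    case 1
    have "t1 \<in> lin_span (binary_monomials t1 t0 1)" "t0 \<in> lin_span (binary_monomials t1 t0 1)"
      by (intro lin_span_base; force simp: binary_monomials_def)+
    then show ?thesis using t 1 unfolding fraction_def by blast
  next
    case 2
    then obtain c where "h = quot (cst c) 1" by (auto simp: constants_def rat_fun_quot)
    moreover have "cst c * 1 \<in> lin_span (binary_monomials t1 t0 0)" by (intro lin_span_scale binary_span_one)
    ultimately show ?thesis using binary_span_one[of t1 t0] one_neq_zero_fun unfolding mult_1_right by blast
  qed
next
  case (a_inv h)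
  then obtain e \<alpha> \<beta> where ab: "\<alpha> \<in> lin_span (binary_monomials t1 t0 e)" "\<beta> \<in> lin_span (binary_monomials t1 t0 e)"
    "\<beta> \<noteq> 0" "h = quot \<alpha> \<beta>" by blast
  have f: "fraction (e * dt) \<alpha> \<beta>" using ab binary_V[OF t] by (auto simp: fraction_def)
  have "cst (-1) * \<alpha> \<in> lin_span (binary_monomials t1 t0 e)" by (intro lin_span_scale ab)
  moreover have "cst (-1) * \<alpha> = - \<alpha>" by (simp add: fun_eq_iff fun_apply)
  ultimately have "- \<alpha> \<in> lin_span (binary_monomials t1 t0 e)" by (simp only:)
  then show ?case using ab quot_uminus[OF f] by blast
next
  case (m_inv h)
  then obtain e \<alpha> \<beta> where ab: "\<alpha> \<in> lin_span (binary_monomials t1 t0 e)" "\<beta> \<in> lin_span (binary_monomials t1 t0 e)"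
    "\<beta> \<noteq> 0" "h = quot \<alpha> \<beta>" by blast
  have f: "fraction (e * dt) \<alpha> \<beta>" using ab binary_V[OF t] by (auto simp: fraction_def)
  have "\<alpha> \<noteq> 0" using m_inv(2) quot_eq_0_iff[OF f] ab by blast
  then show ?case using ab quot_inv[OF f] by blast
next
  case (eng_add h1 h2)
  then obtain e \<alpha> \<beta> e' \<alpha>' \<beta>' where ab: "\<alpha> \<in> lin_span (binary_monomials t1 t0 e)" "\<beta> \<in> lin_span (binary_monomials t1 t0 e)"
    "\<beta> \<noteq> 0" "h1 = quot \<alpha> \<beta>"
    and ab': "\<alpha>' \<in> lin_span (binary_monomials t1 t0 e')" "\<beta>' \<in> lin_span (binary_monomials t1 t0 e')"
    "\<beta>' \<noteq> 0" "h2 = quot \<alpha>' \<beta>'" by blast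
  have f: "fraction (e * dt) \<alpha> \<beta>" "fraction (e' * dt) \<alpha>' \<beta>'" using ab ab' binary_V[OF t] by (auto simp: fraction_def)
  have "\<alpha> * \<beta>' + \<beta> * \<alpha>' \<in> lin_span (binary_monomials t1 t0 (e + e'))"
    "\<beta> * \<beta>' \<in> lin_span (binary_monomials t1 t0 (e + e'))"
    by (intro lin_span_add binary_span_mult ab ab')+
  moreover have "\<beta> * \<beta>' \<noteq> 0" using frac_mult[OF f] by (simp add: fraction_def)
  moreover have "h1 \<oplus>\<^bsub>K\<^esub> h2 = quot (\<alpha> * \<beta>' + \<beta> * \<alpha>') (\<beta> * \<beta>')"
    unfolding ab(4) ab'(4) quot_add[OF f] by (simp only: mult.commute)
  ultimately show ?case by blast
next
  case (eng_mult h1 h2)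
  then obtain e \<alpha> \<beta> e' \<alpha>' \<beta>' where ab: "\<alpha> \<in> lin_span (binary_monomials t1 t0 e)" "\<beta> \<in> lin_span (binary_monomials t1 t0 e)"
    "\<beta> \<noteq> 0" "h1 = quot \<alpha> \<beta>"
    and ab': "\<alpha>' \<in> lin_span (binary_monomials t1 t0 e')" "\<beta>' \<in> lin_span (binary_monomials t1 t0 e')"
    "\<beta>' \<noteq> 0" "h2 = quot \<alpha>' \<beta>'" by blast
  have f: "fraction (e * dt) \<alpha> \<beta>" "fraction (e' * dt) \<alpha>' \<beta>'" using ab ab' binary_V[OF t] by (auto simp: fraction_def)
  have "\<alpha> * \<alpha>' \<in> lin_span (binary_monomials t1 t0 (e + e'))"
    "\<beta> * \<beta>' \<in> lin_span (binary_monomials t1 t0 (e + e'))"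
    by (intro binary_span_mult ab ab')+
  moreover have "\<beta> * \<beta>' \<noteq> 0" using frac_mult[OF f] by (simp add: fraction_def)
  moreover have "h1 \<otimes>\<^bsub>K\<^esub> h2 = quot (\<alpha> * \<alpha>') (\<beta> * \<beta>')"
    unfolding ab(4) ab'(4) by (rule quot_mult[OF f])
  ultimately show ?case by blast
qed

lemma common_denominator:
  assumes t: "fraction dt t1 t0"
    and "set p \<subseteq> generate_field K (insert (quot t1 t0) (constants n C))"
  shows "\<exists>e \<delta> As. \<delta> \<in> lin_span (binary_monomials t1 t0 e) \<and> \<delta> \<noteq> 0 \<and>
    set As \<subseteq> lin_span (binary_monomials t1 t0 e) \<and> p = map (\<lambda>A. quot A \<delta>) As"
  using assms(2)
proof (induction p)
  case Nil
  have "set [] \<subseteq> lin_span (binary_monomials t1 t0 0)" "[] = map (\<lambda>A. quot A 1) []" by simp_all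
  then show ?case using binary_span_one[of t1 t0] one_neq_zero_fun by blast
next
  case (Cons z p)
  then obtain e \<delta> As where d: "\<delta> \<in> lin_span (binary_monomials t1 t0 e)" "\<delta> \<noteq> 0"
    "set As \<subseteq> lin_span (binary_monomials t1 t0 e)" "p = map (\<lambda>A. quot A \<delta>) As" by auto
  obtain e' \<alpha> \<beta> where ab: "\<alpha> \<in> lin_span (binary_monomials t1 t0 e')" "\<beta> \<in> lin_span (binary_monomials t1 t0 e')"
    "\<beta> \<noteq> 0" "z = quot \<alpha> \<beta>" using generated_field_binary[OF t, of z] Cons.prems by auto
  have bd: "fraction (e' * dt) \<beta> \<beta>" "fraction (e * dt) \<delta> \<delta>" "fraction (e' * dt) \<alpha> \<beta>"
    using ab d binary_V[OF t] by (auto simp: fraction_def)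
  have nz: "\<beta> * \<delta> \<noteq> 0" using frac_mult[OF bd(1,2)] by (simp add: fraction_def)
  have 1: "z = quot (\<alpha> * \<delta>) (\<beta> * \<delta>)"
    unfolding ab(4) quot_eq_iff[OF bd(3) frac_mult[OF bd(3,2)]] by (simp only: mult_ac)
  have 2: "quot A \<delta> = quot (\<beta> * A) (\<beta> * \<delta>)" if "A \<in> set As" for A
  proof -
    have f: "fraction (e * dt) A \<delta>" using that d binary_V[OF t] by (auto simp: fraction_def)
    show ?thesis unfolding quot_eq_iff[OF f frac_mult[OF bd(1) f]] by (simp only: mult_ac)
  qed
  have "z # p = map (\<lambda>A. quot A (\<beta> * \<delta>)) (\<alpha> * \<delta> # map ((*) \<beta>) As)"
    using 1 2 d(4) by simp
  moreover have "set (\<alpha> * \<delta> # map ((*) \<beta>) As) \<subseteq> lin_span (binary_monomials t1 t0 (e' + e))"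
    using d(1,3) ab(1,2) by (auto intro!: binary_span_mult)
  moreover have "\<beta> * \<delta> \<in> lin_span (binary_monomials t1 t0 (e' + e))" by (intro binary_span_mult ab d)
  ultimately show ?case using nz
    by (intro exI[of _ "e' + e"] exI[of _ "\<beta> * \<delta>"] exI[of _ "\<alpha> * \<delta> # map ((*) \<beta>) As"] conjI)
qed

text \<open>
  A polynomial is given by its coefficients, leading one first, as for \<open>K.eval\<close>. The result is its
  value at \<open>f1 / f0\<close> multiplied by \<open>f0 ^ length As\<close>, so that it is again a homogeneous function.
\<close>

fun homog_eval :: "(('x \<Rightarrow> 'k)) list \<Rightarrow> ('x \<Rightarrow> 'k) \<Rightarrow> ('x \<Rightarrow> 'k) \<Rightarrow> ('x \<Rightarrow> 'k::field)" where
  "homog_eval [] f1 f0 = 0"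
| "homog_eval (A # As) f1 f0 = f0 * (A * f1 ^ length As + homog_eval As f1 f0)"

lemma homog_eval_V:
  assumes "fraction d f1 f0" "set As \<subseteq> V e"
  shows "homog_eval As f1 f0 \<in> V (e + length As * d)"
  using assms(2)
proof (induction As)
  case (Cons A As)
  have "f0 * (A * f1 ^ length As + homog_eval As f1 f0) \<in> V (d + (e + length As * d))"
    using assms(1) Cons unfolding fraction_def
    by (intro V_mult[of f0] V_add V_mult[of A] V_power[of f1]) auto
  then show ?case unfolding homog_eval.simps by (rule V_eq) simp
next
  case Nil
  show ?case unfolding homog_eval.simps by (rule V_0)
qed

lemma eval_quot:
  assumes f: "fraction d f1 f0" and \<delta>: "\<delta> \<in> V e" "\<delta> \<noteq> 0" and "set As \<subseteq> V e"
  shows "K.eval (map (\<lambda>A. quot A \<delta>) As) (quot f1 f0) = quot (homog_eval As f1 f0) (\<delta> * f0 ^ length As)"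
  using assms(4)
proof (induction As)
  case Nil
  have "fraction e 0 \<delta>" using \<delta> by (simp add: fraction_def)
  then have "quot 0 \<delta> = \<zero>\<^bsub>K\<^esub>" using quot_eq_0_iff[of e 0 \<delta>] by simp
  then show ?case unfolding homog_eval.simps list.map K.eval.simps list.size power_0 mult_1_right by (rule sym)
next
  case (Cons A As)
  have f1f0: "f1 \<in> V d" "f0 \<in> V d" "f0 \<noteq> 0" using f by (auto simp: fraction_def)
  have fA: "fraction e A \<delta>" using Cons \<delta> by (auto simp: fraction_def)
  let ?l = "length As"
  have d0: "\<delta> * f0 ^ ?l \<in> V (e + ?l * d)" "\<delta> * f0 ^ ?l \<noteq> 0"
    using V_mult[OF \<delta>(1) V_power[OF f1f0(2)]] V_mult_nonzero[OF \<delta>(1) V_power[OF f1f0(2)] \<delta>(2)]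
      V_power_nonzero[OF f1f0(2,3)] by auto
  have fl: "fraction (e + ?l * d) (A * f1 ^ ?l) (\<delta> * f0 ^ ?l)"
    by (rule frac_mult[OF fA frac_power[OF f]])
  have fh: "fraction (e + ?l * d) (homog_eval As f1 f0) (\<delta> * f0 ^ ?l)"
    using homog_eval_V[OF f, of As e] Cons d0 by (auto simp: fraction_def)
  have fr: "fraction (d + (e + ?l * d)) (f0 * (A * f1 ^ ?l + homog_eval As f1 f0)) (f0 * (\<delta> * f0 ^ ?l))"
  proof (rule frac_mult)
    show "fraction d f0 f0" using f1f0 by (simp add: fraction_def)
    show "fraction (e + ?l * d) (A * f1 ^ ?l + homog_eval As f1 f0) (\<delta> * f0 ^ ?l)"
      using fl fh V_add by (simp add: fraction_def)
  qed
  have "K.eval (map (\<lambda>A. quot A \<delta>) (A # As)) (quot f1 f0) =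
     (quot A \<delta> \<otimes>\<^bsub>K\<^esub> quot f1 f0 [^]\<^bsub>K\<^esub> ?l) \<oplus>\<^bsub>K\<^esub> K.eval (map (\<lambda>A. quot A \<delta>) As) (quot f1 f0)"
    by simp
  also have "\<dots> = quot (A * f1 ^ ?l) (\<delta> * f0 ^ ?l) \<oplus>\<^bsub>K\<^esub> quot (homog_eval As f1 f0) (\<delta> * f0 ^ ?l)"
    using Cons.IH Cons.prems unfolding quot_nat_pow[OF f] quot_mult[OF fA frac_power[OF f]] by (simp only: set_simps insert_subset)
  also have "\<dots> = quot (f0 * (A * f1 ^ ?l + homog_eval As f1 f0)) (f0 * (\<delta> * f0 ^ ?l))"
    unfolding quot_add[OF fl fh] quot_eq_iff[OF frac_add[OF fl fh] fr] by (simp only: algebra_simps)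
  also have "f0 * (\<delta> * f0 ^ ?l) = \<delta> * f0 ^ length (A # As)" by (simp add: mult_ac)
  finally show ?case by simp
qed

text \<open>
  The homogenised value of a polynomial with \<open>length As\<close> coefficients involves only powers of \<open>f1\<close>
  of smaller exponent; the factor \<open>f0 ^ (m - length As)\<close> adjusts the total degree to \<open>m\<close>.
\<close>

lemma homog_eval_low:
  assumes "set As \<subseteq> lin_span (binary_monomials t1 t0 e)" "length As \<le> m"
  shows "f0 ^ (m - length As) * homog_eval As f1 f0 \<in> lin_span (low_monomials t1 t0 f1 f0 e (length As) m)"
  using assms
proof (induction As)
  case Nil
  show ?case unfolding homog_eval.simps mult_zero_right by (rule lin_span_0)
next
  case (Cons A As)
  let ?l = "length As"
  have fin: "finite (low_monomials t1 t0 f1 f0 e' l m)" for e' l by (simp add: low_monomials_def)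
  have sub: "x \<in> lin_span (low_monomials t1 t0 f1 f0 e (Suc ?l) m)"
    if "x \<in> lin_span (low_monomials t1 t0 f1 f0 e ?l m)" for x
    using that
  proof (induction rule: lin_span_induct)
    case (scale c s)
    then have "s \<in> low_monomials t1 t0 f1 f0 e (Suc ?l) m" by (force simp: low_monomials_def)
    then show ?case by (intro lin_span_scale lin_span_base fin)
  next
    case zero
    show ?case by (rule lin_span_0)
  next
    case (add x y)
    then show ?case by (rule lin_span_add)
  qed
  have "1 * (f1 ^ ?l * f0 ^ (m - ?l)) \<in> low_monomials t1 t0 f1 f0 0 (Suc ?l) m"
    unfolding low_monomials_def by (intro image_eqI[of _ _ "(1, ?l)"]) (auto simp: binary_monomials_def)
  then have "f1 ^ ?l * f0 ^ (m - ?l) \<in> lin_span (low_monomials t1 t0 f1 f0 0 (Suc ?l) m)"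
    unfolding mult_1 by (rule lin_span_base[OF fin])
  moreover have "A \<in> lin_span (binary_monomials t1 t0 e)" using Cons.prems by simp
  ultimately have 1: "A * (f1 ^ ?l * f0 ^ (m - ?l)) \<in> lin_span (low_monomials t1 t0 f1 f0 e (Suc ?l) m)"
    using low_mult[of A t1 t0 e "f1 ^ ?l * f0 ^ (m - ?l)" f1 f0 0 "Suc ?l" m] by simp
  have 2: "f0 ^ (m - ?l) * homog_eval As f1 f0 \<in> lin_span (low_monomials t1 t0 f1 f0 e (Suc ?l) m)"
    using Cons by (intro sub) auto
  have e: "m - ?l = Suc (m - length (A # As))" using Cons.prems by simp
  have "f0 ^ (m - length (A # As)) * homog_eval (A # As) f1 f0 =
     A * (f1 ^ ?l * f0 ^ (m - ?l)) + f0 ^ (m - ?l) * homog_eval As f1 f0"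
    unfolding e homog_eval.simps power_Suc by (simp only: algebra_simps)
  then show ?case using lin_span_add[OF 1 2] by simp
qed

text \<open>
  Algebraicity of \<open>f\<close> over the field generated by \<open>t\<close>, with denominators cleared: the first
  coefficient \<open>A\<close> of the polynomial, its leading one, is isolated on the left.
\<close>

lemma algebraic_relation:
  assumes t: "fraction dt t1 t0"
    and alg: "\<And>f. f \<in> carrier K \<Longrightarrow> (K.algebraic over generate_field K (insert (quot t1 t0) (constants n C))) f"
    and f: "fraction d f1 f0"
  shows "\<exists>e A m. A \<in> lin_span (binary_monomials t1 t0 e) \<and> A \<noteq> 0 \<and> m > 0 \<and>
     A * f1 ^ m \<in> lin_span (low_monomials t1 t0 f1 f0 e m m)"
proof -
  let ?L = "generate_field K (insert (quot t1 t0) (constants n C))"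
  have H: "insert (quot t1 t0) (constants n C) \<subseteq> carrier K"
    using quot_carrier[OF t] quot_carrier[OF frac_cst] by (auto simp: constants_def rat_fun_quot)
  have "subring ?L K" using K.generate_field_is_subfield[OF H] subfieldE(1) by blast
  then obtain p where p: "p \<in> carrier (univ_poly K ?L)" "p \<noteq> []" "K.eval p (quot f1 f0) = \<zero>\<^bsub>K\<^esub>"
    using K.algebraicE[OF _ quot_carrier[OF f] alg[OF quot_carrier[OF f]]] by blast
  then have set: "set p \<subseteq> ?L" and hd: "hd p \<noteq> \<zero>\<^bsub>K\<^esub>"
    by (auto simp: univ_poly_def polynomial_def)
  obtain e \<delta> As where d: "\<delta> \<in> lin_span (binary_monomials t1 t0 e)" "\<delta> \<noteq> 0"
    "set As \<subseteq> lin_span (binary_monomials t1 t0 e)" and pAs: "p = map (\<lambda>A. quot A \<delta>) As"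
    using common_denominator[OF t set] by blast
  obtain A Bs where As: "As = A # Bs" using p(2) pAs by (cases As) auto
  have AV: "set As \<subseteq> V (e * dt)" "\<delta> \<in> V (e * dt)" using binary_V[OF t] d by auto
  have f1f0: "f1 \<in> V d" "f0 \<in> V d" "f0 \<noteq> 0" using f by (auto simp: fraction_def)
  have "A \<noteq> 0"
  proof
    assume "A = 0"
    then have "hd p = quot 0 \<delta>" by (simp add: pAs As)
    moreover have "fraction (e * dt) 0 \<delta>" using AV d by (simp add: fraction_def)
    ultimately show False using hd quot_eq_0_iff by simp
  qed
  have nz: "\<delta> * f0 ^ length As \<noteq> 0"
    by (rule V_mult_nonzero[OF AV(2) V_power[OF f1f0(2)] d(2) V_power_nonzero[OF f1f0(2,3)]])
  have "fraction (e * dt + length As * d) (homog_eval As f1 f0) (\<delta> * f0 ^ length As)"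
    using homog_eval_V[OF f AV(1)] nz V_mult[OF AV(2) V_power[OF f1f0(2)]] by (simp add: fraction_def)
  then have 0: "homog_eval As f1 f0 = 0"
    using p(3) quot_eq_0_iff unfolding pAs eval_quot[OF f AV(2) d(2) AV(1)] by blast
  have BV: "set Bs \<subseteq> V (e * dt)" "A \<in> V (e * dt)" using AV As by auto
  have inV: "A * f1 ^ length Bs + homog_eval Bs f1 f0 \<in> V (e * dt + length Bs * d)"
    by (intro V_add V_mult[OF BV(2)] V_power homog_eval_V[OF f] BV f1f0)
  have "f0 * (A * f1 ^ length Bs + homog_eval Bs f1 f0) = 0" using 0 by (simp only: As homog_eval.simps)
  then have rel: "A * f1 ^ length Bs + homog_eval Bs f1 f0 = 0"
    using V_domain[OF f1f0(2) inV] f1f0(3) by blast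
  have "length Bs > 0"
  proof (rule ccontr)
    assume "\<not> 0 < length Bs"
    then have "A = 0" using rel by simp
    with \<open>A \<noteq> 0\<close> show False ..
  qed
  moreover have "A * f1 ^ length Bs = cst (-1) * homog_eval Bs f1 f0"
    using rel by (simp add: fun_eq_iff eq_neg_iff_add_eq_0 fun_apply)
  moreover have "homog_eval Bs f1 f0 \<in> lin_span (low_monomials t1 t0 f1 f0 e (length Bs) (length Bs))"
    using homog_eval_low[of Bs t1 t0 e "length Bs" f0 f1] d(3) As by simp
  moreover have "A \<in> lin_span (binary_monomials t1 t0 e)" using d(3) As by simp
  ultimately have "A * f1 ^ length Bs \<in> lin_span (low_monomials t1 t0 f1 f0 e (length Bs) (length Bs))"
    using lin_span_scale by (simp only:)
  then show ?thesis using \<open>A \<noteq> 0\<close> \<open>length Bs > 0\<close> \<open>A \<in> lin_span _\<close> by blast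
qed

text \<open>
  The function field has transcendence degree one, so \<open>f\<close> and \<open>g\<close> are algebraically dependent over
  the constants. The proof counts. By \<open>low_power\<close> the products \<open>f\<^sup>a g\<^sup>b\<close> with \<open>a, b \<le> L\<close>, all
  multiplied by the same \<open>N = A\<^sup>L B\<^sup>L\<close>, lie in a span whose number of generators grows linearly in
  \<open>L\<close>; but there are \<open>(L + 1)\<^sup>2\<close> of them.
\<close>

lemma bivariate_relation:
  assumes f: "fraction d f1 f0" and g: "fraction d' g1 g0"
  shows "\<exists>L c. (\<exists>a\<le>L. \<exists>b\<le>L. c a b \<noteq> 0) \<and>
    (\<Sum>a\<le>L. \<Sum>b\<le>L. cst (c a b) * ((f1 ^ a * f0 ^ (L - a)) * (g1 ^ b * g0 ^ (L - b)))) = 0"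
proof -
  obtain dt t1 t0 where t: "fraction dt t1 t0"
    and alg: "\<And>f. f \<in> carrier K \<Longrightarrow> (K.algebraic over generate_field K (insert (quot t1 t0) (constants n C))) f"
    using one_dim_generator by blast
  obtain e A m where A: "A \<in> lin_span (binary_monomials t1 t0 e)" "A \<noteq> 0" and m: "m > 0"
    and relA: "A * f1 ^ m \<in> lin_span (low_monomials t1 t0 f1 f0 e m m)"
    using algebraic_relation[OF t alg f] by blast
  obtain e' B m' where B: "B \<in> lin_span (binary_monomials t1 t0 e')" "B \<noteq> 0" and m': "m' > 0"
    and relB: "B * g1 ^ m' \<in> lin_span (low_monomials t1 t0 g1 g0 e' m' m')"
    using algebraic_relation[OF t alg g] by blast
  \<comment> \<open>Large enough for the count: the span has at most \<open>(L e + L e' + 1) m m'\<close> generators.\<close>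
  define L where "L = (e + e' + 1) * (m * m') + m + m'"
  have L: "m \<le> L" "m' \<le> L" "(e + e' + 1) * (m * m') \<le> L" by (auto simp: L_def)
  define F where "F a = f1 ^ a * f0 ^ (L - a)" for a
  define G where "G b = g1 ^ b * g0 ^ (L - b)" for b
  define T where "T = (\<lambda>(s, v, w). s * (F v * G w)) ` (binary_monomials t1 t0 (L * e + L * e') \<times> {..<m} \<times> {..<m'})"
  have finT: "finite T" by (simp add: T_def)
  have "card T \<le> card (binary_monomials t1 t0 (L * e + L * e') \<times> {..<m} \<times> {..<m'})"
    unfolding T_def by (rule card_image_le) simp
  also have "\<dots> = card (binary_monomials t1 t0 (L * e + L * e')) * (m * m')" by (simp add: card_cartesian_product)
  also have "\<dots> \<le> Suc (L * e + L * e') * (m * m')" by (rule mult_right_mono[OF card_binary_monomials]) simp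
  also have "\<dots> \<le> (Suc L * (e + e' + 1)) * (m * m')" by (rule mult_right_mono) (auto simp: algebra_simps)
  also have "\<dots> = Suc L * ((e + e' + 1) * (m * m'))" by (simp only: mult.assoc)
  also have "\<dots> \<le> Suc L * L" by (rule mult_left_mono[OF L(3)]) simp
  also have "\<dots> < Suc L * Suc L" by simp
  finally have cardT: "card T < Suc L * Suc L" .
  define N where "N = A ^ L * B ^ L"
  have mem: "N * (F a * G b) \<in> lin_span T" if ab: "a \<le> L" "b \<le> L" for a b
  proof -
    have "A ^ (L - a) * (A ^ a * F a) \<in> lin_span (low_monomials t1 t0 f1 f0 ((L - a) * e + a * e) m L)"
      unfolding F_def by (intro low_mult binary_span_power A low_power[OF A(1) relA m L(1) ab(1)])
    moreover have "A ^ (L - a) * (A ^ a * F a) = A ^ L * F a" unfolding mult.assoc[symmetric] using ab by (simp flip: power_add)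
    moreover have "(L - a) * e + a * e = L * e" using ab by (simp flip: add_mult_distrib)
    ultimately have 1: "A ^ L * F a \<in> lin_span (low_monomials t1 t0 f1 f0 (L * e) m L)"
      by (simp only:)
    have "B ^ (L - b) * (B ^ b * G b) \<in> lin_span (low_monomials t1 t0 g1 g0 ((L - b) * e' + b * e') m' L)"
      unfolding G_def by (intro low_mult binary_span_power B low_power[OF B(1) relB m' L(2) ab(2)])
    moreover have "B ^ (L - b) * (B ^ b * G b) = B ^ L * G b" unfolding mult.assoc[symmetric] using ab by (simp flip: power_add)
    moreover have "(L - b) * e' + b * e' = L * e'" using ab by (simp flip: add_mult_distrib)
    ultimately have 2: "B ^ L * G b \<in> lin_span (low_monomials t1 t0 g1 g0 (L * e') m' L)"
      by (simp only:)
    have "(A ^ L * F a) * (B ^ L * G b) \<in> lin_span T"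
    proof (rule lin_span_mult[OF _ 1 2])
      fix s s' assume "s \<in> low_monomials t1 t0 f1 f0 (L * e) m L" "s' \<in> low_monomials t1 t0 g1 g0 (L * e') m' L"
      then obtain r v r' w where s: "s = r * F v" "r \<in> binary_monomials t1 t0 (L * e)" "v < m"
        and s': "s' = r' * G w" "r' \<in> binary_monomials t1 t0 (L * e')" "w < m'"
        unfolding low_monomials_def F_def G_def by auto
      have "s * s' = (r * r') * (F v * G w)" unfolding s(1) s'(1) by (simp only: mult_ac)
      then show "s * s' \<in> lin_span T"
        using binary_monomials_mult[OF s(2) s'(2)] s(3) s'(3)
        by (intro lin_span_base finT) (auto simp: T_def intro!: image_eqI[of _ _ "(r * r', v, w)"])
    qed
    then show ?thesis unfolding N_def by (simp only: mult_ac)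
  qed
  define I where "I = {..L} \<times> {..L}"
  define \<phi> where "\<phi> = (\<lambda>(a, b). N * (F a * G b))"
  have "card I = Suc L * Suc L" by (simp add: I_def card_cartesian_product)
  moreover have "\<phi> ` I \<subseteq> lin_span T" by (auto simp: I_def \<phi>_def intro: mem)
  moreover have "finite I" by (simp add: I_def)
  ultimately have "\<not> indep_family I \<phi>"
    using indep_family_card_le[OF finT, of I \<phi>] cardT by linarith
  then obtain c where c: "(\<Sum>i\<in>I. cst (c i) * \<phi> i) = 0" "\<exists>i\<in>I. c i \<noteq> 0"
    unfolding indep_family_def by blast
  have f1f0: "f1 \<in> V d" "f0 \<in> V d" and g1g0: "g1 \<in> V d'" "g0 \<in> V d'"
    using f g by (auto simp: fraction_def)
  have NV: "N \<in> V (L * (e * dt) + L * (e' * dt))" "N \<noteq> 0"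
    unfolding N_def using V_mult_nonzero[OF V_power[OF binary_V[OF t A(1)]] V_power[OF binary_V[OF t B(1)]]]
      V_power_nonzero[OF binary_V[OF t A(1)] A(2)] V_power_nonzero[OF binary_V[OF t B(1)] B(2)]
      V_mult[OF V_power[OF binary_V[OF t A(1)]] V_power[OF binary_V[OF t B(1)]]] by auto
  let ?S = "\<Sum>a\<le>L. \<Sum>b\<le>L. cst (c (a, b)) * (F a * G b)"
  have "?S \<in> V (L * d + L * d')"
  proof (intro V_sum V_cst_mult V_mult)
    fix a b assume ab: "a \<in> {..L}" "b \<in> {..L}"
    have "F a \<in> V (a * d + (L - a) * d)" unfolding F_def by (intro V_mult V_power f1f0)
    then show "F a \<in> V (L * d)" using ab by (simp flip: add_mult_distrib)
    have "G b \<in> V (b * d' + (L - b) * d')" unfolding G_def by (intro V_mult V_power g1g0)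
    then show "G b \<in> V (L * d')" using ab by (simp flip: add_mult_distrib)
  qed
  moreover have "N * ?S = (\<Sum>i\<in>I. cst (c i) * \<phi> i)"
    unfolding I_def sum.cartesian_product[symmetric] \<phi>_def sum_distrib_left
    by (simp only: sum.cartesian_product) (intro sum.cong, auto simp: mult_ac)
  ultimately have "?S = 0" using V_domain[OF NV(1)] NV(2) c(1) by simp
  moreover have "\<exists>a\<le>L. \<exists>b\<le>L. c (a, b) \<noteq> 0" using c(2) unfolding I_def by blast
  ultimately have "(\<exists>a\<le>L. \<exists>b\<le>L. c (a, b) \<noteq> 0) \<and> ?S = 0" by (rule conjI[rotated])
  then show ?thesis unfolding F_def G_def
    by (intro exI[of _ L] exI[of _ "\<lambda>a b. c (a, b)"])
qed

end

section \<open>Zeros of homogeneous functions\<close>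

text \<open>
  The value of \<open>p\<close> at \<open>l / x\<close>, multiplied by \<open>x ^ N\<close>.
\<close>

definition homog :: "'k::comm_ring_1 poly \<Rightarrow> nat \<Rightarrow> ('x \<Rightarrow> 'k) \<Rightarrow> ('x \<Rightarrow> 'k) \<Rightarrow> 'x \<Rightarrow> 'k" where
  "homog p N l x = (\<Sum>b\<le>N. cst (Polynomial.coeff p b) * (l ^ b * x ^ (N - b)))"

lemma homog_pad:
  assumes "Polynomial.degree p \<le> N"
  shows "homog p (k + N) l x = x ^ k * homog p N l x"
proof -
  have "homog p (k + N) l x = (\<Sum>b\<le>N. cst (Polynomial.coeff p b) * (l ^ b * x ^ (k + N - b)))"
    unfolding homog_def using assms
    by (intro sum.mono_neutral_right) (auto simp: coeff_eq_0)
  also have "\<dots> = (\<Sum>b\<le>N. x ^ k * (cst (Polynomial.coeff p b) * (l ^ b * x ^ (N - b))))"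
  proof (intro sum.cong refl)
    fix b assume "b \<in> {..N}"
    then have e: "k + N - b = k + (N - b)" by simp
    show "cst (Polynomial.coeff p b) * (l ^ b * x ^ (k + N - b)) = x ^ k * (cst (Polynomial.coeff p b) * (l ^ b * x ^ (N - b)))"
      unfolding e power_add by (simp only: mult_ac)
  qed
  finally show ?thesis by (simp add: homog_def sum_distrib_left)
qed

lemma homog_linear_factor:
  assumes "Polynomial.degree q \<le> N"
  shows "homog ([:- c, 1:] * q) (Suc N) l x = (l - cst c * x) * homog q N l x"
proof -
  have cN: "Polynomial.coeff q (Suc N) = 0" using assms by (simp add: coeff_eq_0)
  have 1: "homog ([:- c, 1:] * q) (Suc N) l x =
      (\<Sum>b\<le>Suc N. cst (- c * Polynomial.coeff q b) * (l ^ b * x ^ (Suc N - b))) +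
      (\<Sum>b\<le>Suc N. cst (case b of 0 \<Rightarrow> 0 | Suc b' \<Rightarrow> Polynomial.coeff q b') * (l ^ b * x ^ (Suc N - b)))"
    unfolding homog_def sum.distrib[symmetric]
  proof (intro sum.cong refl)
    fix b
    have "Polynomial.coeff ([:- c, 1:] * q) b = - c * Polynomial.coeff q b + (case b of 0 \<Rightarrow> 0 | Suc b' \<Rightarrow> Polynomial.coeff q b')"
      by (cases b) (auto simp: mult_pCons_left)
    then show "cst (Polynomial.coeff ([:- c, 1:] * q) b) * (l ^ b * x ^ (Suc N - b)) =
       cst (- c * Polynomial.coeff q b) * (l ^ b * x ^ (Suc N - b)) +
       cst (case b of 0 \<Rightarrow> 0 | Suc b' \<Rightarrow> Polynomial.coeff q b') * (l ^ b * x ^ (Suc N - b))"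
      by (simp only: cst_add distrib_right)
  qed
  have 2: "(\<Sum>b\<le>Suc N. cst (- c * Polynomial.coeff q b) * (l ^ b * x ^ (Suc N - b))) = - (cst c * x) * homog q N l x"
  proof -
    have "(\<Sum>b\<le>Suc N. cst (- c * Polynomial.coeff q b) * (l ^ b * x ^ (Suc N - b)))
       = (\<Sum>b\<le>N. cst (- c * Polynomial.coeff q b) * (l ^ b * x ^ (Suc N - b)))"
      by (simp add: cN)
    also have "\<dots> = (\<Sum>b\<le>N. - (cst c * x) * (cst (Polynomial.coeff q b) * (l ^ b * x ^ (N - b))))"
    proof (intro sum.cong refl)
      fix b assume "b \<in> {..N}"
      then have e: "Suc N - b = Suc (N - b)" by simp
      have "cst (- c * Polynomial.coeff q b) = (- (cst c * cst (Polynomial.coeff q b)) :: 'b \<Rightarrow> 'a)"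
        by (simp add: cst_mult cst_uminus)
      then show "cst (- c * Polynomial.coeff q b) * (l ^ b * x ^ (Suc N - b)) =
         - (cst c * x) * (cst (Polynomial.coeff q b) * (l ^ b * x ^ (N - b)))"
        unfolding e power_Suc by (simp add: mult_ac)
    qed
    finally show ?thesis unfolding homog_def sum_distrib_left .
  qed
  have 3: "(\<Sum>b\<le>Suc N. cst (case b of 0 \<Rightarrow> 0 | Suc b' \<Rightarrow> Polynomial.coeff q b') * (l ^ b * x ^ (Suc N - b))) = l * homog q N l x"
    unfolding sum.atMost_Suc_shift homog_def sum_distrib_left by (simp add: mult_ac)
  show ?thesis unfolding 1 2 3 by (simp only: algebra_simps) (simp add: algebra_simps)
qed

lemma homog_const: "Polynomial.degree p = 0 \<Longrightarrow> homog p N l x = cst (Polynomial.coeff p 0) * x ^ N"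
proof -
  assume d: "Polynomial.degree p = 0"
  have "homog p (N + 0) l x = x ^ N * homog p 0 l x" by (rule homog_pad) (simp add: d)
  then show ?thesis by (simp add: homog_def mult.commute)
qed

lemma homog_apply:
  assumes "x v = 1" "Polynomial.degree p \<le> N"
  shows "homog p N l x v = poly p (l v)"
proof -
  have "homog p N l x v = (\<Sum>b\<le>N. Polynomial.coeff p b * l v ^ b)"
    using assms(1) by (simp add: homog_def sum_fun_apply fun_apply power_fun_apply)
  also have "\<dots> = (\<Sum>b\<le>Polynomial.degree p. Polynomial.coeff p b * l v ^ b)"
    using assms(2) by (intro sum.mono_neutral_right) (auto simp: coeff_eq_0)
  finally show ?thesis by (simp add: poly_altdef)
qed

context projective_curve
begin

lemma homog_V: "l \<in> V 1 \<Longrightarrow> x \<in> V 1 \<Longrightarrow> homog p N l x \<in> V N"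
  unfolding homog_def
proof (intro V_sum V_cst_mult)
  fix b assume "l \<in> V 1" "x \<in> V 1" "b \<in> {..N}"
  then show "l ^ b * x ^ (N - b) \<in> V N"
    using V_mult[OF V_power[of l 1 b] V_power[of x 1 "N - b"]] by simp
qed

text \<open>
  On a curve, some nonzero polynomial in the single function \<open>l / x\<close> is a multiple of \<open>\<phi>\<close>: this is
  how the dimension enters all later arguments. The reason is an algebraic relation between
  \<open>\<phi> / x\<^sup>d\<close> and \<open>l / x\<close>. It is written as a polynomial in \<open>\<phi>\<close>; after cancelling the lowest power
  of \<open>\<phi>\<close> the constant term is a nonzero polynomial in \<open>l / x\<close>, and all other terms are divisible
  by \<open>\<phi>\<close>.
\<close>

lemma divides_homog:
  assumes \<phi>: "\<phi> \<in> V d" "\<phi> \<noteq> 0" and x: "x \<in> V 1" "x \<noteq> 0" and l: "l \<in> V 1"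
  shows "\<exists>p e w. p \<noteq> 0 \<and> Polynomial.degree p \<le> d + e \<and> w \<in> V e \<and> homog p (d + e) l x = \<phi> * w"
proof -
  have F: "fraction d \<phi> (x ^ d)" "fraction 1 l x"
    using \<phi> x l V_power[OF x(1), of d] V_power_nonzero[OF x] by (auto simp: fraction_def)
  from bivariate_relation[OF F] obtain L c where nz: "\<exists>a\<le>L. \<exists>b\<le>L. c a b \<noteq> 0" and
    rel: "(\<Sum>a\<le>L. \<Sum>b\<le>L. cst (c a b) * ((\<phi> ^ a * (x ^ d) ^ (L - a)) * (l ^ b * x ^ (L - b)))) = 0"
    by (rule exE) (erule exE, erule conjE, rule that)
  \<comment> \<open>\<open>a0\<close> is the lowest power of \<open>\<phi>\<close> that occurs, and \<open>p a0\<close> will be the required polynomial.\<close>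
  define a0 where "a0 = (LEAST a. a \<le> L \<and> (\<exists>b\<le>L. c a b \<noteq> 0))"
  have a0: "a0 \<le> L" "\<exists>b\<le>L. c a0 b \<noteq> 0"
    using LeastI_ex[of "\<lambda>a. a \<le> L \<and> (\<exists>b\<le>L. c a b \<noteq> 0)"] nz unfolding a0_def by blast+
  have below: "c a b = 0" if "a < a0" "b \<le> L" for a b
    using not_less_Least[of a "\<lambda>a. a \<le> L \<and> (\<exists>b\<le>L. c a b \<noteq> 0)"] that a0(1) unfolding a0_def by fastforce
  define p where "p a = (\<Sum>b\<le>L. Polynomial.monom (c a b) b)" for a
  have coeff_p: "Polynomial.coeff (p a) b = (if b \<le> L then c a b else 0)" for a b
    by (simp add: p_def coeff_sum)
  have deg_p: "Polynomial.degree (p a) \<le> L" for a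
    by (rule degree_le) (simp add: coeff_p)
  have hp: "homog (p a) L l x = (\<Sum>b\<le>L. cst (c a b) * (l ^ b * x ^ (L - b)))" for a
    unfolding homog_def by (intro sum.cong) (auto simp: coeff_p)
  obtain b0 where "b0 \<le> L" "c a0 b0 \<noteq> 0" using a0(2) by blast
  then have "Polynomial.coeff (p a0) b0 \<noteq> 0" by (simp add: coeff_p)
  then have p0: "p a0 \<noteq> 0" by fastforce
  have pb: "p a = 0" if "a < a0" for a
    using below[OF that] by (intro poly_eqI) (simp add: coeff_p)
  define T where "T a = \<phi> ^ (a - a0) * x ^ (d * (L - a)) * homog (p a) L l x" for a
  have TV: "T a \<in> V (d * (L - a0) + L)" if "a0 \<le> a" "a \<le> L" for a
  proof -
    have "T a \<in> V ((a - a0) * d + (d * (L - a)) * 1 + L)"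
      unfolding T_def by (intro V_mult V_power \<phi> x homog_V l)
    moreover have "(a - a0) * d + (d * (L - a)) * 1 = (a - a0 + (L - a)) * d" by (simp add: algebra_simps)
    ultimately show ?thesis using that by (simp add: mult.commute)
  qed
  have "0 = (\<Sum>a\<le>L. \<phi> ^ a * x ^ (d * (L - a)) * homog (p a) L l x)"
    unfolding rel[symmetric] hp sum_distrib_left by (simp only: power_mult mult_ac)
  also have "\<dots> = (\<Sum>a\<in>{a0..L}. \<phi> ^ a * x ^ (d * (L - a)) * homog (p a) L l x)"
    using a0 pb by (intro sum.mono_neutral_right) (auto simp: homog_def)
  also have "\<dots> = (\<Sum>a\<in>{a0..L}. \<phi> ^ a0 * T a)"
  proof (intro sum.cong refl)
    fix a assume "a \<in> {a0..L}"
    then have "a = a0 + (a - a0)" by simp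
    then have "\<phi> ^ a = \<phi> ^ a0 * \<phi> ^ (a - a0)" by (metis power_add)
    then show "\<phi> ^ a * x ^ (d * (L - a)) * homog (p a) L l x = \<phi> ^ a0 * T a"
      unfolding T_def by (simp only: mult_ac)
  qed
  finally have "\<phi> ^ a0 * (\<Sum>a\<in>{a0..L}. T a) = 0" by (simp add: sum_distrib_left)
  moreover have "(\<Sum>a\<in>{a0..L}. T a) \<in> V (d * (L - a0) + L)" by (intro V_sum TV) auto
  ultimately have "(\<Sum>a\<in>{a0..L}. T a) = 0"
    using V_domain[OF V_power[OF \<phi>(1)]] V_power_nonzero[OF \<phi>] by blast
  then have "T a0 + (\<Sum>a\<in>{Suc a0..L}. T a) = 0"
    using a0 by (simp add: sum.atLeast_Suc_atMost)
  then have Ta0: "T a0 = - (\<Sum>a\<in>{Suc a0..L}. T a)" by (simp add: eq_neg_iff_add_eq_0)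
  define e where "e = d * (L - a0) + L"
  define w where "w = - (\<Sum>a\<in>{Suc a0..L}. \<phi> ^ (a - Suc a0) * x ^ (d * (L - a)) * homog (p a) L l x) * x ^ d"
  have "homog (p a0) (d + e) l x = homog (p a0) ((d + d * (L - a0)) + L) l x" by (simp only: e_def add.assoc)
  also have "\<dots> = x ^ d * T a0" unfolding homog_pad[OF deg_p] by (simp add: T_def power_add)
  also have "\<dots> = x ^ d * - (\<Sum>a\<in>{Suc a0..L}. T a)" by (simp only: Ta0)
  also have "(\<Sum>a\<in>{Suc a0..L}. T a) = \<phi> * (\<Sum>a\<in>{Suc a0..L}. \<phi> ^ (a - Suc a0) * x ^ (d * (L - a)) * homog (p a) L l x)"
    unfolding sum_distrib_left
  proof (intro sum.cong refl)
    fix a assume "a \<in> {Suc a0..L}"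
    then have "a - a0 = Suc (a - Suc a0)" by auto
    then show "T a = \<phi> * (\<phi> ^ (a - Suc a0) * x ^ (d * (L - a)) * homog (p a) L l x)"
      unfolding T_def by (simp add: mult_ac)
  qed
  finally have "homog (p a0) (d + e) l x = \<phi> * w" unfolding w_def by (simp add: mult_ac)
  moreover have "w \<in> V e"
    unfolding w_def minus_mult_left[symmetric] sum_distrib_right
  proof (intro V_uminus V_sum)
    fix a assume a: "a \<in> {Suc a0..L}"
    have "\<phi> ^ (a - Suc a0) * x ^ (d * (L - a)) * homog (p a) L l x * x ^ d \<in> V ((a - Suc a0) * d + (d * (L - a)) * 1 + L + d * 1)"
      by (intro V_mult V_power \<phi> x homog_V l)
    moreover have "L - a0 = a - Suc a0 + (L - a) + 1" using a by auto
    then have "(a - Suc a0) * d + (d * (L - a)) * 1 + L + d * 1 = e"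
      unfolding e_def by (simp only: algebra_simps)
    ultimately show "\<phi> ^ (a - Suc a0) * x ^ (d * (L - a)) * homog (p a) L l x * x ^ d \<in> V e"
      by (simp only:)
  qed
  moreover have "Polynomial.degree (p a0) \<le> d + e" using deg_p[of a0] by (simp add: e_def)
  ultimately show ?thesis using p0 by blast
qed

text \<open>
  At a zero of \<open>\<phi>\<close> with coordinate \<open>v\<^sub>i = 1\<close>, every other coordinate is a root of the polynomial
  that \<open>divides_homog\<close> provides for \<open>l = X\<^sub>j\<close> and \<open>x = X\<^sub>i\<close>. So there are finitely many choices
  for each coordinate.
\<close>

lemma finite_zeros:
  assumes \<phi>: "\<phi> \<in> V d" "\<phi> \<noteq> 0"
  shows "finite {P \<in> C. \<exists>v\<in>P. \<phi> v = 0}"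
proof -
  define Z where "Z i = {v \<in> cone. v i = 1 \<and> \<phi> v = 0}" for i
  have fin: "finite (Z i)" if i: "i \<le> n" for i
  proof (cases "Z i = {}")
    case False
    then obtain v where "v \<in> Z i" by blast
    then have "Xc i \<noteq> 0" using X_neq_0[of i v] by (auto simp: Z_def X_apply)
    then have "\<exists>p. p \<noteq> 0 \<and> (\<forall>v\<in>Z i. poly p (v j) = 0)" if jn: "j \<le> n" for j
    proof -
      obtain p e w where p: "p \<noteq> 0" "Polynomial.degree p \<le> d + e" "homog p (d + e) (Xc j) (Xc i) = \<phi> * w"
        using divides_homog[OF \<phi> V_X[OF i] \<open>Xc i \<noteq> 0\<close> V_X[OF jn]] by metis
      have "poly p (v j) = 0" if v: "v \<in> Z i" for v
      proof -
        have v': "v \<in> cone" "v i = 1" "\<phi> v = 0" using v by (auto simp: Z_def)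
        have "homog p (d + e) (Xc j) (Xc i) v = poly p (Xc j v)"
          by (rule homog_apply[OF _ p(2)]) (simp add: X_apply v')
        then show ?thesis using v' by (simp add: p(3) fun_apply X_apply)
      qed
      then show ?thesis using p(1) by blast
    qed
    then obtain p where p: "\<And>j. j \<le> n \<Longrightarrow> p j \<noteq> 0" "\<And>j v. j \<le> n \<Longrightarrow> v \<in> Z i \<Longrightarrow> poly (p j) (v j) = 0" by metis
    define B where "B = (\<Union>j\<in>{..n}. {z. poly (p j) z = 0})"
    have "finite B" unfolding B_def using p(1) by (auto intro!: poly_roots_finite)
    then have "finite {f. \<forall>x. (x \<in> {..n} \<longrightarrow> f x \<in> B) \<and> (x \<notin> {..n} \<longrightarrow> f x = 0)}"
      by (intro finite_set_of_finite_funs) auto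
    moreover have "Z i \<subseteq> {f. \<forall>x. (x \<in> {..n} \<longrightarrow> f x \<in> B) \<and> (x \<notin> {..n} \<longrightarrow> f x = 0)}"
      using p(2) cone_supp by (auto simp: B_def Z_def)
    ultimately show ?thesis by (rule rev_finite_subset)
  qed simp
  have "{P \<in> C. \<exists>v\<in>P. \<phi> v = 0} \<subseteq> point_of ` (\<Union>i\<in>{..n}. Z i)"
  proof
    fix P assume "P \<in> {P \<in> C. \<exists>v\<in>P. \<phi> v = 0}"
    then obtain v where v: "P \<in> C" "v \<in> P" "\<phi> v = 0" by blast
    have vc: "v \<in> cone" using C_cone v by blast
    obtain i where i: "i \<le> n" "v i \<noteq> 0" using cone_nonzero[OF vc] by blast
    define w where "w = (\<lambda>j. inverse (v i) * v j)"
    have "w \<in> cone" unfolding w_def by (rule cone_scale[OF vc]) (use i in simp)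
    moreover have "\<phi> w = 0" unfolding w_def using V_scale[OF \<phi>(1) vc, of "inverse (v i)"] i v by simp
    ultimately have "w \<in> Z i" using i by (simp add: Z_def w_def)
    moreover have "P = point_of w" unfolding w_def
      using point_of_scale[of "inverse (v i)" v] i C_eq_point_of[OF v(1,2)] by simp
    ultimately show "P \<in> point_of ` (\<Union>i\<in>{..n}. Z i)" using i by blast
  qed
  then show ?thesis by (rule finite_subset) (use fin in auto)
qed

end

section \<open>Local parameters\<close>

context projective_variety
begin

text \<open>
  Nakayama's lemma for the maximal ideal at \<open>v\<close>, by elimination: if all \<open>y\<^sub>j\<close> are multiples of \<open>t\<close>
  up to combinations of the \<open>y\<^sub>a\<close> with coefficients vanishing at \<open>v\<close>, then they are multiples of
  \<open>t\<close>. In each equation the total coefficient \<open>u - A\<close> of its own \<open>y\<close> does not vanish at \<open>v\<close>;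
  multiplying by it and substituting removes one unknown. Units of the local ring appear as
  functions \<open>u\<close> with \<open>u v \<noteq> 0\<close>.
\<close>

lemma nakayama:
  assumes "finite J" "\<And>j. j \<in> J \<Longrightarrow> y j \<in> V 1"
    and "\<And>j. j \<in> J \<Longrightarrow> \<exists>N u b A. u \<in> V N \<and> u v \<noteq> 0 \<and> b \<in> V N \<and> (\<forall>a. A a \<in> V N \<and> A a v = 0) \<and>
       u * y j = b * t + (\<Sum>a\<in>J. A a * y a)"
  shows "\<forall>j\<in>J. \<exists>N u b. u \<in> V N \<and> u v \<noteq> 0 \<and> b \<in> V N \<and> u * y j = b * t"
  using assms
proof (induction J rule: finite_induct)
  case empty
  show ?case by simp
next
  case (insert m J)
  have "\<exists>N u b A. u \<in> V N \<and> u v \<noteq> 0 \<and> b \<in> V N \<and> (\<forall>a. A a \<in> V N \<and> A a v = 0) \<and>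
       u * y m = b * t + (\<Sum>a\<in>insert m J. A a * y a)" by (rule insert.prems(2)) simp
  then obtain Nm um bm Am where m: "um \<in> V Nm" "um v \<noteq> 0" "bm \<in> V Nm" and mA: "\<forall>a. Am a \<in> V Nm \<and> Am a v = 0"
    and eqm: "um * y m = bm * t + (\<Sum>a\<in>insert m J. Am a * y a)" by (elim exE conjE) (rule that)
  define w where "w = um - Am m"
  have w: "w \<in> V Nm" "w v \<noteq> 0" using m mA by (auto simp: w_def fun_apply intro: V_diff)
  have eqw: "w * y m = bm * t + (\<Sum>a\<in>J. Am a * y a)"
    using eqm insert.hyps by (simp add: w_def left_diff_distrib)
  have "\<forall>j\<in>J. \<exists>N u b. u \<in> V N \<and> u v \<noteq> 0 \<and> b \<in> V N \<and> u * y j = b * t"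
  proof (rule insert.IH)
    fix j assume j: "j \<in> J"
    then show "y j \<in> V 1" using insert.prems(1) by blast
    have "\<exists>N u b A. u \<in> V N \<and> u v \<noteq> 0 \<and> b \<in> V N \<and> (\<forall>a. A a \<in> V N \<and> A a v = 0) \<and>
       u * y j = b * t + (\<Sum>a\<in>insert m J. A a * y a)" using insert.prems(2)[of j] j by simp
    then obtain N u b A where u: "u \<in> V N" "u v \<noteq> 0" "b \<in> V N" and uA: "\<forall>a. A a \<in> V N \<and> A a v = 0"
      and eq: "u * y j = b * t + (\<Sum>a\<in>insert m J. A a * y a)" by (elim exE conjE) (rule that)
    define A' where "A' a = A m * Am a + w * A a" for a
    have "(w * u) * y j = w * (b * t + (A m * y m + (\<Sum>a\<in>J. A a * y a)))"
      using eq insert.hyps by (simp add: mult.assoc)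
    also have "\<dots> = w * b * t + A m * (w * y m) + w * (\<Sum>a\<in>J. A a * y a)" by (simp only: algebra_simps)
    also have "\<dots> = (w * b + A m * bm) * t + (\<Sum>a\<in>J. A' a * y a)"
      unfolding eqw A'_def by (simp add: algebra_simps sum.distrib sum_distrib_left)
    finally have "(w * u) * y j = (w * b + A m * bm) * t + (\<Sum>a\<in>J. A' a * y a)" .
    moreover have "w * u \<in> V (Nm + N)" "(w * u) v \<noteq> 0" using w u by (auto simp: fun_apply intro: V_mult)
    moreover have "bm * A m \<in> V (Nm + N)" "Am a * A m \<in> V (Nm + N)" "w * A a \<in> V (Nm + N)" for a
      by (intro V_mult w m uA[rule_format, THEN conjunct1] mA[rule_format, THEN conjunct1])+
    then have "w * b + A m * bm \<in> V (Nm + N)" "\<forall>a. A' a \<in> V (Nm + N) \<and> A' a v = 0"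
      unfolding A'_def using V_mult[OF w(1) u(3)] mA uA
      by (simp_all add: V_add mult.commute[of "A m"] fun_apply)
    ultimately show "\<exists>N u b A. u \<in> V N \<and> u v \<noteq> 0 \<and> b \<in> V N \<and> (\<forall>a. A a \<in> V N \<and> A a v = 0) \<and>
       u * y j = b * t + (\<Sum>a\<in>J. A a * y a)"
      by (intro exI[of _ "Nm + N"] exI[of _ "w * u"] exI[of _ "w * b + A m * bm"] exI[of _ A']) blast
  qed
  then have IH: "\<forall>j\<in>J. \<exists>N u b. u \<in> V N \<and> u v \<noteq> 0 \<and> b \<in> V N \<and> u * y j = b * t" .
  then obtain N' u' b' where u': "\<And>j. j \<in> J \<Longrightarrow> u' j \<in> V (N' j) \<and> u' j v \<noteq> 0 \<and> b' j \<in> V (N' j) \<and> u' j * y j = b' j * t"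
    by metis
  define U where "U = (\<Prod>a\<in>J. u' a)"
  define U' where "U' a = (\<Prod>c\<in>J - {a}. u' c)" for a
  have U: "U \<in> V (\<Sum>a\<in>J. N' a)" unfolding U_def by (rule V_prod) (use u' in blast)
  have Uv: "U v \<noteq> 0" unfolding U_def prod_fun_apply using u' insert.hyps(1) by simp
  have UU: "U = U' a * u' a" if "a \<in> J" for a
    unfolding U_def U'_def using that insert.hyps(1) by (simp add: prod.remove mult.commute)
  have U'V: "U' a * b' a \<in> V (\<Sum>a\<in>J. N' a)" if "a \<in> J" for a
  proof -
    have "U' a * b' a \<in> V ((\<Sum>c\<in>J - {a}. N' c) + N' a)"
      unfolding U'_def by (intro V_mult V_prod) (use u' that in auto)
    then show ?thesis using that insert.hyps(1) by (simp add: sum.remove add.commute)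
  qed
  have "(U * w) * y m = U * (bm * t) + (\<Sum>a\<in>J. Am a * (U * y a))"
    unfolding mult.assoc eqw distrib_left sum_distrib_left by (simp only: mult_ac)
  also have "(\<Sum>a\<in>J. Am a * (U * y a)) = (\<Sum>a\<in>J. Am a * (U' a * b' a) * t)"
  proof (intro sum.cong refl)
    fix a assume a: "a \<in> J"
    have "U * y a = U' a * (u' a * y a)" unfolding UU[OF a] by (simp only: mult.assoc)
    then show "Am a * (U * y a) = Am a * (U' a * b' a) * t" using u'[OF a] by (simp only: mult_ac)
  qed
  finally have "(U * w) * y m = (U * bm + (\<Sum>a\<in>J. Am a * (U' a * b' a))) * t"
    by (simp only: distrib_right sum_distrib_right mult.assoc)
  moreover have "U * w \<in> V ((\<Sum>a\<in>J. N' a) + Nm)" by (intro V_mult U w)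
  moreover have "(U * w) v \<noteq> 0" using Uv w by (simp add: fun_apply)
  moreover have "U * bm + (\<Sum>a\<in>J. Am a * (U' a * b' a)) \<in> V ((\<Sum>a\<in>J. N' a) + Nm)"
  proof (rule V_add[OF V_mult[OF U m(3)] V_sum])
    fix a assume "a \<in> J"
    then have "(U' a * b' a) * Am a \<in> V ((\<Sum>a\<in>J. N' a) + Nm)" by (intro V_mult U'V mA[rule_format, THEN conjunct1])
    then show "Am a * (U' a * b' a) \<in> V ((\<Sum>a\<in>J. N' a) + Nm)" by (simp only: mult.commute)
  qed
  ultimately have ym: "\<exists>N u b. u \<in> V N \<and> u v \<noteq> 0 \<and> b \<in> V N \<and> u * y m = b * t" by blast
  show ?case unfolding ball_simps using ym IH by (rule conjI)
qed

text \<open>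
  A linear form vanishing at \<open>v\<close> that generates the maximal ideal there: each homogeneous function
  vanishing at \<open>v\<close> is a multiple of \<open>t\<close>, up to a function \<open>u\<close> that is a unit at \<open>v\<close>.
\<close>

definition loc_param :: "(nat \<Rightarrow> 'k) \<Rightarrow> ((nat \<Rightarrow> 'k) \<Rightarrow> 'k) \<Rightarrow> bool" where
  "loc_param v t \<longleftrightarrow> t \<in> V 1 \<and> t \<noteq> 0 \<and> t v = 0 \<and> (\<forall>d \<phi>. \<phi> \<in> V d \<longrightarrow> \<phi> v = 0 \<longrightarrow>
     (\<exists>e f u \<psi>. u \<in> V e \<and> u v \<noteq> 0 \<and> \<psi> \<in> V f \<and> d + e = f + 1 \<and> u * \<phi> = t * \<psi>))"

text \<open>
  It is enough to divide the local coordinates \<open>v\<^sub>i X\<^sub>a - v\<^sub>a X\<^sub>i\<close> by \<open>t\<close>, since by Taylor's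
  formula every form vanishing at \<open>v\<close> is a combination of them, up to the unit \<open>X\<^sub>i\<close>.
\<close>

lemma loc_param_from_coordinates:
  assumes v: "v \<in> cone" and i: "i \<le> n" "v i \<noteq> 0" and t: "t \<in> V 1" "t \<noteq> 0" "t v = 0"
    and y: "\<And>a. a \<le> n \<Longrightarrow> \<exists>N u b. u \<in> V N \<and> u v \<noteq> 0 \<and> b \<in> V N \<and> u * (cst (v i) * Xc a - cst (v a) * Xc i) = b * t"
  shows "loc_param v t"
  unfolding loc_param_def
proof (intro conjI allI impI t)
  fix d \<phi> assume \<phi>: "\<phi> \<in> V d" "\<phi> v = 0"
  define Y where "Y a = cst (v i) * Xc a - cst (v a) * Xc i" for a
  obtain p where p: "form n d p" "\<phi> = Ev p" using VE[OF \<phi>(1)] by blast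
  have pv: "mpoly_eval v p = 0" using \<phi>(2) p(2) v by (simp add: Ev_apply)
  obtain r where r: "\<And>a. form n d (r a)" and eq: "\<And>x. x i * v i ^ d * mpoly_eval x p = mpoly_eval v p * x i ^ Suc d
       + x i ^ d * (\<Sum>l\<le>n. mpoly_eval v (mpoly_partial l p) * (v i * x l - v l * x i))
       + (\<Sum>l\<le>n. (v i * x l - v l * x i) * mpoly_eval x (r l))"
    using taylor[OF p(1) i(1), of v] by blast
  define B where "B l = cst (inverse (v i ^ d)) * (cst (mpoly_eval v (mpoly_partial l p)) * Xc i ^ d + Ev (r l))" for l
  have BV: "B l \<in> V d" for l
    unfolding B_def using V_power[OF V_X[OF i(1)], of d] VI[OF r] by (intro V_cst_mult V_add) auto
  have YV: "Y a \<in> V 1" if "a \<le> n" for a unfolding Y_def by (intro V_diff V_cst_mult V_X that i)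
  have "Xc i * \<phi> = (\<Sum>l\<le>n. Y l * B l)"
  proof (rule V_eqI)
    show "Xc i * \<phi> \<in> V (1 + d)" by (intro V_mult V_X i \<phi>)
    show "(\<Sum>l\<le>n. Y l * B l) \<in> V (1 + d)" by (intro V_sum V_mult YV BV) simp
    fix x assume x: "x \<in> cone"
    have "v i ^ d * (x i * mpoly_eval x p) = (\<Sum>l\<le>n. (v i * x l - v l * x i) *
        (mpoly_eval v (mpoly_partial l p) * x i ^ d + mpoly_eval x (r l)))"
      using eq[of x] pv by (simp add: sum.distrib[symmetric] sum_distrib_left algebra_simps)
    then have "x i * mpoly_eval x p = inverse (v i ^ d) * (\<Sum>l\<le>n. (v i * x l - v l * x i) *
        (mpoly_eval v (mpoly_partial l p) * x i ^ d + mpoly_eval x (r l)))"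
      using i(2) by (simp add: field_simps)
    then show "(Xc i * \<phi>) x = (\<Sum>l\<le>n. Y l * B l) x"
      using x by (simp add: p(2) Y_def B_def sum_fun_apply fun_apply power_fun_apply X_apply Ev_apply sum_distrib_left mult_ac)
  qed
  have "\<exists>N u b. \<forall>a\<in>{..n}. u a \<in> V (N a) \<and> u a v \<noteq> 0 \<and> b a \<in> V (N a) \<and> u a * Y a = b a * t"
  proof -
    have "\<forall>a\<in>{..n}. \<exists>N u b. u \<in> V N \<and> u v \<noteq> 0 \<and> b \<in> V N \<and> u * Y a = b * t"
      using y unfolding Y_def by simp
    then show ?thesis by metis
  qed
  then obtain N u b where u: "\<And>a. a \<in> {..n} \<Longrightarrow> u a \<in> V (N a) \<and> u a v \<noteq> 0 \<and> b a \<in> V (N a) \<and> u a * Y a = b a * t"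
    by blast
  define U where "U = (\<Prod>a\<in>{..n}. u a)"
  define U' where "U' a = (\<Prod>c\<in>{..n} - {a}. u c)" for a
  define M where "M = (\<Sum>a\<in>{..n}. N a)"
  have U: "U \<in> V M" unfolding U_def M_def by (rule V_prod) (use u in blast)
  have Uv: "U v \<noteq> 0" unfolding U_def prod_fun_apply using u by simp
  have UU: "U = U' a * u a" if "a \<in> {..n}" for a
    unfolding U_def U'_def using that by (simp add: prod.remove[of "{..n}" a] mult.commute)
  have U'V: "U' a * b a \<in> V M" if "a \<in> {..n}" for a
  proof -
    have "U' a * b a \<in> V ((\<Sum>c\<in>{..n} - {a}. N c) + N a)"
      unfolding U'_def by (intro V_mult V_prod) (use u that in auto)
    then show ?thesis unfolding M_def using that by (simp add: sum.remove[of "{..n}" a] add.commute)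
  qed
  define \<psi> where "\<psi> = (\<Sum>a\<in>{..n}. (U' a * b a) * B a)"
  have "(U * Xc i) * \<phi> = (\<Sum>a\<in>{..n}. (U * Y a) * B a)"
    unfolding mult.assoc \<open>Xc i * \<phi> = _\<close> by (simp add: sum_distrib_left)
  also have "\<dots> = (\<Sum>a\<in>{..n}. t * ((U' a * b a) * B a))"
  proof (intro sum.cong refl)
    fix a assume a: "a \<in> {..n}"
    have "U * Y a = U' a * (u a * Y a)" unfolding UU[OF a] by (simp only: mult.assoc)
    then show "(U * Y a) * B a = t * ((U' a * b a) * B a)" using u[OF a] by (simp only: mult_ac)
  qed
  finally have "(U * Xc i) * \<phi> = t * \<psi>" by (simp add: \<psi>_def sum_distrib_left)
  moreover have "U * Xc i \<in> V (M + 1)" by (intro V_mult U V_X i)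
  moreover have "(U * Xc i) v \<noteq> 0" using Uv i v by (simp add: fun_apply X_apply)
  moreover have "\<psi> \<in> V (M + d)" unfolding \<psi>_def by (intro V_sum V_mult U'V BV)
  moreover have "d + (M + 1) = (M + d) + 1" by simp
  ultimately show "\<exists>e f u \<psi>. u \<in> V e \<and> u v \<noteq> 0 \<and> \<psi> \<in> V f \<and> d + e = f + 1 \<and> u * \<phi> = t * \<psi>" by blast
qed

end

locale smooth_variety_curve = projective_curve n C for n and C :: "'k::alg_closed_field proj_point set" +
  assumes smooth: "smooth_curve n C"
begin

text \<open>
  The Jacobian criterion. The vectors \<open>\<Lambda> j\<close> of coefficients of the forms \<open>v\<^sub>i X\<^sub>j - v\<^sub>j X\<^sub>i\<close> are a
  basis of the \<open>n\<close>-dimensional space \<open>W\<close> of linear forms vanishing at \<open>v\<close>; by Euler's formula it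
  contains the gradients at \<open>v\<close> of the forms in the vanishing ideal. By smoothness these gradients
  have rank \<open>n - 1\<close>, hence together with a single \<open>\<Lambda> j\<close> they span \<open>W\<close>. By Taylor's formula the
  linear form belonging to a gradient lies in the square of the maximal ideal (property \<open>Q\<close> in the
  proof), hence \<open>nakayama\<close> applies with \<open>t = v\<^sub>i X\<^sub>j - v\<^sub>j X\<^sub>i\<close>.
\<close>

lemma loc_param_exists:
  assumes v: "v \<in> cone" and i: "i \<le> n" "v i \<noteq> 0"
  shows "\<exists>j\<le>n. loc_param v (cst (v i) * Xc j - cst (v j) * Xc i)"
proof -
  interpret VS: vector_space "\<lambda>(c::'k) (w::nat \<Rightarrow> 'k) l. c * w l"
    by unfold_locales (auto simp: fun_eq_iff fun_apply algebra_simps)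
  define G where "G = {(\<lambda>l. mpoly_eval v (mpoly_partial l g)) |g. g \<in> vanishing_ideal C \<and> (\<exists>d. form n d g)}"
  have dimG: "Suc (VS.dim G) = n"
    unfolding G_def by (rule bspec[OF bspec[OF smooth[unfolded smooth_curve_def] point_of_in_C[OF v]] point_of_self])
  define \<Lambda> where "\<Lambda> j = (\<lambda>l. if l = j then v i else if l = i then - v j else 0)" for j
  define J where "J = {..n} - {i}"
  have J: "finite J" "card J = n" using i by (auto simp: J_def)
  define W where "W = {w. (\<forall>l>n. w l = 0) \<and> (\<Sum>l\<le>n. v l * w l) = 0}"
  have LW: "\<Lambda> j \<in> W" if "j \<in> J" for j
  proof -
    have "(\<Sum>l\<le>n. v l * \<Lambda> j l) = (\<Sum>l\<le>n. (if l = j then v j * v i else 0) + (if l = i then - (v i * v j) else 0))"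
      using that by (intro sum.cong) (auto simp: \<Lambda>_def J_def)
    also have "\<dots> = 0" using that i by (simp add: sum.distrib J_def)
    finally show ?thesis using that i by (auto simp: W_def \<Lambda>_def J_def)
  qed
  have W_span: "W \<subseteq> VS.span (\<Lambda> ` J)"
  proof
    fix w assume w: "w \<in> W"
    have "w = (\<Sum>j\<in>J. (\<lambda>l. (w j / v i) * \<Lambda> j l))"
    proof
      fix l
      have "(\<Sum>j\<in>J. (\<lambda>l. (w j / v i) * \<Lambda> j l)) l = (\<Sum>j\<in>J. (w j / v i) * \<Lambda> j l)" by (simp add: sum_fun_apply)
      also have "\<dots> = w l"
      proof (cases "l = i")
        case True
        have "0 = (\<Sum>l\<le>n. v l * w l)" using w by (simp add: W_def)
        also have "\<dots> = v i * w i + (\<Sum>l\<in>J. v l * w l)" using i by (simp add: J_def sum.remove)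
        finally have "(\<Sum>l\<in>J. v l * w l) = - (v i * w i)" by (simp add: eq_neg_iff_add_eq_0 add.commute)
        moreover have "(\<Sum>j\<in>J. (w j / v i) * \<Lambda> j l) = (\<Sum>j\<in>J. (- 1 / v i) * (v j * w j))"
          by (intro sum.cong) (auto simp: \<Lambda>_def True J_def)
        moreover have "\<dots> = (- 1 / v i) * (\<Sum>j\<in>J. v j * w j)" by (simp only: sum_distrib_left)
        ultimately have "(\<Sum>j\<in>J. (w j / v i) * \<Lambda> j l) = (- 1 / v i) * - (v i * w i)" by (simp only:)
        then show ?thesis using i True by simp
      next
        case False
        have "(\<Sum>j\<in>J. (w j / v i) * \<Lambda> j l) = (\<Sum>j\<in>J. if j = l then w j else 0)"
          using i False by (intro sum.cong) (auto simp: \<Lambda>_def)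
        also have "\<dots> = w l" using w J(1) False by (auto simp: W_def J_def)
        finally show ?thesis .
      qed
      finally show "w l = (\<Sum>j\<in>J. (\<lambda>l. (w j / v i) * \<Lambda> j l)) l" by simp
    qed
    also have "\<dots> \<in> VS.span (\<Lambda> ` J)" by (intro VS.span_sum VS.span_scale VS.span_base) auto
    finally show "w \<in> VS.span (\<Lambda> ` J)" .
  qed
  have injL: "inj_on \<Lambda> J"
  proof (rule inj_onI)
    fix j j' assume "j \<in> J" "j' \<in> J" "\<Lambda> j = \<Lambda> j'"
    then have "\<Lambda> j j = \<Lambda> j' j" by simp
    then show "j = j'" using i \<open>j \<in> J\<close> by (auto simp: \<Lambda>_def J_def split: if_splits)
  qed
  have indL: "VS.independent (\<Lambda> ` J)"
  proof (subst VS.independent_explicit_finite_subsets, intro allI impI ballI)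
    fix S u w assume S: "S \<subseteq> \<Lambda> ` J" "finite S" and 0: "(\<Sum>w\<in>S. (\<lambda>l. u w * w l)) = 0" and w: "w \<in> S"
    then obtain j where j: "j \<in> J" "w = \<Lambda> j" by blast
    have "0 = (\<Sum>w\<in>S. (\<lambda>l. u w * w l)) j" by (simp add: 0 fun_apply)
    also have "\<dots> = (\<Sum>w'\<in>S. if w' = w then u w * v i else 0)"
      unfolding sum_fun_apply
    proof (intro sum.cong refl)
      fix w' assume "w' \<in> S"
      then obtain j' where j': "j' \<in> J" "w' = \<Lambda> j'" using S by blast
      have "w' = w \<longleftrightarrow> j' = j" using inj_on_eq_iff[OF injL j'(1) j(1)] j j' by simp
      then show "u w' * w' j = (if w' = w then u w * v i else 0)" using j j' by (auto simp: \<Lambda>_def J_def)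
    qed
    also have "\<dots> = u w * v i" using S w by simp
    finally show "u w = 0" using i by simp
  qed
  have GW: "G \<subseteq> W"
  proof
    fix w assume "w \<in> G"
    then obtain g d where g: "g \<in> vanishing_ideal C" "form n d g" "w = (\<lambda>l. mpoly_eval v (mpoly_partial l g))"
      by (auto simp: G_def)
    have "mpoly_eval v g = 0" using g(1) v by (auto simp: vanishing_ideal_def cone_def)
    then have "(\<Sum>l\<le>n. v l * w l) = 0" using euler[OF g(2), of v] g(3) by simp
    moreover have "w l = 0" if l: "l > n" for l
    proof -
      have "Poly_Mapping.lookup m l = 0" if "m \<in> Poly_Mapping.keys g" for m
        using g(2) that l unfolding form_iff_monom_deg monom_deg_def
        by (metis atMost_iff in_keys_iff not_le subsetD)
      then show ?thesis unfolding g(3) eval_partial monom_partial_def by simp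
    qed
    ultimately show "w \<in> W" by (simp add: W_def)
  qed
  obtain Bs where Bs: "Bs \<subseteq> G" "VS.independent Bs" "G \<subseteq> VS.span Bs" "card Bs = VS.dim G"
    using VS.basis_exists by blast
  have le: "finite S \<and> card S \<le> n" if "VS.independent S" "S \<subseteq> W" for S
    using VS.independent_span_bound[of "\<Lambda> ` J" S] that W_span J card_image[OF injL] by auto
  have finB: "finite Bs" using le Bs GW by blast
  have "\<exists>j\<in>J. \<Lambda> j \<notin> VS.span Bs"
  proof (rule ccontr)
    assume "\<not> ?thesis"
    then have "\<Lambda> ` J \<subseteq> VS.span Bs" by blast
    then have "card (\<Lambda> ` J) \<le> card Bs"
      using VS.independent_span_bound[OF finB indL] by blast
    then show False using card_image[OF injL] J dimG Bs by simp
  qed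
  then obtain j where j: "j \<in> J" "\<Lambda> j \<notin> VS.span Bs" by blast
  have span: "w \<in> VS.span (insert (\<Lambda> j) Bs)" if w: "w \<in> W" for w
  proof (rule ccontr)
    assume nw: "w \<notin> VS.span (insert (\<Lambda> j) Bs)"
    have i1: "VS.independent (insert (\<Lambda> j) Bs)" using VS.independent_insertI[OF j(2) Bs(2)] .
    have i2: "VS.independent (insert w (insert (\<Lambda> j) Bs))" using VS.independent_insertI[OF nw i1] .
    have "\<Lambda> j \<notin> Bs" "w \<notin> insert (\<Lambda> j) Bs" using j nw VS.span_base by auto
    then have "card (insert w (insert (\<Lambda> j) Bs)) = Suc n" using finB Bs dimG by simp
    moreover have "card (insert w (insert (\<Lambda> j) Bs)) \<le> n"
      using le[OF i2] w LW[OF j(1)] Bs(1) GW by blast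
    ultimately show False by simp
  qed
  define Y where "Y a = cst (v i) * Xc a - cst (v a) * Xc i" for a
  define lin where "lin w = (\<Sum>l\<le>n. cst (w l) * Xc l)" for w
  have lin_add: "lin (w + w') = lin w + lin w'" for w w'
    by (simp add: lin_def fun_apply cst_add distrib_right sum.distrib)
  have lin_scale: "lin (\<lambda>l. c * w l) = cst c * lin w" for c w
    by (simp add: lin_def cst_mult sum_distrib_left mult.assoc)
  have lin_L: "lin (\<Lambda> a) = Y a" if "a \<in> J" for a
  proof -
    have "lin (\<Lambda> a) = (\<Sum>l\<le>n. (if l = a then cst (v i) * Xc a else 0) + (if l = i then - (cst (v a) * Xc i) else 0))"
      unfolding lin_def using that by (intro sum.cong) (auto simp: \<Lambda>_def J_def cst_uminus)
    also have "\<dots> = Y a" using that i by (simp add: sum.distrib J_def Y_def)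
    finally show ?thesis .
  qed
  have YV: "Y a \<in> V 1" if "a \<le> n" for a unfolding Y_def by (intro V_diff V_cst_mult V_X that i)
  define Q where "Q w \<longleftrightarrow> (\<exists>N A. (\<forall>a. A a \<in> V N \<and> A a v = 0) \<and> Xc i ^ N * lin w = (\<Sum>a\<le>n. A a * Y a))" for w
  have XiV: "Xc i ^ N \<in> V N" for N using V_power[OF V_X[OF i(1)], of N] by simp
  have Q_add: "Q (w + w')" if Qs: "Q w" "Q w'" for w w'
  proof -
    obtain N A where A0: "\<forall>a. A a \<in> V N \<and> A a v = 0" and A3: "Xc i ^ N * lin w = (\<Sum>a\<le>n. A a * Y a)"
      using Qs(1) unfolding Q_def by (elim exE conjE) (rule that)
    note A = A0[rule_format, THEN conjunct1] A0[rule_format, THEN conjunct2] A3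
    obtain N' A' where A'0: "\<forall>a. A' a \<in> V N' \<and> A' a v = 0" and A'3: "Xc i ^ N' * lin w' = (\<Sum>a\<le>n. A' a * Y a)"
      using Qs(2) unfolding Q_def by (elim exE conjE) (rule that)
    note A' = A'0[rule_format, THEN conjunct1] A'0[rule_format, THEN conjunct2] A'3
    define A2 where "A2 a = Xc i ^ N' * A a + Xc i ^ N * A' a" for a
    have "A2 a \<in> V (N' + N)" for a
      using V_mult[OF XiV A(1), of N' a] V_mult[OF XiV A'(1), of N a] unfolding A2_def
      by (auto simp: add.commute intro: V_add)
    moreover have "A2 a v = 0" for a by (simp add: A2_def fun_apply A A')
    moreover have "Xc i ^ (N' + N) * lin (w + w') = Xc i ^ N' * (Xc i ^ N * lin w) + Xc i ^ N * (Xc i ^ N' * lin w')"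
      unfolding lin_add power_add by (simp only: algebra_simps)
    then have "Xc i ^ (N' + N) * lin (w + w') = (\<Sum>a\<le>n. A2 a * Y a)"
      unfolding A(3) A'(3) A2_def by (simp add: sum.distrib sum_distrib_left distrib_right mult.assoc)
    ultimately show ?thesis unfolding Q_def by (intro exI[of _ "N' + N"] exI[of _ A2]) blast
  qed
  have Q_scale: "Q (\<lambda>l. c * w l)" if Qs: "Q w" for c w
  proof -
    obtain N A where A0: "\<forall>a. A a \<in> V N \<and> A a v = 0" and A3: "Xc i ^ N * lin w = (\<Sum>a\<le>n. A a * Y a)"
      using Qs(1) unfolding Q_def by (elim exE conjE) (rule that)
    note A = A0[rule_format, THEN conjunct1] A0[rule_format, THEN conjunct2] A3
    have "Xc i ^ N * lin (\<lambda>l. c * w l) = cst c * (Xc i ^ N * lin w)" unfolding lin_scale by (simp only: mult_ac)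
    also have "\<dots> = (\<Sum>a\<le>n. (cst c * A a) * Y a)" unfolding A(3) by (simp add: sum_distrib_left mult.assoc)
    finally show ?thesis unfolding Q_def
      by (intro exI[of _ N] exI[of _ "\<lambda>a. cst c * A a"]) (auto simp: A fun_apply intro: V_cst_mult)
  qed
  have Q_0: "Q 0"
    unfolding Q_def by (intro exI[of _ 0] exI[of _ "\<lambda>_. 0"]) (simp add: lin_def fun_apply)
  have Q_G: "Q w" if w: "w \<in> G" for w
  proof -
    obtain g d where g: "g \<in> vanishing_ideal C" "form n d g" "w = (\<lambda>l. mpoly_eval v (mpoly_partial l g))"
      using w by (auto simp: G_def)
    have gv: "mpoly_eval x g = 0" if "x \<in> cone" for x using g(1) that by (auto simp: vanishing_ideal_def cone_def)
    obtain r where r: "\<And>a. form n d (r a)" "\<And>a. mpoly_eval v (r a) = 0" and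
      eq: "\<And>x. x i * v i ^ d * mpoly_eval x g = mpoly_eval v g * x i ^ Suc d
       + x i ^ d * (\<Sum>l\<le>n. mpoly_eval v (mpoly_partial l g) * (v i * x l - v l * x i))
       + (\<Sum>l\<le>n. (v i * x l - v l * x i) * mpoly_eval x (r l))"
      using taylor[OF g(2) i(1), of v] by blast
    define A where "A a = cst (- inverse (v i)) * Ev (r a)" for a
    have AV: "A a \<in> V d" for a unfolding A_def by (intro V_cst_mult VI r)
    have Av: "A a v = 0" for a by (simp add: A_def fun_apply Ev_apply v r)
    have "Xc i ^ d * lin w = (\<Sum>a\<le>n. A a * Y a)"
    proof (rule V_eqI)
      show "Xc i ^ d * lin w \<in> V (d + 1)" unfolding lin_def by (intro V_mult XiV V_sum V_cst_mult V_X) simp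
      show "(\<Sum>a\<le>n. A a * Y a) \<in> V (d + 1)" by (intro V_sum V_mult AV YV) simp
      fix x assume x: "x \<in> cone"
      have "(\<Sum>l\<le>n. w l * (v i * x l - v l * x i)) = v i * (\<Sum>l\<le>n. w l * x l) - x i * (\<Sum>l\<le>n. v l * w l)"
        by (simp add: sum_subtractf[symmetric] sum_distrib_left algebra_simps)
      moreover have "(\<Sum>l\<le>n. v l * w l) = 0" using w GW by (auto simp: W_def)
      ultimately have "x i ^ d * (v i * (\<Sum>l\<le>n. w l * x l)) + (\<Sum>l\<le>n. (v i * x l - v l * x i) * mpoly_eval x (r l)) = 0"
        using eq[of x] gv[OF x] gv[OF v] g(3) by simp
      then have "v i * (x i ^ d * (\<Sum>l\<le>n. w l * x l)) = - (\<Sum>l\<le>n. (v i * x l - v l * x i) * mpoly_eval x (r l))"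
        by (simp add: eq_neg_iff_add_eq_0 mult.left_commute)
      then have "x i ^ d * (\<Sum>l\<le>n. w l * x l) = - inverse (v i) * (\<Sum>l\<le>n. (v i * x l - v l * x i) * mpoly_eval x (r l))"
        using i(2) by (simp add: field_simps)
      also have "\<dots> = (\<Sum>l\<le>n. - inverse (v i) * mpoly_eval x (r l) * (v i * x l - v l * x i))"
        unfolding sum_distrib_left by (intro sum.cong refl) (simp only: mult_ac)
      finally show "(Xc i ^ d * lin w) x = (\<Sum>a\<le>n. A a * Y a) x"
        using x by (simp add: lin_def Y_def A_def sum_fun_apply fun_apply power_fun_apply X_apply Ev_apply)
    qed
    then show ?thesis unfolding Q_def using AV Av by (intro exI[of _ d] exI[of _ A]) blast
  qed
  have Q_span: "Q w" if "w \<in> VS.span Bs" for w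
    using that
  proof (induction rule: VS.span_induct_alt)
    case base
    show ?case by (rule Q_0)
  next
    case (step c x y)
    show ?case by (rule Q_add[OF Q_scale[OF Q_G[OF subsetD[OF Bs(1) step(1)]]] \<open>Q y\<close>])
  qed
  have nak: "\<forall>a\<in>J. \<exists>N u b. u \<in> V N \<and> u v \<noteq> 0 \<and> b \<in> V N \<and> u * Y a = b * Y j"
  proof (rule nakayama[OF J(1)])
    show "\<And>a. a \<in> J \<Longrightarrow> Y a \<in> V 1" using YV by (auto simp: J_def)
    fix a assume a: "a \<in> J"
    obtain k where k: "\<Lambda> a - (\<lambda>l. k * \<Lambda> j l) \<in> VS.span Bs"
      using span[OF LW[OF a]] unfolding VS.span_insert by blast
    obtain N A where A0: "\<forall>a. A a \<in> V N \<and> A a v = 0" and A3: "Xc i ^ N * lin (\<Lambda> a - (\<lambda>l. k * \<Lambda> j l)) = (\<Sum>a\<le>n. A a * Y a)"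
      using Q_span[OF k] unfolding Q_def by (elim exE conjE) (rule that)
    note A = A0[rule_format, THEN conjunct1] A0[rule_format, THEN conjunct2] A3
    have "lin (\<Lambda> a) = lin ((\<Lambda> a - (\<lambda>l. k * \<Lambda> j l)) + (\<lambda>l. k * \<Lambda> j l))" by simp
    then have "Y a = lin (\<Lambda> a - (\<lambda>l. k * \<Lambda> j l)) + cst k * Y j"
      unfolding lin_add lin_scale lin_L[OF a] lin_L[OF j(1)] .
    then have "Xc i ^ N * Y a = (cst k * Xc i ^ N) * Y j + (\<Sum>a\<le>n. A a * Y a)"
      unfolding A(3)[symmetric] by (simp add: algebra_simps)
    also have "(\<Sum>a\<le>n. A a * Y a) = (\<Sum>a\<in>J. A a * Y a)"
      using i by (simp add: J_def sum.remove[of _ i] Y_def)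
    finally have fe: "Xc i ^ N * Y a = (cst k * Xc i ^ N) * Y j + (\<Sum>a\<in>J. A a * Y a)" .
    have nz: "(Xc i ^ N) v \<noteq> 0" using i v by (simp add: power_fun_apply X_apply)
    show "\<exists>N u b A. u \<in> V N \<and> u v \<noteq> 0 \<and> b \<in> V N \<and> (\<forall>a. A a \<in> V N \<and> A a v = 0) \<and>
       u * Y a = b * Y j + (\<Sum>a\<in>J. A a * Y a)"
      by (rule exI[of _ N], rule exI[of _ "Xc i ^ N"], rule exI[of _ "cst k * Xc i ^ N"], rule exI[of _ A])
        (intro conjI XiV nz V_cst_mult A0 fe)
  qed
  have jn: "j \<le> n" "j \<noteq> i" using j by (auto simp: J_def)
  \<comment> \<open>If \<open>Y j\<close> were zero on \<open>C\<close>, it would belong to the vanishing ideal, and its gradient \<open>\<Lambda> j\<close>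
    would lie in the span of the gradients.\<close>
  have "Y j \<noteq> 0"
  proof
    assume 0: "Y j = 0"
    define g where "g = cst_poly (v i) * pvar j - cst_poly (v j) * pvar i"
    have fg: "form n 1 g" unfolding g_def by (intro form_diff form_cst_mult form_pvar i jn)
    have "Ev g = Y j" by (simp add: g_def Y_def Ev_diff Ev_mult Xc_def)
    then have "g \<in> vanishing_ideal C" using 0 by (simp flip: Ev_eq_0_iff)
    then have "(\<lambda>l. mpoly_eval v (mpoly_partial l g)) \<in> G" using fg unfolding G_def by blast
    moreover have "(\<lambda>l. mpoly_eval v (mpoly_partial l g)) = \<Lambda> j"
    proof
      fix l
      have g': "g = Poly_Mapping.single (Poly_Mapping.single j 1) (v i) + Poly_Mapping.single (Poly_Mapping.single i 1) (- v j)"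
        by (simp add: g_def pvar_def mult_single single_uminus)
      have mp: "monom_partial v (Poly_Mapping.single a 1) l = (if l = a then 1 else 0)" for a
        using monom_partial_Suc[of v 0 a l] by simp
      show "mpoly_eval v (mpoly_partial l g) = \<Lambda> j l"
        unfolding g' eval_partial_add eval_partial_single mp using jn by (auto simp: \<Lambda>_def)
    qed
    ultimately show False using j(2) Bs(3) by auto
  qed
  have "loc_param v (Y j)"
  proof (rule loc_param_from_coordinates[OF v i])
    show "Y j \<in> V 1" by (rule YV[OF jn(1)])
    show "Y j \<noteq> 0" by fact
    show "Y j v = 0" using v by (simp add: Y_def fun_apply X_apply)
    fix a assume a: "a \<le> n"
    show "\<exists>N u b. u \<in> V N \<and> u v \<noteq> 0 \<and> b \<in> V N \<and> u * (cst (v i) * Xc a - cst (v a) * Xc i) = b * Y j"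
    proof (cases "a = i")
      case True
      have "1 \<in> V 0" "(1 :: (nat \<Rightarrow> 'k) \<Rightarrow> 'k) v \<noteq> 0" "0 \<in> V 0" by (auto simp: V_1 fun_apply)
      moreover have "1 * (cst (v i) * Xc a - cst (v a) * Xc i) = 0 * Y j" by (simp add: True)
      ultimately show ?thesis by blast
    next
      case False
      then show ?thesis using nak a unfolding Y_def J_def by simp
    qed
  qed
  then show ?thesis using jn unfolding Y_def by blast
qed

end

section \<open>Orders of vanishing\<close>

lemma infinite_UNIV_alg_closed: "infinite (UNIV :: 'k::alg_closed_field set)"
proof
  assume fin: "finite (UNIV :: 'k set)"
  define p where "p = (\<Prod>a\<in>(UNIV :: 'k set). [:- a, 1:]) + 1"
  have "Polynomial.degree (\<Prod>a\<in>(UNIV :: 'k set). [:- a, 1:]) = card (UNIV :: 'k set)"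
    by (subst degree_prod_eq_sum_degree) auto
  moreover have "card (UNIV :: 'k set) > 0" using fin by (simp add: card_gt_0_iff)
  ultimately have "Polynomial.degree p > 0" unfolding p_def
    by (subst degree_add_eq_left) auto
  then obtain x where "poly p x = 0" using alg_closed_imp_poly_has_root by blast
  moreover have "poly p x = 1"
    unfolding p_def using fin by (auto simp: poly_prod prod_zero_iff)
  ultimately show False by simp
qed

context projective_variety
begin

lemma V_degree_unique:
  assumes "\<phi> \<in> V d" "\<phi> \<in> V e" "\<phi> \<noteq> 0"
  shows "d = e"
proof (rule ccontr)
  assume "d \<noteq> e"
  obtain v where v: "v \<in> cone" "\<phi> v \<noteq> 0" using V_nonzero[OF assms(1,3)] by blast
  let ?p = "Polynomial.monom (1::'k) d - Polynomial.monom 1 e"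
  have "Polynomial.coeff ?p d \<noteq> 0" using \<open>d \<noteq> e\<close> by simp
  then have "?p \<noteq> 0" by fastforce
  then have "finite {c. poly ?p c = 0}" by (rule poly_roots_finite)
  moreover have "poly ?p c = 0" if "c \<noteq> 0" for c
    using V_scale[OF assms(1) v(1) that] V_scale[OF assms(2) v(1) that] v(2)
    by (simp add: poly_monom)
  then have "UNIV \<subseteq> insert 0 {c. poly ?p c = 0}" by auto
  ultimately show False using infinite_UNIV_alg_closed finite_subset by blast
qed

text \<open>
  \<open>t\<^sup>m\<close> divides \<open>\<phi>\<close>, a homogeneous function of degree \<open>d\<close>, in the local ring at \<open>v\<close>; the quotient
  is \<open>\<psi> / u\<close>.
\<close>

definition loc_dvd where
  "loc_dvd v t d m \<phi> \<longleftrightarrow> (\<exists>e f u \<psi>. u \<in> V e \<and> u v \<noteq> 0 \<and> \<psi> \<in> V f \<and> d + e = m + f \<and> u * \<phi> = t ^ m * \<psi>)"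

definition exact_order where
  "exact_order v t d m \<phi> \<longleftrightarrow> (\<exists>e f u \<psi>. u \<in> V e \<and> u v \<noteq> 0 \<and> \<psi> \<in> V f \<and> \<psi> v \<noteq> 0 \<and> d + e = m + f \<and> u * \<phi> = t ^ m * \<psi>)"

lemma loc_dvdI: "u \<in> V e \<Longrightarrow> u v \<noteq> 0 \<Longrightarrow> \<psi> \<in> V f \<Longrightarrow> d + e = m + f \<Longrightarrow> u * \<phi> = t ^ m * \<psi> \<Longrightarrow> loc_dvd v t d m \<phi>"
  unfolding loc_dvd_def by blast

lemma loc_dvdE:
  assumes "loc_dvd v t d m \<phi>"
  obtains e f u \<psi> where "u \<in> V e" "u v \<noteq> 0" "\<psi> \<in> V f" "d + e = m + f" "u * \<phi> = t ^ m * \<psi>"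
  using assms unfolding loc_dvd_def by blast

lemma exact_orderI: "u \<in> V e \<Longrightarrow> u v \<noteq> 0 \<Longrightarrow> \<psi> \<in> V f \<Longrightarrow> \<psi> v \<noteq> 0 \<Longrightarrow> d + e = m + f \<Longrightarrow> u * \<phi> = t ^ m * \<psi> \<Longrightarrow> exact_order v t d m \<phi>"
  unfolding exact_order_def by blast

lemma exact_orderE:
  assumes "exact_order v t d m \<phi>"
  obtains e f u \<psi> where "u \<in> V e" "u v \<noteq> 0" "\<psi> \<in> V f" "\<psi> v \<noteq> 0" "d + e = m + f" "u * \<phi> = t ^ m * \<psi>"
  using assms unfolding exact_order_def by blast

lemma loc_paramD:
  assumes "loc_param v t"
  shows "t \<in> V 1" "t \<noteq> 0" "t v = 0"
  using assms unfolding loc_param_def by blast+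

lemma loc_param_dvd:
  assumes "loc_param v t" "\<phi> \<in> V d" "\<phi> v = 0"
  obtains e f u \<psi> where "u \<in> V e" "u v \<noteq> 0" "\<psi> \<in> V f" "d + e = f + 1" "u * \<phi> = t * \<psi>"
  using assms unfolding loc_param_def by blast

lemma V_tpow: "loc_param v t \<Longrightarrow> t ^ m \<in> V m"
  using V_power[OF loc_paramD(1), of v t m] by simp

lemma exact_order_dvd: "exact_order v t d m \<phi> \<Longrightarrow> loc_dvd v t d m \<phi>"
  by (elim exact_orderE) (rule loc_dvdI)

lemma loc_dvd_le_exact:
  assumes t: "loc_param v t" and ex: "exact_order v t d m \<phi>" and dv: "loc_dvd v t d m' \<phi>"
  shows "m' \<le> m"
proof (rule ccontr)
  assume less: "\<not> m' \<le> m"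
  obtain e f u \<psi> where 1: "u \<in> V e" "u v \<noteq> 0" "\<psi> \<in> V f" "\<psi> v \<noteq> 0" "d + e = m + f" "u * \<phi> = t ^ m * \<psi>"
    using ex by (rule exact_orderE)
  obtain e' f' u' \<psi>' where 2: "u' \<in> V e'" "u' v \<noteq> 0" "\<psi>' \<in> V f'" "d + e' = m' + f'" "u' * \<phi> = t ^ m' * \<psi>'"
    using dv by (rule loc_dvdE)
  have m': "m' = m + (m' - m)" using less by simp
  have "t ^ m * (u' * \<psi>) = u' * (u * \<phi>)" unfolding 1(6) by (simp only: mult_ac)
  also have "\<dots> = u * (u' * \<phi>)" by (simp only: mult_ac)
  also have "\<dots> = u * (t ^ (m + (m' - m)) * \<psi>')" unfolding 2(5) using m' by (simp only:)
  also have "\<dots> = t ^ m * (t ^ (m' - m) * u * \<psi>')" by (simp only: power_add mult_ac)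
  finally have eq: "t ^ m * (u' * \<psi>) = t ^ m * (t ^ (m' - m) * u * \<psi>')" .
  have "u' * \<psi> = t ^ (m' - m) * u * \<psi>'"
  proof (rule V_cancel[OF V_tpow[OF t] V_power_nonzero[OF loc_paramD(1,2)[OF t]] _ _ eq])
    show "u' * \<psi> \<in> V (e' + f)" by (intro V_mult 1 2)
    have "t ^ (m' - m) * u * \<psi>' \<in> V ((m' - m) + e + f')" by (intro V_mult V_tpow[OF t] 1 2)
    then show "t ^ (m' - m) * u * \<psi>' \<in> V (e' + f)" by (rule V_eq) (use 1 2 less in linarith)
  qed
  then have "(u' * \<psi>) v = (t ^ (m' - m) * u * \<psi>') v" by simp
  moreover have "(0::'k) ^ (m' - m) = 0" using less by simp
  ultimately show False using 1 2 loc_paramD(3)[OF t] by (simp add: fun_apply power_fun_apply)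
qed

text \<open>
  Two local parameters divide each other, hence differ by a unit; orders do not depend on the
  choice of the parameter.
\<close>

lemma loc_param_change:
  assumes t: "loc_param v t" and t': "loc_param v t'"
  shows "exact_order v t' 1 1 t"
proof -
  obtain e f u w where 1: "u \<in> V e" "u v \<noteq> 0" "w \<in> V f" "1 + e = f + 1" "u * t = t' * w"
    by (rule loc_param_dvd[OF t' loc_paramD(1,3)[OF t]])
  obtain e' f' u' w' where 2: "u' \<in> V e'" "u' v \<noteq> 0" "w' \<in> V f'" "1 + e' = f' + 1" "u' * t' = t * w'"
    by (rule loc_param_dvd[OF t loc_paramD(1,3)[OF t']])
  have "t * (u * u') = u' * (u * t)" by (simp only: mult_ac)
  also have "\<dots> = (u' * t') * w" unfolding 1(5) by (simp only: mult_ac)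
  also have "\<dots> = t * (w * w')" unfolding 2(5) by (simp only: mult_ac)
  finally have eq: "t * (u * u') = t * (w * w')" .
  have "u * u' = w * w'"
  proof (rule V_cancel[OF loc_paramD(1,2)[OF t] _ _ eq])
    show "u * u' \<in> V (e + e')" by (intro V_mult 1 2)
    have "w * w' \<in> V (f + f')" by (intro V_mult 1 2)
    then show "w * w' \<in> V (e + e')" using 1 2 by simp
  qed
  then have "(u * u') v = (w * w') v" by simp
  then have "w v \<noteq> 0" using 1 2 by (auto simp: fun_apply)
  then show ?thesis using 1 by (intro exact_orderI[of u e v w f]) auto
qed

lemma exact_order_change:
  assumes t: "loc_param v t" and t': "loc_param v t'" and ex: "exact_order v t d m \<phi>"
  shows "exact_order v t' d m \<phi>"
proof -
  obtain e f u \<psi> where 1: "u \<in> V e" "u v \<noteq> 0" "\<psi> \<in> V f" "\<psi> v \<noteq> 0" "d + e = m + f" "u * \<phi> = t ^ m * \<psi>"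
    using ex by (rule exact_orderE)
  obtain e' f' u' w where 2: "u' \<in> V e'" "u' v \<noteq> 0" "w \<in> V f'" "w v \<noteq> 0" "1 + e' = 1 + f'" "u' * t = t' ^ 1 * w"
    using loc_param_change[OF t t'] by (rule exact_orderE)
  have 26: "u' * t = t' * w" using 2(6) by simp
  show ?thesis
  proof (rule exact_orderI)
    show "u' ^ m * u \<in> V (m * e' + e)" "w ^ m * \<psi> \<in> V (m * f' + f)"
      by (intro V_mult V_power 1 2)+
    show "(u' ^ m * u) v \<noteq> 0" "(w ^ m * \<psi>) v \<noteq> 0" using 1 2 by (auto simp: fun_apply power_fun_apply)
    show "d + (m * e' + e) = m + (m * f' + f)" using 1 2 by simp
    have "u' ^ m * u * \<phi> = (u' * t) ^ m * \<psi>" unfolding mult.assoc 1(6) power_mult_distrib by (simp only: mult_ac)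
    then show "u' ^ m * u * \<phi> = t' ^ m * (w ^ m * \<psi>)" unfolding 26 power_mult_distrib by (simp only: mult_ac)
  qed
qed

text \<open>
  The order of vanishing at the point with coordinate vector \<open>v\<close>. A homogeneous function is not a
  function on \<open>C\<close>, but up to a unit at \<open>v\<close> it is one.
\<close>

definition ord where
  "ord v \<phi> = (THE m. \<exists>t d. \<phi> \<in> V d \<and> loc_param v t \<and> exact_order v t d m \<phi>)"

lemma exact_order_nonzero:
  assumes "loc_param v t" "exact_order v t d m \<phi>"
  shows "\<phi> \<noteq> 0"
proof
  assume 0: "\<phi> = 0"
  obtain e f u \<psi> where 1: "u \<in> V e" "u v \<noteq> 0" "\<psi> \<in> V f" "\<psi> v \<noteq> 0" "d + e = m + f" "u * \<phi> = t ^ m * \<psi>"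
    using assms(2) by (rule exact_orderE)
  have "t ^ m * \<psi> = 0" using 1(6) unfolding 0 by simp
  moreover have "\<psi> \<noteq> 0" using 1(4) by (auto simp: fun_apply)
  ultimately show False
    using V_domain[OF V_tpow[OF assms(1)] 1(3)] V_power_nonzero[OF loc_paramD(1,2)[OF assms(1)]] by blast
qed

lemma ord_eqI:
  assumes "\<phi> \<in> V d" "loc_param v t" "exact_order v t d m \<phi>"
  shows "ord v \<phi> = m"
  unfolding ord_def
proof (rule the_equality)
  show "\<exists>t d. \<phi> \<in> V d \<and> loc_param v t \<and> exact_order v t d m \<phi>" using assms by blast
next
  fix m' assume "\<exists>t d. \<phi> \<in> V d \<and> loc_param v t \<and> exact_order v t d m' \<phi>"
  then obtain t' d' where 1: "\<phi> \<in> V d'" "loc_param v t'" "exact_order v t' d' m' \<phi>" by blast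
  have "d' = d" using V_degree_unique[OF 1(1) assms(1) exact_order_nonzero[OF 1(2,3)]] .
  then have "exact_order v t d m' \<phi>" using exact_order_change[OF 1(2) assms(2) 1(3)] by simp
  then show "m' = m"
    using loc_dvd_le_exact[OF assms(2) _ exact_order_dvd] assms(3) by (meson le_antisym)
qed

end

context smooth_variety_curve
begin

lemma loc_param_ex: "v \<in> cone \<Longrightarrow> \<exists>t. loc_param v t"
  using cone_nonzero loc_param_exists by blast

lemma unit_linear_ex: "v \<in> cone \<Longrightarrow> \<exists>x\<in>V 1. x v = 1 \<and> x \<noteq> 0"
proof -
  assume v: "v \<in> cone"
  then obtain i where i: "i \<le> n" "v i \<noteq> 0" using cone_nonzero by blast
  have "(cst (inverse (v i)) * Xc i) v = 1" using i v by (simp add: fun_apply X_apply)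
  moreover from this have "cst (inverse (v i)) * Xc i \<noteq> 0" by (metis zero_fun_apply zero_neq_one)
  moreover have "cst (inverse (v i)) * Xc i \<in> V 1" by (intro V_cst_mult V_X i)
  ultimately show ?thesis by blast
qed

lemma one_apply: "(1 :: 'x \<Rightarrow> 'k) v \<noteq> 0" by (simp add: fun_apply)

text \<open>
  A nonzero function cannot be divisible by all powers of \<open>t\<close>: some multiple of \<open>\<phi>\<close> is a nonzero
  polynomial in \<open>t / x\<close> with \<open>x\<close> a unit at \<open>v\<close>, and the order of such a polynomial is its order at
  the root \<open>0\<close>.
\<close>

lemma loc_dvd_bounded:
  assumes v: "v \<in> cone" and t: "loc_param v t" and \<phi>: "\<phi> \<in> V d" "\<phi> \<noteq> 0"
  shows "\<exists>s. \<forall>m. loc_dvd v t d m \<phi> \<longrightarrow> m \<le> s"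
proof -
  obtain x where x: "x \<in> V 1" "x v = 1" "x \<noteq> 0" using unit_linear_ex[OF v] by blast
  obtain p e0 w where p: "p \<noteq> 0" "Polynomial.degree p \<le> d + e0" "w \<in> V e0" "homog p (d + e0) t x = \<phi> * w"
    using divides_homog[OF \<phi> x(1,3) loc_paramD(1)[OF t]] by blast
  define s where "s = Polynomial.order 0 p"
  obtain q where q: "p = [:- 0, 1:] ^ s * q" "\<not> [:- 0, 1:] dvd q"
    using order_decomp[OF p(1), of 0] unfolding s_def by blast
  have "q \<noteq> 0" using q by auto
  have q0: "poly q 0 \<noteq> 0" using q(2) poly_eq_0_iff_dvd[of q 0] by simp
  have degp: "Polynomial.degree p = s + Polynomial.degree q"
    unfolding q(1) using \<open>q \<noteq> 0\<close> by (simp add: degree_mult_eq degree_linear_power)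
  have fac: "homog ([:- 0, 1:] ^ s * q) (s + M) t x = t ^ s * homog q M t x"
    if M: "Polynomial.degree q \<le> M" for s M
  proof (induction s)
    case (Suc s)
    have "Polynomial.degree ([:- 0, 1:] ^ s * q) \<le> s + M"
      using \<open>q \<noteq> 0\<close> M by (simp add: degree_mult_eq degree_linear_power)
    from homog_linear_factor[OF this, of 0 t x]
    show ?case using Suc by (simp add: mult.assoc)
  qed simp
  define M where "M = d + e0 - s"
  have M: "Polynomial.degree q \<le> M" "d + e0 = s + M" using degp p(2) by (auto simp: M_def)
  define h where "h = homog q M t x"
  have hV: "h \<in> V M" unfolding h_def by (rule homog_V[OF loc_paramD(1)[OF t] x(1)])
  have hv: "h v \<noteq> 0" unfolding h_def using homog_apply[of x v q M t] x(2) M(1) q0 loc_paramD(3)[OF t] by simp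
  have rel: "\<phi> * w = t ^ s * h" using p(4) fac[OF M(1), of s] unfolding q(1) M(2) h_def by simp
  have "m \<le> s" if m: "loc_dvd v t d m \<phi>" for m
  proof -
    obtain e f u \<psi> where 1: "u \<in> V e" "u v \<noteq> 0" "\<psi> \<in> V f" "d + e = m + f" "u * \<phi> = t ^ m * \<psi>"
      using m by (rule loc_dvdE)
    have "exact_order v t (d + e0) s (\<phi> * w)"
    proof (rule exact_orderI[OF V_1 one_apply hV hv])
      show "d + e0 + 0 = s + M" using M by simp
      show "1 * (\<phi> * w) = t ^ s * h" using rel by simp
    qed
    moreover have "loc_dvd v t (d + e0) m (\<phi> * w)"
      by (rule loc_dvdI[OF 1(1,2) V_mult[OF 1(3) p(3)]])
        (use 1(4) in simp, simp add: 1(5) mult.assoc[symmetric])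
    ultimately show ?thesis using loc_dvd_le_exact[OF t] by blast
  qed
  then show ?thesis by blast
qed

text \<open>
  Take the largest power of \<open>t\<close> dividing \<open>\<phi>\<close>; the quotient does not vanish at \<open>v\<close>, as otherwise
  \<open>t\<close> would divide once more.
\<close>

lemma exact_order_ex:
  assumes v: "v \<in> cone" and t: "loc_param v t" and \<phi>: "\<phi> \<in> V d" "\<phi> \<noteq> 0"
  shows "\<exists>m. exact_order v t d m \<phi>"
proof -
  have "loc_dvd v t d 0 \<phi>"
    by (rule loc_dvdI[OF V_1 _ \<phi>(1)]) (auto simp: fun_apply)
  moreover obtain s where "\<And>m. loc_dvd v t d m \<phi> \<Longrightarrow> m \<le> s" using loc_dvd_bounded[OF assms] by blast
  ultimately obtain m where m: "loc_dvd v t d m \<phi>" "\<And>m'. loc_dvd v t d m' \<phi> \<Longrightarrow> m' \<le> m"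
    using Nat.ex_has_greatest_nat[of "\<lambda>m. loc_dvd v t d m \<phi>" 0 s] by blast
  obtain e f u \<psi> where 1: "u \<in> V e" "u v \<noteq> 0" "\<psi> \<in> V f" "d + e = m + f" "u * \<phi> = t ^ m * \<psi>"
    using m(1) by (rule loc_dvdE)
  have "\<psi> v \<noteq> 0"
  proof
    assume "\<psi> v = 0"
    then obtain e' f' u' \<psi>' where 2: "u' \<in> V e'" "u' v \<noteq> 0" "\<psi>' \<in> V f'" "f + e' = f' + 1" "u' * \<psi> = t * \<psi>'"
      by (rule loc_param_dvd[OF t 1(3)])
    have "loc_dvd v t d (Suc m) \<phi>"
    proof (rule loc_dvdI[OF V_mult[OF 2(1) 1(1)] _ 2(3)])
      show "(u' * u) v \<noteq> 0" using 1 2 by (simp add: fun_apply)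
      show "d + (e' + e) = Suc m + f'" using 1 2 by simp
      have "u' * u * \<phi> = t ^ m * (u' * \<psi>)" unfolding mult.assoc 1(5) by (simp only: mult_ac)
      then show "u' * u * \<phi> = t ^ Suc m * \<psi>'" unfolding 2(5) by (simp only: power_Suc mult_ac)
    qed
    then show False using m(2) by fastforce
  qed
  then show ?thesis using 1 exact_orderI by blast
qed

lemma ord_exact:
  assumes "v \<in> cone" "loc_param v t" "\<phi> \<in> V d" "\<phi> \<noteq> 0"
  shows "exact_order v t d (ord v \<phi>) \<phi>"
  using exact_order_ex[OF assms] ord_eqI[OF assms(3,2)] by blast

text \<open>
  The zero function has infinite order, whereas the value of \<open>ord\<close> there carries no meaning.
\<close>

definition ord_ge where "ord_ge v m \<phi> \<longleftrightarrow> \<phi> = 0 \<or> m \<le> ord v \<phi>"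

lemma ord_ge_iff:
  assumes "v \<in> cone" "loc_param v t" "\<phi> \<in> V d"
  shows "ord_ge v m \<phi> \<longleftrightarrow> loc_dvd v t d m \<phi>"
proof (cases "\<phi> = 0")
  case True
  obtain x where x: "x \<in> V 1" "x v = 1" using unit_linear_ex[OF assms(1)] by blast
  have "loc_dvd v t d m \<phi>"
    by (rule loc_dvdI[of "x ^ m" m v 0 d]) (use x V_power[OF x(1), of m] True in \<open>auto simp: power_fun_apply\<close>)
  then show ?thesis using True by (simp add: ord_ge_def)
next
  case False
  have ex: "exact_order v t d (ord v \<phi>) \<phi>" by (rule ord_exact[OF assms False])
  show ?thesis
  proof
    assume "ord_ge v m \<phi>"
    then have le: "m \<le> ord v \<phi>" using False by (simp add: ord_ge_def)
    obtain e f u \<psi> where 1: "u \<in> V e" "u v \<noteq> 0" "\<psi> \<in> V f" "\<psi> v \<noteq> 0" "d + e = ord v \<phi> + f" "u * \<phi> = t ^ ord v \<phi> * \<psi>"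
      using ex by (rule exact_orderE)
    show "loc_dvd v t d m \<phi>"
    proof (rule loc_dvdI[OF 1(1,2) V_mult[OF V_tpow[OF assms(2)] 1(3)]])
      show "d + e = m + (ord v \<phi> - m + f)" using 1 le by simp
      show "u * \<phi> = t ^ m * (t ^ (ord v \<phi> - m) * \<psi>)"
        unfolding 1(6) mult.assoc[symmetric] power_add[symmetric] using le by simp
    qed
  next
    assume "loc_dvd v t d m \<phi>"
    then show "ord_ge v m \<phi>" using loc_dvd_le_exact[OF assms(2) ex] by (simp add: ord_ge_def)
  qed
qed

lemma ord_mult:
  assumes v: "v \<in> cone" and "\<phi> \<in> V d" "\<phi> \<noteq> 0" "\<psi> \<in> V e" "\<psi> \<noteq> 0"
  shows "ord v (\<phi> * \<psi>) = ord v \<phi> + ord v \<psi>"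
proof -
  obtain t where t: "loc_param v t" using loc_param_ex[OF v] by blast
  obtain a b u \<phi>' where 1: "u \<in> V a" "u v \<noteq> 0" "\<phi>' \<in> V b" "\<phi>' v \<noteq> 0" "d + a = ord v \<phi> + b" "u * \<phi> = t ^ ord v \<phi> * \<phi>'"
    using ord_exact[OF v t assms(2,3)] by (rule exact_orderE)
  obtain a' b' u' \<psi>' where 2: "u' \<in> V a'" "u' v \<noteq> 0" "\<psi>' \<in> V b'" "\<psi>' v \<noteq> 0" "e + a' = ord v \<psi> + b'" "u' * \<psi> = t ^ ord v \<psi> * \<psi>'"
    using ord_exact[OF v t assms(4,5)] by (rule exact_orderE)
  have "exact_order v t (d + e) (ord v \<phi> + ord v \<psi>) (\<phi> * \<psi>)"
  proof (rule exact_orderI[OF V_mult[OF 1(1) 2(1)] _ V_mult[OF 1(3) 2(3)]])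
    show "(u * u') v \<noteq> 0" "(\<phi>' * \<psi>') v \<noteq> 0" using 1 2 by (auto simp: fun_apply)
    show "d + e + (a + a') = ord v \<phi> + ord v \<psi> + (b + b')" using 1 2 by simp
    have "u * u' * (\<phi> * \<psi>) = (u * \<phi>) * (u' * \<psi>)" by (simp only: mult_ac)
    then show "u * u' * (\<phi> * \<psi>) = t ^ (ord v \<phi> + ord v \<psi>) * (\<phi>' * \<psi>')"
      unfolding 1(6) 2(6) power_add by (simp only: mult_ac)
  qed
  then show ?thesis by (rule ord_eqI[OF V_mult[OF assms(2,4)] t])
qed

lemma ord_nonvanishing:
  assumes "v \<in> cone" "\<phi> \<in> V d" "\<phi> v \<noteq> 0"
  shows "ord v \<phi> = 0"
proof -
  obtain t where t: "loc_param v t" using loc_param_ex[OF assms(1)] by blast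
  have "exact_order v t d 0 \<phi>"
    by (rule exact_orderI[OF V_1 _ assms(2,3)]) (auto simp: fun_apply)
  then show ?thesis by (rule ord_eqI[OF assms(2) t])
qed

lemma ord_vanishing:
  assumes "v \<in> cone" "\<phi> \<in> V d" "\<phi> \<noteq> 0" "\<phi> v = 0"
  shows "ord v \<phi> > 0"
proof (rule ccontr)
  assume "\<not> ord v \<phi> > 0"
  then have 0: "ord v \<phi> = 0" by simp
  obtain t where t: "loc_param v t" using loc_param_ex[OF assms(1)] by blast
  obtain e f u \<psi> where 1: "u \<in> V e" "u v \<noteq> 0" "\<psi> \<in> V f" "\<psi> v \<noteq> 0" "d + e = ord v \<phi> + f" "u * \<phi> = t ^ ord v \<phi> * \<psi>"
    using ord_exact[OF assms(1) t assms(2,3)] by (rule exact_orderE)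
  have "u * \<phi> = \<psi>" using 1(6) 0 by simp
  then have "(u * \<phi>) v = \<psi> v" by simp
  then show False using 1(4) unfolding times_fun_apply assms(4) by simp
qed

lemma ord_loc_param: assumes "loc_param v t" shows "ord v t = 1"
proof (rule ord_eqI[OF loc_paramD(1)[OF assms] assms])
  show "exact_order v t 1 1 t"
    by (rule exact_orderI[OF V_1 _ V_1]) (auto simp: fun_apply)
qed

lemma ord_power:
  assumes "v \<in> cone" "\<phi> \<in> V d" "\<phi> \<noteq> 0"
  shows "ord v (\<phi> ^ k) = k * ord v \<phi>"
proof (induction k)
  case 0
  show ?case unfolding power_0 mult_0 by (rule ord_nonvanishing[OF assms(1) V_1]) (simp add: fun_apply)
next
  case (Suc k)
  show ?case unfolding power_Suc
    using ord_mult[OF assms V_power[OF assms(2)] V_power_nonzero[OF assms(2,3)], of k] Suc by simp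
qed

lemma ord_prod:
  assumes "v \<in> cone" "finite A" "\<And>i. i \<in> A \<Longrightarrow> f i \<in> V (d i) \<and> f i \<noteq> 0"
  shows "ord v (\<Prod>i\<in>A. f i) = (\<Sum>i\<in>A. ord v (f i))"
  using assms(2,3)
proof (induction A rule: finite_induct)
  case empty
  show ?case unfolding prod.empty sum.empty by (rule ord_nonvanishing[OF assms(1) V_1]) (simp add: fun_apply)
next
  case (insert x F)
  have P: "(\<Prod>i\<in>F. f i) \<in> V (\<Sum>i\<in>F. d i)" by (rule V_prod) (use insert.prems in blast)
  have nz: "(\<Prod>i\<in>F. f i) \<noteq> 0" by (rule V_prod_nonzero[where d = d]) (use insert.prems in blast)
  have x: "f x \<in> V (d x)" "f x \<noteq> 0" using insert.prems by auto
  show ?case unfolding prod.insert[OF insert.hyps] sum.insert[OF insert.hyps]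
    using ord_mult[OF assms(1) x P nz] insert by simp
qed

lemma ord_ge_add:
  assumes v: "v \<in> cone" and "\<phi> \<in> V d" "\<psi> \<in> V d" "ord_ge v m \<phi>" "ord_ge v m \<psi>"
  shows "ord_ge v m (\<phi> + \<psi>)"
proof -
  obtain t where t: "loc_param v t" using loc_param_ex[OF v] by blast
  have "loc_dvd v t d m \<phi>" "loc_dvd v t d m \<psi>" using assms ord_ge_iff[OF v t] by blast+
  note dv = this
  obtain a b u \<phi>' where
    1: "u \<in> V a" "u v \<noteq> 0" "\<phi>' \<in> V b" "d + a = m + b" "u * \<phi> = t ^ m * \<phi>'"
    using dv(1) by (rule loc_dvdE)
  obtain a' b' u' \<psi>' where
    2: "u' \<in> V a'" "u' v \<noteq> 0" "\<psi>' \<in> V b'" "d + a' = m + b'" "u' * \<psi> = t ^ m * \<psi>'"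
    using dv(2) by (rule loc_dvdE)
  have "loc_dvd v t d m (\<phi> + \<psi>)"
  proof (rule loc_dvdI[OF V_mult[OF 1(1) 2(1)]])
    show "(u * u') v \<noteq> 0" using 1 2 by (auto simp: fun_apply)
    have "u * \<psi>' \<in> V (a + b')" "u' * \<phi>' \<in> V (a' + b)" by (intro V_mult 1 2)+
    moreover have "a' + b = a + b'" using 1 2 by simp
    ultimately show "u' * \<phi>' + u * \<psi>' \<in> V (a + b')" by (intro V_add) auto
    show "d + (a + a') = m + (a + b')" using 1 2 by simp
    have "u * u' * (\<phi> + \<psi>) = u' * (u * \<phi>) + u * (u' * \<psi>)" by (simp only: algebra_simps)
    then show "u * u' * (\<phi> + \<psi>) = t ^ m * (u' * \<phi>' + u * \<psi>')"
      unfolding 1(5) 2(5) by (simp only: algebra_simps)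
  qed
  then show ?thesis using ord_ge_iff[OF v t V_add[OF assms(2,3)]] by blast
qed

lemma ord_cst_mult:
  assumes "v \<in> cone" "\<phi> \<in> V d" "\<phi> \<noteq> 0" "c \<noteq> 0"
  shows "ord v (cst c * \<phi>) = ord v \<phi>" "cst c * \<phi> \<noteq> 0"
proof -
  have c: "cst c \<noteq> (0 :: (nat \<Rightarrow> 'k) \<Rightarrow> 'k)" using assms(4) by (auto simp: fun_eq_iff fun_apply)
  have "ord v (cst c) = 0" by (rule ord_nonvanishing[OF assms(1) V_cst]) (simp add: fun_apply assms)
  then show "ord v (cst c * \<phi>) = ord v \<phi>" using ord_mult[OF assms(1) V_cst c assms(2,3)] by simp
  show "cst c * \<phi> \<noteq> 0" using V_mult_nonzero[OF V_cst assms(2) c assms(3)] .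
qed

lemma ord_ge_cst_mult:
  assumes "v \<in> cone" "\<phi> \<in> V d" "ord_ge v m \<phi>"
  shows "ord_ge v m (cst c * \<phi>)"
proof (cases "c = 0 \<or> \<phi> = 0")
  case True
  then have "cst c * \<phi> = 0" by auto
  then show ?thesis by (simp only: ord_ge_def simp_thms)
next
  case False
  then show ?thesis using assms ord_cst_mult(1)[OF assms(1,2)] by (simp add: ord_ge_def)
qed

lemma ord_ge_mult:
  assumes "v \<in> cone" "\<phi> \<in> V d" "\<psi> \<in> V e" "ord_ge v m \<phi>" "ord_ge v k \<psi>"
  shows "ord_ge v (m + k) (\<phi> * \<psi>)"
proof (cases "\<phi> = 0 \<or> \<psi> = 0")
  case True
  then have "\<phi> * \<psi> = 0" by auto
  then show ?thesis by (simp only: ord_ge_def simp_thms)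
next
  case False
  then show ?thesis using assms ord_mult[OF assms(1,2) _ assms(3)] by (simp add: ord_ge_def add_mono)
qed

lemma ord_ge_0 [simp]: "ord_ge v m 0" "ord_ge v 0 \<phi>" by (auto simp: ord_ge_def)

lemma ord_ge_self: "ord_ge v (ord v \<phi>) \<phi>" by (simp add: ord_ge_def)

lemma ord_ge_mono: "ord_ge v m \<phi> \<Longrightarrow> k \<le> m \<Longrightarrow> ord_ge v k \<phi>" by (auto simp: ord_ge_def)

lemma ord_ge_sum:
  assumes "v \<in> cone" "\<And>i. i \<in> A \<Longrightarrow> f i \<in> V d" "\<And>i. i \<in> A \<Longrightarrow> ord_ge v m (f i)"
  shows "ord_ge v m (\<Sum>i\<in>A. f i)"
  using assms(2,3)
  by (induction A rule: infinite_finite_induct) (auto intro!: ord_ge_add[OF assms(1), of _ d] V_sum)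

text \<open>
  Raising the order by one is a single linear condition: the combination is chosen so that the
  coefficients of \<open>t\<^sup>m\<close> cancel. If both coefficients are zero, then already \<open>\<phi>\<close> has larger order.
\<close>

lemma ord_ge_codim:
  assumes v: "v \<in> cone" and "\<phi> \<in> V d" "\<psi> \<in> V d" "ord_ge v m \<phi>" "ord_ge v m \<psi>"
  shows "\<exists>a b. (a \<noteq> 0 \<or> b \<noteq> 0) \<and> ord_ge v (Suc m) (cst a * \<phi> + cst b * \<psi>)"
proof -
  obtain t where t: "loc_param v t" using loc_param_ex[OF v] by blast
  have "loc_dvd v t d m \<phi>" "loc_dvd v t d m \<psi>" using assms ord_ge_iff[OF v t] by blast+
  note dv = this
  obtain a b u \<phi>' where
    1: "u \<in> V a" "u v \<noteq> 0" "\<phi>' \<in> V b" "d + a = m + b" "u * \<phi> = t ^ m * \<phi>'"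
    using dv(1) by (rule loc_dvdE)
  obtain a' b' u' \<psi>' where
    2: "u' \<in> V a'" "u' v \<noteq> 0" "\<psi>' \<in> V b'" "d + a' = m + b'" "u' * \<psi> = t ^ m * \<psi>'"
    using dv(2) by (rule loc_dvdE)
  define A where "A = (u * \<psi>') v"
  define B where "B = - (u' * \<phi>') v"
  show ?thesis
  proof (cases "A = 0 \<and> B = 0")
    case True
    have uV: "u' * \<phi>' \<in> V (a' + b)" by (intro V_mult 1 2)
    have "(u' * \<phi>') v = 0" using True by (simp add: B_def)
    then obtain e f w \<chi> where 3: "w \<in> V e" "w v \<noteq> 0" "\<chi> \<in> V f" "(a' + b) + e = f + 1" "w * (u' * \<phi>') = t * \<chi>"
      by (rule loc_param_dvd[OF t uV])
    have "loc_dvd v t d (Suc m) \<phi>"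
    proof (rule loc_dvdI[OF V_mult[OF V_mult[OF 3(1) 2(1)] 1(1)] _ 3(3)])
      show "(w * u' * u) v \<noteq> 0" using 1 2 3 by (simp add: fun_apply)
      show "d + (e + a' + a) = Suc m + f" using 1 2 3 by simp
      have "w * u' * u * \<phi> = w * (u' * (u * \<phi>))" by (simp only: mult.assoc)
      also have "\<dots> = t ^ m * (w * (u' * \<phi>'))" unfolding 1(5) by (simp only: mult_ac)
      finally show "w * u' * u * \<phi> = t ^ Suc m * \<chi>" unfolding 3(5) by (simp only: power_Suc mult_ac)
    qed
    then have "ord_ge v (Suc m) (cst 1 * \<phi> + cst 0 * \<psi>)"
      using ord_ge_iff[OF v t assms(2)] by simp
    then show ?thesis using zero_neq_one by metis
  next
    case False
    define \<chi> where "\<chi> = cst A * (u' * \<phi>') + cst B * (u * \<psi>')"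
    have "u' * \<phi>' \<in> V (a' + b)" "u * \<psi>' \<in> V (a + b')" by (intro V_mult 1 2)+
    moreover have "a + b' = a' + b" using 1 2 by simp
    ultimately have \<chi>V: "\<chi> \<in> V (a' + b)" unfolding \<chi>_def by (intro V_add V_cst_mult) auto
    have "\<chi> v = 0" by (simp add: \<chi>_def A_def B_def fun_apply)
    then obtain e f w \<omega> where 3: "w \<in> V e" "w v \<noteq> 0" "\<omega> \<in> V f" "(a' + b) + e = f + 1" "w * \<chi> = t * \<omega>"
      by (rule loc_param_dvd[OF t \<chi>V])
    have "loc_dvd v t d (Suc m) (cst A * \<phi> + cst B * \<psi>)"
    proof (rule loc_dvdI[OF V_mult[OF V_mult[OF 3(1) 2(1)] 1(1)] _ 3(3)])
      show "(w * u' * u) v \<noteq> 0" using 1 2 3 by (simp add: fun_apply)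
      show "d + (e + a' + a) = Suc m + f" using 1 2 3 by simp
      have "w * u' * u * (cst A * \<phi> + cst B * \<psi>) = w * (cst A * (u' * (u * \<phi>)) + cst B * (u * (u' * \<psi>)))"
        by (simp only: algebra_simps)
      also have "\<dots> = t ^ m * (w * \<chi>)" unfolding 1(5) 2(5) \<chi>_def by (simp only: algebra_simps)
      finally show "w * u' * u * (cst A * \<phi> + cst B * \<psi>) = t ^ Suc m * \<omega>" unfolding 3(5) by (simp only: power_Suc mult_ac)
    qed
    then have "ord_ge v (Suc m) (cst A * \<phi> + cst B * \<psi>)"
      using ord_ge_iff[OF v t V_add[OF V_cst_mult[OF assms(2)] V_cst_mult[OF assms(3)]]] by blast
    then show ?thesis using False by blast
  qed
qed

lemma leading_value:
  assumes v: "v \<in> cone" and \<phi>: "\<phi> \<in> V d" "ord_ge v m \<phi>" and \<psi>: "\<psi> \<in> V d" "\<psi> \<noteq> 0" "ord v \<psi> = m"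
  shows "\<exists>c. ord_ge v (Suc m) (\<phi> - cst c * \<psi>)"
proof -
  have "ord_ge v m \<psi>" using \<psi> by (simp add: ord_ge_def)
  then obtain a b where ab: "a \<noteq> 0 \<or> b \<noteq> 0" "ord_ge v (Suc m) (cst a * \<phi> + cst b * \<psi>)"
    using ord_ge_codim[OF v \<phi>(1) \<psi>(1) \<phi>(2)] by blast
  have "a \<noteq> 0"
  proof
    assume a: "a = 0"
    then have "b \<noteq> 0" "ord_ge v (Suc m) (cst b * \<psi>)" using ab by auto
    then show False using ord_cst_mult[OF v \<psi>(1,2)] \<psi>(3) by (simp add: ord_ge_def)
  qed
  have "ord_ge v (Suc m) (cst (inverse a) * (cst a * \<phi> + cst b * \<psi>))"
    by (rule ord_ge_cst_mult[OF v V_add[OF V_cst_mult[OF \<phi>(1)] V_cst_mult[OF \<psi>(1)]] ab(2)])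
  also have "cst (inverse a) * (cst a * \<phi> + cst b * \<psi>) = \<phi> - cst (- inverse a * b) * \<psi>"
    using \<open>a \<noteq> 0\<close> by (simp add: fun_eq_iff fun_apply field_simps)
  finally show ?thesis by blast
qed

end

section \<open>The order of a rational function\<close>

context smooth_variety_curve
begin

lemma V_scale_iff: "u \<in> V e \<Longrightarrow> v \<in> cone \<Longrightarrow> c \<noteq> 0 \<Longrightarrow> u (\<lambda>i. c * v i) = 0 \<longleftrightarrow> u v = 0"
  by (simp add: V_scale)

lemma loc_param_scale:
  assumes v: "v \<in> cone" and c: "c \<noteq> 0" and t: "loc_param v t"
  shows "loc_param (\<lambda>i. c * v i) t"
  unfolding loc_param_def
proof (intro conjI allI impI)
  show "t \<in> V 1" "t \<noteq> 0" using loc_paramD[OF t] by auto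
  show "t (\<lambda>i. c * v i) = 0" using V_scale_iff[OF loc_paramD(1)[OF t] v c] loc_paramD[OF t] by simp
  fix d \<phi> assume \<phi>: "\<phi> \<in> V d" "\<phi> (\<lambda>i. c * v i) = 0"
  have "\<phi> v = 0" using V_scale_iff[OF \<phi>(1) v c] \<phi>(2) by simp
  then obtain e f u \<psi> where 1: "u \<in> V e" "u v \<noteq> 0" "\<psi> \<in> V f" "d + e = f + 1" "u * \<phi> = t * \<psi>"
    by (rule loc_param_dvd[OF t \<phi>(1)])
  moreover have "u (\<lambda>i. c * v i) \<noteq> 0" using V_scale_iff[OF 1(1) v c] 1(2) by simp
  ultimately show "\<exists>e f u \<psi>. u \<in> V e \<and> u (\<lambda>i. c * v i) \<noteq> 0 \<and> \<psi> \<in> V f \<and> d + e = f + 1 \<and> u * \<phi> = t * \<psi>"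
    by blast
qed

lemma ord_scale:
  assumes v: "v \<in> cone" and c: "c \<noteq> 0" and \<phi>: "\<phi> \<in> V d" "\<phi> \<noteq> 0"
  shows "ord (\<lambda>i. c * v i) \<phi> = ord v \<phi>"
proof -
  obtain t where t: "loc_param v t" using loc_param_ex[OF v] by blast
  obtain e f u \<psi> where 1: "u \<in> V e" "u v \<noteq> 0" "\<psi> \<in> V f" "\<psi> v \<noteq> 0" "d + e = ord v \<phi> + f" "u * \<phi> = t ^ ord v \<phi> * \<psi>"
    using ord_exact[OF v t \<phi>] by (rule exact_orderE)
  have "exact_order (\<lambda>i. c * v i) t d (ord v \<phi>) \<phi>"
    by (rule exact_orderI[OF 1(1) _ 1(3) _ 1(5,6)])
      (use V_scale_iff[OF 1(1) v c] V_scale_iff[OF 1(3) v c] 1 in auto)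
  then show ?thesis by (rule ord_eqI[OF \<phi>(1) loc_param_scale[OF v c t]])
qed

lemma quot_rep:
  assumes "f \<in> carrier K" "(g, h) \<in> f"
  shows "\<exists>d. form n d g \<and> form n d h \<and> fraction d (Ev g) (Ev h) \<and> f = quot (Ev g) (Ev h)"
proof -
  obtain d \<phi> \<psi> where f: "fraction d \<phi> \<psi>" "f = quot \<phi> \<psi>" using carrierE[OF assms(1)] by blast
  have gh: "(g, h) \<in> quot \<phi> \<psi>" using assms f by simp
  obtain e where e: "form n e g" "form n e h" "fraction e (Ev g) (Ev h)" using quot_memD(1)[OF f(1) gh] by blast
  have "f = quot (Ev g) (Ev h)" unfolding f(2) quot_eq_iff[OF f(1) e(3)] by (rule quot_memD(2)[OF f(1) gh])
  then show ?thesis using e by blast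
qed

lemma all_point_iff:
  assumes "P \<in> C" "v \<in> P" "form n d h"
  shows "(\<forall>w\<in>P. mpoly_eval w h \<noteq> 0) \<longleftrightarrow> Ev h v \<noteq> 0" "(\<forall>w\<in>P. mpoly_eval w h = 0) \<longleftrightarrow> Ev h v = 0"
proof -
  have P: "P = point_of v" using C_eq_point_of assms by blast
  have "mpoly_eval w h = 0 \<longleftrightarrow> mpoly_eval v h = 0" if "w \<in> P" for w
    using that assms(3) by (auto simp: P point_of_def form_eval_scale)
  then show "(\<forall>w\<in>P. mpoly_eval w h \<noteq> 0) \<longleftrightarrow> Ev h v \<noteq> 0" "(\<forall>w\<in>P. mpoly_eval w h = 0) \<longleftrightarrow> Ev h v = 0"
    unfolding Ev_apply[OF C_cone[OF assms(1,2)]] using assms(2) by blast+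
qed

lemma local_ring_iff:
  assumes P: "P \<in> C" "v \<in> P"
  shows "f \<in> local_ring n C P \<longleftrightarrow> (\<exists>d \<phi> \<psi>. fraction d \<phi> \<psi> \<and> \<psi> v \<noteq> 0 \<and> f = quot \<phi> \<psi>)"
proof
  assume "f \<in> local_ring n C P"
  then obtain g h where f: "f \<in> carrier K" "(g, h) \<in> f" "\<forall>w\<in>P. mpoly_eval w h \<noteq> 0"
    unfolding local_ring_def by blast
  obtain d where d: "form n d h" "fraction d (Ev g) (Ev h)" "f = quot (Ev g) (Ev h)" using quot_rep[OF f(1,2)] by blast
  have "Ev h v \<noteq> 0" using all_point_iff(1)[OF P d(1)] f(3) by blast
  then show "\<exists>d \<phi> \<psi>. fraction d \<phi> \<psi> \<and> \<psi> v \<noteq> 0 \<and> f = quot \<phi> \<psi>" using d by blast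
next
  assume "\<exists>d \<phi> \<psi>. fraction d \<phi> \<psi> \<and> \<psi> v \<noteq> 0 \<and> f = quot \<phi> \<psi>"
  then obtain d \<phi> \<psi> where f: "fraction d \<phi> \<psi>" "\<psi> v \<noteq> 0" "f = quot \<phi> \<psi>" by blast
  obtain g h where gh: "form n d g" "form n d h" "\<phi> = Ev g" "\<psi> = Ev h" "(g, h) \<in> fractions n C" using frac_rep[OF f(1)] by blast
  have "(g, h) \<in> f" using gh by (simp add: f(3) quot_def)
  moreover have "\<forall>w\<in>P. mpoly_eval w h \<noteq> 0" using all_point_iff(1)[OF P gh(2)] f(2) gh(4) by blast
  moreover have "f \<in> carrier K" unfolding f(3) by (rule quot_carrier[OF f(1)])
  ultimately show "f \<in> local_ring n C P" unfolding local_ring_def by blast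
qed

lemma local_max_ideal_iff:
  assumes P: "P \<in> C" "v \<in> P"
  shows "f \<in> local_max_ideal n C P \<longleftrightarrow> (\<exists>d \<phi> \<psi>. fraction d \<phi> \<psi> \<and> \<psi> v \<noteq> 0 \<and> \<phi> v = 0 \<and> f = quot \<phi> \<psi>)"
proof
  assume "f \<in> local_max_ideal n C P"
  then obtain g h where f: "f \<in> carrier K" "(g, h) \<in> f" "\<forall>w\<in>P. mpoly_eval w h \<noteq> 0" "\<forall>w\<in>P. mpoly_eval w g = 0"
    unfolding local_max_ideal_def by blast
  obtain d where d: "form n d g" "form n d h" "fraction d (Ev g) (Ev h)" "f = quot (Ev g) (Ev h)" using quot_rep[OF f(1,2)] by blast
  have "Ev h v \<noteq> 0" "Ev g v = 0" using all_point_iff[OF P d(1)] all_point_iff[OF P d(2)] f(3,4) by blast+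
  then show "\<exists>d \<phi> \<psi>. fraction d \<phi> \<psi> \<and> \<psi> v \<noteq> 0 \<and> \<phi> v = 0 \<and> f = quot \<phi> \<psi>" using d by blast
next
  assume "\<exists>d \<phi> \<psi>. fraction d \<phi> \<psi> \<and> \<psi> v \<noteq> 0 \<and> \<phi> v = 0 \<and> f = quot \<phi> \<psi>"
  then obtain d \<phi> \<psi> where f: "fraction d \<phi> \<psi>" "\<psi> v \<noteq> 0" "\<phi> v = 0" "f = quot \<phi> \<psi>" by blast
  obtain g h where gh: "form n d g" "form n d h" "\<phi> = Ev g" "\<psi> = Ev h" "(g, h) \<in> fractions n C" using frac_rep[OF f(1)] by blast
  have "(g, h) \<in> f" using gh by (simp add: f(4) quot_def)
  moreover have "\<forall>w\<in>P. mpoly_eval w h \<noteq> 0" "\<forall>w\<in>P. mpoly_eval w g = 0"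
    using all_point_iff[OF P gh(2)] all_point_iff[OF P gh(1)] f(2,3) gh(3,4) by blast+
  moreover have "f \<in> carrier K" unfolding f(4) by (rule quot_carrier[OF f(1)])
  ultimately show "f \<in> local_max_ideal n C P" unfolding local_max_ideal_def by blast
qed

text \<open>
  Dividing a local parameter by a linear form that does not vanish at \<open>P\<close> makes it a rational
  function.
\<close>

lemma uniformizer_loc_param:
  assumes P: "P \<in> C" "v \<in> P" and t: "loc_param v t" and x: "x \<in> V 1" "x v \<noteq> 0"
  shows "fraction 1 t x" "uniformizer n C P (quot t x)"
proof -
  have x0: "x \<noteq> 0" using x(2) by (auto simp: fun_apply)
  show fr: "fraction 1 t x" using x x0 loc_paramD[OF t] by (simp add: fraction_def)
  show "uniformizer n C P (quot t x)"
    unfolding uniformizer_def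
  proof (intro conjI equalityI subsetI)
    show "quot t x \<in> local_max_ideal n C P"
      unfolding local_max_ideal_iff[OF P] using fr x(2) loc_paramD(3)[OF t] by blast
  next
    fix f assume "f \<in> local_max_ideal n C P"
    then obtain d \<phi> \<psi> where f: "fraction d \<phi> \<psi>" "\<psi> v \<noteq> 0" "\<phi> v = 0" "f = quot \<phi> \<psi>"
      unfolding local_max_ideal_iff[OF P] by blast
    have fV: "\<phi> \<in> V d" "\<psi> \<in> V d" "\<psi> \<noteq> 0" using f(1) by (auto simp: fraction_def)
    obtain e f' u \<chi> where 1: "u \<in> V e" "u v \<noteq> 0" "\<chi> \<in> V f'" "d + e = f' + 1" "u * \<phi> = t * \<chi>"
      by (rule loc_param_dvd[OF t fV(1) f(3)])
    have u0: "u \<noteq> 0" using 1(2) by (auto simp: fun_apply)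
    have fr': "fraction (f' + 1) (\<chi> * x) (u * \<psi>)"
      unfolding fraction_def
    proof (intro conjI)
      show "\<chi> * x \<in> V (f' + 1)" by (intro V_mult 1 x)
      have "u * \<psi> \<in> V (e + d)" by (intro V_mult 1 fV)
      then show "u * \<psi> \<in> V (f' + 1)" using 1(4) by (simp add: add.commute)
      show "u * \<psi> \<noteq> 0" by (rule V_mult_nonzero[OF 1(1) fV(2) u0 fV(3)])
    qed
    have "f = quot (\<chi> * x) (u * \<psi>) \<otimes>\<^bsub>K\<^esub> quot t x"
      unfolding f(4) quot_mult[OF fr' fr] quot_eq_iff[OF f(1) frac_mult[OF fr' fr]]
    proof -
      have "\<phi> * (u * \<psi> * x) = (u * \<phi>) * (\<psi> * x)" by (simp only: mult_ac)
      then show "\<phi> * (u * \<psi> * x) = \<chi> * x * t * \<psi>" unfolding 1(5) by (simp only: mult_ac)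
    qed
    moreover have "(u * \<psi>) v \<noteq> 0" using 1 f by (simp add: fun_apply)
    then have "quot (\<chi> * x) (u * \<psi>) \<in> local_ring n C P" unfolding local_ring_iff[OF P] using fr' by blast
    ultimately show "f \<in> (\<lambda>r. r \<otimes>\<^bsub>K\<^esub> quot t x) ` local_ring n C P" by blast
  next
    fix f assume "f \<in> (\<lambda>r. r \<otimes>\<^bsub>K\<^esub> quot t x) ` local_ring n C P"
    then obtain r where r: "r \<in> local_ring n C P" "f = r \<otimes>\<^bsub>K\<^esub> quot t x" by (rule imageE)
    obtain d \<phi> \<psi> where f': "fraction d \<phi> \<psi>" "\<psi> v \<noteq> 0" "r = quot \<phi> \<psi>"
      using r(1) unfolding local_ring_iff[OF P] by blast
    note f = f'(1,2) r(2)[unfolded f'(3)]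
    have "(\<phi> * t) v = 0" "(\<psi> * x) v \<noteq> 0" using f(2) x(2) loc_paramD(3)[OF t] by (auto simp: fun_apply)
    then show "f \<in> local_max_ideal n C P"
      unfolding local_max_ideal_iff[OF P] f(3) quot_mult[OF f(1) fr] using frac_mult[OF f(1) fr] by blast
  qed
qed

text \<open>
  Any uniformizer divides \<open>t / x\<close>, whose order is one, so its own order is at most one; it
  vanishes at \<open>P\<close>.
\<close>

lemma uniformizer_order:
  assumes P: "P \<in> C" "v \<in> P" and \<tau>: "uniformizer n C P \<tau>"
  shows "\<exists>d \<alpha> \<beta>. fraction d \<alpha> \<beta> \<and> \<alpha> \<noteq> 0 \<and> \<beta> v \<noteq> 0 \<and> ord v \<alpha> = 1 \<and> \<tau> = quot \<alpha> \<beta>"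
proof -
  have v: "v \<in> cone" using C_cone P by blast
  obtain t where t: "loc_param v t" using loc_param_ex[OF v] by blast
  obtain x where x: "x \<in> V 1" "x v = 1" "x \<noteq> 0" using unit_linear_ex[OF v] by blast
  have xv: "x v \<noteq> 0" using x by simp
  note U = uniformizer_loc_param[OF P t x(1) xv]
  have "\<tau> \<in> local_max_ideal n C P" using \<tau> unfolding uniformizer_def by (rule conjunct1)
  then obtain d \<alpha> \<beta> where \<alpha>: "fraction d \<alpha> \<beta>" "\<beta> v \<noteq> 0" "\<alpha> v = 0" "\<tau> = quot \<alpha> \<beta>"
    unfolding local_max_ideal_iff[OF P] by blast
  have "quot t x \<in> local_max_ideal n C P" using U(2) unfolding uniformizer_def by (rule conjunct1)
  also have "local_max_ideal n C P = (\<lambda>r. r \<otimes>\<^bsub>K\<^esub> \<tau>) ` local_ring n C P"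
    using \<tau> unfolding uniformizer_def by (rule conjunct2)
  finally have "quot t x \<in> (\<lambda>r. r \<otimes>\<^bsub>K\<^esub> \<tau>) ` local_ring n C P" .
  then obtain r where r: "r \<in> local_ring n C P" "quot t x = r \<otimes>\<^bsub>K\<^esub> \<tau>" by (rule imageE)
  obtain e \<rho> \<sigma> where \<rho>': "fraction e \<rho> \<sigma>" "\<sigma> v \<noteq> 0" "r = quot \<rho> \<sigma>"
    using r(1) unfolding local_ring_iff[OF P] by blast
  note \<rho> = \<rho>'(1,2) r(2)[unfolded \<rho>'(3) \<alpha>(4)]
  have aV: "\<alpha> \<in> V d" "\<beta> \<in> V d" "\<beta> \<noteq> 0" and rV: "\<rho> \<in> V e" "\<sigma> \<in> V e" "\<sigma> \<noteq> 0" using \<alpha> \<rho> by (auto simp: fraction_def)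
  have eq: "t * (\<sigma> * \<beta>) = (\<rho> * \<alpha>) * x"
    using \<rho>(3) unfolding quot_mult[OF \<rho>(1) \<alpha>(1)] quot_eq_iff[OF U(1) frac_mult[OF \<rho>(1) \<alpha>(1)]] .
  have tV: "t \<in> V 1" "t \<noteq> 0" using loc_paramD[OF t] by auto
  have sb: "\<sigma> * \<beta> \<in> V (e + d)" "\<sigma> * \<beta> \<noteq> 0" using V_mult[OF rV(2) aV(2)] V_mult_nonzero[OF rV(2) aV(2) rV(3) aV(3)] by auto
  have "t * (\<sigma> * \<beta>) \<noteq> 0" by (rule V_mult_nonzero[OF tV(1) sb(1) tV(2) sb(2)])
  then have "\<rho> \<noteq> 0" "\<alpha> \<noteq> 0" unfolding eq by auto
  have "ord v (t * (\<sigma> * \<beta>)) = 1"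
    using ord_mult[OF v tV sb] ord_mult[OF v rV(2,3) aV(2,3)] ord_loc_param[OF t]
      ord_nonvanishing[OF v rV(2) \<rho>(2)] ord_nonvanishing[OF v aV(2) \<alpha>(2)] by simp
  moreover have "ord v (\<rho> * \<alpha> * x) = ord v \<rho> + ord v \<alpha>"
    using ord_mult[OF v V_mult[OF rV(1) aV(1)] V_mult_nonzero[OF rV(1) aV(1) \<open>\<rho> \<noteq> 0\<close> \<open>\<alpha> \<noteq> 0\<close>] x(1,3)]
      ord_mult[OF v rV(1) \<open>\<rho> \<noteq> 0\<close> aV(1) \<open>\<alpha> \<noteq> 0\<close>] ord_nonvanishing[OF v x(1) xv] by simp
  moreover have "ord v \<alpha> > 0" by (rule ord_vanishing[OF v aV(1) \<open>\<alpha> \<noteq> 0\<close> \<alpha>(3)])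
  ultimately have "ord v \<alpha> = 1" unfolding eq by simp
  then show ?thesis using \<alpha> \<open>\<alpha> \<noteq> 0\<close> by blast
qed

text \<open>
  Existence comes from writing numerator and denominator as unit times power of the same local
  parameter, and uniqueness from comparing orders on the two sides.
\<close>

theorem point_order_quot:
  assumes P: "P \<in> C" "v \<in> P" and f: "fraction d \<phi> \<psi>" "\<phi> \<noteq> 0"
  shows "point_order n C P (quot \<phi> \<psi>) = int (ord v \<phi>) - int (ord v \<psi>)"
  unfolding point_order_def
proof (rule the_equality)
  have v: "v \<in> cone" using C_cone P by blast
  have fV: "\<phi> \<in> V d" "\<psi> \<in> V d" "\<psi> \<noteq> 0" using f(1) by (auto simp: fraction_def)
  obtain t where t: "loc_param v t" using loc_param_ex[OF v] by blast
  obtain x where x: "x \<in> V 1" "x v = 1" "x \<noteq> 0" using unit_linear_ex[OF v] by blast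
  have xv: "x v \<noteq> 0" using x by simp
  note U = uniformizer_loc_param[OF P t x(1) xv]
  define a where "a = ord v \<phi>"
  define b where "b = ord v \<psi>"
  obtain e1 f1 u1 \<phi>1 where 1: "u1 \<in> V e1" "u1 v \<noteq> 0" "\<phi>1 \<in> V f1" "\<phi>1 v \<noteq> 0" "d + e1 = a + f1" "u1 * \<phi> = t ^ a * \<phi>1"
    unfolding a_def using ord_exact[OF v t fV(1) f(2)] by (rule exact_orderE)
  obtain e2 f2 u2 \<psi>1 where 2: "u2 \<in> V e2" "u2 v \<noteq> 0" "\<psi>1 \<in> V f2" "\<psi>1 v \<noteq> 0" "d + e2 = b + f2" "u2 * \<psi> = t ^ b * \<psi>1"
    unfolding b_def using ord_exact[OF v t fV(2,3)] by (rule exact_orderE)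
  \<comment> \<open>Truncated subtraction: one of \<open>i\<close>, \<open>j\<close> is zero. The power of \<open>x\<close> equalises the degrees of
    the numerator and the denominator of the unit.\<close>
  define i where "i = a - b"
  define j where "j = b - a"
  define \<mu> where "\<mu> = \<phi>1 * u2 * x ^ i"
  define \<nu> where "\<nu> = \<psi>1 * u1 * x ^ j"
  have \<mu>v: "\<mu> v \<noteq> 0" "\<nu> v \<noteq> 0" using 1 2 x by (auto simp: \<mu>_def \<nu>_def fun_apply power_fun_apply)
  have \<mu>V: "\<mu> \<in> V (f1 + e2 + i * 1)" unfolding \<mu>_def by (intro V_mult V_power 1 2 x)
  have \<nu>V: "\<nu> \<in> V (f2 + e1 + j * 1)" unfolding \<nu>_def by (intro V_mult V_power 1 2 x)
  have "f2 + e1 + j * 1 = f1 + e2 + i * 1" using 1(5) 2(5) by (auto simp: i_def j_def)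
  then have fr: "fraction (f1 + e2 + i * 1) \<mu> \<nu>" unfolding fraction_def using \<mu>V \<nu>V \<mu>v(2) by (auto simp: fun_apply)
  have unit: "quot \<mu> \<nu> \<in> local_ring n C P - local_max_ideal n C P"
  proof
    show "quot \<mu> \<nu> \<in> local_ring n C P" unfolding local_ring_iff[OF P] using fr \<mu>v by blast
    show "quot \<mu> \<nu> \<notin> local_max_ideal n C P"
    proof
      assume "quot \<mu> \<nu> \<in> local_max_ideal n C P"
      then obtain e \<rho> \<sigma> where r: "fraction e \<rho> \<sigma>" "\<sigma> v \<noteq> 0" "\<rho> v = 0" "quot \<mu> \<nu> = quot \<rho> \<sigma>"
        unfolding local_max_ideal_iff[OF P] by blast
      have "\<mu> * \<sigma> = \<rho> * \<nu>" using r(4) unfolding quot_eq_iff[OF fr r(1)] .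
      then have "(\<mu> * \<sigma>) v = (\<rho> * \<nu>) v" by simp
      then show False using r \<mu>v by (simp add: fun_apply)
    qed
  qed
  have "quot \<phi> \<psi> = quot \<mu> \<nu> \<otimes>\<^bsub>K\<^esub> (quot t x [^]\<^bsub>K\<^esub> (int a - int b))"
  proof (cases "b \<le> a")
    case True
    have p: "quot t x [^]\<^bsub>K\<^esub> (int a - int b) = quot (t ^ i) (x ^ i)"
      unfolding quot_int_pow[OF U(1) loc_paramD(2)[OF t]] using True by (simp add: i_def nat_diff_distrib)
    have j0: "j = 0" "a = b + i" using True by (auto simp: i_def j_def)
    have "\<phi> * (\<nu> * x ^ i) = (u1 * \<phi>) * (\<psi>1 * x ^ i)" unfolding \<nu>_def j0(1) power_0 mult_1_right by (simp only: mult_ac)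
    also have "\<dots> = (t ^ b * \<psi>1) * (t ^ i * \<phi>1 * x ^ i)" unfolding 1(6) j0(2) power_add by (simp only: mult_ac)
    also have "\<dots> = \<mu> * t ^ i * \<psi>" unfolding 2(6)[symmetric] \<mu>_def by (simp only: mult_ac)
    finally show ?thesis
      unfolding p quot_mult[OF fr frac_power[OF U(1)]] quot_eq_iff[OF f(1) frac_mult[OF fr frac_power[OF U(1)]]] .
  next
    case False
    have p: "quot t x [^]\<^bsub>K\<^esub> (int a - int b) = quot (x ^ j) (t ^ j)"
      unfolding quot_int_pow[OF U(1) loc_paramD(2)[OF t]] using False by (simp add: j_def nat_diff_distrib)
    have fr': "fraction (j * 1) (x ^ j) (t ^ j)"
      using frac_power[OF frac_inv[OF U(1) loc_paramD(2)[OF t]], of j] .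
    have j0: "i = 0" "b = a + j" using False by (auto simp: i_def j_def)
    have "\<phi> * (\<nu> * t ^ j) = (u1 * \<phi>) * (\<psi>1 * x ^ j * t ^ j)" unfolding \<nu>_def by (simp only: mult_ac)
    also have "\<dots> = (t ^ b * \<psi>1) * (\<phi>1 * x ^ j)" unfolding 1(6) j0(2) power_add by (simp only: mult_ac)
    also have "\<dots> = \<mu> * x ^ j * \<psi>" unfolding 2(6)[symmetric] \<mu>_def j0(1) power_0 mult_1_right by (simp only: mult_ac)
    finally show ?thesis
      unfolding p quot_mult[OF fr fr'] quot_eq_iff[OF f(1) frac_mult[OF fr fr']] .
  qed
  then show "\<exists>t u. uniformizer n C P t \<and> u \<in> local_ring n C P - local_max_ideal n C P \<and>
       quot \<phi> \<psi> = u \<otimes>\<^bsub>K\<^esub> (t [^]\<^bsub>K\<^esub> (int (ord v \<phi>) - int (ord v \<psi>)))"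
    using U(2) unit unfolding a_def b_def by blast
  fix k :: int assume "\<exists>t u. uniformizer n C P t \<and> u \<in> local_ring n C P - local_max_ideal n C P \<and> quot \<phi> \<psi> = u \<otimes>\<^bsub>K\<^esub> (t [^]\<^bsub>K\<^esub> k)"
  then obtain \<tau> r where \<tau>: "uniformizer n C P \<tau>" and r: "r \<in> local_ring n C P" "r \<notin> local_max_ideal n C P"
    and eq: "quot \<phi> \<psi> = r \<otimes>\<^bsub>K\<^esub> (\<tau> [^]\<^bsub>K\<^esub> k)" by blast
  obtain e \<alpha> \<beta> where \<alpha>: "fraction e \<alpha> \<beta>" "\<alpha> \<noteq> 0" "\<beta> v \<noteq> 0" "ord v \<alpha> = 1" "\<tau> = quot \<alpha> \<beta>"
    using uniformizer_order[OF P \<tau>] by blast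
  obtain c \<rho> \<sigma> where \<rho>: "fraction c \<rho> \<sigma>" "\<sigma> v \<noteq> 0" "r = quot \<rho> \<sigma>" using r(1) unfolding local_ring_iff[OF P] by blast
  have \<rho>v: "\<rho> v \<noteq> 0" using r(2) \<rho> unfolding local_max_ideal_iff[OF P] by blast
  have aV: "\<alpha> \<in> V e" "\<beta> \<in> V e" "\<beta> \<noteq> 0" and rV: "\<rho> \<in> V c" "\<sigma> \<in> V c" "\<sigma> \<noteq> 0" "\<rho> \<noteq> 0"
    using \<alpha> \<rho> \<rho>v by (auto simp: fraction_def fun_apply)
  have o: "ord v \<beta> = 0" "ord v \<rho> = 0" "ord v \<sigma> = 0"
    using ord_nonvanishing[OF v aV(2) \<alpha>(3)] ord_nonvanishing[OF v rV(1) \<rho>v] ord_nonvanishing[OF v rV(2) \<rho>(2)] by auto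
  have o3: "ord v (A * (B * D ^ m)) = ord v A + ord v B + m * ord v D"
    if "A \<in> V a'" "A \<noteq> 0" "B \<in> V b'" "B \<noteq> 0" "D \<in> V d'" "D \<noteq> 0" for A B D a' b' d' m
    using ord_mult[OF v that(1,2) V_mult[OF that(3) V_power[OF that(5)]] V_mult_nonzero[OF that(3) V_power[OF that(5)] that(4) V_power_nonzero[OF that(5,6)]]]
      ord_mult[OF v that(3,4) V_power[OF that(5)] V_power_nonzero[OF that(5,6)]] ord_power[OF v that(5,6)] by simp
  show "k = int (ord v \<phi>) - int (ord v \<psi>)"
  proof (cases "k \<ge> 0")
    case True
    have "quot \<phi> \<psi> = quot (\<rho> * \<alpha> ^ nat k) (\<sigma> * \<beta> ^ nat k)"
      using eq True unfolding \<alpha>(5) \<rho>(3) quot_int_pow[OF \<alpha>(1,2)] quot_mult[OF \<rho>(1) frac_power[OF \<alpha>(1)], symmetric] by simp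
    then have "\<phi> * (\<sigma> * \<beta> ^ nat k) = \<rho> * \<alpha> ^ nat k * \<psi>"
      unfolding quot_eq_iff[OF f(1) frac_mult[OF \<rho>(1) frac_power[OF \<alpha>(1)]]] .
    also have "\<dots> = \<psi> * (\<rho> * \<alpha> ^ nat k)" by (simp only: mult_ac)
    finally have "ord v (\<phi> * (\<sigma> * \<beta> ^ nat k)) = ord v (\<psi> * (\<rho> * \<alpha> ^ nat k))" by simp
    then have "ord v \<phi> = ord v \<psi> + nat k"
      using o3[OF fV(1) f(2) rV(2,3) aV(2,3), of "nat k"] o3[OF fV(2,3) rV(1,4) aV(1) \<alpha>(2), of "nat k"] o \<alpha>(4) by simp
    then show ?thesis using True by simp
  next
    case False
    have fr': "fraction (nat (- k) * e) (\<beta> ^ nat (- k)) (\<alpha> ^ nat (- k))"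
      using frac_power[OF frac_inv[OF \<alpha>(1,2)]] .
    have "quot \<phi> \<psi> = quot (\<rho> * \<beta> ^ nat (- k)) (\<sigma> * \<alpha> ^ nat (- k))"
      using eq False unfolding \<alpha>(5) \<rho>(3) quot_int_pow[OF \<alpha>(1,2)] quot_mult[OF \<rho>(1) fr', symmetric] by simp
    then have "\<phi> * (\<sigma> * \<alpha> ^ nat (- k)) = \<rho> * \<beta> ^ nat (- k) * \<psi>"
      unfolding quot_eq_iff[OF f(1) frac_mult[OF \<rho>(1) fr']] .
    also have "\<dots> = \<psi> * (\<rho> * \<beta> ^ nat (- k))" by (simp only: mult_ac)
    finally have "ord v (\<phi> * (\<sigma> * \<alpha> ^ nat (- k))) = ord v (\<psi> * (\<rho> * \<beta> ^ nat (- k)))" by simp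
    then have "ord v \<phi> + nat (- k) = ord v \<psi>"
      using o3[OF fV(1) f(2) rV(2,3) aV(1) \<alpha>(2), of "nat (- k)"] o3[OF fV(2,3) rV(1,4) aV(2,3), of "nat (- k)"] o \<alpha>(4) by simp
    then show ?thesis using False by simp
  qed
qed

end

section \<open>Functions without poles\<close>

context smooth_variety_curve
begin

text \<open>A homogeneous ideal of the coordinate ring, given by its homogeneous parts.\<close>

definition homog_ideal :: "(nat \<Rightarrow> ((nat \<Rightarrow> 'k) \<Rightarrow> 'k) set) \<Rightarrow> bool" where
  "homog_ideal J \<longleftrightarrow> (\<forall>d. J d \<subseteq> V d \<and> 0 \<in> J d \<and> (\<forall>\<phi>\<in>J d. \<forall>\<psi>\<in>J d. \<phi> + \<psi> \<in> J d)) \<and>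
     (\<forall>d e. \<forall>\<phi>\<in>V d. \<forall>\<psi>\<in>J e. \<phi> * \<psi> \<in> J (d + e))"

text \<open>
  The homogeneous part of degree \<open>d\<close> of the ideal generated by \<open>J\<close> and the linear form \<open>l\<close>. In
  degree \<open>0\<close> nothing is added.
\<close>

definition adjoin where
  "adjoin J l d = {\<psi> + l * \<chi> |\<psi> \<chi>. \<psi> \<in> J d \<and> (\<chi> = 0 \<or> (\<exists>e. d = Suc e \<and> \<chi> \<in> V e))}"

lemma homog_idealD:
  assumes "homog_ideal J"
  shows "\<phi> \<in> J d \<Longrightarrow> \<phi> \<in> V d" "0 \<in> J d" "\<phi> \<in> J d \<Longrightarrow> \<psi> \<in> J d \<Longrightarrow> \<phi> + \<psi> \<in> J d"
    "\<phi> \<in> V e \<Longrightarrow> \<psi> \<in> J d \<Longrightarrow> \<phi> * \<psi> \<in> J (e + d)"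
  using assms unfolding homog_ideal_def by blast+

lemma homog_ideal_cst_mult: "homog_ideal J \<Longrightarrow> \<phi> \<in> J d \<Longrightarrow> cst c * \<phi> \<in> J d"
  using homog_idealD(4)[OF _ V_cst, of J \<phi> d c] by simp

lemma adjoin_subset: "homog_ideal J \<Longrightarrow> J d \<subseteq> adjoin J l d"
proof
  fix \<psi> assume "\<psi> \<in> J d"
  moreover have "\<psi> = \<psi> + l * 0" by simp
  ultimately show "\<psi> \<in> adjoin J l d" unfolding adjoin_def by blast
qed

lemma adjoin_mem: "homog_ideal J \<Longrightarrow> l \<in> adjoin J l 1"
proof -
  assume J: "homog_ideal J"
  have "l = 0 + l * 1" "1 = Suc 0" by simp_all
  then show ?thesis unfolding adjoin_def using V_1 homog_idealD(2)[OF J, of 1] by blast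
qed

lemma adjoin_ideal:
  assumes J: "homog_ideal J" and l: "l \<in> V 1"
  shows "homog_ideal (adjoin J l)"
  unfolding homog_ideal_def
proof (intro conjI allI ballI subsetI)
  fix d \<phi> assume "\<phi> \<in> adjoin J l d"
  then obtain \<psi> \<chi> where 1: "\<phi> = \<psi> + l * \<chi>" "\<psi> \<in> J d" "\<chi> = 0 \<or> (\<exists>e. d = Suc e \<and> \<chi> \<in> V e)"
    unfolding adjoin_def by blast
  have "l * \<chi> \<in> V d" using 1(3)
  proof
    assume "\<chi> = 0"
    then have "l * \<chi> = 0" by simp
    then show ?thesis by (simp only: V_0)
  next
    assume "\<exists>e. d = Suc e \<and> \<chi> \<in> V e"
    then show ?thesis using V_mult[OF l] by force
  qed
  then show "\<phi> \<in> V d" unfolding 1(1) using homog_idealD(1)[OF J 1(2)] by (intro V_add)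
next
  fix d show "0 \<in> adjoin J l d" using adjoin_subset[OF J] homog_idealD(2)[OF J] by blast
next
  fix d \<phi> \<phi>' assume "\<phi> \<in> adjoin J l d" "\<phi>' \<in> adjoin J l d"
  then obtain \<psi> \<chi> \<psi>' \<chi>' where 1: "\<phi> = \<psi> + l * \<chi>" "\<psi> \<in> J d" "\<chi> = 0 \<or> (\<exists>e. d = Suc e \<and> \<chi> \<in> V e)"
    and 2: "\<phi>' = \<psi>' + l * \<chi>'" "\<psi>' \<in> J d" "\<chi>' = 0 \<or> (\<exists>e. d = Suc e \<and> \<chi>' \<in> V e)"
    unfolding adjoin_def by blast
  have "\<phi> + \<phi>' = (\<psi> + \<psi>') + l * (\<chi> + \<chi>')" unfolding 1(1) 2(1) by (simp only: algebra_simps)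
  moreover have "\<chi> + \<chi>' = 0 \<or> (\<exists>e. d = Suc e \<and> \<chi> + \<chi>' \<in> V e)"
    using 1(3) 2(3) by (auto intro: V_add)
  ultimately show "\<phi> + \<phi>' \<in> adjoin J l d"
    unfolding adjoin_def using homog_idealD(3)[OF J 1(2) 2(2)] by blast
next
  fix d e \<phi> \<phi>' assume \<phi>: "\<phi> \<in> V d" and "\<phi>' \<in> adjoin J l e"
  then obtain \<psi> \<chi> where 1: "\<phi>' = \<psi> + l * \<chi>" "\<psi> \<in> J e" "\<chi> = 0 \<or> (\<exists>f. e = Suc f \<and> \<chi> \<in> V f)"
    unfolding adjoin_def by blast
  have "\<phi> * \<phi>' = \<phi> * \<psi> + l * (\<phi> * \<chi>)" unfolding 1(1) by (simp only: algebra_simps)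
  moreover have "\<phi> * \<chi> = 0 \<or> (\<exists>f. d + e = Suc f \<and> \<phi> * \<chi> \<in> V f)"
    using 1(3) V_mult[OF \<phi>] by auto
  ultimately show "\<phi> * \<phi>' \<in> adjoin J l (d + e)"
    unfolding adjoin_def using homog_idealD(4)[OF J \<phi> 1(2)] by blast
qed

text \<open>
  If a nonzero polynomial in \<open>l / x\<close> lies in \<open>J\<close>, then \<open>l - c x\<close> can be adjoined for some constant
  \<open>c\<close> without any power of \<open>x\<close> falling into the ideal. Otherwise the linear factors of the
  polynomial could be replaced one after the other by powers of \<open>x\<close>, until a power of \<open>x\<close> itself
  lay in \<open>J\<close>.
\<close>

lemma adjoin_root:
  assumes J: "homog_ideal J" and x: "x \<in> V 1" and l: "l \<in> V 1" and np: "\<And>N. x ^ N \<notin> J N"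
    and p: "p \<noteq> 0" "Polynomial.degree p \<le> N" "homog p N l x \<in> J N"
  shows "\<exists>c. \<forall>N. x ^ N \<notin> adjoin J (l - cst c * x) N"
proof (rule ccontr)
  assume "\<not> ?thesis"
  then obtain M where M: "\<And>c. x ^ M c \<in> adjoin J (l - cst c * x) (M c)" by metis
  have xp: "x ^ k \<in> V k" for k using V_power[OF x, of k] by simp
  have "\<exists>K. x ^ K \<in> J K"
    if "p \<noteq> 0" "Polynomial.degree p \<le> N" "homog p N l x * x ^ k \<in> J (N + k)" for p N k
    using that
  proof (induction "Polynomial.degree p" arbitrary: p N k)
    case 0
    then have h: "homog p N l x = cst (Polynomial.coeff p 0) * x ^ N" by (intro homog_const) simp
    have c0: "Polynomial.coeff p 0 \<noteq> 0" using 0 leading_coeff_0_iff[of p] by simp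
    have "cst (inverse (Polynomial.coeff p 0)) * (homog p N l x * x ^ k) \<in> J (N + k)"
      by (rule homog_ideal_cst_mult[OF J 0(4)])
    also have "cst (inverse (Polynomial.coeff p 0)) * (homog p N l x * x ^ k) = x ^ (N + k)"
      using c0 unfolding h power_add by (simp add: fun_eq_iff fun_apply)
    finally show ?case by blast
  next
    case (Suc D)
    then obtain c where "poly p c = 0" using alg_closed_imp_poly_has_root[of p] by auto
    then obtain q where q: "p = [:- c, 1:] * q" using poly_eq_0_iff_dvd[of p c] by (auto elim: dvdE)
    have "q \<noteq> 0" using q Suc by auto
    have degp: "Polynomial.degree p = Suc (Polynomial.degree q)"
      unfolding q using degree_mult_eq[of "[:- c, 1:]" q] \<open>q \<noteq> 0\<close> by simp
    obtain N' where N': "N = Suc N'" "Polynomial.degree q \<le> N'" using Suc.prems(2) degp by (cases N) auto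
    have h: "homog p N l x = (l - cst c * x) * homog q N' l x"
      unfolding q N'(1) by (rule homog_linear_factor[OF N'(2)])
    obtain \<psi> \<chi> where 1: "x ^ M c = \<psi> + (l - cst c * x) * \<chi>" "\<psi> \<in> J (M c)" "\<chi> = 0 \<or> (\<exists>e. M c = Suc e \<and> \<chi> \<in> V e)"
      using M[of c] unfolding adjoin_def by blast
    have hq: "homog q N' l x * x ^ k \<in> V (N' + k)" by (intro V_mult homog_V l x xp)
    have "homog q N' l x * x ^ (M c + k) = (homog q N' l x * x ^ k) * \<psi> + \<chi> * (homog p N l x * x ^ k)"
      unfolding power_add 1(1) h by (simp only: algebra_simps)
    moreover have "\<chi> * (homog p N l x * x ^ k) \<in> J (N' + (M c + k))" using 1(3)
    proof
      assume "\<chi> = 0"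
      then have "\<chi> * (homog p N l x * x ^ k) = 0" by simp
      then show ?thesis by (simp only: homog_idealD(2)[OF J])
    next
      assume "\<exists>e. M c = Suc e \<and> \<chi> \<in> V e"
      then obtain e where e: "M c = Suc e" "\<chi> \<in> V e" by blast
      have "e + (N + k) = N' + (M c + k)" using e N' by simp
      then show ?thesis using homog_idealD(4)[OF J e(2) Suc.prems(3)] by (simp only:)
    qed
    moreover have "(homog q N' l x * x ^ k) * \<psi> \<in> J (N' + (M c + k))"
    proof -
      have "N' + k + M c = N' + (M c + k)" by simp
      then show ?thesis using homog_idealD(4)[OF J hq 1(2)] by (simp only:)
    qed
    ultimately have "homog q N' l x * x ^ (M c + k) \<in> J (N' + (M c + k))"
      using homog_idealD(3)[OF J] by (simp only:)
    then show ?case using Suc.hyps(1)[of q N' "M c + k"] Suc.hyps(2) degp \<open>q \<noteq> 0\<close> N'(2) by simp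
  qed
  from this[of p N 0] show False using p np by simp
qed

text \<open>
  The case of the Nullstellensatz that is needed, for ideals containing a nonzero element of the
  coordinate ring of a curve. Then \<open>divides_homog\<close> puts a nonzero polynomial in \<open>X\<^sub>j / x\<close> into the
  ideal for each \<open>j\<close>, and by \<open>adjoin_root\<close> one may adjoin \<open>X\<^sub>j - c\<^sub>j x\<close> for all \<open>j\<close>. Modulo the
  resulting ideal every form is its value at \<open>c\<close> times a power of \<open>x\<close>, which makes \<open>c\<close> a common
  zero.
\<close>

theorem nullstellensatz:
  assumes J: "homog_ideal J" and a: "a \<in> J d" "a \<noteq> 0" and x: "x \<in> V 1" "x \<noteq> 0" and np: "\<And>N. x ^ N \<notin> J N"
  shows "\<exists>v\<in>cone. \<forall>d. \<forall>\<phi>\<in>J d. \<phi> v = 0"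
proof -
  have step: "\<exists>c J'. homog_ideal J' \<and> (\<forall>d. J d \<subseteq> J' d) \<and> (\<forall>N. x ^ N \<notin> J' N) \<and> (\<forall>j<m. Xc j - cst (c j) * x \<in> J' 1)"
    if "m \<le> Suc n" for m
    using that
  proof (induction m)
    case 0
    show ?case using J np by (intro exI[of _ "\<lambda>_. 0"] exI[of _ J]) auto
  next
    case (Suc m)
    then obtain c J' where J': "homog_ideal J'" "\<forall>d. J d \<subseteq> J' d" "\<forall>N. x ^ N \<notin> J' N" and c: "\<forall>j<m. Xc j - cst (c j) * x \<in> J' 1"
      using Suc_leD by blast
    have Xm: "Xc m \<in> V 1" using V_X[of m] Suc.prems by simp
    have aV: "a \<in> V d" by (rule homog_idealD(1)[OF J a(1)])
    obtain p e w where p: "p \<noteq> 0" "Polynomial.degree p \<le> d + e" "w \<in> V e" "homog p (d + e) (Xc m) x = a * w"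
      using divides_homog[OF aV a(2) x Xm] by blast
    have "w * a \<in> J (e + d)" by (rule homog_idealD(4)[OF J p(3) a(1)])
    then have "a * w \<in> J (d + e)" by (simp only: mult.commute add.commute)
    then have "homog p (d + e) (Xc m) x \<in> J' (d + e)"
      unfolding p(4) using J'(2) by blast
    then obtain c' where c': "\<forall>N. x ^ N \<notin> adjoin J' (Xc m - cst c' * x) N"
      using adjoin_root[OF J'(1) x(1) Xm _ p(1,2)] J'(3) by blast
    define J2 where "J2 = adjoin J' (Xc m - cst c' * x)"
    have "Xc m - cst c' * x \<in> V 1" by (intro V_diff V_cst_mult Xm x)
    then have "homog_ideal J2" unfolding J2_def by (rule adjoin_ideal[OF J'(1)])
    moreover have sub: "J' d \<subseteq> J2 d" for d unfolding J2_def by (rule adjoin_subset[OF J'(1)])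
    then have "\<forall>d. J d \<subseteq> J2 d" using J'(2) by blast
    moreover have "\<forall>N. x ^ N \<notin> J2 N" using c' unfolding J2_def .
    moreover have "Xc j - cst ((c(m := c')) j) * x \<in> J2 1" if "j < Suc m" for j
    proof (cases "j = m")
      case True
      then show ?thesis unfolding J2_def using adjoin_mem[OF J'(1)] by simp
    next
      case False
      then have "Xc j - cst (c j) * x \<in> J' 1" using c that by simp
      then show ?thesis using sub False by auto
    qed
    ultimately show ?case by blast
  qed
  obtain c J' where J': "homog_ideal J'" "\<forall>d. J d \<subseteq> J' d" "\<forall>N. x ^ N \<notin> J' N"
    and c: "\<forall>j<Suc n. Xc j - cst (c j) * x \<in> J' 1"
    using step[OF order_refl] by blast
  define w where "w j = (if j \<le> n then c j else 0)" for j
  have w: "Xc j - cst (w j) * x \<in> J' 1" if "j \<le> n" for j using c that by (simp add: w_def)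
  have xp: "x ^ k \<in> V k" for k using V_power[OF x(1), of k] by simp
  have mon: "Ev (Poly_Mapping.single m 1) - cst (monom_eval w m) * x ^ d \<in> J' d" if "monom_deg n d m" for m d
    using that
  proof (induction rule: monom_deg_induct)
    case zero
    show ?case using homog_idealD(2)[OF J'(1), of 0] by simp
  next
    case (Suc d m j)
    have E: "Ev (Poly_Mapping.single (m + Poly_Mapping.single j 1) 1) = Ev (Poly_Mapping.single m 1) * Xc j"
      unfolding Xc_def pvar_def Ev_mult[symmetric] mult_single by simp
    have "Ev (Poly_Mapping.single (m + Poly_Mapping.single j 1) 1) - cst (monom_eval w (m + Poly_Mapping.single j 1)) * x ^ Suc d
      = Ev (Poly_Mapping.single m 1) * (Xc j - cst (w j) * x) +
        (cst (w j) * x) * (Ev (Poly_Mapping.single m 1) - cst (monom_eval w m) * x ^ d)"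
      unfolding E monom_eval_add monom_eval_var cst_mult power_Suc by (simp only: algebra_simps)
    moreover have "Ev (Poly_Mapping.single m 1) * (Xc j - cst (w j) * x) \<in> J' (d + 1)"
      by (rule homog_idealD(4)[OF J'(1) VI[OF form_single[OF Suc.hyps(1)]] w[OF Suc.hyps(2)]])
    moreover have "(cst (w j) * x) * (Ev (Poly_Mapping.single m 1) - cst (monom_eval w m) * x ^ d) \<in> J' (1 + d)"
      by (rule homog_idealD(4)[OF J'(1) V_cst_mult[OF x(1)] Suc.IH])
    ultimately show ?case using homog_idealD(3)[OF J'(1), of _ "Suc d"] by simp
  qed
  have ev: "Ev p - cst (mpoly_eval w p) * x ^ d \<in> J' d" if "form n d p" for p d
    using that
  proof (induction rule: form_induct)
    case zero
    show ?case using homog_idealD(2)[OF J'(1), of d] by simp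
  next
    case (single m c)
    have "Ev (Poly_Mapping.single m c) = cst c * Ev (Poly_Mapping.single m 1)"
      by (simp add: mult_single flip: Ev_cst Ev_mult)
    then have "Ev (Poly_Mapping.single m c) - cst (mpoly_eval w (Poly_Mapping.single m c)) * x ^ d
      = cst c * (Ev (Poly_Mapping.single m 1) - cst (monom_eval w m) * x ^ d)"
      unfolding mpoly_eval_single cst_mult by (simp only: algebra_simps)
    then show ?case using homog_ideal_cst_mult[OF J'(1) mon[OF single], of c] by (simp only:)
  next
    case (add p q)
    have "Ev (p + q) - cst (mpoly_eval w (p + q)) * x ^ d =
      (Ev p - cst (mpoly_eval w p) * x ^ d) + (Ev q - cst (mpoly_eval w q) * x ^ d)"
      unfolding Ev_add mpoly_eval_add cst_add by (simp only: algebra_simps)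
    then show ?case using homog_idealD(3)[OF J'(1) add] by (simp only:)
  qed
  have van: "mpoly_eval w p = 0" if p: "form n d p" "Ev p \<in> J' d" for p d
  proof (rule ccontr)
    assume nz: "mpoly_eval w p \<noteq> 0"
    have "Ev p + cst (- 1) * (Ev p - cst (mpoly_eval w p) * x ^ d) \<in> J' d"
      by (intro homog_idealD(3)[OF J'(1)] p homog_ideal_cst_mult[OF J'(1)] ev)
    then have "cst (inverse (mpoly_eval w p)) * (Ev p + cst (- 1) * (Ev p - cst (mpoly_eval w p) * x ^ d)) \<in> J' d"
      by (rule homog_ideal_cst_mult[OF J'(1)])
    also have "cst (inverse (mpoly_eval w p)) * (Ev p + cst (- 1) * (Ev p - cst (mpoly_eval w p) * x ^ d)) = x ^ d"
      using nz by (simp add: fun_eq_iff fun_apply)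
    finally show False using J'(3) by blast
  qed
  obtain px where px: "form n 1 px" "x = Ev px" using VE[OF x(1)] by blast
  have "w \<noteq> (\<lambda>_. 0)"
  proof
    assume w0: "w = (\<lambda>_. 0)"
    have "mpoly_eval w px = 0" using form_eval_scale[OF px(1), of 0 w] unfolding w0 by simp
    then have "x ^ 1 \<in> J' 1" using ev[OF px(1)] px(2) by simp
    then show False using J'(3) by blast
  qed
  then have w0: "\<exists>i. w i \<noteq> 0" by (auto simp: fun_eq_iff)
  have "w \<in> cone"
  proof (rule cone_memI[OF _ w0])
    show "\<forall>i>n. w i = 0" by (simp add: w_def)
    fix p d assume "form n d p" "Ev p = 0"
    then show "mpoly_eval w p = 0" using van[of d p] homog_idealD(2)[OF J'(1), of d] by simp
  qed
  moreover have "\<phi> w = 0" if \<phi>: "\<phi> \<in> J d" for \<phi> d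
  proof -
    obtain p where p: "form n d p" "\<phi> = Ev p" using VE[OF homog_idealD(1)[OF J \<phi>]] by blast
    then have "mpoly_eval w p = 0" using van[OF p(1)] J'(2) \<phi> by blast
    then show ?thesis using p \<open>w \<in> cone\<close> by (simp add: Ev_apply)
  qed
  ultimately show ?thesis by blast
qed

lemma finite_monomials: "finite {m. monom_deg n d m}"
proof -
  let ?B = "{f. \<forall>x. (x \<in> {..n} \<longrightarrow> f x \<in> {..d}) \<and> (x \<notin> {..n} \<longrightarrow> f x = (0::nat))}"
  have finB: "finite ?B" by (rule finite_set_of_finite_funs) auto
  have sub: "Poly_Mapping.lookup ` {m. monom_deg n d m} \<subseteq> ?B"
  proof -
    have "Poly_Mapping.lookup m x \<le> d" if m: "monom_deg n d m" for m x
    proof (cases "x \<in> Poly_Mapping.keys m")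
      case True
      then have "Poly_Mapping.lookup m x \<le> (\<Sum>i\<in>Poly_Mapping.keys m. Poly_Mapping.lookup m i)"
        by (intro member_le_sum) auto
      then show ?thesis using m by (simp add: monom_deg_def)
    qed (simp add: in_keys_iff)
    moreover have "Poly_Mapping.lookup m x = 0" if "monom_deg n d m" "x \<notin> {..n}" for m x
      using that unfolding monom_deg_def by (metis in_keys_iff subsetD)
    ultimately show ?thesis by auto
  qed
  have "inj_on Poly_Mapping.lookup {m. monom_deg n d m}" by (auto intro!: inj_onI poly_mapping_eqI)
  then show ?thesis by (rule finite_imageD[OF finite_subset[OF sub finB]])
qed

lemma V_finite_dim: "\<exists>S. finite S \<and> V d \<subseteq> lin_span S"
proof -
  let ?S = "(\<lambda>m. Ev (Poly_Mapping.single m 1)) ` {m. monom_deg n d m}"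
  have fin: "finite ?S" using finite_monomials by blast
  have "\<phi> \<in> lin_span ?S" if "\<phi> \<in> V d" for \<phi>
    using that
  proof (induction rule: V_induct)
    case zero
    show ?case by (rule lin_span_0)
  next
    case (monom m c)
    then show ?case by (intro lin_span_scale lin_span_base fin) blast
  next
    case (add \<phi> \<psi>)
    then show ?case by (rule lin_span_add)
  qed
  then show ?thesis using fin by blast
qed

text \<open>
  A monomial of degree larger than the sum of the \<open>N i\<close> is divisible by some \<open>X\<^sub>i\<close> to the power
  \<open>N i\<close>.
\<close>

lemma contains_all_forms:
  assumes J: "homog_ideal J" and N: "\<And>i. i \<le> n \<Longrightarrow> Xc i ^ N i \<in> J (N i)"
  shows "\<exists>M. V M \<subseteq> J M"
proof -
  define M where "M = Suc (\<Sum>i\<le>n. N i)"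
  have mon: "Ev (Poly_Mapping.single m 1) \<in> J M" if m: "monom_deg n M m" for m
  proof -
    have "\<exists>i\<le>n. N i \<le> Poly_Mapping.lookup m i"
    proof (rule ccontr)
      assume "\<not> ?thesis"
      then have less: "Poly_Mapping.lookup m i \<le> N i" if "i \<le> n" for i using that by force
      have "M = (\<Sum>i\<in>Poly_Mapping.keys m. Poly_Mapping.lookup m i)" using m by (simp add: monom_deg_def)
      also have "\<dots> = (\<Sum>i\<le>n. Poly_Mapping.lookup m i)"
        using m by (intro sum.mono_neutral_left) (auto simp: monom_deg_def in_keys_iff)
      also have "\<dots> \<le> (\<Sum>i\<le>n. N i)" by (rule sum_mono) (use less in simp)
      finally show False by (simp add: M_def)
    qed
    then obtain i where i: "i \<le> n" "N i \<le> Poly_Mapping.lookup m i" by blast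
    define m' where "m' = m - Poly_Mapping.single i (N i)"
    have mm': "m = m' + Poly_Mapping.single i (N i)"
      using i(2) by (intro poly_mapping_eqI) (auto simp: m'_def lookup_add lookup_minus lookup_single when_def)
    have "Poly_Mapping.keys m' \<subseteq> {..n}"
      using m by (auto simp: m'_def monom_deg_def in_keys_iff lookup_minus subset_iff)
    then obtain d' where d': "monom_deg n d' m'" by (auto simp: monom_deg_def)
    have "monom_deg n (N i) (Poly_Mapping.single i (N i))" using i by (simp add: monom_deg_def)
    then have "monom_deg n (d' + N i) m" unfolding mm' by (rule monom_deg_add[OF d'])
    then have M: "d' + N i = M" using m by (simp add: monom_deg_def)
    have pw: "Poly_Mapping.single (Poly_Mapping.single i k) 1 = (pvar i ^ k :: 'k mpoly)" for k
    proof (induction k)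
      case (Suc k)
      have "Poly_Mapping.single i (Suc k) = Poly_Mapping.single i 1 + Poly_Mapping.single i k"
        by (simp flip: single_add)
      then have "Poly_Mapping.single (Poly_Mapping.single i (Suc k)) 1 = pvar i * (Poly_Mapping.single (Poly_Mapping.single i k) 1 :: 'k mpoly)"
        unfolding pvar_def mult_single by simp
      then show ?case unfolding Suc power_Suc .
    qed simp
    have "Poly_Mapping.single m (1::'k) = Poly_Mapping.single m' 1 * Poly_Mapping.single (Poly_Mapping.single i (N i)) 1"
      unfolding mult_single mm'[symmetric] by simp
    then have "Ev (Poly_Mapping.single m 1) = Ev (Poly_Mapping.single m' 1) * Xc i ^ N i"
      unfolding pw by (simp only: Ev_mult Ev_power Xc_def)
    moreover have "Ev (Poly_Mapping.single m' 1) * Xc i ^ N i \<in> J (d' + N i)"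
      by (rule homog_idealD(4)[OF J VI[OF form_single[OF d']] N[OF i(1)]])
    ultimately show ?thesis unfolding M by (simp only:)
  qed
  have "\<phi> \<in> J M" if "\<phi> \<in> V M" for \<phi>
    using that
  proof (induction rule: V_induct)
    case zero
    show ?case by (rule homog_idealD(2)[OF J])
  next
    case (monom m c)
    show ?case by (rule homog_ideal_cst_mult[OF J mon[OF monom]])
  next
    case (add \<phi> \<psi>)
    then show ?case by (rule homog_idealD(3)[OF J])
  qed
  then show ?thesis by blast
qed

text \<open>
  A regular function on a projective curve is constant, in the form that such a function with a
  zero is \<open>0\<close>. Let \<open>J\<close> be the ideal of all \<open>u\<close> for which \<open>u g / h\<close> is again a form. By regularity
  it has no common zero, so by \<open>nullstellensatz\<close> it contains powers of all coordinates, and hence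
  all forms of some degree \<open>M\<close>. Multiplication by \<open>g / h\<close> thus maps the finite-dimensional space
  \<open>V M\<close> to itself, and \<open>g / h\<close> satisfies a polynomial equation with constant coefficients. The
  lowest term of that equation, after cancelling a power of \<open>g\<close>, is a nonzero constant, but every
  other term vanishes at \<open>w\<close>.
\<close>

theorem no_poles_imp_zero:
  assumes g: "g \<in> V d" and h: "h \<in> V d" "h \<noteq> 0"
    and reg: "\<And>v. v \<in> cone \<Longrightarrow> ord_ge v (ord v h) g"
    and w: "w \<in> cone" "ord_ge w (Suc (ord w h)) g"
  shows "g = 0"
proof (rule ccontr)
  assume g0: "g \<noteq> 0"
  define J where "J e = {u \<in> V e. \<exists>\<psi>\<in>V e. u * g = \<psi> * h}" for e
  have J: "homog_ideal J"
    unfolding homog_ideal_def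
  proof (intro conjI allI ballI subsetI)
    fix e show "0 \<in> J e" unfolding J_def by (auto intro!: bexI[of _ 0])
  next
    fix e \<phi> \<psi> assume "\<phi> \<in> J e" "\<psi> \<in> J e"
    then obtain a b where 1: "\<phi> \<in> V e" "a \<in> V e" "\<phi> * g = a * h" and 2: "\<psi> \<in> V e" "b \<in> V e" "\<psi> * g = b * h"
      unfolding J_def by blast
    have "(\<phi> + \<psi>) * g = (a + b) * h" unfolding distrib_right 1(3) 2(3) ..
    then show "\<phi> + \<psi> \<in> J e" unfolding J_def using V_add[OF 1(1) 2(1)] V_add[OF 1(2) 2(2)] by blast
  next
    fix d e \<phi> \<psi> assume \<phi>: "\<phi> \<in> V d" and "\<psi> \<in> J e"
    then obtain b where 2: "\<psi> \<in> V e" "b \<in> V e" "\<psi> * g = b * h" unfolding J_def by blast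
    have "\<phi> * \<psi> * g = \<phi> * b * h" unfolding mult.assoc 2(3) ..
    then show "\<phi> * \<psi> \<in> J (d + e)" unfolding J_def using V_mult[OF \<phi> 2(1)] V_mult[OF \<phi> 2(2)] by blast
  qed (simp add: J_def)
  have hJ: "h \<in> J d" unfolding J_def using g h mult.commute[of h g] by blast
  have unit: "\<exists>e. \<exists>u\<in>J e. u v \<noteq> 0" if v: "v \<in> cone" for v
  proof -
    obtain t where t: "loc_param v t" using loc_param_ex[OF v] by blast
    obtain e1 f1 u1 \<psi>1 where 1: "u1 \<in> V e1" "u1 v \<noteq> 0" "\<psi>1 \<in> V f1" "d + e1 = ord v h + f1" "u1 * g = t ^ ord v h * \<psi>1"
      using reg[OF v] unfolding ord_ge_iff[OF v t g] by (rule loc_dvdE)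
    obtain e2 f2 u2 \<psi>2 where 2: "u2 \<in> V e2" "u2 v \<noteq> 0" "\<psi>2 \<in> V f2" "\<psi>2 v \<noteq> 0" "d + e2 = ord v h + f2" "u2 * h = t ^ ord v h * \<psi>2"
      using ord_exact[OF v t h] by (rule exact_orderE)
    have "u1 * \<psi>2 * g = (u1 * g) * \<psi>2" by (simp only: mult_ac)
    also have "\<dots> = \<psi>1 * (t ^ ord v h * \<psi>2)" unfolding 1(5) by (simp only: mult_ac)
    also have "\<dots> = \<psi>1 * u2 * h" unfolding 2(6)[symmetric] by (simp only: mult_ac)
    finally have "u1 * \<psi>2 * g = \<psi>1 * u2 * h" .
    moreover have "u1 * \<psi>2 \<in> V (e1 + f2)" "\<psi>1 * u2 \<in> V (f1 + e2)" by (intro V_mult 1 2)+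
    moreover have "f1 + e2 = e1 + f2" using 1(4) 2(5) by simp
    ultimately have "u1 * \<psi>2 \<in> J (e1 + f2)" unfolding J_def by auto
    moreover have "(u1 * \<psi>2) v \<noteq> 0" using 1 2 by (simp add: fun_apply)
    ultimately show ?thesis by blast
  qed
  have "\<exists>N. Xc i ^ N \<in> J N" if i: "i \<le> n" for i
  proof (cases "Xc i = 0")
    case True
    then have "Xc i ^ 1 \<in> J 1" using homog_idealD(2)[OF J, of 1] by simp
    then show ?thesis by blast
  next
    case False
    show ?thesis
    proof (rule ccontr)
      assume "\<not> ?thesis"
      then have "\<And>N. Xc i ^ N \<notin> J N" by blast
      from nullstellensatz[OF J hJ h(2) V_X[OF i] False this] show False using unit by blast
    qed
  qed
  then obtain N where "\<And>i. i \<le> n \<Longrightarrow> Xc i ^ N i \<in> J (N i)" by metis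
  from contains_all_forms[OF J this] obtain M where M: "V M \<subseteq> J M" by blast
  have "\<exists>\<psi>. \<psi> \<in> V M \<and> \<phi> * g = \<psi> * h" if "\<phi> \<in> V M" for \<phi> using M that unfolding J_def by blast
  then obtain F where F: "\<And>\<phi>. \<phi> \<in> V M \<Longrightarrow> F \<phi> \<in> V M \<and> \<phi> * g = F \<phi> * h" by metis
  obtain x where x: "x \<in> V 1" "x \<noteq> 0" using unit_linear_ex[OF w(1)] by blast
  \<comment> \<open>The forms \<open>x\<^sup>M (g / h)\<^sup>k\<close>, all of degree \<open>M\<close>.\<close>
  define \<psi> where "\<psi> k = (F ^^ k) (x ^ M)" for k
  have \<psi>V: "\<psi> k \<in> V M" for k
    by (induction k) (use V_power[OF x(1), of M] F in \<open>auto simp: \<psi>_def\<close>)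
  have \<psi>_eq: "h ^ k * \<psi> k = g ^ k * x ^ M" for k
  proof (induction k)
    case 0
    show ?case by (simp add: \<psi>_def)
  next
    case (Suc k)
    have "\<psi> (Suc k) * h = \<psi> k * g" using F[OF \<psi>V[of k]] by (simp add: \<psi>_def)
    moreover have "h ^ Suc k * \<psi> (Suc k) = h ^ k * (\<psi> (Suc k) * h)" by (simp only: power_Suc mult_ac)
    ultimately have "h ^ Suc k * \<psi> (Suc k) = (h ^ k * \<psi> k) * g" by (simp only: mult.assoc)
    then show ?case unfolding Suc by (simp only: power_Suc mult_ac)
  qed
  obtain S where S: "finite S" "V M \<subseteq> lin_span S" using V_finite_dim by blast
  define r where "r = card S"
  have "\<psi> ` {..r} \<subseteq> lin_span S" using \<psi>V S(2) by blast
  then have "\<not> indep_family {..r} \<psi>"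
    using indep_family_card_le[OF S(1), of "{..r}" \<psi>] by (auto simp: r_def)
  then obtain c where c: "(\<Sum>k\<le>r. cst (c k) * \<psi> k) = 0" "\<exists>k\<le>r. c k \<noteq> 0"
    unfolding indep_family_def by auto
  define k0 where "k0 = (LEAST k. k \<le> r \<and> c k \<noteq> 0)"
  have k0: "k0 \<le> r" "c k0 \<noteq> 0"
    using LeastI_ex[of "\<lambda>k. k \<le> r \<and> c k \<noteq> 0"] c(2) unfolding k0_def by blast+
  have below: "c k = 0" if "k < k0" for k
    using not_less_Least[of k "\<lambda>k. k \<le> r \<and> c k \<noteq> 0"] that k0(1) unfolding k0_def by fastforce
  define T where "T k = cst (c k) * (h ^ (r - k) * g ^ (k - k0))" for k
  have TV: "T k \<in> V ((r - k0) * d)" if "k0 \<le> k" "k \<le> r" for k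
  proof -
    have "T k \<in> V ((r - k) * d + (k - k0) * d)" unfolding T_def by (intro V_cst_mult V_mult V_power g h)
    moreover have "(r - k) * d + (k - k0) * d = (r - k0) * d" using that by (simp flip: add_mult_distrib)
    ultimately show ?thesis by simp
  qed
  have "0 = h ^ r * (\<Sum>k\<le>r. cst (c k) * \<psi> k)" unfolding c(1) by simp
  also have "\<dots> = (\<Sum>k\<le>r. cst (c k) * (h ^ r * \<psi> k))" unfolding sum_distrib_left by (simp only: mult_ac)
  also have "\<dots> = (\<Sum>k\<in>{k0..r}. cst (c k) * (h ^ r * \<psi> k))"
    using k0 below by (intro sum.mono_neutral_right) auto
  also have "\<dots> = (\<Sum>k\<in>{k0..r}. (x ^ M * g ^ k0) * T k)"
  proof (intro sum.cong refl)
    fix k assume k: "k \<in> {k0..r}"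
    have "h ^ r = h ^ (r - k) * h ^ k" using k by (simp flip: power_add)
    then have "h ^ r * \<psi> k = h ^ (r - k) * (h ^ k * \<psi> k)" by (simp only: mult.assoc)
    moreover have "g ^ k = g ^ k0 * g ^ (k - k0)" using k by (simp flip: power_add)
    ultimately show "cst (c k) * (h ^ r * \<psi> k) = (x ^ M * g ^ k0) * T k"
      unfolding T_def \<psi>_eq by (simp only: mult_ac)
  qed
  finally have "(x ^ M * g ^ k0) * (\<Sum>k\<in>{k0..r}. T k) = 0" by (simp add: sum_distrib_left)
  moreover have "(\<Sum>k\<in>{k0..r}. T k) \<in> V ((r - k0) * d)" by (intro V_sum TV) auto
  moreover have "x ^ M * g ^ k0 \<in> V (M * 1 + k0 * d)" "x ^ M * g ^ k0 \<noteq> 0"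
    using V_mult_nonzero[OF V_power[OF x(1)] V_power[OF g] V_power_nonzero[OF x] V_power_nonzero[OF g g0]]
    by (intro V_mult V_power x g, blast)
  ultimately have "(\<Sum>k\<in>{k0..r}. T k) = 0" using V_domain by blast
  then have "T k0 + (\<Sum>k\<in>{Suc k0..r}. T k) = 0" using k0(1) by (simp add: sum.atLeast_Suc_atMost)
  then have T0: "T k0 = cst (- 1) * (\<Sum>k\<in>{Suc k0..r}. T k)"
    by (simp add: eq_neg_iff_add_eq_0 cst_uminus)
  define A where "A = (r - k0) * ord w h"
  have hp: "ord_ge w (m * ord w h) (h ^ m)" for m
    using ord_power[OF w(1) h, of m] by (simp add: ord_ge_def)
  have gp: "ord_ge w (m * Suc (ord w h)) (g ^ m)" for m
    using ord_power[OF w(1) g g0, of m] w(2) g0 by (simp add: ord_ge_def del: mult_Suc_right)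
  have "ord_ge w (Suc A) (T k)" if k: "k \<in> {Suc k0..r}" for k
  proof -
    have "ord_ge w ((r - k) * ord w h + (k - k0) * Suc (ord w h)) (T k)"
      unfolding T_def
      by (rule ord_ge_cst_mult[OF w(1) V_mult[OF V_power[OF h(1)] V_power[OF g]] ord_ge_mult[OF w(1) V_power[OF h(1)] V_power[OF g] hp gp]])
    moreover have "Suc A \<le> (r - k) * ord w h + (k - k0) * Suc (ord w h)"
    proof -
      have "r - k0 = (r - k) + (k - k0)" using k by auto
      then have "(r - k) * ord w h + (k - k0) * Suc (ord w h) = A + (k - k0)"
        by (simp add: A_def add_mult_distrib)
      then show ?thesis using k by auto
    qed
    ultimately show ?thesis by (rule ord_ge_mono)
  qed
  then have "ord_ge w (Suc A) (\<Sum>k\<in>{Suc k0..r}. T k)"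
    by (intro ord_ge_sum[OF w(1), of _ _ "(r - k0) * d"] TV) auto
  then have "ord_ge w (Suc A) (T k0)"
    unfolding T0 by (intro ord_ge_cst_mult[OF w(1), of _ "(r - k0) * d"] V_sum TV) auto
  moreover have "T k0 = cst (c k0) * h ^ (r - k0)" by (simp add: T_def)
  ultimately show False
    using ord_cst_mult[OF w(1) V_power[OF h(1)] V_power_nonzero[OF h] k0(2), of "r - k0"] ord_power[OF w(1) h, of "r - k0"]
    by (simp add: ord_ge_def A_def)
qed

end

section \<open>Functions with a single pole\<close>

context smooth_variety_curve
begin

definition rep :: "'k proj_point \<Rightarrow> nat \<Rightarrow> 'k" where "rep P = (SOME v. v \<in> P)"

lemma rep_in: "P \<in> C \<Longrightarrow> rep P \<in> P"
  unfolding rep_def using C_rep someI_ex by metis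

lemma rep_cone: "P \<in> C \<Longrightarrow> rep P \<in> cone"
  using rep_in C_cone by blast

lemma rep_point_of: "P \<in> C \<Longrightarrow> point_of (rep P) = P"
  using C_eq_point_of rep_in by metis

abbreviation ordp where "ordp P \<phi> \<equiv> ord (rep P) \<phi>"
abbreviation ordp_ge where "ordp_ge P m \<phi> \<equiv> ord_ge (rep P) m \<phi>"

lemma ord_eq_ordp:
  assumes "P \<in> C" "v \<in> P" "\<phi> \<in> V d" "\<phi> \<noteq> 0"
  shows "ord v \<phi> = ordp P \<phi>"
proof -
  have "v \<in> point_of (rep P)" using assms rep_point_of by blast
  then obtain c where c: "c \<noteq> 0" "v = (\<lambda>i. c * rep P i)" by (auto simp: point_of_def)
  show ?thesis unfolding c(2) by (rule ord_scale[OF rep_cone[OF assms(1)] c(1) assms(3,4)])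
qed

lemma ord_add_dominant:
  assumes v: "v \<in> cone" and \<phi>: "\<phi> \<in> V d" "ord_ge v (Suc (ord v \<psi>)) \<phi>" and \<psi>: "\<psi> \<in> V d" "\<psi> \<noteq> 0"
  shows "ord v (\<phi> + \<psi>) = ord v \<psi>" "\<phi> + \<psi> \<noteq> 0"
proof -
  have n: "\<not> ord_ge v (Suc (ord v \<psi>)) (\<phi> + \<psi>)"
  proof
    assume ge: "ord_ge v (Suc (ord v \<psi>)) (\<phi> + \<psi>)"
    have "ord_ge v (Suc (ord v \<psi>)) ((\<phi> + \<psi>) + cst (- 1) * \<phi>)"
      by (rule ord_ge_add[OF v V_add[OF \<phi>(1) \<psi>(1)] V_cst_mult[OF \<phi>(1)] ge ord_ge_cst_mult[OF v \<phi>]])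
    also have "(\<phi> + \<psi>) + cst (- 1) * \<phi> = \<psi>" by (simp add: fun_eq_iff fun_apply)
    finally show False using \<psi>(2) by (simp add: ord_ge_def)
  qed
  then show nz: "\<phi> + \<psi> \<noteq> 0" by (auto simp: ord_ge_def)
  have "ord_ge v (ord v \<psi>) (\<phi> + \<psi>)"
    by (rule ord_ge_add[OF v \<phi>(1) \<psi>(1) ord_ge_mono[OF \<phi>(2)] ord_ge_self]) simp
  then show "ord v (\<phi> + \<psi>) = ord v \<psi>" using n nz by (simp add: ord_ge_def)
qed

text \<open>
  Linear forms \<open>\<Sum> s\<^sup>i X\<^sub>i\<close>: for each \<open>w\<close> only finitely many \<open>s\<close> give a zero at \<open>w\<close>.
\<close>

lemma linear_nonvanishing:
  assumes "finite W" "W \<subseteq> cone"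
  shows "\<exists>b\<in>V 1. \<forall>w\<in>W. b w \<noteq> 0"
proof -
  define p where "p w = (\<Sum>i\<le>n. Polynomial.monom (w i) i)" for w :: "nat \<Rightarrow> 'k"
  have coeff_p: "Polynomial.coeff (p w) i = (if i \<le> n then w i else 0)" for w i
    by (simp add: p_def coeff_sum)
  have p0: "p w \<noteq> 0" if w: "w \<in> W" for w
  proof -
    obtain i where "i \<le> n" "w i \<noteq> 0" using cone_nonzero[of w] assms(2) w by blast
    then have "Polynomial.coeff (p w) i \<noteq> 0" by (simp add: coeff_p)
    then show ?thesis by fastforce
  qed
  have "finite (\<Union>w\<in>W. {s. poly (p w) s = 0})" using assms(1) p0 by (auto intro: poly_roots_finite)
  then obtain s where s: "s \<notin> (\<Union>w\<in>W. {s. poly (p w) s = 0})"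
    using infinite_UNIV_alg_closed by (metis UNIV_I finite_subset subsetI)
  define b where "b = (\<Sum>i\<le>n. cst (s ^ i) * Xc i)"
  have "b \<in> V 1" unfolding b_def by (intro V_sum V_cst_mult V_X) simp
  moreover have "b w \<noteq> 0" if w: "w \<in> W" for w
  proof -
    have "b w = (\<Sum>i\<le>n. s ^ i * w i)" unfolding b_def sum_fun_apply
      using w assms(2) by (intro sum.cong) (auto simp: fun_apply X_apply)
    also have "\<dots> = poly (p w) s" by (simp add: p_def poly_sum poly_monom mult.commute)
    finally show ?thesis using s w by simp
  qed
  ultimately show ?thesis by blast
qed

lemma separate_reps:
  assumes "P \<in> C" "R \<in> C" "P \<noteq> R"
  shows "\<exists>l\<in>V 1. l (rep P) \<noteq> 0 \<and> l (rep R) = 0"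
  by (rule separate_points[OF rep_cone[OF assms(1)] rep_cone[OF assms(2)]]) (simp add: assms rep_point_of)

lemma finite_zero_points:
  assumes "\<phi> \<in> V d" "\<phi> \<noteq> 0"
  shows "finite {P \<in> C. \<phi> (rep P) = 0}"
  by (rule finite_subset[OF _ finite_zeros[OF assms]]) (use rep_in in blast)

text \<open>
  Vanishing to order \<open>k R\<close> amounts to \<open>k R\<close> linear conditions, imposed one at a time.
\<close>

lemma impose_conditions:
  assumes Z: "finite Z" "Z \<subseteq> C" and I: "finite I" "indep_family I \<phi>" "\<phi> ` I \<subseteq> V D"
  shows "\<exists>J \<psi>. J \<subseteq> I \<and> card I \<le> card J + (\<Sum>R\<in>Z. k R) \<and> indep_family J \<psi> \<and>
     \<psi> ` J \<subseteq> {u \<in> V D. \<forall>R\<in>Z. ordp_ge R (k R) u}"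
  using Z
proof (induction Z rule: finite_induct)
  case empty
  show ?case using I by (intro exI[of _ I] exI[of _ \<phi>]) auto
next
  case (insert R Z)
  then obtain J \<psi> where J: "J \<subseteq> I" "card I \<le> card J + (\<Sum>R\<in>Z. k R)" "indep_family J \<psi>"
     "\<psi> ` J \<subseteq> {u \<in> V D. \<forall>R\<in>Z. ordp_ge R (k R) u}" by auto
  have cone: "rep R' \<in> cone" if "R' \<in> insert R Z" for R' using that insert.prems rep_cone by blast
  define W where "W t = {u \<in> V D. (\<forall>R\<in>Z. ordp_ge R (k R) u) \<and> ordp_ge R t u}" for t
  have lin: "linear_space (W t)" for t
    unfolding linear_space_def W_def using cone
    by (auto intro: V_add V_cst_mult ord_ge_add ord_ge_cst_mult)
  have cod: "codim_le_1 (W (Suc t)) (W t)" for t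
    unfolding codim_le_1_def
  proof (intro ballI)
    fix x y assume xy: "x \<in> W t" "y \<in> W t"
    then have xV: "x \<in> V D" "y \<in> V D" "ordp_ge R t x" "ordp_ge R t y" by (auto simp: W_def)
    obtain a b where ab: "a \<noteq> 0 \<or> b \<noteq> 0" "ordp_ge R (Suc t) (cst a * x + cst b * y)"
      using ord_ge_codim[OF cone[of R] xV] by blast
    have "cst a * x + cst b * y \<in> W t" using xy lin[of t] unfolding linear_space_def by blast
    then have "cst a * x + cst b * y \<in> W (Suc t)" using ab(2) by (auto simp: W_def)
    then show "\<exists>a b. (a \<noteq> 0 \<or> b \<noteq> 0) \<and> cst a * x + cst b * y \<in> W (Suc t)" using ab(1) by blast
  qed
  have "finite J" using J(1) I(1) by (rule finite_subset)
  moreover have "\<psi> ` J \<subseteq> W 0" using J(4) by (auto simp: W_def)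
  ultimately obtain J' \<psi>' where J': "J' \<subseteq> J" "card J \<le> card J' + k R" "indep_family J' \<psi>'" "\<psi>' ` J' \<subseteq> W (k R)"
    using indep_family_steps[of J \<psi> W "k R"] J(3) lin cod by blast
  have "J' \<subseteq> I" using J'(1) J(1) by blast
  moreover have "card I \<le> card J' + (\<Sum>R\<in>insert R Z. k R)" using J(2) J'(2) insert.hyps by simp
  moreover have "\<psi>' ` J' \<subseteq> {u \<in> V D. \<forall>R\<in>insert R Z. ordp_ge R (k R) u}" using J'(4) by (auto simp: W_def)
  ultimately show ?case using J'(3) by blast
qed

text \<open>
  A lower bound for the growth of the spaces \<open>V d\<close>, from which functions with prescribed poles are
  obtained by counting. \<open>N\<close> is the degree of \<open>a\<close>, the number of its zeros counted with
  multiplicity. For each zero \<open>R\<close> and each \<open>i < ordp R a\<close> there is a form \<open>\<phi> R i\<close> of order \<open>i\<close> at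
  \<open>R\<close> and of high order at the other zeros; these \<open>N\<close> forms are independent modulo \<open>a\<close>. Hence
  their products with the powers \<open>a\<^sup>j\<close> are independent, as one sees by looking at the lowest \<open>j\<close>
  in a relation, and then at the lowest \<open>i\<close> belonging to it. The factors \<open>x R\<close> only adjust
  degrees.
\<close>

lemma many_forms:
  assumes a: "a \<in> V 1" "a \<noteq> 0"
  defines "Z \<equiv> {R \<in> C. a (rep R) = 0}"
  defines "N \<equiv> (\<Sum>R\<in>Z. ordp R a)"
  shows "\<exists>M. \<forall>d. \<exists>(I :: (nat \<times> 'k proj_point \<times> nat) set) \<Phi>. finite I \<and> card I = Suc d * N \<and> indep_family I \<Phi> \<and> \<Phi> ` I \<subseteq> V (M + d)"
proof -
  have finZ: "finite Z" unfolding Z_def by (rule finite_zero_points[OF a])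
  have ZC: "R \<in> C" if "R \<in> Z" for R using that by (simp add: Z_def)
  have e_le: "ordp R a \<le> N" if "R \<in> Z" for R unfolding N_def using finZ that by (intro member_le_sum) auto
  have "\<exists>t. loc_param (rep R) t" if "R \<in> Z" for R using loc_param_ex rep_cone ZC that by blast
  then obtain t where t: "\<And>R. R \<in> Z \<Longrightarrow> loc_param (rep R) (t R)" by metis
  have "\<exists>x. x \<in> V 1 \<and> x (rep R) = 1 \<and> x \<noteq> 0" if "R \<in> Z" for R using unit_linear_ex rep_cone ZC that by blast
  then obtain x where x: "\<And>R. R \<in> Z \<Longrightarrow> x R \<in> V 1 \<and> x R (rep R) = 1 \<and> x R \<noteq> 0" by metis
  have "\<exists>l. l \<in> V 1 \<and> l (rep R) \<noteq> 0 \<and> l (rep R') = 0" if "R \<in> Z" "R' \<in> Z" "R \<noteq> R'" for R R'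
    using separate_reps ZC that by blast
  then obtain l where l: "\<And>R R'. R \<in> Z \<Longrightarrow> R' \<in> Z \<Longrightarrow> R \<noteq> R' \<Longrightarrow> l R R' \<in> V 1 \<and> l R R' (rep R) \<noteq> 0 \<and> l R R' (rep R') = 0"
    by metis
  define y where "y R = (\<Prod>R'\<in>Z - {R}. l R R' ^ N)" for R
  define M where "M = N + (card Z - 1) * N"
  have yV: "y R \<in> V ((card Z - 1) * N)" if R: "R \<in> Z" for R
  proof -
    have "y R \<in> V (\<Sum>R'\<in>Z - {R}. N * 1)" unfolding y_def by (intro V_prod V_power) (use l R in blast)
    then show ?thesis using R finZ by simp
  qed
  have yR: "y R (rep R) \<noteq> 0" if R: "R \<in> Z" for R
  proof -
    have "(l R R' ^ N) (rep R) \<noteq> 0" if "R' \<in> Z - {R}" for R' using l[of R R'] R that by (auto simp: power_fun_apply)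
    then show ?thesis unfolding y_def prod_fun_apply using finZ by (simp add: prod_zero_iff)
  qed
  have y_ge: "ordp_ge R' N (y R)" if R: "R \<in> Z" "R' \<in> Z" "R \<noteq> R'" for R R'
  proof -
    have yy: "y R = l R R' ^ N * (\<Prod>S\<in>Z - {R} - {R'}. l R S ^ N)"
      unfolding y_def using R finZ by (subst prod.remove[of _ R']) auto
    have lR: "l R R' \<in> V 1" "l R R' (rep R') = 0" "l R R' \<noteq> 0" using l[OF R] by (auto simp: fun_apply)
    have c: "rep R' \<in> cone" using rep_cone ZC R by blast
    have pos: "ordp R' (l R R') > 0" by (rule ord_vanishing[OF c lR(1,3,2)])
    have PV: "(\<Prod>S\<in>Z - {R} - {R'}. l R S ^ N) \<in> V (\<Sum>S\<in>Z - {R} - {R'}. N * 1)"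
    proof (rule V_prod)
      fix S assume "S \<in> Z - {R} - {R'}"
      then show "l R S ^ N \<in> V (N * 1)" using l[of R S] R(1) by (intro V_power) blast
    qed
    have "ordp_ge R' N (l R R' ^ N)" using ord_power[OF c lR(1,3), of N] pos by (simp add: ord_ge_def)
    then have "ordp_ge R' (N + 0) (l R R' ^ N * (\<Prod>S\<in>Z - {R} - {R'}. l R S ^ N))"
      by (rule ord_ge_mult[OF c V_power[OF lR(1)] PV _ ord_ge_0(2)])
    then show ?thesis unfolding yy by simp
  qed
  define \<phi> where "\<phi> R i = t R ^ i * x R ^ (N - i) * y R" for R i
  have \<phi>V: "\<phi> R i \<in> V M" if "R \<in> Z" "i \<le> N" for R i
  proof -
    have "\<phi> R i \<in> V (i * 1 + (N - i) * 1 + (card Z - 1) * N)"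
      unfolding \<phi>_def using x t loc_paramD(1) that by (intro V_mult V_power yV) auto
    then show ?thesis using that by (simp add: M_def)
  qed
  show ?thesis
  proof (intro exI[of _ M] allI)
    fix d :: nat
    define I where "I = {..d} \<times> (SIGMA R:Z. {..<ordp R a})"
    define \<Phi> where "\<Phi> = (\<lambda>(j, R, i). \<phi> R i * x R ^ (d - j) * a ^ j)"
    have finI: "finite I" unfolding I_def using finZ by auto
    have cardI: "card I = Suc d * N"
      unfolding I_def N_def using finZ by (simp add: card_cartesian_product card_SigmaI)
    have \<Phi>V: "\<Phi> ` I \<subseteq> V (M + d)"
    proof
      fix z assume "z \<in> \<Phi> ` I"
      then obtain j R i where z: "z = \<phi> R i * x R ^ (d - j) * a ^ j" "j \<le> d" "R \<in> Z" "i < ordp R a"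
        by (auto simp: \<Phi>_def I_def)
      have "i \<le> N" using z e_le[of R] by simp
      then have "z \<in> V (M + (d - j) * 1 + j * 1)"
        unfolding z(1) using x z by (intro V_mult V_power \<phi>V a) auto
      then show "z \<in> V (M + d)" using z by simp
    qed
    have "indep_family I \<Phi>"
      unfolding indep_family_def
    proof (intro allI impI, rule ccontr)
      fix c assume c0: "(\<Sum>s\<in>I. cst (c s) * \<Phi> s) = 0" and "\<not> (\<forall>s\<in>I. c s = 0)"
      then obtain j1 R1 i1 where "(j1, R1, i1) \<in> I" "c (j1, R1, i1) \<noteq> 0" by auto
      then have ex: "\<exists>j. \<exists>R i. (j, R, i) \<in> I \<and> c (j, R, i) \<noteq> 0" by blast
      define j0 where "j0 = (LEAST j. \<exists>R i. (j, R, i) \<in> I \<and> c (j, R, i) \<noteq> 0)"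
      obtain R i1 where R: "(j0, R, i1) \<in> I" "c (j0, R, i1) \<noteq> 0" using LeastI_ex[OF ex] unfolding j0_def by blast
      have below_j: "c (j, R, i) = 0" if "j < j0" "(j, R, i) \<in> I" for j R i
        using not_less_Least[of j "\<lambda>j. \<exists>R i. (j, R, i) \<in> I \<and> c (j, R, i) \<noteq> 0"] that unfolding j0_def by blast
      define i0 where "i0 = (LEAST i. (j0, R, i) \<in> I \<and> c (j0, R, i) \<noteq> 0)"
      have i0: "(j0, R, i0) \<in> I" "c (j0, R, i0) \<noteq> 0"
        using LeastI[of "\<lambda>i. (j0, R, i) \<in> I \<and> c (j0, R, i) \<noteq> 0" i1] R unfolding i0_def by blast+
      have below_i: "c (j0, R, i) = 0" if "i < i0" "(j0, R, i) \<in> I" for i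
        using not_less_Least[of i "\<lambda>i. (j0, R, i) \<in> I \<and> c (j0, R, i) \<noteq> 0"] that unfolding i0_def by blast
      have RZ: "R \<in> Z" "i0 < ordp R a" "j0 \<le> d" using i0(1) by (auto simp: I_def)
      have cone: "rep R \<in> cone" using rep_cone ZC RZ by blast
      let ?B = "SIGMA R:Z. {..<ordp R a}"
      define S where "S j = (\<Sum>(R, i)\<in>?B. cst (c (j, R, i)) * (\<phi> R i * x R ^ (d - j)))" for j
      have termV: "\<phi> R i * x R ^ (d - j) \<in> V (M + (d - j))" if "(R, i) \<in> ?B" for R i j
      proof -
        have "i \<le> N" "R \<in> Z" using that e_le[of R] by auto
        then have "\<phi> R i * x R ^ (d - j) \<in> V (M + (d - j) * 1)" using x by (intro V_mult \<phi>V V_power) auto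
        then show ?thesis by simp
      qed
      have SV: "S j \<in> V (M + (d - j))" for j
        unfolding S_def by (intro V_sum) (use termV in \<open>auto intro!: V_cst_mult\<close>)
      have "0 = (\<Sum>j\<le>d. \<Sum>(R, i)\<in>?B. cst (c (j, R, i)) * \<Phi> (j, R, i))"
        unfolding c0[symmetric] I_def sum.cartesian_product' by (simp only: split_def prod.collapse)
      also have "\<dots> = (\<Sum>j\<le>d. a ^ j * S j)"
        unfolding S_def sum_distrib_left \<Phi>_def by (intro sum.cong refl) (simp add: split_def mult_ac)
      also have "\<dots> = (\<Sum>j\<in>{j0..d}. a ^ j * S j)"
      proof (intro sum.mono_neutral_right ballI)
        fix j assume "j \<in> {..d} - {j0..d}"
        then have j: "j < j0" "j \<le> d" by auto
        have "S j = (\<Sum>(R, i)\<in>?B. 0)" unfolding S_def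
          using j by (intro sum.cong refl) (auto simp: I_def below_j)
        also have "\<dots> = 0" by (simp add: split_def)
        finally show "a ^ j * S j = 0" by (simp only: mult_zero_right)
      qed auto
      also have "\<dots> = a ^ j0 * (\<Sum>j\<in>{j0..d}. a ^ (j - j0) * S j)"
        unfolding sum_distrib_left mult.assoc[symmetric] power_add[symmetric] by (intro sum.cong) auto
      finally have 0: "a ^ j0 * (\<Sum>j\<in>{j0..d}. a ^ (j - j0) * S j) = 0" by simp
      have T0V: "a ^ (j - j0) * S j \<in> V (M + (d - j0))" if "j \<in> {j0..d}" for j
      proof -
        have "a ^ (j - j0) * S j \<in> V ((j - j0) * 1 + (M + (d - j)))" by (intro V_mult V_power a SV)
        then show ?thesis using that by simp
      qed
      then have "(\<Sum>j\<in>{j0..d}. a ^ (j - j0) * S j) \<in> V (M + (d - j0))" by (intro V_sum)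
      then have "(\<Sum>j\<in>{j0..d}. a ^ (j - j0) * S j) = 0"
        using V_domain[OF V_power[OF a(1)] _ 0] V_power_nonzero[OF a] by blast
      then have "S j0 + (\<Sum>j\<in>{Suc j0..d}. a ^ (j - j0) * S j) = 0"
        using RZ(3) by (simp add: sum.atLeast_Suc_atMost)
      then have S0: "S j0 = cst (- 1) * (\<Sum>j\<in>{Suc j0..d}. a ^ (j - j0) * S j)"
        by (simp add: eq_neg_iff_add_eq_0 cst_uminus)
      have "ordp_ge R (ordp R a) (a ^ (j - j0) * S j)" if j: "j \<in> {Suc j0..d}" for j
      proof -
        have "ordp_ge R ((j - j0) * ordp R a + 0) (a ^ (j - j0) * S j)"
          using ord_power[OF cone a, of "j - j0"] by (intro ord_ge_mult[OF cone V_power[OF a(1)] SV]) (auto simp: ord_ge_def)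
        moreover have "1 * ordp R a \<le> (j - j0) * ordp R a" using j by (intro mult_right_mono) auto
        ultimately show ?thesis by (auto intro: ord_ge_mono)
      qed
      then have "ordp_ge R (ordp R a) (\<Sum>j\<in>{Suc j0..d}. a ^ (j - j0) * S j)"
        by (intro ord_ge_sum[OF cone, of _ _ "M + (d - j0)"] T0V) auto
      then have "ordp_ge R (ordp R a) (S j0)"
        unfolding S0 by (intro ord_ge_cst_mult[OF cone, of _ "M + (d - j0)"] V_sum T0V) auto
      then have S_ge: "ordp_ge R (Suc i0) (S j0)" using RZ(2) by (auto intro: ord_ge_mono)
      define F where "F = (\<lambda>(R, i). cst (c (j0, R, i)) * (\<phi> R i * x R ^ (d - j0)))"
      have FV: "F s \<in> V (M + (d - j0))" if "s \<in> ?B" for s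
        unfolding F_def using that by (auto intro!: V_cst_mult termV)
      have F_ge: "ordp_ge R (Suc i0) (F s)" if s: "s \<in> ?B - {(R, i0)}" for s
      proof -
        obtain R' i where s': "s = (R', i)" "R' \<in> Z" "i < ordp R' a" "R' \<noteq> R \<or> i \<noteq> i0" using s by auto
        have xV: "x R' ^ (d - j0) \<in> V ((d - j0) * 1)" using x[OF s'(2)] by (intro V_power) auto
        have iN: "i \<le> N" using s'(3) e_le[OF s'(2)] by simp
        have tx: "t R' ^ i * x R' ^ (N - i) \<in> V (i * 1 + (N - i) * 1)"
          using x[OF s'(2)] loc_paramD(1)[OF t[OF s'(2)]] by (intro V_mult V_power) auto
        show ?thesis
        proof (cases "R' = R")
          case False
          have "ordp_ge R (0 + N) (\<phi> R' i)" unfolding \<phi>_def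
            by (rule ord_ge_mult[OF cone tx yV[OF s'(2)] ord_ge_0(2) y_ge[OF s'(2) RZ(1) False]])
          then have "ordp_ge R (0 + N + 0) (\<phi> R' i * x R' ^ (d - j0))"
            by (intro ord_ge_mult[OF cone \<phi>V[OF s'(2) iN] xV _ ord_ge_0(2)])
          moreover have "Suc i0 \<le> N" using RZ e_le[OF RZ(1)] by simp
          ultimately have "ordp_ge R (Suc i0) (\<phi> R' i * x R' ^ (d - j0))" by (auto intro: ord_ge_mono)
          then show ?thesis unfolding F_def s'(1) prod.case
            using termV[of R' i j0] s' by (intro ord_ge_cst_mult[OF cone]) auto
        next
          case True
          show ?thesis
          proof (cases "i < i0")
            case True
            then have "c (j0, R, i) = 0" using below_i[of i] RZ s' \<open>R' = R\<close> by (simp add: I_def)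
            then have "F s = 0" unfolding F_def s'(1) \<open>R' = R\<close> by simp
            then show ?thesis by (simp only: ord_ge_0)
          next
            case False
            then have i: "Suc i0 \<le> i" using s' \<open>R' = R\<close> by simp
            have tR: "t R \<in> V 1" "t R \<noteq> 0" "ordp R (t R) = 1" using t[OF RZ(1)] loc_paramD ord_loc_param by blast+
            have "ordp_ge R i (t R ^ i)" using ord_power[OF cone tR(1,2), of i] tR(3) by (simp add: ord_ge_def)
            moreover have "x R ^ (N - i) * (y R * x R ^ (d - j0)) \<in> V ((N - i) * 1 + ((card Z - 1) * N + (d - j0) * 1))"
              using x[OF RZ(1)] by (intro V_mult V_power yV RZ) auto
            ultimately have "ordp_ge R (i + 0) (t R ^ i * (x R ^ (N - i) * (y R * x R ^ (d - j0))))"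
              by (intro ord_ge_mult[OF cone V_power[OF tR(1)] _ _ ord_ge_0(2)])
            moreover have "\<phi> R i * x R ^ (d - j0) = t R ^ i * (x R ^ (N - i) * (y R * x R ^ (d - j0)))"
              unfolding \<phi>_def by (simp only: mult_ac)
            ultimately have "ordp_ge R (Suc i0) (\<phi> R i * x R ^ (d - j0))" using i by (auto intro: ord_ge_mono)
            then show ?thesis unfolding F_def s'(1) True prod.case
              using termV[of R i j0] s' True by (intro ord_ge_cst_mult[OF cone]) auto
          qed
        qed
      qed
      have R0: "(R, i0) \<in> ?B" using RZ by auto
      have finB: "finite ?B" using finZ by auto
      have "S j0 = F (R, i0) + (\<Sum>s\<in>?B - {(R, i0)}. F s)"
        unfolding S_def F_def[symmetric] by (rule sum.remove[OF finB R0])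
      then have F0: "F (R, i0) = S j0 + cst (- 1) * (\<Sum>s\<in>?B - {(R, i0)}. F s)" by (simp add: cst_uminus)
      have GV: "(\<Sum>s\<in>?B - {(R, i0)}. F s) \<in> V (M + (d - j0))" by (intro V_sum FV) blast
      have "ordp_ge R (Suc i0) (\<Sum>s\<in>?B - {(R, i0)}. F s)"
        by (rule ord_ge_sum[OF cone, of _ _ "M + (d - j0)"]) (use FV F_ge in blast)+
      then have "ordp_ge R (Suc i0) (F (R, i0))"
        unfolding F0 by (rule ord_ge_add[OF cone SV[of j0] V_cst_mult[OF GV] S_ge ord_ge_cst_mult[OF cone GV]])
      moreover have "F (R, i0) = cst (c (j0, R, i0)) * (t R ^ i0 * (x R ^ (N - i0) * (y R * x R ^ (d - j0))))"
        unfolding F_def \<phi>_def by (simp add: mult_ac)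
      moreover have "ordp R (cst (c (j0, R, i0)) * (t R ^ i0 * (x R ^ (N - i0) * (y R * x R ^ (d - j0))))) = i0"
        "cst (c (j0, R, i0)) * (t R ^ i0 * (x R ^ (N - i0) * (y R * x R ^ (d - j0)))) \<noteq> 0"
      proof -
        have tR: "t R \<in> V 1" "t R \<noteq> 0" "ordp R (t R) = 1" using t[OF RZ(1)] loc_paramD ord_loc_param by blast+
        define q where "q = x R ^ (N - i0) * (y R * x R ^ (d - j0))"
        have qV: "q \<in> V ((N - i0) * 1 + ((card Z - 1) * N + (d - j0) * 1))"
          unfolding q_def using x[OF RZ(1)] by (intro V_mult V_power yV RZ) auto
        have qR: "q (rep R) \<noteq> 0" unfolding q_def using x[OF RZ(1)] yR[OF RZ(1)] by (simp add: fun_apply power_fun_apply)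
        then have q0: "q \<noteq> 0" by (auto simp: fun_apply)
        have tq: "t R ^ i0 * q \<noteq> 0" by (rule V_mult_nonzero[OF V_power[OF tR(1)] qV V_power_nonzero[OF tR(1,2)] q0])
        have tqV: "t R ^ i0 * q \<in> V (i0 * 1 + ((N - i0) * 1 + ((card Z - 1) * N + (d - j0) * 1)))" by (intro V_mult V_power tR qV)
        have "ordp R (t R ^ i0 * q) = i0"
          using ord_mult[OF cone V_power[OF tR(1)] V_power_nonzero[OF tR(1,2)] qV q0, of i0]
            ord_power[OF cone tR(1,2), of i0] ord_nonvanishing[OF cone qV qR] tR(3) by simp
        then show "ordp R (cst (c (j0, R, i0)) * (t R ^ i0 * (x R ^ (N - i0) * (y R * x R ^ (d - j0))))) = i0"
          "cst (c (j0, R, i0)) * (t R ^ i0 * (x R ^ (N - i0) * (y R * x R ^ (d - j0)))) \<noteq> 0"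
          using ord_cst_mult[OF cone tqV tq i0(2)] unfolding q_def by simp_all
      qed
      ultimately show False by (simp add: ord_ge_def)
    qed
    then show "\<exists>(I :: (nat \<times> 'k proj_point \<times> nat) set) \<Phi>. finite I \<and> card I = Suc d * N \<and> indep_family I \<Phi> \<and> \<Phi> ` I \<subseteq> V (M + d)"
      using finI cardI \<Phi>V by blast
  qed
qed

text \<open>
  The functions \<open>\<psi> / a\<^sup>D\<close>, where \<open>a\<close> is a local parameter at \<open>Q\<close> and \<open>\<psi>\<close> vanishes to order at
  least \<open>D ordp R a\<close> at the other zeros \<open>R\<close> of \<open>a\<close>, have poles only at \<open>Q\<close>. The conditions number
  \<open>D (N - 1)\<close>, whereas by \<open>many_forms\<close> about \<open>D N\<close> independent forms are available, up to a
  constant. So two independent forms are left for large \<open>D\<close>, and one of them is not a multiple of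
  \<open>a\<^sup>D\<close>.
\<close>

theorem pole_function:
  assumes Q: "Q \<in> C"
  shows "\<exists>D u A. u \<in> V D \<and> A \<in> V D \<and> A \<noteq> 0 \<and> (\<forall>R\<in>C. R \<noteq> Q \<longrightarrow> ordp_ge R (ordp R A) u) \<and> (\<forall>c. u \<noteq> cst c * A)"
proof -
  obtain a where a': "loc_param (rep Q) a" using loc_param_ex[OF rep_cone[OF Q]] by blast
  have a: "a \<in> V 1" "a \<noteq> 0" and aQ: "a (rep Q) = 0" using loc_paramD[OF a'] by auto
  define Z where "Z = {R \<in> C. a (rep R) = 0}"
  define N where "N = (\<Sum>R\<in>Z. ordp R a)"
  have finZ: "finite Z" unfolding Z_def by (rule finite_zero_points[OF a])
  have QZ: "Q \<in> Z" using Q aQ by (simp add: Z_def)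
  obtain M where M: "\<And>d. \<exists>(I :: (nat \<times> 'k proj_point \<times> nat) set) \<Phi>. finite I \<and> card I = Suc d * N \<and> indep_family I \<Phi> \<and> \<Phi> ` I \<subseteq> V (M + d)"
    using many_forms[OF a] unfolding N_def Z_def by blast
  \<comment> \<open>Chosen such that at least two independent forms survive the conditions below.\<close>
  define d where "d = M * N + 2"
  define D where "D = M + d"
  obtain I :: "(nat \<times> 'k proj_point \<times> nat) set" and \<Phi> where
    I: "finite I" "card I = Suc d * N" "indep_family I \<Phi>" "\<Phi> ` I \<subseteq> V D"
    using M[of d] unfolding D_def by blast
  have ZC: "Z - {Q} \<subseteq> C" by (auto simp: Z_def)
  obtain J \<psi> where J: "J \<subseteq> I" "card I \<le> card J + (\<Sum>R\<in>Z - {Q}. D * ordp R a)" "indep_family J \<psi>"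
     "\<psi> ` J \<subseteq> {u \<in> V D. \<forall>R\<in>Z - {Q}. ordp_ge R (D * ordp R a) u}"
    using impose_conditions[OF _ ZC I(1,3,4), of "\<lambda>R. D * ordp R a"] finZ by blast
  have finJ: "finite J" using J(1) I(1) by (rule finite_subset)
  have "ordp Q a = 1" by (rule ord_loc_param[OF a'])
  then have N1: "N = Suc (\<Sum>R\<in>Z - {Q}. ordp R a)"
    unfolding N_def using finZ QZ by (simp add: sum.remove)
  define N' where "N' = (\<Sum>R\<in>Z - {Q}. ordp R a)"
  have "Suc d * Suc N' \<le> card J + (M + d) * N'"
    using J(2) unfolding I(2) N1 N'_def[symmetric] D_def sum_distrib_left[symmetric] .
  moreover have "(M + d) * N' + 2 \<le> Suc d * Suc N'"
    unfolding d_def N1 N'_def[symmetric] by (simp add: algebra_simps)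
  ultimately have "2 \<le> card J" by linarith
  then obtain s s' where s: "s \<in> J" "s' \<in> J" "s \<noteq> s'"
    by (metis card_le_Suc0_iff_eq finJ not_less_eq_eq numeral_2_eq_2)
  have AV: "a ^ D \<in> V D" "a ^ D \<noteq> 0" using V_power[OF a(1), of D] V_power_nonzero[OF a] by auto
  have "\<exists>r\<in>J. \<forall>c. \<psi> r \<noteq> cst c * a ^ D"
  proof (rule ccontr)
    assume "\<not> ?thesis"
    then obtain c c' where c: "\<psi> s = cst c * a ^ D" "\<psi> s' = cst c' * a ^ D" using s by blast
    define f where "f r = (if r = s then c' else if r = s' then - c else 0)" for r
    have ind: "indep_family {s, s'} \<psi>" by (rule indep_family_subset[OF J(3) _ finJ]) (use s in auto)
    have "(\<Sum>r\<in>{s, s'}. cst (f r) * \<psi> r) = 0"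
      using s by (simp add: f_def c fun_eq_iff fun_apply)
    then have "\<forall>r\<in>{s, s'}. f r = 0" using indep_familyD[OF ind, of f] by blast
    then have "c = 0" using s by (auto simp: f_def)
    then have "\<psi> s = 0" using c by simp
    then have "(\<Sum>r\<in>{s, s'}. cst (if r = s then 1 else 0) * \<psi> r) = 0" using s by simp
    from indep_familyD[OF ind this, of s] show False by simp
  qed
  then obtain r where r: "r \<in> J" "\<And>c. \<psi> r \<noteq> cst c * a ^ D" by blast
  have "ordp_ge R (ordp R (a ^ D)) (\<psi> r)" if R: "R \<in> C" "R \<noteq> Q" for R
  proof -
    have oD: "ordp R (a ^ D) = D * ordp R a" by (rule ord_power[OF rep_cone[OF R(1)] a])
    show ?thesis
    proof (cases "R \<in> Z")
      case True
      then show ?thesis unfolding oD using J(4) r(1) R by blast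
    next
      case False
      then have "ordp R a = 0" using R by (intro ord_nonvanishing[OF rep_cone[OF R(1)] a(1)]) (simp add: Z_def)
      then show ?thesis unfolding oD by simp
    qed
  qed
  moreover have "\<psi> r \<in> V D" using J(4) r(1) by blast
  ultimately show ?thesis using AV r(2) by blast
qed

end

section \<open>Vanishing and approximation\<close>

context smooth_variety_curve
begin

lemma no_poles_imp_zero_points:
  assumes g: "g \<in> V d" and h: "h \<in> V d" "h \<noteq> 0"
    and reg: "\<And>R. R \<in> C \<Longrightarrow> ordp_ge R (ordp R h) g"
    and Q: "Q \<in> C" "ordp_ge Q (Suc (ordp Q h)) g"
  shows "g = 0"
proof (rule no_poles_imp_zero[OF g h _ rep_cone[OF Q(1)] Q(2)])
  fix v assume v: "v \<in> cone"
  show "ord_ge v (ord v h) g"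
  proof (cases "g = 0")
    case True
    then show ?thesis by simp
  next
    case False
    have P: "point_of v \<in> C" by (rule point_of_in_C[OF v])
    have "ord v h = ordp (point_of v) h" "ord v g = ordp (point_of v) g"
      using ord_eq_ordp[OF P point_of_self h] ord_eq_ordp[OF P point_of_self g False] by auto
    then show ?thesis using reg[OF P] False by (simp add: ord_ge_def)
  qed
qed

text \<open>
  A function on \<open>C\<close> with poles only in \<open>S\<close>, of order at most \<open>\<kappa>\<close>, and with a zero of sufficiently
  high order at \<open>Q\<close> is zero. If \<open>u / A\<close> is a function with a pole only at \<open>Q\<close>, then for every \<open>R\<close>
  in \<open>S\<close> some \<open>u / A - c R\<close> vanishes at \<open>R\<close>; multiplying by suitable powers of these functions
  removes the poles, and \<open>no_poles_imp_zero\<close> applies.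
\<close>

lemma sections_vanish:
  assumes Q: "Q \<in> C" and S: "finite S" "S \<subseteq> C - {Q}"
  shows "\<exists>N. \<forall>d g h. g \<in> V d \<longrightarrow> h \<in> V d \<longrightarrow> h \<noteq> 0 \<longrightarrow>
    (\<forall>R\<in>S. ordp_ge R (ordp R h - \<kappa>) g) \<longrightarrow> (\<forall>R\<in>C - S - {Q}. ordp_ge R (ordp R h) g) \<longrightarrow>
    ordp_ge Q (ordp Q h + N) g \<longrightarrow> g = 0"
proof -
  obtain D u A where uA: "u \<in> V D \<and> A \<in> V D \<and> A \<noteq> 0 \<and> (\<forall>R\<in>C. R \<noteq> Q \<longrightarrow> ordp_ge R (ordp R A) u) \<and> (\<forall>c. u \<noteq> cst c * A)"
    using pole_function[OF Q] by (elim exE) (rule that)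
  have u: "u \<in> V D" and A: "A \<in> V D" "A \<noteq> 0" and nc: "\<And>c. u \<noteq> cst c * A" using uA by simp_all
  have reg: "ordp_ge R (ordp R A) u" if "R \<in> C" "R \<noteq> Q" for R using uA that by simp
  have SC: "R \<in> C" "R \<noteq> Q" if "R \<in> S" for R using S(2) that by auto
  have "\<exists>c. ordp_ge R (Suc (ordp R A)) (u - cst c * A)" if "R \<in> S" for R
    using leading_value[OF rep_cone u reg A refl] SC[OF that] by blast
  then obtain c where c: "\<And>R. R \<in> S \<Longrightarrow> ordp_ge R (Suc (ordp R A)) (u - cst (c R) * A)" by metis
  define w where "w R = u - cst (c R) * A" for R
  have wV: "w R \<in> V D" for R unfolding w_def by (intro V_diff V_cst_mult u A)
  have w0: "w R \<noteq> 0" for R unfolding w_def using nc by simp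
  define y where "y = (\<Prod>R\<in>S. w R ^ \<kappa>)"
  define B where "B = (\<Prod>R\<in>S. A ^ \<kappa>)"
  define e where "e = (\<Sum>R\<in>S. \<kappa> * D)"
  have wk: "w R ^ \<kappa> \<in> V (\<kappa> * D) \<and> w R ^ \<kappa> \<noteq> 0" for R using V_power[OF wV] V_power_nonzero[OF wV w0] by blast
  have Ak: "A ^ \<kappa> \<in> V (\<kappa> * D) \<and> A ^ \<kappa> \<noteq> 0" using V_power[OF A(1)] V_power_nonzero[OF A] by blast
  have y: "y \<in> V e" "y \<noteq> 0" unfolding y_def e_def
    using wk by (intro V_prod, blast) (rule V_prod_nonzero[where d = "\<lambda>_. \<kappa> * D"], rule wk)
  have B: "B \<in> V e" "B \<noteq> 0" unfolding B_def e_def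
    using Ak by (intro V_prod, blast) (rule V_prod_nonzero[where d = "\<lambda>_. \<kappa> * D"], rule Ak)
  have oy: "ordp R y = (\<Sum>R'\<in>S. \<kappa> * ordp R (w R'))" if R: "R \<in> C" for R
    unfolding y_def using ord_prod[OF rep_cone[OF R] S(1), of "\<lambda>R. w R ^ \<kappa>" "\<lambda>_. \<kappa> * D"]
      wk ord_power[OF rep_cone[OF R] wV w0] by simp
  have oB: "ordp R B = (\<Sum>R'\<in>S. \<kappa> * ordp R A)" if R: "R \<in> C" for R
    unfolding B_def using ord_prod[OF rep_cone[OF R] S(1), of "\<lambda>R. A ^ \<kappa>" "\<lambda>_. \<kappa> * D"]
      Ak ord_power[OF rep_cone[OF R] A] by simp
  have ow: "ordp R A \<le> ordp R (w R')" if R: "R \<in> C" "R \<noteq> Q" for R R'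
  proof -
    have "ordp_ge R (ordp R A) (u + cst (- c R') * A)"
      by (rule ord_ge_add[OF rep_cone[OF R(1)] u V_cst_mult[OF A(1)] reg[OF R] ord_ge_cst_mult[OF rep_cone[OF R(1)] A(1) ord_ge_self]])
    also have "u + cst (- c R') * A = w R'" by (simp add: w_def cst_uminus)
    finally show ?thesis using w0 by (simp add: ord_ge_def)
  qed
  have ow': "Suc (ordp R A) \<le> ordp R (w R)" if "R \<in> S" for R
    using c[OF that] w0[of R] unfolding w_def[symmetric] by (simp add: ord_ge_def)
  have ge: "ordp R B \<le> ordp R y" if "R \<in> C" "R \<noteq> Q" for R
    unfolding oy[OF that(1)] oB[OF that(1)] by (intro sum_mono mult_left_mono ow that) auto
  have geS: "ordp R B + \<kappa> \<le> ordp R y" if R: "R \<in> S" for R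
  proof -
    have "ordp R B + \<kappa> = (\<Sum>R'\<in>S. \<kappa> * ordp R A + (if R' = R then \<kappa> else 0))"
      unfolding oB[OF SC(1)[OF R]] using R S(1) by (simp add: sum.distrib)
    also have "\<dots> \<le> ordp R y" unfolding oy[OF SC(1)[OF R]]
    proof (rule sum_mono)
      fix R' assume "R' \<in> S"
      show "\<kappa> * ordp R A + (if R' = R then \<kappa> else 0) \<le> \<kappa> * ordp R (w R')"
      proof (cases "R' = R")
        case True
        have "\<kappa> * Suc (ordp R A) \<le> \<kappa> * ordp R (w R)" by (rule mult_left_mono[OF ow'[OF R]]) simp
        then show ?thesis using True by simp
      next
        case False
        then show ?thesis using mult_left_mono[OF ow[OF SC[OF R], of R'], of \<kappa>] by simp
      qed
    qed
    finally show ?thesis .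
  qed
  show ?thesis
  proof (intro exI[of _ "Suc (ordp Q B)"] allI impI)
    fix d g h assume g: "g \<in> V d" and h: "h \<in> V d" "h \<noteq> 0" and gS: "\<forall>R\<in>S. ordp_ge R (ordp R h - \<kappa>) g"
      and gC: "\<forall>R\<in>C - S - {Q}. ordp_ge R (ordp R h) g" and gQ: "ordp_ge Q (ordp Q h + Suc (ordp Q B)) g"
    have hB: "h * B \<in> V (d + e)" "h * B \<noteq> 0" by (intro V_mult h B) (rule V_mult_nonzero[OF h(1) B(1) h(2) B(2)])
    have oh: "ordp R (h * B) = ordp R h + ordp R B" if "R \<in> C" for R by (rule ord_mult[OF rep_cone[OF that] h B])
    have "g * y = 0"
    proof (rule no_poles_imp_zero_points[OF V_mult[OF g y(1)] hB _ Q])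
      have "ordp_ge Q (ordp Q h + Suc (ordp Q B) + 0) (g * y)"
        by (rule ord_ge_mult[OF rep_cone[OF Q] g y(1) gQ ord_ge_0(2)])
      then show gyQ: "ordp_ge Q (Suc (ordp Q (h * B))) (g * y)" unfolding oh[OF Q] by simp
      fix R assume R: "R \<in> C"
      consider "R = Q" | "R \<in> S" | "R \<in> C - S - {Q}" using R by blast
      then show "ordp_ge R (ordp R (h * B)) (g * y)"
      proof cases
        case 1
        then show ?thesis using gyQ by (auto intro: ord_ge_mono)
      next
        case 2
        have "ordp_ge R ((ordp R h - \<kappa>) + ordp R y) (g * y)"
          using gS 2 by (intro ord_ge_mult[OF rep_cone[OF R] g y(1) _ ord_ge_self]) blast
        then show ?thesis unfolding oh[OF R] using geS[OF 2] by (auto intro: ord_ge_mono)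
      next
        case 3
        have "ordp_ge R (ordp R h + ordp R y) (g * y)"
          using gC 3 by (intro ord_ge_mult[OF rep_cone[OF R] g y(1) _ ord_ge_self]) blast
        then show ?thesis unfolding oh[OF R] using ge[of R] 3 by (auto intro: ord_ge_mono)
      qed
    qed
    then show "g = 0" using V_domain[OF g y(1)] y(2) by blast
  qed
qed

text \<open>
  The function \<open>Y1 / Y2\<close> has poles only at \<open>Q\<close>, vanishes to order \<open>\<kappa>\<close> on \<open>S\<close> and is a unit at \<open>P\<close>.
  The numerator starts from a form \<open>g\<close> with the right zeros, the denominator from a power of a
  linear form \<open>b\<close>. The unwanted poles at the zeros \<open>R\<close> of \<open>b\<close> are removed by powers of functions
  \<open>u / A - c R\<close> vanishing at \<open>R\<close>, as in \<open>sections_vanish\<close>. These must not vanish at \<open>P\<close>. For this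
  \<open>u / A\<close> is shifted so as to be zero at \<open>P\<close>, and \<open>b\<close> is chosen nonzero at every point of \<open>T\<close>, the
  zeros of \<open>u / A\<close>; then all \<open>c R\<close> are nonzero.
\<close>

theorem approximation:
  assumes P: "P \<in> C" and Q: "Q \<in> C" "P \<noteq> Q" and S: "finite S" "S \<subseteq> C - {P, Q}"
  shows "\<exists>e Y1 Y2. Y1 \<in> V e \<and> Y2 \<in> V e \<and> Y1 \<noteq> 0 \<and> Y2 \<noteq> 0 \<and> ordp P Y1 = ordp P Y2 \<and>
     (\<forall>R\<in>C - {Q}. ordp R Y2 \<le> ordp R Y1) \<and> (\<forall>R\<in>S. ordp R Y2 + \<kappa> \<le> ordp R Y1)"
proof -
  obtain D u0 A where uA: "u0 \<in> V D \<and> A \<in> V D \<and> A \<noteq> 0 \<and> (\<forall>R\<in>C. R \<noteq> Q \<longrightarrow> ordp_ge R (ordp R A) u0) \<and> (\<forall>c. u0 \<noteq> cst c * A)"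
    using pole_function[OF Q(1)] by (elim exE) (rule that)
  have u0: "u0 \<in> V D" and A: "A \<in> V D" "A \<noteq> 0" and nc0: "\<And>c. u0 \<noteq> cst c * A" using uA by simp_all
  have reg0: "ordp_ge R (ordp R A) u0" if "R \<in> C" "R \<noteq> Q" for R using uA that by simp
  have cP: "rep P \<in> cone" by (rule rep_cone[OF P])
  obtain c0 where c0: "ordp_ge P (Suc (ordp P A)) (u0 - cst c0 * A)"
    using leading_value[OF cP u0 reg0[OF P Q(2)] A refl] by blast
  define u where "u = u0 - cst c0 * A"
  have u: "u \<in> V D" unfolding u_def by (intro V_diff V_cst_mult u0 A)
  have nc: "u \<noteq> cst c * A" for c
  proof
    assume "u = cst c * A"
    then have "u0 = cst (c + c0) * A" unfolding u_def cst_add by (simp add: algebra_simps)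
    then show False using nc0 by blast
  qed
  have u_nz: "u \<noteq> 0" using nc[of 0] by simp
  have shift: "ordp_ge R (ordp R A) (f - cst c * A)" if "R \<in> C" "f \<in> V D" "ordp_ge R (ordp R A) f" for R f c
  proof -
    have "ordp_ge R (ordp R A) (f + cst (- c) * A)"
      by (rule ord_ge_add[OF rep_cone[OF that(1)] that(2) V_cst_mult[OF A(1)] that(3) ord_ge_cst_mult[OF rep_cone[OF that(1)] A(1) ord_ge_self]])
    then show ?thesis by (simp add: cst_uminus)
  qed
  have reg: "ordp_ge R (ordp R A) u" if "R \<in> C" "R \<noteq> Q" for R
    unfolding u_def by (rule shift[OF that(1) u0 reg0[OF that]])
  define T where "T = {R \<in> C. ordp_ge R (Suc (ordp R A)) u}"
  have "T \<subseteq> {R \<in> C. u (rep R) = 0}"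
    using ord_nonvanishing[OF rep_cone u] u_nz by (fastforce simp: T_def ord_ge_def)
  then have finT: "finite T" using finite_zero_points[OF u u_nz] by (rule finite_subset)
  have PT: "P \<in> T" using P c0 by (simp add: T_def u_def)
  obtain b where b: "b \<in> V 1" "\<And>R. R \<in> T \<Longrightarrow> b (rep R) \<noteq> 0"
    using linear_nonvanishing[of "rep ` T"] finT rep_cone by (auto simp: T_def)
  have bP: "b (rep P) \<noteq> 0" by (rule b(2)[OF PT])
  then have b0: "b \<noteq> 0" by (auto simp: fun_apply)
  have "\<exists>l. l \<in> V 1 \<and> l (rep P) \<noteq> 0 \<and> l (rep R) = 0" if "R \<in> S" for R
    using separate_reps[OF P, of R] S(2) that by blast
  then obtain l where l: "\<And>R. R \<in> S \<Longrightarrow> l R \<in> V 1 \<and> l R (rep P) \<noteq> 0 \<and> l R (rep R) = 0" by metis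
  have l0: "l R \<noteq> 0" if "R \<in> S" for R using l[OF that] by (auto simp: fun_apply)
  define \<gamma> where "\<gamma> = (\<Sum>R\<in>S. \<kappa> * 1)"
  define g where "g = (\<Prod>R\<in>S. l R ^ \<kappa>)"
  have lK: "l R ^ \<kappa> \<in> V (\<kappa> * 1) \<and> l R ^ \<kappa> \<noteq> 0" if "R \<in> S" for R
    using l[OF that] l0[OF that] V_power[of "l R" 1 \<kappa>] V_power_nonzero[of "l R" 1 \<kappa>] by blast
  have g: "g \<in> V \<gamma>" "g \<noteq> 0"
    unfolding g_def \<gamma>_def using lK by (intro V_prod, blast) (rule V_prod_nonzero[where d = "\<lambda>_. \<kappa> * 1"], rule lK)
  have og: "ordp R g = (\<Sum>R'\<in>S. ordp R (l R' ^ \<kappa>))" if "R \<in> C" for R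
    unfolding g_def by (rule ord_prod[OF rep_cone[OF that] S(1) lK])
  have gP: "ordp P g = 0"
  proof (rule ord_nonvanishing[OF cP g(1)])
    show "g (rep P) \<noteq> 0" unfolding g_def prod_fun_apply using S(1) l by (simp add: prod_zero_iff power_fun_apply)
  qed
  have gS: "\<kappa> \<le> ordp R g" if R: "R \<in> S" for R
  proof -
    have RC: "R \<in> C" using R S(2) by blast
    have "ordp R (l R) > 0" using ord_vanishing[OF rep_cone[OF RC], of "l R" 1] l[OF R] l0[OF R] by blast
    then have "\<kappa> \<le> ordp R (l R ^ \<kappa>)" using ord_power[OF rep_cone[OF RC], of "l R" 1 \<kappa>] l[OF R] l0[OF R] by simp
    also have "\<dots> \<le> ordp R g" unfolding og[OF RC] using R S(1) by (intro member_le_sum) auto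
    finally show ?thesis .
  qed
  define Z where "Z = {R \<in> C. b (rep R) = 0} - {Q}"
  have finZ: "finite Z" unfolding Z_def using finite_zero_points[OF b(1) b0] by blast
  have ZC: "R \<in> C" "R \<noteq> Q" "R \<notin> T" if "R \<in> Z" for R using that b(2) by (auto simp: Z_def)
  have "\<exists>c. ordp_ge R (Suc (ordp R A)) (u - cst c * A)" if "R \<in> Z" for R
    using leading_value[OF rep_cone u reg A refl] ZC[OF that] by blast
  then obtain c where c: "\<And>R. R \<in> Z \<Longrightarrow> ordp_ge R (Suc (ordp R A)) (u - cst (c R) * A)" by metis
  have c_nz: "c R \<noteq> 0" if "R \<in> Z" for R using c[OF that] ZC[OF that] by (auto simp: T_def)
  define w where "w R = u - cst (c R) * A" for R
  have wV: "w R \<in> V D" for R unfolding w_def by (intro V_diff V_cst_mult u A)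
  have w0: "w R \<noteq> 0" for R unfolding w_def using nc by simp
  define k where "k R = \<gamma> * ordp R b" for R
  define y where "y = (\<Prod>R\<in>Z. w R ^ k R)"
  define B where "B = (\<Prod>R\<in>Z. A ^ k R)"
  define e where "e = (\<Sum>R\<in>Z. k R * D)"
  have wk: "w R ^ k R \<in> V (k R * D) \<and> w R ^ k R \<noteq> 0" for R using V_power[OF wV] V_power_nonzero[OF wV w0] by blast
  have Ak: "A ^ k R \<in> V (k R * D) \<and> A ^ k R \<noteq> 0" for R using V_power[OF A(1)] V_power_nonzero[OF A] by blast
  have y: "y \<in> V e" "y \<noteq> 0" unfolding y_def e_def
    using wk by (intro V_prod, blast) (rule V_prod_nonzero[where d = "\<lambda>R. k R * D"], rule wk)
  have B: "B \<in> V e" "B \<noteq> 0" unfolding B_def e_def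
    using Ak by (intro V_prod, blast) (rule V_prod_nonzero[where d = "\<lambda>R. k R * D"], rule Ak)
  have oy: "ordp R y = (\<Sum>R'\<in>Z. k R' * ordp R (w R'))" if R: "R \<in> C" for R
    unfolding y_def using ord_prod[OF rep_cone[OF R] finZ, of "\<lambda>R. w R ^ k R" "\<lambda>R. k R * D"] wk
      ord_power[OF rep_cone[OF R] wV w0] by simp
  have oB: "ordp R B = (\<Sum>R'\<in>Z. k R' * ordp R A)" if R: "R \<in> C" for R
    unfolding B_def using ord_prod[OF rep_cone[OF R] finZ, of "\<lambda>R. A ^ k R" "\<lambda>R. k R * D"] Ak
      ord_power[OF rep_cone[OF R] A] by simp
  have ow: "ordp R A \<le> ordp R (w R')" if R: "R \<in> C" "R \<noteq> Q" for R R'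
    using shift[OF R(1) u reg[OF R], of "c R'"] w0[of R'] unfolding w_def by (simp add: ord_ge_def)
  have ow': "Suc (ordp R A) \<le> ordp R (w R)" if "R \<in> Z" for R
    using c[OF that] w0[of R] unfolding w_def[symmetric] by (simp add: ord_ge_def)
  have owP: "ordp P (w R) = ordp P A" if R: "R \<in> Z" for R
  proof -
    have cA: "cst (- c R) * A \<in> V D" "cst (- c R) * A \<noteq> 0" "ordp P (cst (- c R) * A) = ordp P A"
      using ord_cst_mult[OF cP A, of "- c R"] c_nz[OF R] V_cst_mult[OF A(1)] by auto
    have "ordp_ge P (Suc (ordp P (cst (- c R) * A))) u" unfolding cA(3) using PT by (simp add: T_def)
    then have "ordp P (u + cst (- c R) * A) = ordp P A"
      using ord_add_dominant(1)[OF cP u _ cA(1,2)] cA(3) by simp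
    then show ?thesis by (simp add: w_def cst_uminus)
  qed
  define Y1 where "Y1 = g * y"
  define Y2 where "Y2 = b ^ \<gamma> * B"
  have b\<gamma>: "b ^ \<gamma> \<in> V \<gamma>" "b ^ \<gamma> \<noteq> 0" using V_power[OF b(1), of \<gamma>] V_power_nonzero[OF b(1) b0] by auto
  have oY1: "ordp R Y1 = ordp R g + ordp R y" if "R \<in> C" for R
    unfolding Y1_def by (rule ord_mult[OF rep_cone[OF that] g y])
  have oY2: "ordp R Y2 = \<gamma> * ordp R b + ordp R B" if "R \<in> C" for R
    unfolding Y2_def using ord_mult[OF rep_cone[OF that] b\<gamma> B] ord_power[OF rep_cone[OF that] b(1) b0] by simp
  have key: "\<gamma> * ordp R b + ordp R B \<le> ordp R y" if R: "R \<in> C" "R \<noteq> Q" for R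
  proof (cases "R \<in> Z")
    case True
    have "\<gamma> * ordp R b + ordp R B = (\<Sum>R'\<in>Z. k R' * ordp R A + (if R' = R then k R else 0))"
      unfolding oB[OF R(1)] using True finZ by (simp add: sum.distrib k_def)
    also have "\<dots> \<le> ordp R y" unfolding oy[OF R(1)]
    proof (rule sum_mono)
      fix R' assume "R' \<in> Z"
      show "k R' * ordp R A + (if R' = R then k R else 0) \<le> k R' * ordp R (w R')"
      proof (cases "R' = R")
        case True
        have "k R * Suc (ordp R A) \<le> k R * ordp R (w R)" by (rule mult_left_mono[OF ow'[OF \<open>R \<in> Z\<close>]]) simp
        then show ?thesis using True by simp
      next
        case False
        then show ?thesis using mult_left_mono[OF ow[OF R, of R'], of "k R'"] by simp
      qed
    qed
    finally show ?thesis .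
  next
    case False
    then have "b (rep R) \<noteq> 0" using R by (simp add: Z_def)
    then have "ordp R b = 0" by (rule ord_nonvanishing[OF rep_cone[OF R(1)] b(1)])
    then show ?thesis unfolding oB[OF R(1)] oy[OF R(1)] by (simp add: sum_mono mult_left_mono ow R)
  qed
  have "Y1 \<in> V (\<gamma> + e)" "Y2 \<in> V (\<gamma> + e)" unfolding Y1_def Y2_def by (intro V_mult g y b\<gamma> B)+
  moreover have "Y1 \<noteq> 0" "Y2 \<noteq> 0" unfolding Y1_def Y2_def
    by (rule V_mult_nonzero[OF g(1) y(1) g(2) y(2)], rule V_mult_nonzero[OF b\<gamma>(1) B(1) b\<gamma>(2) B(2)])
  moreover have "ordp P Y1 = ordp P Y2"
    unfolding oY1[OF P] oY2[OF P] oy[OF P] oB[OF P] gP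
    using ord_nonvanishing[OF cP b(1) bP] owP by simp
  moreover have "\<forall>R\<in>C - {Q}. ordp R Y2 \<le> ordp R Y1"
    using key oY1 oY2 by (simp add: trans_le_add2)
  moreover have "\<forall>R\<in>S. ordp R Y2 + \<kappa> \<le> ordp R Y1"
  proof
    fix R assume R: "R \<in> S"
    then have "R \<in> C" "R \<noteq> Q" using S(2) by auto
    then show "ordp R Y2 + \<kappa> \<le> ordp R Y1" using key[of R] gS[OF R] oY1 oY2 by simp
  qed
  ultimately show ?thesis by blast
qed

end

section \<open>Frobenius\<close>

lemma card_UNIV_pos [simp]: "0 < card (UNIV :: 'a::finite set)"
  by (simp add: card_gt_0_iff)

lemma finite_field_power_card_eq:
  fixes a :: "'a::{field,finite}"
  shows "a ^ card (UNIV :: 'a set) = a"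
proof (cases "a = 0")
  case True
  then show ?thesis by (simp add: zero_power)
next
  case False
  let ?U = "UNIV - {0 :: 'a}"
  have "bij_betw ((*) a) ?U ?U"
    by (rule bij_betw_byWitness[where f' = "(*) (inverse a)"]) (use False in \<open>auto simp: field_simps\<close>)
  then have "(\<Prod>x\<in>?U. a * x) = (\<Prod>x\<in>?U. x)" by (rule prod.reindex_bij_betw)
  then have "a ^ card ?U * (\<Prod>x\<in>?U. x) = (\<Prod>x\<in>?U. x)" by (simp add: prod.distrib)
  moreover have "(\<Prod>x\<in>?U. x) \<noteq> 0" by (simp add: prod_zero_iff)
  ultimately have 1: "a ^ card ?U = 1" by simp
  have c: "card (UNIV :: 'a set) = Suc (card ?U)" by (simp add: card_Diff_singleton)
  show ?thesis unfolding c power_Suc2 1 by simp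
qed

definition frob :: "'a::{field,finite} alg_closure \<Rightarrow> 'a alg_closure" where
  "frob x = x ^ card (UNIV :: 'a set)"

text \<open>
  The polynomial \<open>(X + 1)\<^sup>q - X\<^sup>q - 1\<close>, with \<open>q\<close> the number of field elements, vanishes on the
  whole field and has degree less than \<open>q\<close>, so all its coefficients are \<open>0\<close>.
\<close>

lemma binomial_card_eq_0:
  assumes "0 < i" "i < card (UNIV :: 'a::{field,finite} set)"
  shows "of_nat (card (UNIV :: 'a set) choose i) = (0 :: 'a)"
proof -
  let ?q = "card (UNIV :: 'a set)"
  define p where "p = (\<Sum>i\<in>{0<..<?q}. Polynomial.monom (of_nat (?q choose i) :: 'a) i)"
  have c: "Polynomial.coeff p i = (if 0 < i \<and> i < ?q then of_nat (?q choose i) else 0)" for i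
    by (simp add: p_def coeff_sum)
  have q0: "0 < ?q" by simp
  have "poly p a = 0" for a
  proof -
    have "{..?q} = insert 0 (insert ?q {0<..<?q})" using q0 by auto
    then have "(a + 1) ^ ?q = 1 + (a ^ ?q + (\<Sum>i\<in>{0<..<?q}. of_nat (?q choose i) * a ^ i))"
      unfolding binomial_ring using q0 by simp
    also have "(\<Sum>i\<in>{0<..<?q}. of_nat (?q choose i) * a ^ i) = poly p a"
      by (simp add: p_def poly_sum poly_monom)
    finally show ?thesis unfolding finite_field_power_card_eq by simp
  qed
  then have "card {x. poly p x = 0} = ?q" by simp
  moreover have "Polynomial.degree p < ?q"
    by (rule le_less_trans[OF degree_le[of "?q - 1"]]) (auto simp: c q0)
  ultimately have "p = 0" using card_poly_roots_bound[of p] by fastforce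
  then show ?thesis using c[of i] assms by simp
qed

lemma frob_add: "frob (x + y) = frob x + frob (y :: 'a::{field,finite} alg_closure)"
proof -
  let ?q = "card (UNIV :: 'a set)"
  have q0: "0 < ?q" by simp
  have z: "of_nat (?q choose i) = (0 :: 'a alg_closure)" if "0 < i" "i < ?q" for i
    using binomial_card_eq_0[OF that] by (metis to_ac_0 to_ac_of_nat)
  have "{..?q} = insert 0 (insert ?q {0<..<?q})" using q0 by auto
  then have "(x + y) ^ ?q = y ^ ?q + (x ^ ?q + (\<Sum>i\<in>{0<..<?q}. of_nat (?q choose i) * x ^ i * y ^ (?q - i)))"
    unfolding binomial_ring using q0 by simp
  also have "(\<Sum>i\<in>{0<..<?q}. of_nat (?q choose i) * x ^ i * y ^ (?q - i)) = 0"
    using z by (intro sum.neutral) simp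
  finally show ?thesis by (simp add: frob_def add.commute)
qed

lemma frob_mult: "frob (x * y) = frob x * frob y" by (simp add: frob_def power_mult_distrib)
lemma frob_0 [simp]: "frob 0 = 0" by (simp add: frob_def zero_power)
lemma frob_1 [simp]: "frob 1 = 1" by (simp add: frob_def)
lemma frob_eq_0_iff [simp]: "frob x = 0 \<longleftrightarrow> x = 0" by (simp add: frob_def)

lemma frob_to_ac [simp]: "frob (to_ac a) = to_ac a"
  by (simp add: frob_def flip: to_ac_power) (simp add: finite_field_power_card_eq)

lemma frob_diff: "frob (x - y) = frob x - frob y"
  using frob_add[of "x - y" y] by (simp add: algebra_simps)

lemma inj_frob: "inj frob"
proof (rule injI)
  fix x y :: "'a alg_closure" assume "frob x = frob y"
  then have "frob (x - y) = 0" by (simp add: frob_diff)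
  then show "x = y" by simp
qed

text \<open>
  The elements of the base field are already \<open>q\<close> roots of \<open>X\<^sup>q - X\<close>.
\<close>

lemma frob_fixed: assumes "frob (x :: 'a::{field,finite} alg_closure) = x" shows "x \<in> range to_ac"
proof -
  let ?q = "card (UNIV :: 'a set)"
  have "card {0, 1 :: 'a} \<le> ?q" by (rule card_mono) auto
  then have q1: "1 < ?q" by simp
  let ?p = "Polynomial.monom 1 ?q - Polynomial.monom (1 :: 'a alg_closure) 1"
  have p0: "?p \<noteq> 0"
  proof
    assume "?p = 0"
    then have "Polynomial.coeff ?p ?q = 0" by (simp only: coeff_0)
    then show False using q1 by simp
  qed
  have deg: "Polynomial.degree ?p \<le> ?q" by (rule degree_le) (use q1 in auto)
  have roots: "{x. poly ?p x = 0} = {x. frob x = x}" by (simp add: poly_monom frob_def)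
  have sub: "range to_ac \<subseteq> {x :: 'a alg_closure. frob x = x}" by auto
  have fin: "finite {x :: 'a alg_closure. frob x = x}" using poly_roots_finite[OF p0] roots by simp
  have le: "card {x :: 'a alg_closure. frob x = x} \<le> card (range (to_ac :: 'a \<Rightarrow> _))"
    using card_poly_roots_bound[OF p0] deg roots by (simp add: card_image[OF inj_to_ac])
  have "range to_ac = {x :: 'a alg_closure. frob x = x}" by (rule card_seteq[OF fin sub le])
  then show ?thesis using assms by blast
qed

lemma frob_power: "(frob ^^ i) x = (x :: 'a::{field,finite} alg_closure) ^ (card (UNIV :: 'a set) ^ i)"
  by (induction i) (simp_all add: frob_def power_mult mult.commute flip: power_mult)

text \<open>
  All powers of \<open>x\<close> lie in the space \<open>S\<close> spanned by finitely many of them over the base field.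
  This space is finite, so two iterates of Frobenius agree on \<open>x\<close>, and Frobenius is injective.
\<close>

lemma frob_periodic: "\<exists>r>0. (frob ^^ r) x = (x :: 'a::{field,finite} alg_closure)"
proof -
  obtain p :: "'a poly" where p: "p \<noteq> 0" "poly (map_poly to_ac p) x = 0" by (rule alg_closure_algebraic)
  define D where "D = Polynomial.degree p"
  have px: "(\<Sum>i\<le>D. to_ac (Polynomial.coeff p i) * x ^ i) = 0"
    using p(2) by (simp add: poly_altdef degree_map_poly coeff_map_poly D_def)
  have lc: "Polynomial.coeff p D \<noteq> 0" using p(1) by (simp add: D_def)
  have D0: "D > 0"
  proof (rule ccontr)
    assume "\<not> D > 0"
    then show False using px lc by simp
  qed
  define S where "S = {\<Sum>i<D. to_ac (c i) * x ^ i |c :: nat \<Rightarrow> 'a. True}"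
  have S_add: "s + s' \<in> S" if s: "s \<in> S" "s' \<in> S" for s s'
  proof -
    obtain c c' where "s = (\<Sum>i<D. to_ac (c i) * x ^ i)" "s' = (\<Sum>i<D. to_ac (c' i) * x ^ i)"
      using s by (auto simp: S_def)
    then have "s + s' = (\<Sum>i<D. to_ac (c i + c' i) * x ^ i)" by (simp add: sum.distrib distrib_right)
    then show ?thesis unfolding S_def by (intro CollectI exI[of _ "\<lambda>i. c i + c' i"] conjI TrueI)
  qed
  have S_scale: "to_ac a * s \<in> S" if s: "s \<in> S" for s a
  proof -
    obtain c where "s = (\<Sum>i<D. to_ac (c i) * x ^ i)" using s by (auto simp: S_def)
    then have "to_ac a * s = (\<Sum>i<D. to_ac (a * c i) * x ^ i)" by (simp add: sum_distrib_left mult.assoc)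
    then show ?thesis unfolding S_def by (intro CollectI exI[of _ "\<lambda>i. a * c i"] conjI TrueI)
  qed
  have S_0: "0 \<in> S" unfolding S_def by (rule CollectI, rule exI[of _ "\<lambda>_. 0"]) simp
  have S_sum: "(\<Sum>i\<in>A. f i) \<in> S" if "\<And>i. i \<in> A \<Longrightarrow> f i \<in> S" for A :: "nat set" and f
    using that by (induction A rule: infinite_finite_induct) (auto intro: S_0 S_add)
  have S_base: "x ^ i \<in> S" if "i < D" for i
  proof -
    have "(\<Sum>j<D. to_ac (if j = i then 1 else 0 :: 'a) * x ^ j) = (\<Sum>j<D. if j = i then x ^ j else 0)"
      by (intro sum.cong) auto
    also have "\<dots> = x ^ i" using that by simp
    finally have "x ^ i = (\<Sum>j<D. to_ac (if j = i then 1 else 0 :: 'a) * x ^ j)" by (rule sym)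
    then show ?thesis unfolding S_def by (intro CollectI exI[of _ "\<lambda>j. if j = i then 1 else 0"] conjI TrueI)
  qed
  have S_D: "x ^ D \<in> S"
  proof -
    have "(\<Sum>i<D. to_ac (Polynomial.coeff p i) * x ^ i) + to_ac (Polynomial.coeff p D) * x ^ D = 0"
      using px by (simp flip: lessThan_Suc_atMost)
    then have "to_ac (Polynomial.coeff p D) * x ^ D = - (\<Sum>i<D. to_ac (Polynomial.coeff p i) * x ^ i)"
      by (simp add: eq_neg_iff_add_eq_0 add.commute)
    then have "x ^ D = to_ac (- inverse (Polynomial.coeff p D)) * (\<Sum>i<D. to_ac (Polynomial.coeff p i) * x ^ i)"
      using lc by (simp add: field_simps)
    also have "\<dots> \<in> S" by (rule S_scale) (auto simp: S_def)
    finally show ?thesis .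
  qed
  have S_x: "x * s \<in> S" if s: "s \<in> S" for s
  proof -
    obtain c where c: "s = (\<Sum>i<D. to_ac (c i) * x ^ i)" using s by (auto simp: S_def)
    have "x * s = (\<Sum>i<D. to_ac (c i) * x ^ Suc i)" unfolding c by (simp add: sum_distrib_left mult_ac)
    also have "\<dots> \<in> S"
    proof (rule S_sum, rule S_scale)
      fix i assume "i \<in> {..<D}"
      then show "x ^ Suc i \<in> S" using S_base[of "Suc i"] S_D by (cases "Suc i = D") auto
    qed
    finally show ?thesis .
  qed
  have S_pow: "x ^ m \<in> S" for m
    by (induction m) (use S_base[OF D0] S_x in auto)
  have "finite S"
  proof -
    have "S \<subseteq> (\<lambda>c. \<Sum>i<D. to_ac (c i) * x ^ i) ` {f. \<forall>i. (i \<in> {..<D} \<longrightarrow> f i \<in> (UNIV :: 'a set)) \<and> (i \<notin> {..<D} \<longrightarrow> f i = 0)}"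
    proof
      fix s assume "s \<in> S"
      then obtain c where c: "s = (\<Sum>i<D. to_ac (c i) * x ^ i)" by (auto simp: S_def)
      then have "s = (\<Sum>i<D. to_ac ((\<lambda>i. if i < D then c i else 0) i) * x ^ i)" by simp
      then show "s \<in> (\<lambda>c. \<Sum>i<D. to_ac (c i) * x ^ i) ` {f. \<forall>i. (i \<in> {..<D} \<longrightarrow> f i \<in> (UNIV :: 'a set)) \<and> (i \<notin> {..<D} \<longrightarrow> f i = 0)}"
        by (rule image_eqI[of _ _ "\<lambda>i. if i < D then c i else 0"]) auto
    qed
    moreover have "finite {f. \<forall>i. (i \<in> {..<D} \<longrightarrow> f i \<in> (UNIV :: 'a set)) \<and> (i \<notin> {..<D} \<longrightarrow> f i = 0)}"
      by (rule finite_set_of_finite_funs) auto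
    ultimately show ?thesis using finite_subset by blast
  qed
  moreover have "range (\<lambda>i. (frob ^^ i) x) \<subseteq> S" using S_pow by (auto simp: frob_power)
  ultimately have "finite (range (\<lambda>i. (frob ^^ i) x))" by (rule rev_finite_subset)
  then have "\<not> inj (\<lambda>i. (frob ^^ i) x)" using finite_imageD infinite_UNIV_nat by blast
  then obtain i j where "i \<noteq> j" "(frob ^^ i) x = (frob ^^ j) x" by (auto simp: inj_def)
  then obtain i j where ij: "i < j" "(frob ^^ i) x = (frob ^^ j) x"
    by (metis linorder_neqE_nat)
  have "(frob ^^ j) x = (frob ^^ i) ((frob ^^ (j - i)) x)"
    using ij(1) by (metis add_diff_inverse_nat comp_apply funpow_add not_less_iff_gr_or_eq)
  then have "(frob ^^ i) x = (frob ^^ i) ((frob ^^ (j - i)) x)" using ij(2) by simp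
  moreover have "inj (frob ^^ i :: 'a alg_closure \<Rightarrow> _)" by (rule inj_fn[OF inj_frob])
  ultimately have "(frob ^^ (j - i)) x = x" by (metis injD)
  then show ?thesis using ij(1) by (intro exI[of _ "j - i"]) simp
qed

lemma frob_periodic_finite:
  assumes "finite S"
  shows "\<exists>r>0. \<forall>x\<in>S. (frob ^^ r) (x :: 'a::{field,finite} alg_closure) = x"
  using assms
proof (induction S rule: finite_induct)
  case empty
  show ?case by auto
next
  case (insert y S)
  then obtain r where r: "r > 0" "\<forall>x\<in>S. (frob ^^ r) x = x" by blast
  obtain s where s: "s > 0" "(frob ^^ s) y = y" using frob_periodic by blast
  have it: "((frob ^^ a) ^^ b) x = x" if "(frob ^^ a) x = x" for a b and x :: "'a alg_closure"
    using that by (induction b) auto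
  have "(frob ^^ (r * s)) x = x" if "x \<in> insert y S" for x
    using that r s it[of r x s] it[of s x r] by (auto simp: funpow_mult mult.commute)
  then show ?case using r s by (intro exI[of _ "r * s"]) auto
qed

section \<open>Conjugate polynomials\<close>

locale coeff_hom =
  fixes h :: "'a::field \<Rightarrow> 'b::field"
  assumes h_add: "h (x + y) = h x + h y" and h_mult: "h (x * y) = h x * h y" and h_1: "h 1 = 1"
begin

lemma h_0 [simp]: "h 0 = 0" using h_add[of 0 0] by (metis add.right_neutral add_left_cancel)

lemma h_power: "h (x ^ k) = h x ^ k" by (induction k) (auto simp: h_1 h_mult)

lemma h_prod: "h (\<Prod>i\<in>A. f i) = (\<Prod>i\<in>A. h (f i))"
  by (induction A rule: infinite_finite_induct) (auto simp: h_mult h_1)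

lemma lookup_map_h: "Poly_Mapping.lookup (Poly_Mapping.map h p) m = h (Poly_Mapping.lookup p m)"
  by (simp add: Poly_Mapping.map.rep_eq when_def)

lemma map_h_add: "Poly_Mapping.map h (p + q) = Poly_Mapping.map h p + Poly_Mapping.map h q"
  by (rule poly_mapping_eqI) (simp add: lookup_map_h lookup_add h_add)

lemma map_h_single: "Poly_Mapping.map h (Poly_Mapping.single m c) = Poly_Mapping.single m (h c)"
  by (rule poly_mapping_eqI) (simp add: lookup_map_h lookup_single when_def)

lemma map_h_0: "Poly_Mapping.map h 0 = 0"
  by (rule poly_mapping_eqI) (simp add: lookup_map_h)

lemma map_h_mult: "Poly_Mapping.map h (p * q) = Poly_Mapping.map h p * Poly_Mapping.map h (q :: 'a mpoly)"
proof (induction p rule: mpoly_induct)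
  case (single m c)
  show ?case
    by (induction q rule: mpoly_induct) (simp_all add: map_h_0 map_h_add map_h_single mult_single h_mult distrib_left)
qed (simp_all add: map_h_0 map_h_add distrib_right)

lemma map_h_1: "Poly_Mapping.map h (1 :: 'a mpoly) = 1"
  using map_h_single[of 0 1] by (simp add: h_1)

lemma map_h_prod: "Poly_Mapping.map h (\<Prod>i\<in>A. f i) = (\<Prod>i\<in>A. Poly_Mapping.map h (f i :: 'a mpoly))"
  by (induction A rule: infinite_finite_induct) (simp_all add: map_h_mult map_h_1)

lemma eval_map_h: "mpoly_eval (\<lambda>i. h (v i)) (Poly_Mapping.map h p) = h (mpoly_eval v p)"
proof (induction p rule: mpoly_induct)
  case zero
  show ?case by (simp add: map_h_0)
next
  case (single m c)
  show ?case by (simp add: map_h_single mpoly_eval_single monom_eval_def h_mult h_prod h_power)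
next
  case (add p q)
  then show ?case by (simp add: map_h_add mpoly_eval_add h_add)
qed

lemma form_map_h: "form n d p \<Longrightarrow> form n d (Poly_Mapping.map h p)"
  unfolding form_iff_monom_deg by (auto simp: in_keys_iff lookup_map_h)

end

interpretation frob: coeff_hom "frob :: 'a::{field,finite} alg_closure \<Rightarrow> 'a alg_closure"
  by unfold_locales (simp_all add: frob_add frob_mult)

interpretation to_ac: coeff_hom "to_ac :: 'a::field \<Rightarrow> 'a alg_closure"
  by unfold_locales simp_all

definition conj_poly :: "'a::{field,finite} alg_closure mpoly \<Rightarrow> 'a alg_closure mpoly" where
  "conj_poly = Poly_Mapping.map frob"

definition conj_vec :: "(nat \<Rightarrow> 'a::{field,finite} alg_closure) \<Rightarrow> nat \<Rightarrow> 'a alg_closure" where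
  "conj_vec v = (\<lambda>i. frob (v i))"

lemma eval_conj: "mpoly_eval (conj_vec v) (conj_poly p) = frob (mpoly_eval v p)"
  unfolding conj_vec_def conj_poly_def by (rule frob.eval_map_h)

lemma conj_base_change: "conj_poly (base_change p) = base_change p"
  unfolding conj_poly_def
  by (rule poly_mapping_eqI) (simp add: frob.lookup_map_h to_ac.lookup_map_h)

lemma form_conj: "form n d p \<Longrightarrow> form n d (conj_poly p)"
  unfolding conj_poly_def by (rule frob.form_map_h)

lemma form_conj_iter: "form n d p \<Longrightarrow> form n d ((conj_poly ^^ i) p)"
  by (induction i) (auto intro: form_conj)

text \<open>Two polynomials have only finitely many coefficients, hence a common period.\<close>

lemma conj_poly_periodic:
  fixes p p' :: "'a::{field,finite} alg_closure mpoly"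
  shows "\<exists>r>0. (conj_poly ^^ r) p = p \<and> (conj_poly ^^ r) p' = p'"
proof -
  have lk: "Poly_Mapping.lookup ((conj_poly ^^ r) s) m = (frob ^^ r) (Poly_Mapping.lookup s m)"
    for r s and m :: "nat \<Rightarrow>\<^sub>0 nat"
    by (induction r) (simp_all add: conj_poly_def frob.lookup_map_h)
  let ?S = "Poly_Mapping.lookup p ` Poly_Mapping.keys p \<union> Poly_Mapping.lookup p' ` Poly_Mapping.keys p'"
  obtain r where r: "r > 0" "\<forall>x\<in>?S. (frob ^^ r) x = x" using frob_periodic_finite[of ?S] by auto
  have 0: "(frob ^^ r) 0 = 0" by (induction r) auto
  have "(conj_poly ^^ r) p = p"
    by (rule poly_mapping_eqI) (use r 0 in \<open>metis (no_types, lifting) UnCI image_eqI in_keys_iff lk\<close>)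
  moreover have "(conj_poly ^^ r) p' = p'"
    by (rule poly_mapping_eqI) (use r 0 in \<open>metis (no_types, lifting) UnCI image_eqI in_keys_iff lk\<close>)
  ultimately show ?thesis using r by blast
qed

text \<open>
  If \<open>r\<close> is a period of \<open>p\<close>, this product of conjugates is invariant under Frobenius.
\<close>

definition norm_poly :: "nat \<Rightarrow> 'a::{field,finite} alg_closure mpoly \<Rightarrow> 'a alg_closure mpoly" where
  "norm_poly r p = (\<Prod>i<r. (conj_poly ^^ i) p)"

lemma norm_poly_base:
  assumes "(conj_poly ^^ r) p = p" "r > 0"
  shows "\<exists>g. norm_poly r p = base_change g"
proof -
  have "conj_poly (norm_poly r p) = (\<Prod>i<r. (conj_poly ^^ Suc i) p)"
    unfolding norm_poly_def conj_poly_def frob.map_h_prod by simp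
  moreover have "p * (\<Prod>i<r. (conj_poly ^^ Suc i) p) = (\<Prod>i<Suc r. (conj_poly ^^ i) p)"
    by (subst prod.lessThan_Suc_shift) simp
  moreover obtain r' where r': "r = Suc r'" using assms(2) by (cases r) auto
  have "(\<Prod>i<r. (conj_poly ^^ Suc i) p) = (\<Prod>i<r'. (conj_poly ^^ Suc i) p) * p"
    unfolding r' prod.lessThan_Suc using assms(1) r' by simp
  moreover have "norm_poly r p = p * (\<Prod>i<r'. (conj_poly ^^ Suc i) p)"
    unfolding norm_poly_def r' by (subst prod.lessThan_Suc_shift) simp
  ultimately have fixd: "conj_poly (norm_poly r p) = norm_poly r p" by (simp add: mult.commute)
  have "Poly_Mapping.lookup (norm_poly r p) m \<in> range to_ac" for m
  proof (rule frob_fixed)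
    show "frob (Poly_Mapping.lookup (norm_poly r p) m) = Poly_Mapping.lookup (norm_poly r p) m"
      using arg_cong[OF fixd, of "\<lambda>s. Poly_Mapping.lookup s m"] unfolding conj_poly_def frob.lookup_map_h .
  qed
  then have "norm_poly r p = base_change (Poly_Mapping.map of_ac (norm_poly r p))"
    by (intro poly_mapping_eqI) (simp add: to_ac.lookup_map_h Poly_Mapping.map.rep_eq when_def to_ac_of_ac del: of_ac_to_ac, metis of_ac_to_ac rangeE to_ac_0)
  then show ?thesis by blast
qed

lemma form_norm: "form n d p \<Longrightarrow> form n (r * d) (norm_poly r p)"
proof (induction r)
  case 0
  show ?case by (simp add: norm_poly_def form_1)
next
  case (Suc r)
  then have "form n (r * d + d) (norm_poly r p * (conj_poly ^^ r) p)"
    by (intro form_mult form_conj_iter)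
  then show ?case by (simp add: norm_poly_def add.commute)
qed

section \<open>Descent to the base field\<close>

locale finite_field_curve = smooth_variety_curve n C
  for n and C :: "'a::{field,finite} alg_closure proj_point set" +
  assumes over_base: "defined_over_base n C"
begin

text \<open>
  The equations of \<open>C\<close> have coefficients in the base field, so Frobenius maps \<open>C\<close> to itself.
\<close>

lemma conj_vec_cone:
  assumes v: "v \<in> cone"
  shows "conj_vec v \<in> cone"
proof -
  obtain E :: "'a mpoly set" where E: "\<forall>p\<in>E. \<exists>d. form n d p" "C = proj_zeros n (base_change ` E)"
    using over_base unfolding defined_over_base_def by blast
  have vC: "point_of v \<in> C" by (rule point_of_in_C[OF v])
  have "point_of (conj_vec v) \<in> proj_zeros n (base_change ` E)"
    unfolding proj_zeros_def
  proof (intro CollectI conjI ballI)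
    obtain i where "v i \<noteq> 0" using cone_nonzero[OF v] by blast
    then show "point_of (conj_vec v) \<in> proj_space n"
      using cone_supp[OF v] unfolding proj_space_iff conj_vec_def
      by (intro exI[of _ "\<lambda>i. frob (v i)"]) auto
    fix p' w assume "p' \<in> base_change ` E" and w: "w \<in> point_of (conj_vec v)"
    then obtain p where p: "p \<in> E" "p' = base_change p" by blast
    obtain d where d: "form n d p" using E(1) p by blast
    have d': "form n d (base_change p)" by (rule to_ac.form_map_h[OF d])
    have "mpoly_eval v (base_change p) = 0" using vC p(1) point_of_self unfolding E(2) proj_zeros_def by blast
    then have "mpoly_eval (conj_vec v) (base_change p) = 0"
      using eval_conj[of v "base_change p"] by (simp add: conj_base_change)
    then show "mpoly_eval w p' = 0" using w form_eval_scale[OF d'] by (auto simp: p point_of_def)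
  qed
  then show ?thesis using C_cone[of "point_of (conj_vec v)"] point_of_self E(2) by blast
qed

lemma conj_vec_iter: "(conj_vec ^^ r) v i = (frob ^^ r) (v i)"
  by (induction r) (simp_all add: conj_vec_def)

lemma conj_vec_iter_cone: "v \<in> cone \<Longrightarrow> (conj_vec ^^ r) v \<in> cone"
  by (induction r) (auto intro: conj_vec_cone)

lemma conj_vec_surj:
  assumes v: "v \<in> cone"
  shows "\<exists>v'\<in>cone. conj_vec v' = v"
proof -
  obtain r where r: "r > 0" "\<forall>x\<in>v ` {..n}. (frob ^^ r) x = x" using frob_periodic_finite[of "v ` {..n}"] by auto
  have 0: "(frob ^^ r) 0 = (0 :: 'a alg_closure)" by (induction r) auto
  have "conj_vec ((conj_vec ^^ (r - 1)) v) = (conj_vec ^^ r) v"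
    using r(1) by (metis Suc_diff_1 comp_apply funpow.simps(2))
  also have "\<dots> = v"
  proof
    fix i show "(conj_vec ^^ r) v i = v i"
      unfolding conj_vec_iter using r(2) 0 cone_supp[OF v, of i] by (cases "i \<le> n") auto
  qed
  finally show ?thesis using conj_vec_iter_cone[OF v] by blast
qed

lemma conj_vec_iter_surj: "v \<in> cone \<Longrightarrow> \<exists>v'\<in>cone. (conj_vec ^^ i) v' = v"
proof (induction i arbitrary: v)
  case (Suc i)
  obtain w where w: "w \<in> cone" "conj_vec w = v" using conj_vec_surj[OF Suc.prems] by blast
  obtain v' where "v' \<in> cone" "(conj_vec ^^ i) v' = w" using Suc.IH[OF w(1)] by blast
  then show ?case using w(2) by (intro bexI[of _ v']) auto
qed auto

lemma Ev_conj: "v \<in> cone \<Longrightarrow> Ev (conj_poly p) (conj_vec v) = frob (Ev p v)"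
  by (simp add: Ev_apply conj_vec_cone eval_conj)

lemma V_eqI_conj:
  assumes "\<phi> \<in> V d" "\<psi> \<in> V e" "\<And>v. v \<in> cone \<Longrightarrow> \<phi> (conj_vec v) = \<psi> (conj_vec v)"
  shows "\<phi> = \<psi>"
  by (rule V_eqI[OF assms(1,2)]) (use conj_vec_surj assms(3) in blast)

lemma Ev_conj_nonzero:
  assumes p: "form n d p" "Ev p \<noteq> 0"
  shows "Ev (conj_poly p) \<noteq> 0"
proof
  assume 0: "Ev (conj_poly p) = 0"
  obtain v where v: "v \<in> cone" "Ev p v \<noteq> 0" using V_nonzero[OF VI[OF p(1)] p(2)] by blast
  show False using Ev_conj[OF v(1), of p] v(2) unfolding 0 by (simp add: fun_apply)
qed

lemma conj_poly_surj: "form n d p \<Longrightarrow> \<exists>p'. form n d p' \<and> conj_poly p' = p"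
proof -
  assume p: "form n d p"
  obtain r where r: "r > 0" "(conj_poly ^^ r) p = p" using conj_poly_periodic[of p p] by blast
  have "conj_poly ((conj_poly ^^ (r - 1)) p) = p" using r by (metis Suc_diff_1 comp_apply funpow.simps(2))
  then show ?thesis using form_conj_iter[OF p] by blast
qed

text \<open>
  Frobenius acts bijectively on forms and on the cone and respects values, so every divisibility
  in the local ring at \<open>v\<close> has a conjugate at the conjugate point.
\<close>

lemma loc_param_conj:
  assumes v: "v \<in> cone" and p: "form n 1 p" "loc_param v (Ev p)"
  shows "loc_param (conj_vec v) (Ev (conj_poly p))"
  unfolding loc_param_def
proof (intro conjI allI impI)
  show "Ev (conj_poly p) \<in> V 1" by (rule VI[OF form_conj[OF p(1)]])
  show "Ev (conj_poly p) \<noteq> 0" by (rule Ev_conj_nonzero[OF p(1) loc_paramD(2)[OF p(2)]])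
  show "Ev (conj_poly p) (conj_vec v) = 0" using Ev_conj[OF v, of p] loc_paramD(3)[OF p(2)] by simp
  fix d \<phi> assume \<phi>: "\<phi> \<in> V d" "\<phi> (conj_vec v) = 0"
  obtain s' where s': "form n d s'" "\<phi> = Ev s'" using VE[OF \<phi>(1)] by blast
  obtain s where s: "form n d s" "conj_poly s = s'" using conj_poly_surj[OF s'(1)] by blast
  have "frob (Ev s v) = 0" using \<phi>(2) unfolding s'(2) s(2)[symmetric] Ev_conj[OF v] .
  then have sv: "Ev s v = 0" by simp
  obtain e f u \<psi> where 1: "u \<in> V e" "u v \<noteq> 0" "\<psi> \<in> V f" "d + e = f + 1" "u * Ev s = Ev p * \<psi>"
    by (rule loc_param_dvd[OF p(2) VI[OF s(1)] sv])
  obtain pu where pu: "form n e pu" "u = Ev pu" using VE[OF 1(1)] by blast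
  obtain ps where ps: "form n f ps" "\<psi> = Ev ps" using VE[OF 1(3)] by blast
  have "Ev (conj_poly pu) * \<phi> = Ev (conj_poly p) * Ev (conj_poly ps)"
  proof (rule V_eqI_conj)
    show "Ev (conj_poly pu) * \<phi> \<in> V (e + d)" by (intro V_mult VI form_conj pu \<phi>)
    show "Ev (conj_poly p) * Ev (conj_poly ps) \<in> V (1 + f)" by (intro V_mult VI form_conj p ps)
    fix x assume x: "x \<in> cone"
    have "(u * Ev s) x = (Ev p * \<psi>) x" using 1(5) by simp
    then have "Ev pu x * Ev s x = Ev p x * Ev ps x" by (simp add: fun_apply pu ps)
    then have "frob (Ev pu x) * frob (Ev s x) = frob (Ev p x) * frob (Ev ps x)" by (simp flip: frob_mult)
    then show "(Ev (conj_poly pu) * \<phi>) (conj_vec x) = (Ev (conj_poly p) * Ev (conj_poly ps)) (conj_vec x)"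
      unfolding s'(2) s(2)[symmetric] times_fun_apply Ev_conj[OF x] .
  qed
  moreover have "Ev (conj_poly pu) (conj_vec v) \<noteq> 0" using Ev_conj[OF v, of pu] 1(2) pu(2) by simp
  moreover have "Ev (conj_poly pu) \<in> V e" "Ev (conj_poly ps) \<in> V f" by (intro VI form_conj pu ps)+
  ultimately show "\<exists>e f u \<psi>. u \<in> V e \<and> u (conj_vec v) \<noteq> 0 \<and> \<psi> \<in> V f \<and> d + e = f + 1 \<and> u * \<phi> = Ev (conj_poly p) * \<psi>"
    using 1(4) by blast
qed

lemma ord_conj:
  assumes v: "v \<in> cone" and p: "form n d p" "Ev p \<noteq> 0"
  shows "ord (conj_vec v) (Ev (conj_poly p)) = ord v (Ev p)"
proof -
  obtain t where t: "loc_param v t" using loc_param_ex[OF v] by blast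
  obtain pt where pt: "form n 1 pt" "t = Ev pt" using VE[OF loc_paramD(1)[OF t]] by blast
  define m where "m = ord v (Ev p)"
  obtain e f u \<psi> where 1: "u \<in> V e" "u v \<noteq> 0" "\<psi> \<in> V f" "\<psi> v \<noteq> 0" "d + e = m + f" "u * Ev p = t ^ m * \<psi>"
    unfolding m_def using ord_exact[OF v t VI[OF p(1)] p(2)] by (rule exact_orderE)
  obtain pu where pu: "form n e pu" "u = Ev pu" using VE[OF 1(1)] by blast
  obtain ps where ps: "form n f ps" "\<psi> = Ev ps" using VE[OF 1(3)] by blast
  have t': "loc_param (conj_vec v) (Ev (conj_poly pt))" using loc_param_conj[OF v pt(1)] t pt(2) by simp
  have "exact_order (conj_vec v) (Ev (conj_poly pt)) d m (Ev (conj_poly p))"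
  proof (rule exact_orderI)
    show "Ev (conj_poly pu) \<in> V e" "Ev (conj_poly ps) \<in> V f" by (intro VI form_conj pu ps)+
    show "Ev (conj_poly pu) (conj_vec v) \<noteq> 0" "Ev (conj_poly ps) (conj_vec v) \<noteq> 0"
      using Ev_conj[OF v] 1 pu ps by simp_all
    show "d + e = m + f" by fact
    show "Ev (conj_poly pu) * Ev (conj_poly p) = Ev (conj_poly pt) ^ m * Ev (conj_poly ps)"
    proof (rule V_eqI_conj)
      show "Ev (conj_poly pu) * Ev (conj_poly p) \<in> V (e + d)" by (intro V_mult VI form_conj pu p)
      show "Ev (conj_poly pt) ^ m * Ev (conj_poly ps) \<in> V (m * 1 + f)" by (intro V_mult V_power VI form_conj pt ps)
      fix x assume x: "x \<in> cone"
      have "(u * Ev p) x = (t ^ m * \<psi>) x" using 1(6) by simp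
      then have "Ev pu x * Ev p x = Ev pt x ^ m * Ev ps x" by (simp add: fun_apply power_fun_apply pu ps pt)
      then have "frob (Ev pu x) * frob (Ev p x) = frob (Ev pt x) ^ m * frob (Ev ps x)"
        by (metis frob_mult frob.h_power)
      then show "(Ev (conj_poly pu) * Ev (conj_poly p)) (conj_vec x) = (Ev (conj_poly pt) ^ m * Ev (conj_poly ps)) (conj_vec x)"
        unfolding times_fun_apply power_fun_apply Ev_conj[OF x] .
    qed
  qed
  then show ?thesis unfolding m_def[symmetric] by (rule ord_eqI[OF VI[OF form_conj[OF p(1)]] t'])
qed

lemma ord_conj_iter:
  assumes v: "v \<in> cone" and p: "form n d p" "Ev p \<noteq> 0"
  shows "Ev ((conj_poly ^^ i) p) \<noteq> 0" "ord ((conj_vec ^^ i) v) (Ev ((conj_poly ^^ i) p)) = ord v (Ev p)"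
proof (induction i)
  case (Suc i)
  { case 1 show ?case using Ev_conj_nonzero[OF form_conj_iter[OF p(1)] Suc(1)] by simp }
  { case 2 show ?case using ord_conj[OF conj_vec_iter_cone[OF v] form_conj_iter[OF p(1)] Suc(1)] Suc(2) by simp }
qed (use p in auto)

lemma norm_nonzero: "form n d p \<Longrightarrow> Ev p \<noteq> 0 \<Longrightarrow> Ev (norm_poly r p) \<noteq> 0"
  unfolding norm_poly_def Ev_prod
  using ord_conj_iter(1)[OF retr_in] by (intro V_prod_nonzero[where d = "\<lambda>_. d"]) (auto intro: VI form_conj_iter)

lemma ord_norm:
  assumes v: "v \<in> cone" and p: "form n d p" "Ev p \<noteq> 0"
  shows "ord v (Ev (norm_poly r p)) = (\<Sum>i<r. ord v (Ev ((conj_poly ^^ i) p)))"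
  unfolding norm_poly_def Ev_prod
  using ord_conj_iter(1)[OF v p] by (intro ord_prod[OF v, where d = "\<lambda>_. d"]) (auto intro: VI form_conj_iter p)

lemma rational_vec:
  assumes "rational_point C P"
  shows "P \<in> C" "\<exists>w :: nat \<Rightarrow> 'a. (\<lambda>i. to_ac (w i)) \<in> P"
  using assms by (auto simp: rational_point_def)

text \<open>Frobenius fixes rational points.\<close>

lemma rational_conj_iter:
  assumes Q: "rational_point C Q" and v: "v \<in> Q"
  shows "(conj_vec ^^ i) v \<in> Q"
proof -
  obtain w :: "nat \<Rightarrow> 'a" where w: "(\<lambda>i. to_ac (w i)) \<in> Q" using rational_vec[OF Q] by blast
  have Qw: "Q = point_of (\<lambda>i. to_ac (w i))" using C_eq_point_of[OF _ w] rational_vec(1)[OF Q] by blast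
  have step: "conj_vec x \<in> Q" if xQ: "x \<in> Q" for x
  proof -
    obtain c where c: "c \<noteq> 0" "x = (\<lambda>i. c * to_ac (w i))" using xQ unfolding Qw point_of_def by auto
    have "conj_vec x = (\<lambda>i. frob c * to_ac (w i))" by (simp add: c conj_vec_def frob_mult)
    moreover have "frob c \<noteq> 0" using c by simp
    ultimately show ?thesis unfolding Qw point_of_def by (intro CollectI exI[of _ "frob c"] conjI)
  qed
  show ?thesis by (induction i) (auto intro: v step)
qed

text \<open>
  The norm of the function from \<open>approximation\<close> has coefficients in the base field. Its order at a
  point \<open>R\<close> is the sum of the orders of the original function at the points that the iterates of
  Frobenius map to \<open>R\<close>. As \<open>Q\<close> is rational, none of these is \<open>Q\<close> unless \<open>R\<close> is, so no new poles
  arise; as \<open>P\<close> is rational, the norm is still a unit at \<open>P\<close>.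
\<close>

theorem rational_approximation:
  assumes P: "rational_point C P" and Q: "rational_point C Q" "P \<noteq> Q" and S: "finite S" "S \<subseteq> C - {P, Q}"
  shows "\<exists>e (g1 :: 'a mpoly) g2. form n e (base_change g1) \<and> form n e (base_change g2) \<and>
     Ev (base_change g1) \<noteq> 0 \<and> Ev (base_change g2) \<noteq> 0 \<and> ordp P (Ev (base_change g1)) = ordp P (Ev (base_change g2)) \<and>
     (\<forall>R\<in>C - {Q}. ordp R (Ev (base_change g2)) \<le> ordp R (Ev (base_change g1))) \<and>
     (\<forall>R\<in>S. ordp R (Ev (base_change g2)) + \<kappa> \<le> ordp R (Ev (base_change g1)))"
proof -
  have PC: "P \<in> C" and QC: "Q \<in> C" using rational_vec P Q by auto
  obtain e Y1 Y2 where Y: "Y1 \<in> V e" "Y2 \<in> V e" "Y1 \<noteq> 0" "Y2 \<noteq> 0" and YP: "ordp P Y1 = ordp P Y2"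
    and YR: "\<forall>R\<in>C - {Q}. ordp R Y2 \<le> ordp R Y1" and YS: "\<forall>R\<in>S. ordp R Y2 + \<kappa> \<le> ordp R Y1"
    using approximation[OF PC QC Q(2) S, of \<kappa>] by blast
  obtain p1 where p1: "form n e p1" "Y1 = Ev p1" using VE[OF Y(1)] by blast
  obtain p2 where p2: "form n e p2" "Y2 = Ev p2" using VE[OF Y(2)] by blast
  have nz: "Ev p1 \<noteq> 0" "Ev p2 \<noteq> 0" using Y p1 p2 by auto
  obtain r where r: "r > 0" "(conj_poly ^^ r) p1 = p1" "(conj_poly ^^ r) p2 = p2" using conj_poly_periodic[of p1 p2] by blast
  obtain g1 where g1: "norm_poly r p1 = base_change g1" using norm_poly_base[OF r(2,1)] by blast
  obtain g2 where g2: "norm_poly r p2 = base_change g2" using norm_poly_base[OF r(3,1)] by blast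
  have o: "ordp R (Ev (norm_poly r p1)) = (\<Sum>i<r. ordp R (Ev ((conj_poly ^^ i) p1)))"
    "ordp R (Ev (norm_poly r p2)) = (\<Sum>i<r. ordp R (Ev ((conj_poly ^^ i) p2)))" if "R \<in> C" for R
    using ord_norm[OF rep_cone[OF that] p1(1) nz(1)] ord_norm[OF rep_cone[OF that] p2(1) nz(2)] by auto
  have oi: "ordp R (Ev ((conj_poly ^^ i) p)) = ordp R' (Ev p)"
    if R: "R \<in> C" "R' \<in> C" and x: "x \<in> R'" "(conj_vec ^^ i) x \<in> R" and p: "form n e p" "Ev p \<noteq> 0" for R R' x i p
  proof -
    have xc: "x \<in> cone" using C_cone R x by blast
    have "ordp R (Ev ((conj_poly ^^ i) p)) = ord ((conj_vec ^^ i) x) (Ev ((conj_poly ^^ i) p))"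
      by (rule ord_eq_ordp[OF R(1) x(2) VI[OF form_conj_iter[OF p(1)]] ord_conj_iter(1)[OF xc p], symmetric])
    also have "\<dots> = ord x (Ev p)" by (rule ord_conj_iter(2)[OF xc p])
    also have "\<dots> = ordp R' (Ev p)" by (rule ord_eq_ordp[OF R(2) x(1) VI[OF p(1)] p(2)])
    finally show ?thesis .
  qed
  have oP: "ordp P (Ev ((conj_poly ^^ i) p)) = ordp P (Ev p)" if "form n e p" "Ev p \<noteq> 0" for p i
    by (rule oi[OF PC PC rep_in[OF PC] rational_conj_iter[OF P rep_in[OF PC]] that])
  have le: "ordp R (Ev ((conj_poly ^^ i) p2)) \<le> ordp R (Ev ((conj_poly ^^ i) p1))" if R: "R \<in> C" "R \<noteq> Q" for R i
  proof -
    obtain x where x: "x \<in> cone" "(conj_vec ^^ i) x = rep R" using conj_vec_iter_surj[OF rep_cone[OF R(1)]] by blast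
    define R' where "R' = point_of x"
    have R': "R' \<in> C" "x \<in> R'" unfolding R'_def using point_of_in_C[OF x(1)] point_of_self by auto
    have xR: "(conj_vec ^^ i) x \<in> R" unfolding x(2) by (rule rep_in[OF R(1)])
    have "R' \<noteq> Q"
    proof
      assume "R' = Q"
      then have "(conj_vec ^^ i) x \<in> Q" using rational_conj_iter[OF Q(1)] R'(2) by blast
      then show False using C_eq_point_of[OF R(1) xR] C_eq_point_of[OF QC] R(2) by metis
    qed
    then show ?thesis
      using YR R'(1) oi[OF R(1) R' xR p1(1) nz(1)] oi[OF R(1) R' xR p2(1) nz(2)] p1(2) p2(2) by simp
  qed
  have "ordp P (Ev (norm_poly r p1)) = ordp P (Ev (norm_poly r p2))"
    unfolding o[OF PC] oP[OF p1(1) nz(1)] oP[OF p2(1) nz(2)] using YP p1(2) p2(2) by simp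
  moreover have "ordp R (Ev (norm_poly r p2)) \<le> ordp R (Ev (norm_poly r p1))" if "R \<in> C - {Q}" for R
    using that o[of R] le[of R] by (simp add: sum_mono)
  moreover have "ordp R (Ev (norm_poly r p2)) + \<kappa> \<le> ordp R (Ev (norm_poly r p1))" if R: "R \<in> S" for R
  proof -
    have RC: "R \<in> C" "R \<noteq> Q" using R S(2) by auto
    obtain r' where r': "r = Suc r'" using r(1) by (cases r) auto
    have "ordp R (Ev p2) + \<kappa> \<le> ordp R (Ev p1)" using YS R p1(2) p2(2) by simp
    moreover have "(\<Sum>i<r'. ordp R (Ev ((conj_poly ^^ Suc i) p2))) \<le> (\<Sum>i<r'. ordp R (Ev ((conj_poly ^^ Suc i) p1)))"
      by (intro sum_mono le RC)
    ultimately have "(\<Sum>i<r. ordp R (Ev ((conj_poly ^^ i) p2))) + \<kappa> \<le> (\<Sum>i<r. ordp R (Ev ((conj_poly ^^ i) p1)))"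
      unfolding r' sum.lessThan_Suc_shift by simp
    then show ?thesis by (simp only: o[OF RC(1)])
  qed
  moreover have "form n (r * e) (norm_poly r p1)" "form n (r * e) (norm_poly r p2)"
    by (intro form_norm p1 p2)+
  moreover have "Ev (norm_poly r p1) \<noteq> 0" "Ev (norm_poly r p2) \<noteq> 0"
    by (rule norm_nonzero[OF p1(1) nz(1)], rule norm_nonzero[OF p2(1) nz(2)])
  ultimately show ?thesis unfolding g1 g2 by blast
qed

text \<open>
  The local parameter \<open>v\<^sub>i X\<^sub>j - v\<^sub>j X\<^sub>i\<close> has coefficients in the base field if the coordinates of
  the point do.
\<close>

lemma rational_parameter:
  assumes P: "rational_point C P"
  shows "\<exists>(t :: 'a mpoly) b. form n 1 t \<and> form n 1 b \<and> Ev (base_change t) \<noteq> 0 \<and> Ev (base_change b) \<noteq> 0 \<and>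
     ordp P (Ev (base_change t)) = 1 \<and> ordp P (Ev (base_change b)) = 0"
proof -
  have PC: "P \<in> C" using rational_vec P by auto
  obtain w :: "nat \<Rightarrow> 'a" where w: "(\<lambda>i. to_ac (w i)) \<in> P" using rational_vec[OF P] by blast
  define v where "v = (\<lambda>i. to_ac (w i))"
  have v: "v \<in> P" "v \<in> cone" using w C_cone[OF PC w] by (auto simp: v_def)
  obtain i where i: "i \<le> n" "v i \<noteq> 0" using cone_nonzero[OF v(2)] by blast
  obtain j where j: "j \<le> n" "loc_param v (cst (v i) * Xc j - cst (v j) * Xc i)" using loc_param_exists[OF v(2) i] by blast
  define t where "t = cst_poly (w i) * pvar j - cst_poly (w j) * pvar i"
  have ft: "form n 1 t" unfolding t_def by (intro form_diff form_cst_mult form_pvar i j)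
  have fb: "form n 1 (pvar i :: 'a mpoly)" by (rule form_pvar[OF i(1)])
  have bv: "base_change (pvar k) = pvar k" for k by (simp add: pvar_def to_ac.map_h_single)
  have bt: "base_change t = cst_poly (v i) * pvar j - cst_poly (v j) * pvar i"
  proof -
    have t': "t = cst_poly (w i) * pvar j + cst_poly (- w j) * pvar i" by (simp add: t_def single_uminus)
    have "base_change t = cst_poly (v i) * pvar j + cst_poly (- v j) * pvar i"
      unfolding t' to_ac.map_h_add to_ac.map_h_mult bv by (simp add: to_ac.map_h_single v_def)
    then show ?thesis by (simp add: single_uminus)
  qed
  have Et: "Ev (base_change t) = cst (v i) * Xc j - cst (v j) * Xc i"
    unfolding bt by (simp add: Ev_diff Ev_mult Xc_def)
  have Eb: "Ev (base_change (pvar i)) = Xc i" unfolding bv Xc_def ..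
  have tV: "Ev (base_change t) \<in> V 1" by (rule VI[OF to_ac.form_map_h[OF ft]])
  have t0: "Ev (base_change t) \<noteq> 0" using loc_paramD(2)[OF j(2)] unfolding Et .
  have bV: "Xc i \<in> V 1" by (rule V_X[OF i(1)])
  have bv: "Xc i v \<noteq> 0" using i v by (simp add: X_apply)
  then have b0: "Xc i \<noteq> 0" by (auto simp: fun_apply)
  have "ordp P (Ev (base_change t)) = 1"
    using ord_eq_ordp[OF PC v(1) tV t0] ord_loc_param[OF j(2)] unfolding Et by simp
  moreover have "ordp P (Xc i) = 0"
    using ord_eq_ordp[OF PC v(1) bV b0] ord_nonvanishing[OF v(2) bV bv] by simp
  ultimately show ?thesis using ft fb t0 b0 Eb by (intro exI[of _ t] exI[of _ "pvar i"]) simp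
qed

section \<open>Riemann-Roch spaces\<close>

abbreviation RR where "RR \<equiv> riemann_roch_space n C"

lemma zero_in_RR: "\<zero>\<^bsub>K\<^esub> \<in> RR D" by (simp add: riemann_roch_space_def)

lemma RR_quot_iff:
  assumes "fraction d \<phi> \<psi>" "\<phi> \<noteq> 0"
  shows "quot \<phi> \<psi> \<in> RR D \<longleftrightarrow> quot \<phi> \<psi> \<in> base_functions n C \<and>
     (\<forall>R\<in>C. int (ordp R \<phi>) - int (ordp R \<psi>) \<ge> - Poly_Mapping.lookup D R)"
  using assms quot_eq_0_iff[OF assms(1)] point_order_quot[OF _ rep_in assms]
  by (auto simp: riemann_roch_space_def)

lemma RR_mono:
  assumes "\<And>R. R \<in> C \<Longrightarrow> Poly_Mapping.lookup D R \<le> Poly_Mapping.lookup D' R"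
  shows "RR D \<subseteq> RR D'"
  using assms unfolding riemann_roch_space_def by fastforce

lemma lookup_add_points:
  "Poly_Mapping.lookup (B + mult_pt a P + mult_pt b Q) R =
     Poly_Mapping.lookup B R + (if R = P then a else 0) + (if R = Q then b else 0)"
  by (simp add: lookup_add lookup_single when_def)

text \<open>
  For very negative \<open>j\<close> the functions in question have a zero of high order at \<open>Q\<close>, whereas their
  poles at the other points are bounded by the rest of the divisor.
\<close>

lemma RR_trivial:
  assumes P: "P \<in> C" and Q: "Q \<in> C" "P \<noteq> Q" and B: "divisor C B"
  shows "\<exists>j0. \<forall>j\<le>j0. RR (B + mult_pt a P + mult_pt j Q) = {\<zero>\<^bsub>K\<^esub>}"
proof -
  define S where "S = insert P (Poly_Mapping.keys B) - {Q}"
  have S: "finite S" "S \<subseteq> C - {Q}" using B P by (auto simp: S_def divisor_def)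
  define \<kappa> where "\<kappa> = (\<Sum>R\<in>S. nat \<bar>Poly_Mapping.lookup B R + (if R = P then a else 0)\<bar>)"
  obtain N where N: "\<And>d g h. g \<in> V d \<Longrightarrow> h \<in> V d \<Longrightarrow> h \<noteq> 0 \<Longrightarrow>
    (\<forall>R\<in>S. ordp_ge R (ordp R h - \<kappa>) g) \<Longrightarrow> (\<forall>R\<in>C - S - {Q}. ordp_ge R (ordp R h) g) \<Longrightarrow>
    ordp_ge Q (ordp Q h + N) g \<Longrightarrow> g = 0"
    using sections_vanish[OF Q(1) S, of \<kappa>] by blast
  define j0 where "j0 = - Poly_Mapping.lookup B Q - int N"
  show ?thesis
  proof (intro exI[of _ j0] allI impI)
    fix j assume j: "j \<le> j0"
    let ?D = "B + mult_pt a P + mult_pt j Q"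
    have "f = \<zero>\<^bsub>K\<^esub>" if f: "f \<in> RR ?D" for f
    proof (rule ccontr)
      assume nz: "f \<noteq> \<zero>\<^bsub>K\<^esub>"
      then have "f \<in> carrier K" using f by (auto simp: riemann_roch_space_def base_functions_def)
      then obtain d \<phi> \<psi> where fr: "fraction d \<phi> \<psi>" "f = quot \<phi> \<psi>" by (rule carrierE)
      have \<phi>0: "\<phi> \<noteq> 0" using nz quot_eq_0_iff[OF fr(1)] fr(2) by blast
      have V: "\<phi> \<in> V d" "\<psi> \<in> V d" "\<psi> \<noteq> 0" using fr(1) by (auto simp: fraction_def)
      have ge: "int (ordp R \<phi>) - int (ordp R \<psi>) \<ge> - Poly_Mapping.lookup ?D R" if "R \<in> C" for R
        using f that unfolding fr(2) RR_quot_iff[OF fr(1) \<phi>0] by blast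
      have "\<phi> = 0"
      proof (rule N[OF V])
        show "\<forall>R\<in>S. ordp_ge R (ordp R \<psi> - \<kappa>) \<phi>"
        proof
          fix R assume R: "R \<in> S"
          then have RC: "R \<in> C" "R \<noteq> Q" using S by auto
          have "nat \<bar>Poly_Mapping.lookup B R + (if R = P then a else 0)\<bar> \<le> \<kappa>"
            unfolding \<kappa>_def by (rule member_le_sum[OF R _ S(1)]) simp
          moreover have "int (ordp R \<phi>) - int (ordp R \<psi>) \<ge> - (Poly_Mapping.lookup B R + (if R = P then a else 0))"
            using ge[OF RC(1)] RC(2) unfolding lookup_add_points by simp
          ultimately have "ordp R \<psi> - \<kappa> \<le> ordp R \<phi>" by linarith
          then show "ordp_ge R (ordp R \<psi> - \<kappa>) \<phi>" by (simp add: ord_ge_def)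
        qed
        show "\<forall>R\<in>C - S - {Q}. ordp_ge R (ordp R \<psi>) \<phi>"
        proof
          fix R assume R: "R \<in> C - S - {Q}"
          then have "Poly_Mapping.lookup ?D R = 0" unfolding lookup_add_points by (auto simp: S_def in_keys_iff)
          then show "ordp_ge R (ordp R \<psi>) \<phi>" using ge[of R] R by (simp add: ord_ge_def)
        qed
        have "Poly_Mapping.lookup ?D Q = Poly_Mapping.lookup B Q + j" unfolding lookup_add_points using Q(2) by simp
        then have "ordp Q \<psi> + N \<le> ordp Q \<phi>" using ge[OF Q(1)] j by (simp add: j0_def)
        then show "ordp_ge Q (ordp Q \<psi> + N) \<phi>" by (simp add: ord_ge_def)
      qed
      then show False using \<phi>0 by simp
    qed
    then show "RR ?D = {\<zero>\<^bsub>K\<^esub>}" using zero_in_RR by blast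
  qed
qed

text \<open>
  There is a function whose pole at \<open>P\<close> has exactly the order \<open>m\<close> allowed by the divisor and that
  respects the divisor at all points other than \<open>P\<close> and \<open>Q\<close>; then \<open>j\<close> is read off from its order
  at \<open>Q\<close>. It is the power \<open>(b / t)\<^sup>m\<close> of a rational local parameter, multiplied by a function from
  \<open>rational_approximation\<close>. The latter vanishes to high order on \<open>S\<close>, which contains the further
  poles of the former and the points where the divisor is negative.
\<close>

lemma exact_pole_exists:
  assumes P: "rational_point C P" and Q: "rational_point C Q" "P \<noteq> Q" and B: "divisor C B"
  shows "\<exists>j. RR (B + mult_pt a P + mult_pt j Q) \<noteq> RR (B + mult_pt a P + mult_pt j Q - pt P)"
proof -
  have PC: "P \<in> C" and QC: "Q \<in> C" using rational_vec P Q by auto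
  define m where "m = Poly_Mapping.lookup B P + a"
  obtain t b :: "'a mpoly" where tb: "form n 1 t" "form n 1 b" "Ev (base_change t) \<noteq> 0" "Ev (base_change b) \<noteq> 0"
     "ordp P (Ev (base_change t)) = 1" "ordp P (Ev (base_change b)) = 0"
    using rational_parameter[OF P] by blast
  define k where "k = nat \<bar>m\<bar>"
  \<comment> \<open>\<open>(x1 / x2)\<^sup>k = (b / t)\<^sup>m\<close>, written with natural exponents.\<close>
  define x1 where "x1 = (if m \<ge> 0 then b else t)"
  define x2 where "x2 = (if m \<ge> 0 then t else b)"
  have x: "form n 1 x1" "form n 1 x2" "Ev (base_change x1) \<noteq> 0" "Ev (base_change x2) \<noteq> 0"
    using tb by (auto simp: x1_def x2_def)
  define T1 where "T1 = Ev (base_change x1)"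
  define T2 where "T2 = Ev (base_change x2)"
  have TV: "T1 \<in> V 1" "T2 \<in> V 1" "T1 \<noteq> 0" "T2 \<noteq> 0" unfolding T1_def T2_def using x by (auto intro: VI to_ac.form_map_h)
  have TP: "int (k * ordp P T1) - int (k * ordp P T2) = - m"
    using tb by (auto simp: T1_def T2_def x1_def x2_def k_def)
  define S where "S = ({R \<in> C. T1 (rep R) = 0} \<union> {R \<in> C. T2 (rep R) = 0} \<union> Poly_Mapping.keys B) - {P, Q}"
  have S: "finite S" "S \<subseteq> C - {P, Q}"
    unfolding S_def using finite_zero_points[OF TV(1,3)] finite_zero_points[OF TV(2,4)] B by (auto simp: divisor_def)
  define \<kappa> where "\<kappa> = (\<Sum>R\<in>S. k * ordp R T2 + nat \<bar>Poly_Mapping.lookup B R\<bar>)"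
  obtain e and g1 g2 :: "'a mpoly" where fg: "form n e (base_change g1)" "form n e (base_change g2)"
     and gnz: "Ev (base_change g1) \<noteq> 0" "Ev (base_change g2) \<noteq> 0"
     and gP: "ordp P (Ev (base_change g1)) = ordp P (Ev (base_change g2))"
     and gR: "\<forall>R\<in>C - {Q}. ordp R (Ev (base_change g2)) \<le> ordp R (Ev (base_change g1))"
     and gS: "\<forall>R\<in>S. ordp R (Ev (base_change g2)) + \<kappa> \<le> ordp R (Ev (base_change g1))"
    using rational_approximation[OF P Q S, of \<kappa>] by blast
  define G1 where "G1 = Ev (base_change g1)"
  define G2 where "G2 = Ev (base_change g2)"
  have GV: "G1 \<in> V e" "G2 \<in> V e" "G1 \<noteq> 0" "G2 \<noteq> 0" unfolding G1_def G2_def using fg gnz by (auto intro: VI)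
  have TkV: "T1 ^ k \<in> V (k * 1)" "T2 ^ k \<in> V (k * 1)" "T1 ^ k \<noteq> 0" "T2 ^ k \<noteq> 0"
    using V_power[OF TV(1)] V_power[OF TV(2)] V_power_nonzero[OF TV(1,3)] V_power_nonzero[OF TV(2,4)] by blast+
  define \<phi> where "\<phi> = T1 ^ k * G1"
  define \<psi> where "\<psi> = T2 ^ k * G2"
  have \<phi>: "\<phi> \<in> V (k * 1 + e)" "\<phi> \<noteq> 0" and \<psi>: "\<psi> \<in> V (k * 1 + e)" "\<psi> \<noteq> 0"
    unfolding \<phi>_def \<psi>_def
    by (intro V_mult TkV GV, rule V_mult_nonzero[OF TkV(1) GV(1) TkV(3) GV(3)], intro V_mult TkV GV,
        rule V_mult_nonzero[OF TkV(2) GV(2) TkV(4) GV(4)])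
  have fr: "fraction (k * 1 + e) \<phi> \<psi>" using \<phi> \<psi> by (simp add: fraction_def)
  have o\<phi>: "ordp R \<phi> = k * ordp R T1 + ordp R G1" if "R \<in> C" for R
    unfolding \<phi>_def using ord_mult[OF rep_cone[OF that] TkV(1,3) GV(1,3)] ord_power[OF rep_cone[OF that] TV(1,3)] by simp
  have o\<psi>: "ordp R \<psi> = k * ordp R T2 + ordp R G2" if "R \<in> C" for R
    unfolding \<psi>_def using ord_mult[OF rep_cone[OF that] TkV(2,4) GV(2,4)] ord_power[OF rep_cone[OF that] TV(2,4)] by simp
  have base: "quot \<phi> \<psi> \<in> base_functions n C"
  proof -
    have pw: "base_change (q ^ l) = base_change q ^ l" for q :: "'a mpoly" and l
      by (induction l) (simp_all add: to_ac.map_h_1 to_ac.map_h_mult)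
    have E: "\<phi> = Ev (base_change (x1 ^ k * g1))" "\<psi> = Ev (base_change (x2 ^ k * g2))"
      by (simp_all add: \<phi>_def \<psi>_def T1_def T2_def G1_def G2_def to_ac.map_h_mult pw Ev_mult Ev_power)
    have "form n (k * 1 + e) (base_change (x1 ^ k * g1))" "form n (k * 1 + e) (base_change (x2 ^ k * g2))"
      unfolding to_ac.map_h_mult pw by (intro form_mult form_power to_ac.form_map_h x fg)+
    then have "(base_change (x1 ^ k * g1), base_change (x2 ^ k * g2)) \<in> fractions n C"
      unfolding fractions_iff using \<psi>(2) E(2) by auto
    then have "(base_change (x1 ^ k * g1), base_change (x2 ^ k * g2)) \<in> quot \<phi> \<psi>"
      unfolding quot_def using E by simp
    then show ?thesis unfolding base_functions_def using quot_carrier[OF fr] by blast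
  qed
  define j where "j = int (ordp Q \<psi>) - Poly_Mapping.lookup B Q"
  let ?D = "B + mult_pt a P + mult_pt j Q"
  have ordP: "int (ordp P \<phi>) - int (ordp P \<psi>) = - m"
    using o\<phi>[OF PC] o\<psi>[OF PC] TP gP by (simp add: G1_def G2_def)
  have DP: "Poly_Mapping.lookup ?D P = m" unfolding lookup_add_points using Q(2) by (simp add: m_def)
  have ge: "- Poly_Mapping.lookup ?D R \<le> int (ordp R \<phi>) - int (ordp R \<psi>)" if R: "R \<in> C" for R
  proof -
    consider "R = P" | "R = Q" | "R \<in> S" | "R \<noteq> P" "R \<noteq> Q" "R \<notin> S" by blast
    then show ?thesis
    proof cases
      case 1
      then show ?thesis using ordP DP by simp
    next
      case 2
      then show ?thesis unfolding lookup_add_points using Q(2) by (simp add: j_def)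
    next
      case 3
      then have ne: "R \<noteq> P" "R \<noteq> Q" using S by auto
      have "k * ordp R T2 + nat \<bar>Poly_Mapping.lookup B R\<bar> \<le> \<kappa>"
        unfolding \<kappa>_def by (rule member_le_sum[OF 3 _ S(1)]) simp
      moreover have "ordp R G2 + \<kappa> \<le> ordp R G1" using gS 3 by (simp add: G1_def G2_def)
      ultimately have "ordp R \<psi> + nat \<bar>Poly_Mapping.lookup B R\<bar> \<le> ordp R \<phi>"
        unfolding o\<phi>[OF R] o\<psi>[OF R] by linarith
      then show ?thesis unfolding lookup_add_points using ne by simp
    next
      case 4
      then have "T1 (rep R) \<noteq> 0" "T2 (rep R) \<noteq> 0" "Poly_Mapping.lookup B R = 0" using R by (auto simp: S_def in_keys_iff)
      then have "ordp R T1 = 0" "ordp R T2 = 0" "Poly_Mapping.lookup ?D R = 0"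
        unfolding lookup_add_points using ord_nonvanishing[OF rep_cone[OF R]] TV 4 by auto
      moreover have "ordp R G2 \<le> ordp R G1" using gR R 4 by (simp add: G1_def G2_def)
      ultimately show ?thesis unfolding o\<phi>[OF R] o\<psi>[OF R] by simp
    qed
  qed
  have "quot \<phi> \<psi> \<in> RR ?D" unfolding RR_quot_iff[OF fr \<phi>(2)] using base ge by blast
  moreover have "quot \<phi> \<psi> \<notin> RR (?D - pt P)"
  proof
    assume "quot \<phi> \<psi> \<in> RR (?D - pt P)"
    then have "- Poly_Mapping.lookup (?D - pt P) P \<le> int (ordp P \<phi>) - int (ordp P \<psi>)"
      unfolding RR_quot_iff[OF fr \<phi>(2)] using PC by blast
    then show False unfolding ordP lookup_minus DP by simp
  qed
  ultimately show ?thesis by blast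
qed

lemma RR_sub_point: "RR (D - pt P) \<subseteq> RR D"
  by (rule RR_mono) (simp add: lookup_minus lookup_single when_def)

text \<open>
  A function with the exact pole order at \<open>P\<close> allowed by the smaller divisor also has the exact
  order for the larger one, as the two divisors agree at \<open>P\<close>.
\<close>

lemma basepoint_antimono:
  assumes "P \<in> C" "P \<noteq> Q" "j \<le> j'"
    and bp: "has_basepoint n C (B + mult_pt a P + mult_pt j' Q) P"
  shows "has_basepoint n C (B + mult_pt a P + mult_pt j Q) P"
proof (rule ccontr)
  let ?D = "\<lambda>j. B + mult_pt a P + mult_pt j Q"
  assume "\<not> has_basepoint n C (?D j) P"
  then obtain f where f: "f \<in> RR (?D j)" "f \<notin> RR (?D j - pt P)"
    using RR_sub_point unfolding has_basepoint_def by blast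
  have nz: "f \<noteq> \<zero>\<^bsub>K\<^esub>" using f(2) zero_in_RR by blast
  have base: "f \<in> base_functions n C" and ge: "\<And>R. R \<in> C \<Longrightarrow> - Poly_Mapping.lookup (?D j) R \<le> point_order n C R f"
    using f(1) nz by (auto simp: riemann_roch_space_def)
  obtain R where R: "R \<in> C" "\<not> - Poly_Mapping.lookup (?D j - pt P) R \<le> point_order n C R f"
    using f(2) base nz by (auto simp: riemann_roch_space_def)
  have RP: "R = P"
  proof (rule ccontr)
    assume "R \<noteq> P"
    then have "Poly_Mapping.lookup (?D j - pt P) R = Poly_Mapping.lookup (?D j) R" by (simp add: lookup_minus lookup_single when_def)
    then show False using R ge[OF R(1)] by simp
  qed
  have same: "Poly_Mapping.lookup (?D j' - pt P) P = Poly_Mapping.lookup (?D j - pt P) P"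
    unfolding lookup_minus lookup_add_points using assms(2) by simp
  have "f \<notin> RR (?D j' - pt P)"
  proof
    assume "f \<in> RR (?D j' - pt P)"
    then have "- Poly_Mapping.lookup (?D j' - pt P) P \<le> point_order n C P f"
      using nz assms(1) unfolding riemann_roch_space_def by blast
    then show False using R(2) same unfolding RP by simp
  qed
  moreover have "RR (?D j) \<subseteq> RR (?D j')"
    by (rule RR_mono) (simp add: lookup_add_points assms(3))
  then have "f \<in> RR (?D j')" using f(1) by (rule subsetD)
  ultimately show False using bp unfolding has_basepoint_def by blast
qed

text \<open>Rational points are fixed by all automorphisms over the base field.\<close>

lemma divisor_add_points:
  assumes "divisor C B" "rational_point C P" "rational_point C Q"
  shows "divisor C (B + mult_pt a P + mult_pt b Q)"
proof -
  have PC: "P \<in> C" "Q \<in> C" using assms by (auto simp: rational_point_def)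
  have fixed: "(\<lambda>v. s \<circ> v) ` R = P' \<longleftrightarrow> R = P'"
    if s: "s \<in> base_automorphisms" and P': "rational_point C P'" for s R and P' :: "'a alg_closure proj_point"
  proof -
    have sb: "bij s" "\<And>x y. s (x * y) = s x * s y" "\<And>x. s (to_ac x) = to_ac x"
      using s by (auto simp: base_automorphisms_def)
    have s0: "s x = 0 \<longleftrightarrow> x = 0" for x
    proof -
      have "s 0 = 0" using sb(3)[of 0] by simp
      then show ?thesis using sb(1) by (metis bij_is_inj injD)
    qed
    obtain w :: "nat \<Rightarrow> 'a" where w: "(\<lambda>i. to_ac (w i)) \<in> P'" using rational_vec[OF P'] by blast
    have Pw: "P' = point_of (\<lambda>i. to_ac (w i))" using C_eq_point_of[OF _ w] rational_vec(1)[OF P'] by blast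
    have PP: "(\<lambda>v. s \<circ> v) ` P' = P'"
    proof (intro equalityI subsetI)
      fix x assume "x \<in> (\<lambda>v. s \<circ> v) ` P'"
      then obtain c where c: "c \<noteq> 0" "x = s \<circ> (\<lambda>i. c * to_ac (w i))" unfolding Pw point_of_def by auto
      then have "x = (\<lambda>i. s c * to_ac (w i))" "s c \<noteq> 0" by (auto simp: fun_eq_iff sb s0)
      then show "x \<in> P'" unfolding Pw point_of_def by (intro CollectI exI[of _ "s c"] conjI)
    next
      fix x assume "x \<in> P'"
      then obtain c where c: "c \<noteq> 0" "x = (\<lambda>i. c * to_ac (w i))" unfolding Pw point_of_def by auto
      obtain c' where c': "s c' = c" using sb(1) by (metis bij_pointE)
      then have "x = s \<circ> (\<lambda>i. c' * to_ac (w i))" "c' \<noteq> 0" using c s0 by (auto simp: fun_eq_iff sb)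
      then show "x \<in> (\<lambda>v. s \<circ> v) ` P'" unfolding Pw point_of_def by blast
    qed
    have "inj (\<lambda>v :: nat \<Rightarrow> 'a alg_closure. s \<circ> v)"
    proof (rule injI)
      fix x y :: "nat \<Rightarrow> 'a alg_closure" assume "s \<circ> x = s \<circ> y"
      then have "s (x i) = s (y i)" for i by (metis comp_apply)
      then show "x = y" using sb(1) by (metis bij_is_inj ext injD)
    qed
    then show ?thesis using PP by (metis inj_image_eq_iff)
  qed
  have "Poly_Mapping.keys (B + mult_pt a P + mult_pt b Q) \<subseteq> C"
  proof
    fix R assume "R \<in> Poly_Mapping.keys (B + mult_pt a P + mult_pt b Q)"
    then have "R \<in> Poly_Mapping.keys B \<or> R = P \<or> R = Q"
      unfolding in_keys_iff lookup_add_points by (auto split: if_splits)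
    then show "R \<in> C" using PC assms(1) by (auto simp: divisor_def)
  qed
  then show ?thesis using assms fixed unfolding divisor_def lookup_add_points by simp
qed

text \<open>
  For fixed \<open>a\<close>, the integers \<open>j\<close> for which \<open>B + a P + j Q\<close> has a basepoint at \<open>P\<close> form a
  down-closed set (\<open>basepoint_antimono\<close>) that is neither empty (\<open>RR_trivial\<close>) nor everything
  (\<open>exact_pole_exists\<close>), that is, \<open>{..<\<sigma>}\<close> for some \<open>\<sigma>\<close>. The divisor with index \<open>j\<close> is a
  discrepancy iff \<open>j\<close> is not in this set but \<open>j - 1\<close> is, which says \<open>j = \<sigma>\<close>. So the discrepancy
  function takes the value \<open>\<sigma>\<close> at \<open>a\<close>.
\<close>

theorem basepoint_iff:
  assumes P: "rational_point C P" and Q: "rational_point C Q" "P \<noteq> Q" and B: "divisor C B"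
  shows "has_basepoint n C (B + mult_pt a P + mult_pt b Q) P \<longleftrightarrow> discrepancy_fun n C P Q B a > b"
proof -
  let ?D = "\<lambda>j. B + mult_pt a P + mult_pt j Q"
  define bp where "bp j \<longleftrightarrow> has_basepoint n C (?D j) P" for j
  have PC: "P \<in> C" and QC: "Q \<in> C" using rational_vec P Q by auto
  have mono: "bp j" if "bp j'" "j \<le> j'" for j j'
    using basepoint_antimono[OF PC Q(2) that(2)] that(1) unfolding bp_def by blast
  obtain j0 where j0_all: "\<forall>j\<le>j0. RR (?D j) = {\<zero>\<^bsub>K\<^esub>}"
    using RR_trivial[OF PC QC Q(2) B, of a] by (elim exE) (rule that)
  have "RR (?D j0) = {\<zero>\<^bsub>K\<^esub>}" using j0_all[rule_format, OF order_refl] .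
  then have j0: "bp j0"
    unfolding bp_def has_basepoint_def using RR_sub_point[of "?D j0" P] zero_in_RR[of "?D j0 - pt P"] by auto
  obtain j1 where "RR (?D j1) \<noteq> RR (?D j1 - pt P)"
    using exact_pole_exists[OF P Q B, of a] by (elim exE) (rule that)
  then have j1: "\<not> bp j1" unfolding bp_def has_basepoint_def .
  have j01: "j0 < j1" using mono[OF j0] j1 by (meson not_less)
  define k where "k = (LEAST k. \<not> bp (j0 + int k))"
  have "\<not> bp (j0 + int (nat (j1 - j0)))" using j1 j01 by simp
  then have k: "\<not> bp (j0 + int k)" unfolding k_def by (rule LeastI)
  have k0: "k \<noteq> 0" using k j0 by (cases k) auto
  have k1: "bp (j0 + int k - 1)"
  proof -
    have "k - 1 < k" using k0 by simp
    then have "bp (j0 + int (k - 1))" unfolding k_def using not_less_Least by blast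
    then show ?thesis using k0 by (simp add: of_nat_diff algebra_simps)
  qed
  define \<sigma> where "\<sigma> = j0 + int k"
  have bp_iff: "bp j \<longleftrightarrow> j < \<sigma>" for j
  proof
    assume "bp j"
    show "j < \<sigma>"
    proof (rule ccontr)
      assume "\<not> j < \<sigma>"
      then have "bp \<sigma>" using mono[OF \<open>bp j\<close>] by simp
      then show False using k by (simp add: \<sigma>_def)
    qed
  next
    assume "j < \<sigma>"
    then show "bp j" using mono[OF k1] by (simp add: \<sigma>_def)
  qed
  have disc: "?D j \<in> discrepancies n C P Q \<longleftrightarrow> j = \<sigma>" for j
  proof -
    have e1: "?D j - pt Q = ?D (j - 1)"
      by (rule poly_mapping_eqI) (simp add: lookup_add lookup_minus lookup_single when_def)
    have e2: "?D j - pt P - pt Q = ?D (j - 1) - pt P"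
      by (rule poly_mapping_eqI) (simp add: lookup_add lookup_minus lookup_single when_def)
    have "?D j \<in> discrepancies n C P Q \<longleftrightarrow> \<not> bp j \<and> bp (j - 1)"
      unfolding discrepancies_def bp_def has_basepoint_def mem_Collect_eq e1 e2
      using divisor_add_points[OF B P Q(1)] by blast
    then show ?thesis unfolding bp_iff by auto
  qed
  have "discrepancy_fun n C P Q B a = \<sigma>"
    unfolding discrepancy_fun_def disc by simp
  then show ?thesis using bp_iff[of b] unfolding bp_def by simp
qed

end

theorem proposition8:
  fixes C :: "'a::{field,finite} alg_closure proj_point set"
    and P Q :: "'a alg_closure proj_point"
    and B :: "'a alg_closure proj_point \<Rightarrow>\<^sub>0 int"
    and n :: nat and a b :: int
  assumes "smooth_projective_curve n C"
    and "rational_point C P" and "rational_point C Q" and "P \<noteq> Q"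
    and "divisor C B"
  shows "has_basepoint n C (B + mult_pt a P + mult_pt b Q) P \<longleftrightarrow> discrepancy_fun n C P Q B a > b"
proof -
  have C: "defined_over_base n C" "zariski_irreducible n C" "one_dimensional n C" "smooth_curve n C"
    using assms(1) unfolding smooth_projective_curve_def by auto
  have "zariski_closed n C"
  proof -
    obtain E :: "'a mpoly set" where E: "\<forall>p\<in>E. \<exists>d. form n d p" "C = proj_zeros n (base_change ` E)"
      using C(1) unfolding defined_over_base_def by blast
    have "\<forall>p\<in>base_change ` E. \<exists>d. form n d p" using E(1) to_ac.form_map_h by blast
    then show ?thesis using E(2) unfolding zariski_closed_def by blast
  qed
  then interpret finite_field_curve n C using C by unfold_locales
  show ?thesis by (rule basepoint_iff[OF assms(2-5)])
qed

end
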